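(* Let $(P,A,\mathcal T)$ be an extendable poset with extended admissible system $\underline{\mathcal R}=\{\mathcal R_{x,y}\}$ on $\underline P^m=P\cup\{0,m\}$, and suppose that $\mathcal R_x$ is a field for all $x\in\underline P^m$ and that $\mathcal R_{0,x}$ is one-dimensional as a left $\mathcal R_0$-vector space for every $x$. Let $M$ and $N$ be two objects of $\mathrm{mod}\,\mathcal D^e$ with local bases $\mathscr B(M)$ and $\mathscr B(N)$, respectively, and matrix representations $\mathscr M(M)$, $\mathscr M(N)$ with stripes $\mathscr M(M)_x$, $\mathscr M(N)_x$. Then $M\cong N$ if and only if $M$ and $N$ have the same dimension vector $(d_x)$ and there are non-singular square matrices $T_0\in\mathscr M_{d_0}(\mathcal R_0)$, $T_x\in\mathscr M_{d_x}(\mathcal R_x)$ for all $x\in P^m$, and for each $y<x$ in $P^m$ a matrix $T_{yx}\in\mathscr M_{d_y\times d_x}(\mathcal R_{y,x})$, such that for all $x\in P^m$ $$\mathscr M(M)_x=T_0\,\mathscr M(N)_x\,\phi_x(T_x)+\sum_{y<x}T_0\,\mathscr M(N)_y\,\chi_{y,x}(T_{yx}),$$ where the sum is over $y\in P^m$ with $y<x$ and $\phi_x,\chi_{y,x}$ are applied entrywise.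
   Context: Posets. $K$ is a field, $A$ a finite-dimensional $K$-algebra, $P$ a finite poset. A $P$-multiplicative system over $A$ is a family $\{\mathcal R_{i,j}\subseteq A\mid i\le j\}$ of $K$-subspaces with $\mathcal R_{i,j}\mathcal R_{j,l}\subseteq\mathcal R_{i,l}$ for $i\le j\le l$, and each $\mathcal R_i=\mathcal R_{i,i}$ a $K$-algebra with unit $1_i$ such that $1_ir=r=r1_j$ for $r\in\mathcal R_{i,j}$. $\Lambda(\mathcal R)=\bigoplus_{i\le j}e_{i,j}\mathcal R_{i,j}$ ($e_{i,j}$ matrix units, matrix operations), $e_i=e_{i,i}1_i$. For a poset with greatest element $m$ the system is admissible if each $\mathcal R_i$ is a division ring and, whenever $j<m$ and $0\ne x\in\mathcal R_{i,j}$, there is $y\in\mathcal R_{j,l}$, $l\neq j$, with $xy\ne0$. $P^m$ is $P$ with a greatest element $m$ added; $\mathcal T^m$ consists of $\mathcal T_{i,j}$ for $i\le j$ in $P$ and $\mathcal T_{i,m}=A$ for $i\in P^m$. $(P,A,\mathcal T)$ is extendable if $A$ is semisimple with exactly one simple module $\varepsilon_mA$ up to isomorphism, each $\mathcal T_i$ is a unital subalgebra of $A$, and there are idempotents $\varepsilon_i\in\mathcal T_i$ ($i\in P^m$) such that $\{\varepsilon_i\mathcal T_{i,j}\varepsilon_j\}_{i\le j\in P^m}$ is admissible with incidence algebra Morita equivalent to $\Lambda(\mathcal T^m)$. $\underline P^m=P^m\cup\{0\}$ with $0$ least, $\mathcal T_{0,i}=A$, $\varepsilon_0=\varepsilon_m$,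 $\underline{\mathcal R}=\{\mathcal R_{i,j}=\varepsilon_i\mathcal T_{i,j}\varepsilon_j\mid i\le j\in\underline P^m\}$; $\Lambda=\Lambda(\underline{\mathcal R})$. The ditalgebra $\mathcal D^e$. $\Lambda=S\oplus J$, $S=\bigoplus_ie_{i,i}\mathcal R_i$, $J=\bigoplus_{i<j}e_{i,j}\mathcal R_{i,j}$, $\hat e=1-e_0$. ${}^*J=\mathrm{Hom}_S({}_SJ,S)$ is an $S$-bimodule by $(s\gamma)(u)=\gamma(us)$, $(\gamma s)(u)=\gamma(u)s$ (so $e_x{}^*Je_y$ is dual to $e_yJe_x$). Choose left $\mathcal R_y$-bases of the $e_yJe_x$ ($y<x$); their union $\{p_i\}$ with dual elements $\gamma_i\in{}^*J$ is a dual basis of ${}_SJ$. Put $R^e=w_1\hat eS\oplus w_2e_0S$ ($w_1,w_2$ orthogonal idempotents), $W_0=w_{1,2}\hat e\,{}^*Je_0$ (left action through $w_1$, right action through $w_2$), $W_1=w_1\hat e\,{}^*J\hat e$ (both actions through $w_1$), and $T=T_{R^e}(W_0\oplus W_1)$, graded with $R^e,W_0$ in degree 0 and $W_1$ in degree 1. The differential $d_e$ (degree 1, $d_e(R^e)=0$, graded Leibniz rule $d_e(ab)=d_e(a)b+(-1)^{\deg a}a\,d_e(b)$) is given by $d_e(w_{1,2}\gamma)=-\sum_{i,j}w_1\gamma_i\otimes w_{1,2}\gamma_j\,\gamma(p_jp_i)$ for $\gamma\in\hat e\,{}^*Je_0$ and $d_e(w_1\gamma)=-\sum_{i,j}w_1\gamma_i\otimes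 w_1\gamma_j\,\gamma(p_jp_i)$ for $\gamma\in\hat e\,{}^*J\hat e$ (only non-zero terms are written). $\mathcal D^e=(T,d_e)$. $\mathrm{Mod}\,\mathcal D^e$: objects are right $T_0$-modules $M$ ($T_0=R^e\oplus W_0$); write $M_0=Mw_2e_0$ and $M_x=Mw_1e_x$ for $x\in P^m$. A morphism $f:M\to N$ is a pair $(f^0,f^1)$ with $f^0$ right $R^e$-linear and $f^1:T_1\to\mathrm{Hom}_K(M,N)$ a $T_0$-bimodule morphism (where $(ah)(m)=h(ma)$, $(ha)(m)=h(m)a$) such that $f^0(m)a=f^0(ma)+f^1(d_e(a))(m)$ for $a\in T_0,m\in M$. Composition: $(gf)^0=g^0f^0$, $(gf)^1(v)=g^1(v)f^0+g^0f^1(v)-\sum g^1(v'')f^1(v')$ where $d_e(v)=\sum v'\otimes v''$; identities are $(\mathrm{id},0)$. $\mathrm{mod}\,\mathcal D^e$ is the full subcategory of objects finite-dimensional over $K$. Matrices. A local basis of $M$ is $\mathscr B(M)=\bigcup_{x\in\underline P^m}\mathscr B_x(M)$ with $\mathscr B_x(M)=\{m^x_i:1\le i\le d_x\}$ an $\mathcal R_x$-basis of $M_x$; the dimension vector is $(d_x=\dim_{\mathcal R_x}M_x)_x$. For $x\in P^m$ fix $v_{0,x}$ with $\mathcal R_{0,x}=\mathcal R_0v_{0,x}$. $\chi_{y,x}:\mathcal R_{y,x}\to\mathcal R_0$ is the $K$-linear map with $v_{0,y}r=\chi_{y,x}(r)v_{0,x}$. $\hat u_{0,x}\in e_x{}^*Je_0$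 is the element with $\hat u_{0,x}(e_{0,x}v_{0,x})=e_0$, and $\phi_x:\mathcal R_x\to\mathcal R_0$ is the $K$-linear map with $z\hat u_{0,x}=\hat u_{0,x}\phi_x(z)$. The stripe $\mathscr M(M)_x=(M^x_{j,i})$ is the $d_0\times d_x$ matrix over $\mathcal R_0$ with $m^x_iw_{1,2}\hat u_{0,x}=\sum_{j}m^0_jM^x_{j,i}$. Matrices with 0 rows or columns are allowed; products with them behave as zero matrices. *)

theory Defs
  imports "Jordan_Normal_Form.Matrix" "HOL-Algebra.QuotRing"
begin

section \<open>Rings, right modules, Morita equivalence\<close>

text \<open>The corner $\varepsilon A \varepsilon$ and similar subsets of a ring type are turned into
  HOL-Algebra rings with their own unit \<open>u\<close>; algebras over a field are
  records of type \<^typ>\<open>('k, 'r) module\<close> whose \<^const>\<open>smult\<close> is the scalar action.\<close>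

definition sub_ring :: "'a::ring_1 set \<Rightarrow> 'a \<Rightarrow> 'a ring" where
  "sub_ring X u = \<lparr>carrier = X, mult = (*), one = u, zero = 0, add = (+)\<rparr>"

definition division_ring :: "('a, 'b) ring_scheme \<Rightarrow> bool" where
  "division_ring R \<longleftrightarrow> ring R \<and> Units R = carrier R - {\<zero>\<^bsub>R\<^esub>}"

definition fd_algebra :: "('k::field \<Rightarrow> 'a::ring_1 \<Rightarrow> 'a) \<Rightarrow> bool" where
  "fd_algebra scale \<longleftrightarrow>
     (\<exists>Basis. finite_dimensional_vector_space scale Basis) \<and>
     (\<forall>k a b. scale k (a * b) = scale k a * b \<and> scale k (a * b) = a * scale k b)"

text \<open>As for \<^typ>\<open>('r, 'm) module\<close>, the fields \<^const>\<open>mult\<close> and \<^const>\<open>one\<close> of a module record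
  carry no information.\<close>

record ('r, 'm) rmodule = "'m ring" +
  ract :: "'m \<Rightarrow> 'r \<Rightarrow> 'm"

definition right_module :: "('r, 'c) ring_scheme \<Rightarrow> ('r, 'm) rmodule \<Rightarrow> bool" where
  "right_module A M \<longleftrightarrow> ring A \<and> abelian_group M \<and>
     (\<forall>m\<in>carrier M. \<forall>a\<in>carrier A. ract M m a \<in> carrier M) \<and>
     (\<forall>m\<in>carrier M. \<forall>n\<in>carrier M. \<forall>a\<in>carrier A.
        ract M (m \<oplus>\<^bsub>M\<^esub> n) a = ract M m a \<oplus>\<^bsub>M\<^esub> ract M n a) \<and>
     (\<forall>m\<in>carrier M. \<forall>a\<in>carrier A. \<forall>b\<in>carrier A.
        ract M m (a \<oplus>\<^bsub>A\<^esub> b) = ract M m a \<oplus>\<^bsub>M\<^esub> ract M m b) \<and>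
     (\<forall>m\<in>carrier M. \<forall>a\<in>carrier A. \<forall>b\<in>carrier A.
        ract M m (a \<otimes>\<^bsub>A\<^esub> b) = ract M (ract M m a) b) \<and>
     (\<forall>m\<in>carrier M. ract M m \<one>\<^bsub>A\<^esub> = m)"

definition right_submodule :: "('r, 'c) ring_scheme \<Rightarrow> ('r, 'm) rmodule \<Rightarrow> 'm set \<Rightarrow> bool" where
  "right_submodule A M N \<longleftrightarrow> additive_subgroup N M \<and>
     (\<forall>n\<in>N. \<forall>a\<in>carrier A. ract M n a \<in> N)"

definition simple_module :: "('r, 'c) ring_scheme \<Rightarrow> ('r, 'm) rmodule \<Rightarrow> bool" where
  "simple_module A M \<longleftrightarrow> right_module A M \<and> carrier M \<noteq> {\<zero>\<^bsub>M\<^esub>} \<and>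
     (\<forall>N. right_submodule A M N \<longrightarrow> N = {\<zero>\<^bsub>M\<^esub>} \<or> N = carrier M)"

definition module_homs ::
    "('r, 'c) ring_scheme \<Rightarrow> ('r, 'm) rmodule \<Rightarrow> ('r, 'n) rmodule \<Rightarrow> ('m \<Rightarrow> 'n) set" where
  "module_homs A M N = {f \<in> carrier M \<rightarrow>\<^sub>E carrier N.
     (\<forall>m\<in>carrier M. \<forall>m'\<in>carrier M. f (m \<oplus>\<^bsub>M\<^esub> m') = f m \<oplus>\<^bsub>N\<^esub> f m') \<and>
     (\<forall>m\<in>carrier M. \<forall>a\<in>carrier A. f (ract M m a) = ract N (f m) a)}"

definition module_isomorphic ::
    "('r, 'c) ring_scheme \<Rightarrow> ('r, 'm) rmodule \<Rightarrow> ('r, 'n) rmodule \<Rightarrow> bool" where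
  "module_isomorphic A M N \<longleftrightarrow>
     (\<exists>f\<in>module_homs A M N. bij_betw f (carrier M) (carrier N))"

definition type_ring :: "'a::ring_1 ring" where
  "type_ring = sub_ring UNIV 1"

definition right_ideal_module :: "'a::ring_1 set \<Rightarrow> ('a, 'a) rmodule" where
  "right_ideal_module X = \<lparr>carrier = X, mult = undefined, one = undefined,
     zero = 0, add = (+), ract = (*)\<rparr>"

text \<open>The regular right module is the sum of its simple submodules, i.e. the least submodule
  containing all of them.\<close>

definition semisimple_ring :: "'a::ring_1 itself \<Rightarrow> bool" where
  "semisimple_ring _ \<longleftrightarrow>
     (\<forall>X::'a set. right_submodule type_ring (right_ideal_module UNIV) X \<and>
        (\<forall>Y. right_submodule type_ring (right_ideal_module UNIV) Y \<and>
             simple_module type_ring (right_ideal_module Y) \<longrightarrow> Y \<subseteq> X)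
        \<longrightarrow> X = UNIV)"

text \<open>Every simple right module over a ring \<open>'a\<close> is isomorphic to a quotient of the regular
  module by a right ideal, and such quotients have carriers of type \<^typ>\<open>'a set set\<close>;
  so it suffices that the bound module has elements of type \<^typ>\<open>'a set\<close>.\<close>

definition unique_simple_module :: "'a::ring_1 \<Rightarrow> bool" where
  "unique_simple_module e \<longleftrightarrow>
     simple_module type_ring (right_ideal_module (range ((*) e))) \<and>
     (\<forall>S::('a, 'a set) rmodule. simple_module type_ring S \<longrightarrow>
        module_isomorphic type_ring S (right_ideal_module (range ((*) e))))"

text \<open>Finite-dimensional right modules over a $K$-algebra, up to isomorphism: the underlying
  vector space is some $K^n$. They form a full subcategory equivalent to the
  category of all finite-dimensional modules.\<close>

definition coord_space :: "nat \<Rightarrow> (nat \<Rightarrow> 'k::field) set" where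
  "coord_space n = {v. \<forall>i\<ge>n. v i = 0}"

definition fd_modules :: "('k::field, 'r) module \<Rightarrow> ('r, nat \<Rightarrow> 'k) rmodule set" where
  "fd_modules L = {M. right_module L M \<and>
     (\<exists>n. carrier M = coord_space n \<and> zero M = (\<lambda>i. 0) \<and> add M = (\<lambda>v w i. v i + w i) \<and>
        (\<forall>k. \<forall>v\<in>coord_space n. ract M v (k \<odot>\<^bsub>L\<^esub> \<one>\<^bsub>L\<^esub>) = (\<lambda>i. k * v i)))}"

text \<open>A $K$-linear functor between the categories of finite-dimensional modules that is
  fully faithful and essentially surjective.\<close>

definition morita_equivalent ::
    "('k::field, 'r) module \<Rightarrow> ('k, 's) module \<Rightarrow> bool" where
  "morita_equivalent L L' \<longleftrightarrow>
   (\<exists>(F :: ('r, nat \<Rightarrow> 'k) rmodule \<Rightarrow> ('s, nat \<Rightarrow> 'k) rmodule)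
     (H :: ('r, nat \<Rightarrow> 'k) rmodule \<Rightarrow> ('r, nat \<Rightarrow> 'k) rmodule \<Rightarrow>
             ((nat \<Rightarrow> 'k) \<Rightarrow> (nat \<Rightarrow> 'k)) \<Rightarrow> ((nat \<Rightarrow> 'k) \<Rightarrow> (nat \<Rightarrow> 'k))).
     (\<forall>M\<in>fd_modules L. F M \<in> fd_modules L') \<and>
     (\<forall>M\<in>fd_modules L. H M M (restrict id (carrier M)) = restrict id (carrier (F M))) \<and>
     (\<forall>M\<in>fd_modules L. \<forall>N\<in>fd_modules L. \<forall>Q\<in>fd_modules L.
        \<forall>f\<in>module_homs L M N. \<forall>g\<in>module_homs L N Q.
          H M Q (compose (carrier M) g f) = compose (carrier (F M)) (H N Q g) (H M N f)) \<and>
     (\<forall>M\<in>fd_modules L. \<forall>N\<in>fd_modules L.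
        bij_betw (H M N) (module_homs L M N) (module_homs L' (F M) (F N)) \<and>
        (\<forall>f\<in>module_homs L M N. \<forall>g\<in>module_homs L M N.
           H M N (\<lambda>v\<in>carrier M. \<lambda>i. f v i + g v i)
             = (\<lambda>v\<in>carrier (F M). \<lambda>i. H M N f v i + H M N g v i)) \<and>
        (\<forall>k. \<forall>f\<in>module_homs L M N.
           H M N (\<lambda>v\<in>carrier M. \<lambda>i. k * f v i)
             = (\<lambda>v\<in>carrier (F M). \<lambda>i. k * H M N f v i))) \<and>
     (\<forall>N\<in>fd_modules L'. \<exists>M\<in>fd_modules L. module_isomorphic L' (F M) N))"


section \<open>Multiplicative systems and incidence algebras\<close>

definition mult_system ::
    "('k::field \<Rightarrow> 'a::ring_1 \<Rightarrow> 'a) \<Rightarrow> 'i::order set \<Rightarrow> ('i \<Rightarrow> 'i \<Rightarrow> 'a set) \<Rightarrow> ('i \<Rightarrow> 'a) \<Rightarrow> bool" where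
  "mult_system scale X R u \<longleftrightarrow>
     (\<forall>i\<in>X. \<forall>j\<in>X. i \<le> j \<longrightarrow> module.subspace scale (R i j)) \<and>
     (\<forall>i\<in>X. \<forall>j\<in>X. \<forall>l\<in>X. i \<le> j \<and> j \<le> l \<longrightarrow>
        (\<forall>r\<in>R i j. \<forall>s\<in>R j l. r * s \<in> R i l)) \<and>
     (\<forall>i\<in>X. u i \<in> R i i) \<and>
     (\<forall>i\<in>X. \<forall>j\<in>X. i \<le> j \<longrightarrow> (\<forall>r\<in>R i j. u i * r = r \<and> r * u j = r))"

definition incidence_algebra ::
    "('k::field \<Rightarrow> 'a::ring_1 \<Rightarrow> 'a) \<Rightarrow> 'i::order set \<Rightarrow> ('i \<Rightarrow> 'i \<Rightarrow> 'a set) \<Rightarrow> ('i \<Rightarrow> 'a) \<Rightarrow>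
       ('k, 'i \<Rightarrow> 'i \<Rightarrow> 'a) module" where
  "incidence_algebra scale X R u =
     \<lparr>carrier = {f. \<forall>i j. if i \<in> X \<and> j \<in> X \<and> i \<le> j then f i j \<in> R i j else f i j = 0},
      mult = (\<lambda>f g i j. \<Sum>l\<in>X. f i l * g l j),
      one = (\<lambda>i j. if i \<in> X \<and> i = j then u i else 0),
      zero = (\<lambda>i j. 0),
      add = (\<lambda>f g i j. f i j + g i j),
      smult = (\<lambda>k f i j. scale k (f i j))\<rparr>"

definition admissible ::
    "('k::field \<Rightarrow> 'a::ring_1 \<Rightarrow> 'a) \<Rightarrow> 'i::order set \<Rightarrow> 'i \<Rightarrow> ('i \<Rightarrow> 'i \<Rightarrow> 'a set) \<Rightarrow> ('i \<Rightarrow> 'a) \<Rightarrow> bool" where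
  "admissible scale X m R u \<longleftrightarrow>
     m \<in> X \<and> (\<forall>i\<in>X. i \<le> m) \<and> mult_system scale X R u \<and>
     (\<forall>i\<in>X. division_ring (sub_ring (R i i) (u i))) \<and>
     (\<forall>i\<in>X. \<forall>j\<in>X. i \<le> j \<and> j < m \<longrightarrow>
        (\<forall>x\<in>R i j. x \<noteq> 0 \<longrightarrow> (\<exists>l\<in>X. j \<le> l \<and> l \<noteq> j \<and> (\<exists>y\<in>R j l. x * y \<noteq> 0))))"

text \<open>\<open>Zero\<close> and \<open>Top\<close> are the elements $0$ and $m$ adjoined to a poset.\<close>

datatype 'p extp = Zero | Pt 'p | Top

instantiation extp :: (order) order
begin

definition less_eq_extp :: "'a extp \<Rightarrow> 'a extp \<Rightarrow> bool" where
  "x \<le> y \<longleftrightarrow> x = Zero \<or> y = Top \<or> (\<exists>p q. x = Pt p \<and> y = Pt q \<and> p \<le> q)"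

definition less_extp :: "'a extp \<Rightarrow> 'a extp \<Rightarrow> bool" where
  "(x :: 'a extp) < y \<longleftrightarrow> x \<le> y \<and> \<not> y \<le> x"

instance
  by standard (auto simp: less_eq_extp_def less_extp_def, metis extp.exhaust)

end

text \<open>The data $(P, A, \mathcal T)$ over $K$ with the idempotents $\varepsilon_i$, $i \in P^m$
  (the value of \<open>idm\<close> at \<open>Zero\<close> is not used). The poset is a subset of an ordered type,
  so that it may be empty.\<close>

record ('k, 'a, 'p) poset_datum =
  scl :: "'k \<Rightarrow> 'a \<Rightarrow> 'a"
  pos :: "'p set"
  sys :: "'p \<Rightarrow> 'p \<Rightarrow> 'a set"
  idm :: "'p extp \<Rightarrow> 'a"

definition Pm :: "('k, 'a, 'p) poset_datum \<Rightarrow> 'p extp set" where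
  "Pm E = insert Top (Pt ` pos E)"

definition Pum :: "('k, 'a, 'p) poset_datum \<Rightarrow> 'p extp set" where
  "Pum E = insert Zero (Pm E)"

fun ext_sys :: "('p \<Rightarrow> 'p \<Rightarrow> 'a::ring_1 set) \<Rightarrow> 'p extp \<Rightarrow> 'p extp \<Rightarrow> 'a set" where
  "ext_sys T (Pt i) (Pt j) = T i j"
| "ext_sys T x Top = UNIV"
| "ext_sys T Zero y = UNIV"
| "ext_sys T x y = {0}"

definition eps :: "('k, 'a, 'p) poset_datum \<Rightarrow> 'p extp \<Rightarrow> 'a" where
  "eps E x = (if x = Zero then idm E Top else idm E x)"

definition Rs :: "('k, 'a::ring_1, 'p) poset_datum \<Rightarrow> 'p extp \<Rightarrow> 'p extp \<Rightarrow> 'a set" where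
  "Rs E x y = (\<lambda>t. eps E x * t * eps E y) ` ext_sys (sys E) x y"

definition extendable :: "('k::field, 'a::ring_1, 'p::order) poset_datum \<Rightarrow> bool" where
  "extendable E \<longleftrightarrow>
     finite (pos E) \<and> fd_algebra (scl E) \<and>
     semisimple_ring TYPE('a) \<and> unique_simple_module (idm E Top) \<and>
     mult_system (scl E) (pos E) (sys E) (\<lambda>_. 1) \<and>
     (\<forall>x\<in>Pm E. idm E x \<in> ext_sys (sys E) x x \<and> idm E x * idm E x = idm E x) \<and>
     admissible (scl E) (Pm E) Top (Rs E) (idm E) \<and>
     morita_equivalent
       (incidence_algebra (scl E) (Pm E) (Rs E) (idm E))
       (incidence_algebra (scl E) (Pm E) (ext_sys (sys E)) (\<lambda>_. 1))"


section \<open>The algebra $\Lambda = S \oplus J$ and the dual bimodule of $J$\<close>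

type_synonym ('a, 'p) lam = "'p extp \<Rightarrow> 'p extp \<Rightarrow> 'a"
type_synonym ('a, 'p) dual = "('a, 'p) lam \<Rightarrow> ('a, 'p) lam"

definition Lam :: "('k::field, 'a::ring_1, 'p::order) poset_datum \<Rightarrow> ('k, ('a, 'p) lam) module" where
  "Lam E = incidence_algebra (scl E) (Pum E) (Rs E) (eps E)"

definition mu :: "'p extp \<Rightarrow> 'p extp \<Rightarrow> 'a::zero \<Rightarrow> ('a, 'p) lam" where
  "mu x y r = (\<lambda>i j. if i = x \<and> j = y then r else 0)"

definition ei :: "('k, 'a::zero, 'p) poset_datum \<Rightarrow> 'p extp \<Rightarrow> ('a, 'p) lam" where
  "ei E x = mu x x (eps E x)"

definition ehat :: "('k::field, 'a::ring_1, 'p::order) poset_datum \<Rightarrow> ('a, 'p) lam" where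
  "ehat E = \<one>\<^bsub>Lam E\<^esub> \<ominus>\<^bsub>Lam E\<^esub> ei E Zero"

definition Ss :: "('k::field, 'a::ring_1, 'p::order) poset_datum \<Rightarrow> ('a, 'p) lam set" where
  "Ss E = {u \<in> carrier (Lam E). \<forall>i j. i \<noteq> j \<longrightarrow> u i j = 0}"

definition Js :: "('k::field, 'a::ring_1, 'p::order) poset_datum \<Rightarrow> ('a, 'p) lam set" where
  "Js E = {u \<in> carrier (Lam E). \<forall>i. u i i = 0}"

text \<open>Elements of ${}^*J$ are functions on \<^typ>\<open>('a, 'p) lam\<close> vanishing outside $J$.\<close>

definition Jdual :: "('k::field, 'a::ring_1, 'p::order) poset_datum \<Rightarrow> ('a, 'p) dual set" where
  "Jdual E = {\<gamma>. (\<forall>u. u \<notin> Js E \<longrightarrow> \<gamma> u = \<zero>\<^bsub>Lam E\<^esub>) \<and> (\<forall>u\<in>Js E. \<gamma> u \<in> Ss E) \<and>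
     (\<forall>u\<in>Js E. \<forall>u'\<in>Js E. \<gamma> (u \<oplus>\<^bsub>Lam E\<^esub> u') = \<gamma> u \<oplus>\<^bsub>Lam E\<^esub> \<gamma> u') \<and>
     (\<forall>s\<in>Ss E. \<forall>u\<in>Js E. \<gamma> (s \<otimes>\<^bsub>Lam E\<^esub> u) = s \<otimes>\<^bsub>Lam E\<^esub> \<gamma> u)}"

definition dual_zero :: "('a::zero, 'p) dual" where
  "dual_zero = (\<lambda>u i j. 0)"

definition dual_add :: "('a::plus, 'p) dual \<Rightarrow> ('a, 'p) dual \<Rightarrow> ('a, 'p) dual" where
  "dual_add \<gamma> \<gamma>' = (\<lambda>u i j. \<gamma> u i j + \<gamma>' u i j)"

definition dual_l ::
    "('k::field, 'a::ring_1, 'p::order) poset_datum \<Rightarrow> ('a, 'p) lam \<Rightarrow> ('a, 'p) dual \<Rightarrow> ('a, 'p) dual" where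
  "dual_l E s \<gamma> = (\<lambda>u. if u \<in> Js E then \<gamma> (u \<otimes>\<^bsub>Lam E\<^esub> s) else \<zero>\<^bsub>Lam E\<^esub>)"

definition dual_r ::
    "('k::field, 'a::ring_1, 'p::order) poset_datum \<Rightarrow> ('a, 'p) dual \<Rightarrow> ('a, 'p) lam \<Rightarrow> ('a, 'p) dual" where
  "dual_r E \<gamma> s = (\<lambda>u. \<gamma> u \<otimes>\<^bsub>Lam E\<^esub> s)"

definition dual_corner ::
    "('k::field, 'a::ring_1, 'p::order) poset_datum \<Rightarrow> ('a, 'p) lam \<Rightarrow> ('a, 'p) lam \<Rightarrow> ('a, 'p) dual set" where
  "dual_corner E e e' = {dual_l E e (dual_r E \<gamma> e') |\<gamma>. \<gamma> \<in> Jdual E}"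

text \<open>\<open>B y x\<close> is a left $\mathcal R_y$-basis of $e_y J e_x$ for $y < x$, and \<open>gam p\<close> is the
  dual element of the member \<open>p\<close> of the union of these bases.\<close>

definition pair_basis ::
    "('k::field, 'a::ring_1, 'p::order) poset_datum \<Rightarrow> 'p extp \<Rightarrow> 'p extp \<Rightarrow> ('a, 'p) lam set \<Rightarrow> bool" where
  "pair_basis E y x B \<longleftrightarrow>
     (let V = {ei E y \<otimes>\<^bsub>Lam E\<^esub> u \<otimes>\<^bsub>Lam E\<^esub> ei E x |u. u \<in> Js E} in
      finite B \<and> B \<subseteq> V \<and>
      (\<forall>u\<in>V. \<exists>!c. (\<forall>p. if p \<in> B then c p \<in> Rs E y y else c p = 0) \<and>
         u = (\<Oplus>\<^bsub>Lam E\<^esub>p\<in>B. mu y y (c p) \<otimes>\<^bsub>Lam E\<^esub> p)))"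

definition dual_basis ::
    "('k::field, 'a::ring_1, 'p::order) poset_datum \<Rightarrow> ('p extp \<Rightarrow> 'p extp \<Rightarrow> ('a, 'p) lam set) \<Rightarrow>
       (('a, 'p) lam \<Rightarrow> ('a, 'p) dual) \<Rightarrow> bool" where
  "dual_basis E B gam \<longleftrightarrow>
     (\<forall>y\<in>Pum E. \<forall>x\<in>Pum E. y < x \<longrightarrow> pair_basis E y x (B y x) \<and>
        (\<forall>p\<in>B y x. gam p \<in> Jdual E \<and>
           (\<forall>y'\<in>Pum E. \<forall>x'\<in>Pum E. y' < x' \<longrightarrow>
              (\<forall>q\<in>B y' x'. gam p q = (if q = p then ei E y else \<zero>\<^bsub>Lam E\<^esub>)))))"


section \<open>Tensor rings of bimodules\<close>

text \<open>The free ring on a set \<open>G\<close> of letters: finitely supported integer-valued functions on words,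
  with the convolution product. A tensor ring $T_R(W)$ is its quotient, for the letters
  \<open>R\<close> and \<open>W\<close>, by the relations below. No scalars are needed, since they are part of \<open>R\<close>.\<close>

definition free_ring :: "'g set \<Rightarrow> ('g list \<Rightarrow> int) ring" where
  "free_ring G =
     \<lparr>carrier = {f. finite {w. f w \<noteq> 0} \<and> {w. f w \<noteq> 0} \<subseteq> lists G},
      mult = (\<lambda>f g w. \<Sum>i\<le>length w. f (take i w) * g (drop i w)),
      one = (\<lambda>w. if w = [] then 1 else 0),
      zero = (\<lambda>w. 0),
      add = (\<lambda>f g w. f w + g w)\<rparr>"

definition word :: "'g list \<Rightarrow> 'g list \<Rightarrow> int" where
  "word w = (\<lambda>w'. if w' = w then 1 else 0)"

record ('r, 'w) bimod =
  bcarrier :: "'w set"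
  badd :: "'w \<Rightarrow> 'w \<Rightarrow> 'w"
  bleft :: "'r \<Rightarrow> 'w \<Rightarrow> 'w"
  bright :: "'w \<Rightarrow> 'r \<Rightarrow> 'w"

definition tensor_letters :: "'r ring \<Rightarrow> ('r, 'w) bimod \<Rightarrow> ('r + 'w) set" where
  "tensor_letters R W = Inl ` carrier R \<union> Inr ` bcarrier W"

definition free_diff :: "('g list \<Rightarrow> int) \<Rightarrow> ('g list \<Rightarrow> int) \<Rightarrow> 'g list \<Rightarrow> int" where
  "free_diff f g = (\<lambda>w. f w - g w)"

definition tensor_relations :: "'r ring \<Rightarrow> ('r, 'w) bimod \<Rightarrow> (('r + 'w) list \<Rightarrow> int) set" where
  "tensor_relations R W =
     {free_diff (word [Inl \<one>\<^bsub>R\<^esub>]) (word [])}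
   \<union> {free_diff (word [Inl (r \<otimes>\<^bsub>R\<^esub> s)]) (word [Inl r, Inl s]) |r s.
        r \<in> carrier R \<and> s \<in> carrier R}
   \<union> {free_diff (free_diff (word [Inl (r \<oplus>\<^bsub>R\<^esub> s)]) (word [Inl r])) (word [Inl s]) |r s.
        r \<in> carrier R \<and> s \<in> carrier R}
   \<union> {free_diff (free_diff (word [Inr (badd W v w)]) (word [Inr v])) (word [Inr w]) |v w.
        v \<in> bcarrier W \<and> w \<in> bcarrier W}
   \<union> {free_diff (word [Inr (bleft W r w)]) (word [Inl r, Inr w]) |r w.
        r \<in> carrier R \<and> w \<in> bcarrier W}
   \<union> {free_diff (word [Inr (bright W w r)]) (word [Inr w, Inl r]) |r w.
        r \<in> carrier R \<and> w \<in> bcarrier W}"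

definition tensor_ideal :: "'r ring \<Rightarrow> ('r, 'w) bimod \<Rightarrow> (('r + 'w) list \<Rightarrow> int) set" where
  "tensor_ideal R W = genideal (free_ring (tensor_letters R W)) (tensor_relations R W)"

definition tensor_ring :: "'r ring \<Rightarrow> ('r, 'w) bimod \<Rightarrow> (('r + 'w) list \<Rightarrow> int) set ring" where
  "tensor_ring R W = free_ring (tensor_letters R W) Quot tensor_ideal R W"

definition tensor_class ::
    "'r ring \<Rightarrow> ('r, 'w) bimod \<Rightarrow> (('r + 'w) list \<Rightarrow> int) \<Rightarrow> (('r + 'w) list \<Rightarrow> int) set" where
  "tensor_class R W f = tensor_ideal R W +>\<^bsub>free_ring (tensor_letters R W)\<^esub> f"

text \<open>Homogeneous part of degree \<open>n\<close> when \<open>dg l k\<close> says that the letter \<open>l\<close> has degree \<open>k\<close>.\<close>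

definition tensor_part ::
    "'r ring \<Rightarrow> ('r, 'w) bimod \<Rightarrow> ('r + 'w \<Rightarrow> nat \<Rightarrow> bool) \<Rightarrow> nat \<Rightarrow> (('r + 'w) list \<Rightarrow> int) set set" where
  "tensor_part R W dg n =
     tensor_class R W ` {f \<in> carrier (free_ring (tensor_letters R W)).
        \<forall>w. f w \<noteq> 0 \<longrightarrow> (\<exists>ks. list_all2 dg w ks \<and> sum_list ks = n)}"


section \<open>Ditalgebras and their modules\<close>

text \<open>A ditalgebra $(T, d)$ over $K$: the graded algebra $T$ with homogeneous parts \<open>part\<close>,
  the subalgebra \<open>base\<close> over which it is a tensor algebra, and the differential.\<close>

record ('k, 't) ditalgebra = "('k, 't) module" +
  part :: "nat \<Rightarrow> 't set"
  base :: "'t set"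
  diff :: "'t \<Rightarrow> 't"

definition graded_derivation :: "('k, 't) ditalgebra \<Rightarrow> bool" where
  "graded_derivation D \<longleftrightarrow>
     (\<forall>n. \<forall>a\<in>part D n. diff D a \<in> part D (Suc n)) \<and>
     (\<forall>a\<in>carrier D. \<forall>b\<in>carrier D. diff D (a \<oplus>\<^bsub>D\<^esub> b) = diff D a \<oplus>\<^bsub>D\<^esub> diff D b) \<and>
     (\<forall>a\<in>base D. diff D a = \<zero>\<^bsub>D\<^esub>) \<and>
     (\<forall>n. \<forall>a\<in>part D n. \<forall>b\<in>carrier D.
        diff D (a \<otimes>\<^bsub>D\<^esub> b) = diff D a \<otimes>\<^bsub>D\<^esub> b \<oplus>\<^bsub>D\<^esub>
          (if even n then a \<otimes>\<^bsub>D\<^esub> diff D b else \<ominus>\<^bsub>D\<^esub> (a \<otimes>\<^bsub>D\<^esub> diff D b)))"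

text \<open>An object is an abelian group type with a right action of $T_0$; its vector space structure
  comes from the scalars in $T_0$.\<close>

definition kact :: "('k, 't) ditalgebra \<Rightarrow> ('m \<Rightarrow> 't \<Rightarrow> 'm) \<Rightarrow> 'k \<Rightarrow> 'm \<Rightarrow> 'm" where
  "kact D aM k m = aM m (k \<odot>\<^bsub>D\<^esub> \<one>\<^bsub>D\<^esub>)"

definition dit_module :: "('k, 't) ditalgebra \<Rightarrow> ('m::ab_group_add \<Rightarrow> 't \<Rightarrow> 'm) \<Rightarrow> bool" where
  "dit_module D aM \<longleftrightarrow>
     (\<forall>m n. \<forall>a\<in>part D 0. aM (m + n) a = aM m a + aM n a) \<and>
     (\<forall>m. \<forall>a\<in>part D 0. \<forall>b\<in>part D 0. aM m (a \<oplus>\<^bsub>D\<^esub> b) = aM m a + aM m b) \<and>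
     (\<forall>m. \<forall>a\<in>part D 0. \<forall>b\<in>part D 0. aM m (a \<otimes>\<^bsub>D\<^esub> b) = aM (aM m a) b) \<and>
     (\<forall>m. aM m \<one>\<^bsub>D\<^esub> = m)"

definition fd_dit_module ::
    "('k::field, 't) ditalgebra \<Rightarrow> ('m::ab_group_add \<Rightarrow> 't \<Rightarrow> 'm) \<Rightarrow> bool" where
  "fd_dit_module D aM \<longleftrightarrow>
     dit_module D aM \<and> (\<exists>Basis. finite_dimensional_vector_space (kact D aM) Basis)"

text \<open>Only the values of the second component on $T_1$ are significant.\<close>

type_synonym ('t, 'm, 'n) dit_mor = "('m \<Rightarrow> 'n) \<times> ('t \<Rightarrow> 'm \<Rightarrow> 'n)"

definition dit_morphism ::
    "('k, 't) ditalgebra \<Rightarrow> ('m::ab_group_add \<Rightarrow> 't \<Rightarrow> 'm) \<Rightarrow> ('n::ab_group_add \<Rightarrow> 't \<Rightarrow> 'n) \<Rightarrow>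
       ('t, 'm, 'n) dit_mor \<Rightarrow> bool" where
  "dit_morphism D aM aN f \<longleftrightarrow> (case f of (f0, f1) \<Rightarrow>
     (\<forall>m m'. f0 (m + m') = f0 m + f0 m') \<and>
     (\<forall>m. \<forall>r\<in>base D. f0 (aM m r) = aN (f0 m) r) \<and>
     (\<forall>v\<in>part D 1. \<forall>m m'. f1 v (m + m') = f1 v m + f1 v m') \<and>
     (\<forall>v\<in>part D 1. \<forall>k m. f1 v (kact D aM k m) = kact D aN k (f1 v m)) \<and>
     (\<forall>v\<in>part D 1. \<forall>v'\<in>part D 1. \<forall>m. f1 (v \<oplus>\<^bsub>D\<^esub> v') m = f1 v m + f1 v' m) \<and>
     (\<forall>v\<in>part D 1. \<forall>a\<in>part D 0. \<forall>m. f1 (a \<otimes>\<^bsub>D\<^esub> v) m = f1 v (aM m a)) \<and>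
     (\<forall>v\<in>part D 1. \<forall>a\<in>part D 0. \<forall>m. f1 (v \<otimes>\<^bsub>D\<^esub> a) m = aN (f1 v m) a) \<and>
     (\<forall>a\<in>part D 0. \<forall>m. aN (f0 m) a = f0 (aM m a) + f1 (diff D a) m))"

text \<open>An expression of an element of $T_2$ as a sum of products $v' v''$ with $v', v'' \in T_1$;
  composition does not depend on its choice, as $T_2 = T_1 \otimes_{T_0} T_1$.\<close>

definition tensor_terms :: "('k, 't) ditalgebra \<Rightarrow> 't \<Rightarrow> ('t \<times> 't) list" where
  "tensor_terms D t = (SOME vs. set vs \<subseteq> part D 1 \<times> part D 1 \<and>
     t = foldr (\<lambda>(v', v'') s. (v' \<otimes>\<^bsub>D\<^esub> v'') \<oplus>\<^bsub>D\<^esub> s) vs \<zero>\<^bsub>D\<^esub>)"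

definition dit_comp ::
    "('k, 't) ditalgebra \<Rightarrow> ('t, 'n, 'l::ab_group_add) dit_mor \<Rightarrow> ('t, 'm, 'n) dit_mor \<Rightarrow>
       ('t, 'm, 'l) dit_mor" where
  "dit_comp D g f =
     (fst g \<circ> fst f,
      \<lambda>v m. snd g v (fst f m) + fst g (snd f v m)
        - (\<Sum>(v', v'')\<leftarrow>tensor_terms D (diff D v). snd g v'' (snd f v' m)))"

definition dit_is_id :: "('k, 't) ditalgebra \<Rightarrow> ('t, 'm::zero, 'm) dit_mor \<Rightarrow> bool" where
  "dit_is_id D f \<longleftrightarrow> fst f = id \<and> (\<forall>v\<in>part D 1. \<forall>m. snd f v m = 0)"

definition dit_isomorphic ::
    "('k, 't) ditalgebra \<Rightarrow> ('m::ab_group_add \<Rightarrow> 't \<Rightarrow> 'm) \<Rightarrow> ('n::ab_group_add \<Rightarrow> 't \<Rightarrow> 'n) \<Rightarrow> bool" where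
  "dit_isomorphic D aM aN \<longleftrightarrow>
     (\<exists>f g. dit_morphism D aM aN f \<and> dit_morphism D aN aM g \<and>
        dit_is_id D (dit_comp D g f) \<and> dit_is_id D (dit_comp D f g))"


section \<open>The ditalgebra $\mathcal D^e$\<close>

text \<open>\<open>(s, t)\<close> stands for $w_1 s + w_2 t$ in $R^e$, and \<open>(\<gamma>, \<delta>)\<close> for
  $w_{1,2} \gamma + w_1 \delta$ in $W_0 \oplus W_1$.\<close>

type_synonym ('a, 'p) re = "('a, 'p) lam \<times> ('a, 'p) lam"
type_synonym ('a, 'p) we = "('a, 'p) dual \<times> ('a, 'p) dual"
type_synonym ('a, 'p) te = "((('a, 'p) re + ('a, 'p) we) list \<Rightarrow> int) set"

definition Re :: "('k::field, 'a::ring_1, 'p::order) poset_datum \<Rightarrow> ('a, 'p) re ring" where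
  "Re E =
     \<lparr>carrier = ((\<otimes>\<^bsub>Lam E\<^esub>) (ehat E) ` Ss E) \<times> ((\<otimes>\<^bsub>Lam E\<^esub>) (ei E Zero) ` Ss E),
      mult = (\<lambda>(s, t) (s', t'). (s \<otimes>\<^bsub>Lam E\<^esub> s', t \<otimes>\<^bsub>Lam E\<^esub> t')),
      one = (ehat E, ei E Zero),
      zero = (\<zero>\<^bsub>Lam E\<^esub>, \<zero>\<^bsub>Lam E\<^esub>),
      add = (\<lambda>(s, t) (s', t'). (s \<oplus>\<^bsub>Lam E\<^esub> s', t \<oplus>\<^bsub>Lam E\<^esub> t'))\<rparr>"

definition We :: "('k::field, 'a::ring_1, 'p::order) poset_datum \<Rightarrow> (('a, 'p) re, ('a, 'p) we) bimod" where
  "We E =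
     \<lparr>bcarrier = dual_corner E (ehat E) (ei E Zero) \<times> dual_corner E (ehat E) (ehat E),
      badd = (\<lambda>(\<gamma>, \<delta>) (\<gamma>', \<delta>'). (dual_add \<gamma> \<gamma>', dual_add \<delta> \<delta>')),
      bleft = (\<lambda>(s, t) (\<gamma>, \<delta>). (dual_l E s \<gamma>, dual_l E s \<delta>)),
      bright = (\<lambda>(\<gamma>, \<delta>) (s, t). (dual_r E \<gamma> t, dual_r E \<delta> s))\<rparr>"

fun letter_degree :: "('a::zero, 'p) re + ('a, 'p) we \<Rightarrow> nat \<Rightarrow> bool" where
  "letter_degree (Inl r) n \<longleftrightarrow> n = 0"
| "letter_degree (Inr (\<gamma>, \<delta>)) n \<longleftrightarrow> \<delta> = dual_zero \<and> n = 0 \<or> \<gamma> = dual_zero \<and> n = 1"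

abbreviation Te :: "('k::field, 'a::ring_1, 'p::order) poset_datum \<Rightarrow> ('a, 'p) te ring" where
  "Te E \<equiv> tensor_ring (Re E) (We E)"

definition tR :: "('k::field, 'a::ring_1, 'p::order) poset_datum \<Rightarrow> ('a, 'p) re \<Rightarrow> ('a, 'p) te" where
  "tR E r = tensor_class (Re E) (We E) (word [Inl r])"

definition w12 :: "('k::field, 'a::ring_1, 'p::order) poset_datum \<Rightarrow> ('a, 'p) dual \<Rightarrow> ('a, 'p) te" where
  "w12 E \<gamma> = tensor_class (Re E) (We E) (word [Inr (\<gamma>, dual_zero)])"

definition w1 :: "('k::field, 'a::ring_1, 'p::order) poset_datum \<Rightarrow> ('a, 'p) dual \<Rightarrow> ('a, 'p) te" where
  "w1 E \<delta> = tensor_class (Re E) (We E) (word [Inr (dual_zero, \<delta>)])"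

definition De ::
    "('k::field, 'a::ring_1, 'p::order) poset_datum \<Rightarrow> (('a, 'p) te \<Rightarrow> ('a, 'p) te) \<Rightarrow>
       ('k, ('a, 'p) te) ditalgebra" where
  "De E d =
     \<lparr>carrier = carrier (Te E), mult = mult (Te E), one = one (Te E),
      zero = zero (Te E), add = add (Te E),
      smult = (\<lambda>k t. tR E (k \<odot>\<^bsub>Lam E\<^esub> ehat E, k \<odot>\<^bsub>Lam E\<^esub> ei E Zero) \<otimes>\<^bsub>Te E\<^esub> t),
      part = tensor_part (Re E) (We E) letter_degree,
      base = tR E ` carrier (Re E),
      diff = d\<rparr>"

text \<open>The sums run over the pairs for which $\gamma_i$ and $\gamma_j$ lie in the relevant
  corners; all other terms vanish. The right-hand sides are $R^e$-bimodule maps in $\gamma$, so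
  such a \<open>d\<close> exists, and it is unique on the carrier because $T$ is generated by
  $R^e$, $W_0$ and $W_1$.\<close>

definition De_differential ::
    "('k::field, 'a::ring_1, 'p::order) poset_datum \<Rightarrow> ('p extp \<Rightarrow> 'p extp \<Rightarrow> ('a, 'p) lam set) \<Rightarrow>
       (('a, 'p) lam \<Rightarrow> ('a, 'p) dual) \<Rightarrow> (('a, 'p) te \<Rightarrow> ('a, 'p) te) \<Rightarrow> bool" where
  "De_differential E B gam d \<longleftrightarrow>
     (let B0 = \<Union> {B Zero x |x. x \<in> Pm E};
          Bh = \<Union> {B y x |y x. y \<in> Pm E \<and> x \<in> Pm E \<and> y < x};
          z = \<zero>\<^bsub>Lam E\<^esub>
      in graded_derivation (De E d) \<and>
        (\<forall>\<gamma>\<in>dual_corner E (ehat E) (ei E Zero).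
           d (w12 E \<gamma>) = \<ominus>\<^bsub>Te E\<^esub> (\<Oplus>\<^bsub>Te E\<^esub>p\<in>Bh. \<Oplus>\<^bsub>Te E\<^esub>q\<in>B0.
             w1 E (gam p) \<otimes>\<^bsub>Te E\<^esub> w12 E (gam q) \<otimes>\<^bsub>Te E\<^esub> tR E (z, \<gamma> (q \<otimes>\<^bsub>Lam E\<^esub> p)))) \<and>
        (\<forall>\<gamma>\<in>dual_corner E (ehat E) (ehat E).
           d (w1 E \<gamma>) = \<ominus>\<^bsub>Te E\<^esub> (\<Oplus>\<^bsub>Te E\<^esub>p\<in>Bh. \<Oplus>\<^bsub>Te E\<^esub>q\<in>Bh.
             w1 E (gam p) \<otimes>\<^bsub>Te E\<^esub> w1 E (gam q) \<otimes>\<^bsub>Te E\<^esub> tR E (\<gamma> (q \<otimes>\<^bsub>Lam E\<^esub> p), z))))"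


section \<open>Local bases, dimension vectors and matrices\<close>

text \<open>\<open>loc E x s\<close> is $w_2 s$ if $x = 0$ and $w_1 s$ otherwise, for $s \in e_x S$; so $\mathcal R_x$
  acts on $M_x$ through \<open>loc E x (mu x x r)\<close>.\<close>

definition loc ::
    "('k::field, 'a::ring_1, 'p::order) poset_datum \<Rightarrow> 'p extp \<Rightarrow> ('a, 'p) lam \<Rightarrow> ('a, 'p) te" where
  "loc E x s = tR E (if x = Zero then (\<zero>\<^bsub>Lam E\<^esub>, s) else (s, \<zero>\<^bsub>Lam E\<^esub>))"

definition comp_at ::
    "('k::field, 'a::ring_1, 'p::order) poset_datum \<Rightarrow> ('m \<Rightarrow> ('a, 'p) te \<Rightarrow> 'm) \<Rightarrow> 'p extp \<Rightarrow> 'm set" where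
  "comp_at E aM x = range (\<lambda>m. aM m (loc E x (ei E x)))"

definition lin_comb ::
    "('k::field, 'a::ring_1, 'p::order) poset_datum \<Rightarrow> ('m::ab_group_add \<Rightarrow> ('a, 'p) te \<Rightarrow> 'm) \<Rightarrow>
       'p extp \<Rightarrow> nat \<Rightarrow> (nat \<Rightarrow> 'm) \<Rightarrow> (nat \<Rightarrow> 'a) \<Rightarrow> 'm" where
  "lin_comb E aM x n b c = (\<Sum>i<n. aM (b i) (loc E x (mu x x (c i))))"

definition coeffs_at ::
    "('k, 'a::ring_1, 'p) poset_datum \<Rightarrow> 'p extp \<Rightarrow> nat \<Rightarrow> (nat \<Rightarrow> 'a) set" where
  "coeffs_at E x n = {c. \<forall>i. if i < n then c i \<in> Rs E x x else c i = 0}"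

definition basis_at ::
    "('k::field, 'a::ring_1, 'p::order) poset_datum \<Rightarrow> ('m::ab_group_add \<Rightarrow> ('a, 'p) te \<Rightarrow> 'm) \<Rightarrow>
       'p extp \<Rightarrow> nat \<Rightarrow> (nat \<Rightarrow> 'm) \<Rightarrow> bool" where
  "basis_at E aM x n b \<longleftrightarrow> (\<forall>i<n. b i \<in> comp_at E aM x) \<and>
     (\<forall>m\<in>comp_at E aM x. \<exists>!c. c \<in> coeffs_at E x n \<and> m = lin_comb E aM x n b c)"

definition dimv ::
    "('k::field, 'a::ring_1, 'p::order) poset_datum \<Rightarrow> ('m::ab_group_add \<Rightarrow> ('a, 'p) te \<Rightarrow> 'm) \<Rightarrow>
       'p extp \<Rightarrow> nat" where
  "dimv E aM x = (THE n. \<exists>b. basis_at E aM x n b)"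

text \<open>The basis vectors of $M_x$ are indexed from $0$ rather than from $1$.\<close>

definition local_basis ::
    "('k::field, 'a::ring_1, 'p::order) poset_datum \<Rightarrow> ('m::ab_group_add \<Rightarrow> ('a, 'p) te \<Rightarrow> 'm) \<Rightarrow>
       ('p extp \<Rightarrow> nat \<Rightarrow> 'm) \<Rightarrow> bool" where
  "local_basis E aM b \<longleftrightarrow> (\<forall>x\<in>Pum E. basis_at E aM x (dimv E aM x) (b x))"

text \<open>In the following \<open>v x\<close> is the chosen generator $v_{0,x}$ of $\mathcal R_{0,x}$.\<close>

definition chi ::
    "('k, 'a::ring_1, 'p) poset_datum \<Rightarrow> ('p extp \<Rightarrow> 'a) \<Rightarrow> 'p extp \<Rightarrow> 'p extp \<Rightarrow> 'a \<Rightarrow> 'a" where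
  "chi E v y x r = (THE c. c \<in> Rs E Zero Zero \<and> v y * r = c * v x)"

definition uhat ::
    "('k::field, 'a::ring_1, 'p::order) poset_datum \<Rightarrow> ('p extp \<Rightarrow> 'a) \<Rightarrow> 'p extp \<Rightarrow> ('a, 'p) dual" where
  "uhat E v x = (THE \<gamma>. \<gamma> \<in> dual_corner E (ei E x) (ei E Zero) \<and>
     \<gamma> (mu Zero x (v x)) = ei E Zero)"

definition phi ::
    "('k::field, 'a::ring_1, 'p::order) poset_datum \<Rightarrow> ('p extp \<Rightarrow> 'a) \<Rightarrow> 'p extp \<Rightarrow> 'a \<Rightarrow> 'a" where
  "phi E v x z = (THE c. c \<in> Rs E Zero Zero \<and>
     dual_l E (mu x x z) (uhat E v x) = dual_r E (uhat E v x) (mu Zero Zero c))"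

definition stripe ::
    "('k::field, 'a::ring_1, 'p::order) poset_datum \<Rightarrow> ('p extp \<Rightarrow> 'a) \<Rightarrow>
       ('m::ab_group_add \<Rightarrow> ('a, 'p) te \<Rightarrow> 'm) \<Rightarrow> ('p extp \<Rightarrow> nat \<Rightarrow> 'm) \<Rightarrow> 'p extp \<Rightarrow> 'a mat" where
  "stripe E v aM b x = mat (dimv E aM Zero) (dimv E aM x)
     (\<lambda>(j, i). (THE c. c \<in> coeffs_at E Zero (dimv E aM Zero) \<and>
        aM (b x i) (w12 E (uhat E v x)) = lin_comb E aM Zero (dimv E aM Zero) (b Zero) c) j)"

definition mats :: "nat \<Rightarrow> nat \<Rightarrow> 'a set \<Rightarrow> 'a mat set" where
  "mats n k X = {A \<in> carrier_mat n k. elements_mat A \<subseteq> X}"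

text \<open>Non-singularity over a subring \<open>X\<close> with its own unit \<open>u\<close>.\<close>

definition nonsingular :: "nat \<Rightarrow> 'a::ring_1 set \<Rightarrow> 'a \<Rightarrow> 'a mat \<Rightarrow> bool" where
  "nonsingular n X u A \<longleftrightarrow> A \<in> mats n n X \<and>
     (\<exists>A'\<in>mats n n X. A * A' = u \<cdot>\<^sub>m 1\<^sub>m n \<and> A' * A = u \<cdot>\<^sub>m 1\<^sub>m n)"

end

theory Submission
  imports Defs "HOL-Library.Product_Plus"
begin

text \<open>A $\mathcal D^e$-module is a right $S$-module together with matrices over the bimodules
  $\mathcal R_{0,x}$: the stripe of $x$ multiplied on the right by $v_{0,x}$ is a matrix
  $\widetilde M_x$ over $A$, and since $\phi_x(z) v_{0,x} = v_{0,x} z$ and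
  $\chi_{y,x}(r) v_{0,x} = v_{0,y} r$, the equation of the theorem turns into
  $\widetilde M = T_0 \widetilde N T$, where $T$ is the block upper triangular matrix with diagonal
  blocks $T_x$ and the blocks $T_{yx}$ above the diagonal. Expanding $f^1$ along the dual basis, a
  morphism $(f^0, f^1)$ amounts to such matrices $F_0$ and $F$: $f^0$ gives $F_0$ and the diagonal
  blocks, $f^1$ the other blocks, and compatibility with $d_e$ on $W_0$ becomes
  $F_0 \widetilde M = \widetilde N F$, so that $T_0 = F_0^{-1}$ and $T = F$. Composition of morphisms is multiplication of matrices, and
  a block upper triangular matrix with invertible diagonal blocks is invertible.

  To show that a map given on the letters of $T$ is compatible with the defining relations,
  the tensor ring is made to act on the direct sum of the modules involved.\<close>

section \<open>Free rings and tensor rings\<close>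

text \<open>Elements of \<open>T\<close> have no normal form, so a map on \<open>T\<close> is never
  defined by cases: it is read off from an action, and identities on T_1 are tested on letters. The
  blocks above the diagonal enter through rows. A row of \<open>F\<close> applied to
  \<open>m\<close> is an element of \<open>J\<close>; a form \<open>\<delta>\<close> sends it into
  \<open>S\<close>, and the sum of the basis vectors of \<open>N\<close> multiplied by these values
  is f^1(w_1 \<open>\<delta>\<close>)(m). The double sums over dual bases in \<open>d\<close> then
  collapse, because the sum of all \<open>gam q U \<otimes> q\<close> is \<open>U\<close>: what
  remains is \<open>\<delta>\<close> of a product of strictly upper triangular matrices. The sign of
  \<open>d\<close>, and for composition the second sign in \<open>dit_comp\<close>, make this
  product add to the contributions of f^0, which supply the terms with a diagonal factor; together
  they form the full matrix product. One-dimensionality of R_{0,x} makes multiplication by v_{0,x}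
  injective on R_0, so that passing from stripes to matrices over \<open>A\<close> loses
  nothing.\<close>

definition splits :: "'g list \<Rightarrow> ('g list \<times> 'g list) set" where
  "splits w = {(u, v). u @ v = w}"

lemma splits_conv_image: "splits w = (\<lambda>i. (take i w, drop i w)) ` {..length w}"
proof -
  have "(u, v) \<in> (\<lambda>i. (take i w, drop i w)) ` {..length w}" if "u @ v = w" for u v
    using that by (intro image_eqI[where x = "length u"]) auto
  then show ?thesis by (auto simp: splits_def)
qed

lemma mem_splits [simp]: "(u, v) \<in> splits w \<longleftrightarrow> u @ v = w"
  by (simp add: splits_def)

lemma finite_splits [simp]: "finite (splits w)"
  by (simp add: splits_conv_image)

lemma inj_on_splits: "inj_on (\<lambda>i. (take i w, drop i w)) {..length w}"
proof (rule inj_onI)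
  fix i j
  assume "i \<in> {..length w}" "j \<in> {..length w}" "(take i w, drop i w) = (take j w, drop j w)"
  then have "length (take i w) = length (take j w)" "i \<le> length w" "j \<le> length w" by auto
  then show "i = j" by simp
qed

lemma sum_splits:
  "(\<Sum>i\<le>length w. f (take i w) * g (drop i w)) = (\<Sum>(u, v)\<in>splits w. f u * g v)"
  by (simp add: splits_conv_image sum.reindex[OF inj_on_splits])

lemma free_ring_simps:
  "f \<in> carrier (free_ring G) \<longleftrightarrow> finite {w. f w \<noteq> 0} \<and> {w. f w \<noteq> 0} \<subseteq> lists G"
  "f \<otimes>\<^bsub>free_ring G\<^esub> g = (\<lambda>w. \<Sum>(u, v)\<in>splits w. f u * g v)"
  "\<one>\<^bsub>free_ring G\<^esub> = word []"
  "\<zero>\<^bsub>free_ring G\<^esub> = (\<lambda>w. 0)"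
  "f \<oplus>\<^bsub>free_ring G\<^esub> g = (\<lambda>w. f w + g w)"
  by (simp_all add: free_ring_def sum_splits word_def)

text \<open>Both sides run over the ways to cut \<open>w\<close> into three pieces; the bijection
  moves the middle piece from the left part to the right part.\<close>

lemma sum_splits_assoc:
  fixes f g h :: "'g list \<Rightarrow> int"
  shows "(\<Sum>(u, v)\<in>splits w. (\<Sum>(a, b)\<in>splits u. f a * g b) * h v) =
    (\<Sum>(a, u)\<in>splits w. f a * (\<Sum>(b, v)\<in>splits u. g b * h v))"
proof -
  have "(\<Sum>(u, v)\<in>splits w. (\<Sum>(a, b)\<in>splits u. f a * g b) * h v) =
      (\<Sum>(uv, ab)\<in>Sigma (splits w) (\<lambda>uv. splits (fst uv)). f (fst ab) * g (snd ab) * h (snd uv))"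
    by (subst sum.Sigma[symmetric]) (auto simp: sum_distrib_right case_prod_unfold)
  also have "\<dots> = (\<Sum>(au, bv)\<in>Sigma (splits w) (\<lambda>au. splits (snd au)).
      f (fst au) * (g (fst bv) * h (snd bv)))"
    by (rule sum.reindex_bij_witness
        [where i = "\<lambda>((a, u), (b, v)). ((a @ b, v), (a, b))"
          and j = "\<lambda>((u, v), (a, b)). ((a, b @ v), (b, v))"])
       auto
  also have "\<dots> = (\<Sum>(a, u)\<in>splits w. f a * (\<Sum>(b, v)\<in>splits u. g b * h v))"
    by (subst sum.Sigma[symmetric]) (auto simp: sum_distrib_left case_prod_unfold)
  finally show ?thesis .
qed

text \<open>A non-zero sum has a non-zero term. This gives finiteness of supports here and
  additivity of degrees later.\<close>

lemma conv_support:
  "{w. (\<Sum>(u, v)\<in>splits w. f u * g v) \<noteq> (0::int)} \<subseteq> (\<lambda>(u, v). u @ v) ` ({w. f w \<noteq> 0} \<times> {w. g w \<noteq> 0})"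
proof
  fix w assume "w \<in> {w. (\<Sum>(u, v)\<in>splits w. f u * g v) \<noteq> 0}"
  then have "(\<Sum>x\<in>splits w. f (fst x) * g (snd x)) \<noteq> 0" by (simp add: case_prod_unfold)
  then obtain x where "x \<in> splits w" "f (fst x) * g (snd x) \<noteq> 0"
    by (rule sum.not_neutral_contains_not_neutral)
  then show "w \<in> (\<lambda>(u, v). u @ v) ` ({w. f w \<noteq> 0} \<times> {w. g w \<noteq> 0})"
    by (intro image_eqI[where x = x]) (auto simp: splits_def)
qed

lemma splits_single_left:
  fixes w :: "'g list"
  shows "(\<Sum>(u, v)\<in>splits w. word [] u * g v) = g w"
proof -
  have "(\<Sum>(u, v)\<in>splits w. word [] u * g v) = (\<Sum>(u, v)\<in>{([] :: 'g list, w)}. word [] u * g v)"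
    by (rule sum.mono_neutral_right) (auto simp: word_def split: if_splits)
  then show ?thesis by (simp add: word_def)
qed

lemma splits_single_right:
  fixes w :: "'g list"
  shows "(\<Sum>(u, v)\<in>splits w. g u * word [] v) = g w"
proof -
  have "(\<Sum>(u, v)\<in>splits w. g u * word [] v) = (\<Sum>(u, v)\<in>{(w, [] :: 'g list)}. g u * word [] v)"
    by (rule sum.mono_neutral_right) (auto simp: word_def split: if_splits)
  then show ?thesis by (simp add: word_def)
qed

lemma free_ring_mult_closed:
  assumes "f \<in> carrier (free_ring G)" "g \<in> carrier (free_ring G)"
  shows "f \<otimes>\<^bsub>free_ring G\<^esub> g \<in> carrier (free_ring G)"
proof -
  let ?P = "(\<lambda>(u, v). u @ v) ` ({w. f w \<noteq> 0} \<times> {w. g w \<noteq> 0})"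
  have "finite ?P" using assms by (auto simp: free_ring_simps)
  moreover have "?P \<subseteq> lists G" using assms by (fastforce simp: free_ring_simps)
  ultimately show ?thesis
    using conv_support[of f g] unfolding free_ring_simps by (meson finite_subset subset_trans)
qed

lemma free_ring_add_closed:
  assumes "f \<in> carrier (free_ring G)" "g \<in> carrier (free_ring G)"
  shows "f \<oplus>\<^bsub>free_ring G\<^esub> g \<in> carrier (free_ring G)"
proof -
  have "{w. f w + g w \<noteq> 0} \<subseteq> {w. f w \<noteq> 0} \<union> {w. g w \<noteq> 0}" by auto
  moreover have "finite ({w. f w \<noteq> 0} \<union> {w. g w \<noteq> 0})" "{w. f w \<noteq> 0} \<union> {w. g w \<noteq> 0} \<subseteq> lists G"
    using assms by (simp_all add: free_ring_simps)
  ultimately show ?thesis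
    unfolding free_ring_simps by (meson finite_subset subset_trans)
qed

lemma ring_free_ring: "ring (free_ring G)"
proof (rule ringI)
  show "abelian_group (free_ring G)"
  proof (rule abelian_groupI)
    fix f g assume "f \<in> carrier (free_ring G)" "g \<in> carrier (free_ring G)"
    then show "f \<oplus>\<^bsub>free_ring G\<^esub> g \<in> carrier (free_ring G)" by (rule free_ring_add_closed)
  next
    fix f assume f: "f \<in> carrier (free_ring G)"
    then have "(\<lambda>w. - f w) \<in> carrier (free_ring G)" by (simp add: free_ring_simps)
    then show "\<exists>g\<in>carrier (free_ring G). g \<oplus>\<^bsub>free_ring G\<^esub> f = \<zero>\<^bsub>free_ring G\<^esub>"
      by (rule bexI[rotated]) (simp add: free_ring_simps)
  qed (auto simp: free_ring_simps algebra_simps)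
  show "Group.monoid (free_ring G)"
  proof (rule monoidI)
    fix f g assume "f \<in> carrier (free_ring G)" "g \<in> carrier (free_ring G)"
    then show "f \<otimes>\<^bsub>free_ring G\<^esub> g \<in> carrier (free_ring G)" by (rule free_ring_mult_closed)
  next
    show "\<one>\<^bsub>free_ring G\<^esub> \<in> carrier (free_ring G)"
      by (auto simp: free_ring_simps word_def)
  next
    fix f g h :: "'a list \<Rightarrow> int"
    show "f \<otimes>\<^bsub>free_ring G\<^esub> g \<otimes>\<^bsub>free_ring G\<^esub> h = f \<otimes>\<^bsub>free_ring G\<^esub> (g \<otimes>\<^bsub>free_ring G\<^esub> h)"
      unfolding free_ring_simps by (rule ext) (rule sum_splits_assoc)
    show "\<one>\<^bsub>free_ring G\<^esub> \<otimes>\<^bsub>free_ring G\<^esub> f = f"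
      unfolding free_ring_simps by (rule ext) (rule splits_single_left)
    show "f \<otimes>\<^bsub>free_ring G\<^esub> \<one>\<^bsub>free_ring G\<^esub> = f"
      unfolding free_ring_simps by (rule ext) (rule splits_single_right)
  qed
  fix f g h :: "'a list \<Rightarrow> int"
  show "(f \<oplus>\<^bsub>free_ring G\<^esub> g) \<otimes>\<^bsub>free_ring G\<^esub> h =
      f \<otimes>\<^bsub>free_ring G\<^esub> h \<oplus>\<^bsub>free_ring G\<^esub> g \<otimes>\<^bsub>free_ring G\<^esub> h"
    unfolding free_ring_simps by (simp add: sum.distrib[symmetric] case_prod_unfold distrib_right)
  show "h \<otimes>\<^bsub>free_ring G\<^esub> (f \<oplus>\<^bsub>free_ring G\<^esub> g) =
      h \<otimes>\<^bsub>free_ring G\<^esub> f \<oplus>\<^bsub>free_ring G\<^esub> h \<otimes>\<^bsub>free_ring G\<^esub> g"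
    unfolding free_ring_simps by (simp add: sum.distrib[symmetric] case_prod_unfold distrib_left)
qed

lemma word_in_free_ring [simp]: "word w \<in> carrier (free_ring G) \<longleftrightarrow> w \<in> lists G"
  by (auto simp: free_ring_simps word_def)

lemma word_append: "word u \<otimes>\<^bsub>free_ring G\<^esub> word v = word (u @ v)"
proof
  fix w
  have "(\<Sum>(a, b)\<in>splits w. word u a * word v b) =
      (\<Sum>(a, b)\<in>splits w \<inter> {(u, v)}. word u a * word v b)"
    by (rule sum.mono_neutral_right) (auto simp: word_def split: if_splits)
  also have "\<dots> = word (u @ v) w"
    by (cases "(u, v) \<in> splits w") (auto simp: word_def split: if_splits)
  finally show "(word u \<otimes>\<^bsub>free_ring G\<^esub> word v) w = word (u @ v) w"
    by (simp add: free_ring_simps)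
qed

lemma free_ring_a_inv:
  assumes "f \<in> carrier (free_ring G)" shows "\<ominus>\<^bsub>free_ring G\<^esub> f = (\<lambda>w. - f w)"
proof -
  interpret ring "free_ring G" by (rule ring_free_ring)
  have "(\<lambda>w. - f w) \<in> carrier (free_ring G)" using assms by (simp add: free_ring_simps)
  then show ?thesis
    by (intro minus_equality) (use assms in \<open>auto simp: free_ring_simps\<close>)
qed

lemma free_ring_minus:
  assumes "f \<in> carrier (free_ring G)" "g \<in> carrier (free_ring G)"
  shows "f \<ominus>\<^bsub>free_ring G\<^esub> g = free_diff f g"
  using assms by (simp add: a_minus_def free_ring_a_inv free_ring_simps(5) free_diff_def)

text \<open>Integer coefficients are reached from words by addition and negation, so there is no
  case for scalars. The premise \<open>f w \<noteq> 0\<close> of the word case lets degree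
  conditions on the support of \<open>f\<close> pass to the words.\<close>

lemma free_ring_induct [consumes 1, case_names add uminus word]:
  assumes f: "f \<in> carrier (free_ring G)"
    and add: "\<And>f g. \<lbrakk>Q f; Q g\<rbrakk> \<Longrightarrow> Q (\<lambda>w. f w + g w)"
    and uminus: "\<And>f. Q f \<Longrightarrow> Q (\<lambda>w. - f w)"
    and word: "\<And>w. w \<in> lists G \<Longrightarrow> f w \<noteq> 0 \<Longrightarrow> Q (word w)"
    and zero: "Q (\<lambda>w. 0)"
  shows "Q f"
proof -
  have mult: "Q (\<lambda>w'. k * word w w')" if "Q (word w)" for k :: int and w
  proof (induction k rule: int_induct[where k = 0])
    case base then show ?case using zero by simp
  next
    case (step1 i)
    then show ?case using add[OF step1(2) that] by (simp add: algebra_simps)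
  next
    case (step2 i)
    then show ?case using add[OF step2(2) uminus[OF that]] by (simp add: algebra_simps)
  qed
  \<comment> \<open>Induction over finite parts of the support; at the end \<open>A\<close> is the
    whole support.\<close>
  have "Q (\<lambda>w. if w \<in> A then f w else 0)" if "finite A" "A \<subseteq> {w. f w \<noteq> 0}" for A
    using that
  proof (induction A)
    case empty then show ?case using zero by simp
  next
    case (insert a A)
    have "Q (\<lambda>w. (if w \<in> A then f w else 0) + f a * word a w)"
      by (intro add mult word insert.IH) (use insert f in \<open>auto simp: free_ring_simps\<close>)
    moreover have "(\<lambda>w. (if w \<in> A then f w else 0) + f a * word a w) = (\<lambda>w. if w \<in> insert a A then f w else 0)"
      using insert by (auto simp: word_def)
    ultimately show ?case by simp
  qed
  from this[of "{w. f w \<noteq> 0}"] f have "Q (\<lambda>w. if w \<in> {w. f w \<noteq> 0} then f w else 0)"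
    by (simp add: free_ring_simps)
  also have "(\<lambda>w. if w \<in> {w. f w \<noteq> 0} then f w else 0) = f" by auto
  finally show ?thesis .
qed

section \<open>Actions of the free ring on an abelian group\<close>

text \<open>Written as an iterated sum, so that every additive map commutes with it.\<close>

definition int_mult :: "int \<Rightarrow> 'x::ab_group_add \<Rightarrow> 'x" where
  "int_mult k x = (if 0 \<le> k then \<Sum>i<nat k. x else - (\<Sum>i<nat (- k). x))"

lemma int_mult_0 [simp]: "int_mult 0 x = 0" and int_mult_1 [simp]: "int_mult 1 x = x"
  by (simp_all add: int_mult_def)

lemma int_mult_plus_1: "int_mult (k + 1) x = int_mult k x + x"
proof (cases "0 \<le> k")
  case True
  then have "nat (k + 1) = Suc (nat k)" by simp
  then show ?thesis using True by (simp add: int_mult_def)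
next
  case False
  then have "nat (- k) = Suc (nat (- (k + 1)))" by simp
  then show ?thesis using False by (auto simp: int_mult_def)
qed

lemma int_mult_add: "int_mult (k + l) x = int_mult k x + int_mult l x"
proof (induction l rule: int_induct[where k = 0])
  case (step1 i)
  then show ?case
    using int_mult_plus_1[of "k + i" x] int_mult_plus_1[of i x] by (simp add: algebra_simps)
next
  case (step2 i)
  then show ?case
    using int_mult_plus_1[of "k + i - 1" x] int_mult_plus_1[of "i - 1" x] by (simp add: algebra_simps)
qed simp

lemma int_mult_uminus: "int_mult (- k) x = - int_mult k x"
  using int_mult_add[of k "- k" x] by (simp add: add_eq_0_iff)

lemma int_mult_mult: "int_mult (k * l) x = int_mult l (int_mult k x)"
proof (induction l rule: int_induct[where k = 0])
  case (step1 i)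
  then show ?case by (simp add: int_mult_add distrib_left)
next
  case (step2 i)
  then show ?case
    using int_mult_add[of "k * i - k" k x] int_mult_plus_1[of "i - 1" "int_mult k x"]
    by (simp add: algebra_simps)
qed simp

lemma additive_int_mult: "additive h \<Longrightarrow> h (int_mult k x) = int_mult k (h x)"
  by (simp add: int_mult_def additive.sum additive.minus)

lemma int_mult_sum:
  fixes f :: "'i \<Rightarrow> 'x::ab_group_add"
  shows "int_mult k (\<Sum>a\<in>A. f a) = (\<Sum>a\<in>A. int_mult k (f a))"
proof -
  have "additive (int_mult k :: 'x \<Rightarrow> 'x)"
    by (rule additive.intro) (simp add: int_mult_def sum.distrib)
  then show ?thesis by (rule additive.sum)
qed

text \<open>A right action: the first letter acts first, so that concatenation of words is
  composition of actions in reading order.\<close>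

definition word_act :: "('g \<Rightarrow> 'x \<Rightarrow> 'x) \<Rightarrow> 'x \<Rightarrow> 'g list \<Rightarrow> 'x" where
  "word_act \<beta> x w = foldl (\<lambda>x l. \<beta> l x) x w"

lemma word_act_simps [simp]:
  "word_act \<beta> x [] = x"
  "word_act \<beta> x (l # w) = word_act \<beta> (\<beta> l x) w"
  "word_act \<beta> x (u @ w) = word_act \<beta> (word_act \<beta> x u) w"
  by (simp_all add: word_act_def)

lemma additive_word_act: "(\<And>l. additive (\<beta> l)) \<Longrightarrow> additive (\<lambda>x. word_act \<beta> x w)"
  by (induction w) (auto simp: additive_def)

definition free_act :: "('g \<Rightarrow> 'x \<Rightarrow> 'x::ab_group_add) \<Rightarrow> 'x \<Rightarrow> ('g list \<Rightarrow> int) \<Rightarrow> 'x" where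
  "free_act \<beta> x f = (\<Sum>w | f w \<noteq> 0. int_mult (f w) (word_act \<beta> x w))"

lemma free_act_superset:
  assumes "finite A" "{w. f w \<noteq> 0} \<subseteq> A"
  shows "free_act \<beta> x f = (\<Sum>w\<in>A. int_mult (f w) (word_act \<beta> x w))"
  unfolding free_act_def by (rule sum.mono_neutral_left) (use assms in auto)

lemma free_act_add:
  assumes "f \<in> carrier (free_ring G)" "g \<in> carrier (free_ring G)"
  shows "free_act \<beta> x (\<lambda>w. f w + g w) = free_act \<beta> x f + free_act \<beta> x g"
proof -
  let ?A = "{w. f w \<noteq> 0} \<union> {w. g w \<noteq> 0}"
  have fin: "finite ?A" using assms by (simp add: free_ring_simps)
  show ?thesis
    by (subst (1 2 3) free_act_superset[OF fin]) (auto simp: sum.distrib[symmetric] int_mult_add)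
qed

lemma free_act_uminus: "free_act \<beta> x (\<lambda>w. - f w) = - free_act \<beta> x f"
  by (simp add: free_act_def sum_negf int_mult_uminus)

lemma free_act_zero: "free_act \<beta> x (\<lambda>w. 0) = 0"
  by (simp add: free_act_def)

lemma free_act_word: "free_act \<beta> x (word w) = word_act \<beta> x w"
  by (subst free_act_superset[of "{w}"]) (auto simp: word_def)

lemma additive_free_act:
  assumes "\<And>l. additive (\<beta> l)" shows "additive (\<lambda>x. free_act \<beta> x f)"
proof (rule additive.intro)
  fix x y
  have "int_mult k (a + b) = int_mult k a + int_mult k b" for k and a b :: 'b
    by (simp add: int_mult_def sum.distrib)
  then show "free_act \<beta> (x + y) f = free_act \<beta> x f + free_act \<beta> y f"
    by (simp add: free_act_def sum.distrib[symmetric] additive.add[OF additive_word_act[OF assms]])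
qed

text \<open>Pairs of words from the two supports are grouped by their concatenation; the total
  coefficient of each group is the value of the convolution.\<close>

lemma free_act_mult:
  assumes f: "f \<in> carrier (free_ring G)" and g: "g \<in> carrier (free_ring G)"
    and \<beta>: "\<And>l. additive (\<beta> l)"
  shows "free_act \<beta> x (f \<otimes>\<^bsub>free_ring G\<^esub> g) = free_act \<beta> (free_act \<beta> x f) g"
proof -
  let ?A = "{w. f w \<noteq> 0}" and ?B = "{w. g w \<noteq> 0}"
  let ?p = "word_act \<beta> x"
  have fin: "finite (?A \<times> ?B)" using f g by (simp add: free_ring_simps)
  \<comment> \<open>Replaces the cuts of \<open>w\<close> by the supported pairs with concatenation
    \<open>w\<close>, which are the fibres of the regrouping below.\<close>
  have conv: "(\<Sum>(u, v)\<in>splits w. f u * g v) = (\<Sum>(u, v)\<in>{x \<in> ?A \<times> ?B. fst x @ snd x = w}. f u * g v)" for w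
    by (rule sum.mono_neutral_right) auto
  have isum: "int_mult (\<Sum>a\<in>C. h a) y = (\<Sum>a\<in>C. int_mult (h a) y)"
    for h :: "_ \<Rightarrow> int" and C and y :: 'b
    by (induction C rule: infinite_finite_induct) (simp_all add: int_mult_add)
  have "free_act \<beta> (free_act \<beta> x f) g =
      (\<Sum>v\<in>?B. \<Sum>u\<in>?A. int_mult (g v) (word_act \<beta> (int_mult (f u) (?p u)) v))"
    unfolding free_act_def additive.sum[OF additive_word_act[OF \<beta>]] int_mult_sum ..
  also have "\<dots> = (\<Sum>v\<in>?B. \<Sum>u\<in>?A. int_mult (f u * g v) (?p (u @ v)))"
    by (simp add: additive_int_mult[OF additive_word_act[OF \<beta>]] int_mult_mult)
  also have "\<dots> = (\<Sum>(u, v)\<in>?A \<times> ?B. int_mult (f u * g v) (?p (u @ v)))"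
    by (subst sum.swap) (simp add: sum.cartesian_product)
  also have "\<dots> = (\<Sum>w\<in>(\<lambda>x. fst x @ snd x) ` (?A \<times> ?B).
      \<Sum>(u, v)\<in>{x \<in> ?A \<times> ?B. fst x @ snd x = w}. int_mult (f u * g v) (?p (u @ v)))"
    by (rule sum.image_gen[OF fin])
  also have "\<dots> = (\<Sum>w\<in>(\<lambda>x. fst x @ snd x) ` (?A \<times> ?B).
      int_mult (\<Sum>(u, v)\<in>{x \<in> ?A \<times> ?B. fst x @ snd x = w}. f u * g v) (?p w))"
    unfolding isum
    by (intro sum.cong refl) (auto simp: case_prod_unfold simp del: word_act_simps intro!: sum.cong)
  also have "\<dots> = free_act \<beta> x (f \<otimes>\<^bsub>free_ring G\<^esub> g)"
  proof -
    have "{w. (f \<otimes>\<^bsub>free_ring G\<^esub> g) w \<noteq> 0} \<subseteq> (\<lambda>x. fst x @ snd x) ` (?A \<times> ?B)"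
      using conv_support[of f g] by (simp add: free_ring_simps(2) case_prod_unfold)
    from free_act_superset[OF finite_imageI[OF fin] this, of \<beta> x] show ?thesis
      by (simp only: free_ring_simps(2) conv)
  qed
  finally show ?thesis by simp
qed

section \<open>The quotient by the tensor relations\<close>

text \<open>Closure under the operations puts the defining relations inside the free ring, so that
  they generate an ideal there; the relations themselves then impose the bimodule laws.\<close>

locale tensor_datum =
  fixes R :: "'r ring" and W :: "('r, 'w) bimod"
  assumes one_closed: "\<one>\<^bsub>R\<^esub> \<in> carrier R"
    and mult_closed: "\<And>r s. \<lbrakk>r \<in> carrier R; s \<in> carrier R\<rbrakk> \<Longrightarrow> r \<otimes>\<^bsub>R\<^esub> s \<in> carrier R"
    and add_closed: "\<And>r s. \<lbrakk>r \<in> carrier R; s \<in> carrier R\<rbrakk> \<Longrightarrow> r \<oplus>\<^bsub>R\<^esub> s \<in> carrier R"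
    and badd_closed: "\<And>v w. \<lbrakk>v \<in> bcarrier W; w \<in> bcarrier W\<rbrakk> \<Longrightarrow> badd W v w \<in> bcarrier W"
    and bleft_closed: "\<And>r w. \<lbrakk>r \<in> carrier R; w \<in> bcarrier W\<rbrakk> \<Longrightarrow> bleft W r w \<in> bcarrier W"
    and bright_closed: "\<And>r w. \<lbrakk>r \<in> carrier R; w \<in> bcarrier W\<rbrakk> \<Longrightarrow> bright W w r \<in> bcarrier W"
begin

abbreviation FR where "FR \<equiv> free_ring (tensor_letters R W)"
abbreviation cls where "cls \<equiv> tensor_class R W"
abbreviation TR where "TR \<equiv> tensor_ring R W"

sublocale FR: ring FR by (rule ring_free_ring)

lemma free_diff_closed: "\<lbrakk>f \<in> carrier FR; g \<in> carrier FR\<rbrakk> \<Longrightarrow> free_diff f g \<in> carrier FR"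
  using FR.minus_closed[of f g] by (simp add: free_ring_minus)

lemma Inl_letter [simp]: "Inl r \<in> tensor_letters R W \<longleftrightarrow> r \<in> carrier R"
  and Inr_letter [simp]: "Inr w \<in> tensor_letters R W \<longleftrightarrow> w \<in> bcarrier W"
  by (auto simp: tensor_letters_def)

lemma relations_closed: "tensor_relations R W \<subseteq> carrier FR"
  unfolding tensor_relations_def
  by (auto simp: one_closed mult_closed add_closed badd_closed bleft_closed bright_closed
      intro!: free_diff_closed)

lemma ideal_tensor_ideal: "ideal (tensor_ideal R W) FR"
  unfolding tensor_ideal_def by (rule ring.genideal_ideal[OF ring_free_ring relations_closed])

sublocale TI: ideal "tensor_ideal R W" FR by (rule ideal_tensor_ideal)
sublocale TR: ring TR unfolding tensor_ring_def by (rule TI.quotient_is_ring)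

lemma carrier_TR: "carrier TR = cls ` carrier FR"
  by (auto simp: tensor_ring_def FactRing_def A_RCOSETS_def' tensor_class_def)

lemma cls_hom: "cls \<in> ring_hom FR TR"
  unfolding tensor_ring_def using TI.rcos_ring_hom by (simp add: tensor_class_def[abs_def])

lemma cls_closed [simp]: "f \<in> carrier FR \<Longrightarrow> cls f \<in> carrier TR"
  using ring_hom_closed[OF cls_hom] .

lemma cls_mult: "\<lbrakk>f \<in> carrier FR; g \<in> carrier FR\<rbrakk> \<Longrightarrow> cls (f \<otimes>\<^bsub>FR\<^esub> g) = cls f \<otimes>\<^bsub>TR\<^esub> cls g"
  using ring_hom_mult[OF cls_hom] .

lemma cls_add: "\<lbrakk>f \<in> carrier FR; g \<in> carrier FR\<rbrakk> \<Longrightarrow> cls (\<lambda>w. f w + g w) = cls f \<oplus>\<^bsub>TR\<^esub> cls g"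
  using ring_hom_add[OF cls_hom, of f g] by (simp add: free_ring_simps(5))

lemma cls_one: "cls (word []) = \<one>\<^bsub>TR\<^esub>"
  using ring_hom_one[OF cls_hom] by (simp add: free_ring_simps)

lemma cls_zero: "cls (\<lambda>w. 0) = \<zero>\<^bsub>TR\<^esub>"
  using ring_hom_zero[OF cls_hom ring_free_ring TR.ring_axioms] by (simp add: free_ring_simps)

lemma cls_uminus:
  assumes f: "f \<in> carrier FR" shows "cls (\<lambda>w. - f w) = \<ominus>\<^bsub>TR\<^esub> cls f"
proof -
  have g: "(\<lambda>w. - f w) \<in> carrier FR" using f by (simp add: free_ring_simps)
  have "cls (\<lambda>w. - f w) \<oplus>\<^bsub>TR\<^esub> cls f = \<zero>\<^bsub>TR\<^esub>"
    using cls_add[OF g f] by (simp add: cls_zero)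
  then show ?thesis using TR.minus_equality f g by simp
qed

lemma cls_eq_iff:
  assumes "f \<in> carrier FR" "g \<in> carrier FR"
  shows "cls f = cls g \<longleftrightarrow> free_diff f g \<in> tensor_ideal R W"
proof -
  have "cls f = cls g \<longleftrightarrow> f \<ominus>\<^bsub>FR\<^esub> g \<in> tensor_ideal R W"
    unfolding tensor_class_def
    by (rule FR.quotient_eq_iff_same_a_r_cos[OF ideal_tensor_ideal assms, symmetric])
  then show ?thesis by (simp add: free_ring_minus assms)
qed

lemma relation_cls: "\<lbrakk>free_diff f g \<in> tensor_relations R W; f \<in> carrier FR; g \<in> carrier FR\<rbrakk> \<Longrightarrow> cls f = cls g"
  using FR.genideal_self[OF relations_closed] cls_eq_iff unfolding tensor_ideal_def by blast

lemma cls_append: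
  "\<lbrakk>u \<in> lists (tensor_letters R W); w \<in> lists (tensor_letters R W)\<rbrakk> \<Longrightarrow>
    cls (word (u @ w)) = cls (word u) \<otimes>\<^bsub>TR\<^esub> cls (word w)"
  by (simp add: word_append[where G = "tensor_letters R W", symmetric] cls_mult)

lemma cls_R_one: "cls (word [Inl \<one>\<^bsub>R\<^esub>]) = \<one>\<^bsub>TR\<^esub>"
  using relation_cls[of "word [Inl \<one>\<^bsub>R\<^esub>]" "word []"] one_closed
  by (simp add: tensor_relations_def cls_one)

lemma cls_R_mult:
  assumes "r \<in> carrier R" "s \<in> carrier R"
  shows "cls (word [Inl (r \<otimes>\<^bsub>R\<^esub> s)]) = cls (word [Inl r]) \<otimes>\<^bsub>TR\<^esub> cls (word [Inl s])"
proof -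
  have "cls (word [Inl (r \<otimes>\<^bsub>R\<^esub> s)]) = cls (word [Inl r, Inl s])"
  proof (rule relation_cls)
    show "free_diff (word [Inl (r \<otimes>\<^bsub>R\<^esub> s)]) (word [Inl r, Inl s]) \<in> tensor_relations R W"
      unfolding tensor_relations_def using assms by blast
  qed (use assms mult_closed in simp_all)
  then show ?thesis using cls_append[of "[Inl r]" "[Inl s]"] assms by simp
qed

lemma cls_W_left:
  assumes "r \<in> carrier R" "w \<in> bcarrier W"
  shows "cls (word [Inr (bleft W r w)]) = cls (word [Inl r]) \<otimes>\<^bsub>TR\<^esub> cls (word [Inr w])"
proof -
  have "cls (word [Inr (bleft W r w)]) = cls (word [Inl r, Inr w])"
  proof (rule relation_cls)
    show "free_diff (word [Inr (bleft W r w)]) (word [Inl r, Inr w]) \<in> tensor_relations R W"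
      unfolding tensor_relations_def using assms by blast
  qed (use assms bleft_closed in simp_all)
  then show ?thesis using cls_append[of "[Inl r]" "[Inr w]"] assms by simp
qed

lemma cls_W_right:
  assumes "r \<in> carrier R" "w \<in> bcarrier W"
  shows "cls (word [Inr (bright W w r)]) = cls (word [Inr w]) \<otimes>\<^bsub>TR\<^esub> cls (word [Inl r])"
proof -
  have "cls (word [Inr (bright W w r)]) = cls (word [Inr w, Inl r])"
  proof (rule relation_cls)
    show "free_diff (word [Inr (bright W w r)]) (word [Inr w, Inl r]) \<in> tensor_relations R W"
      unfolding tensor_relations_def using assms by blast
  qed (use assms bright_closed in simp_all)
  then show ?thesis using cls_append[of "[Inr w]" "[Inl r]"] assms by simp
qed

text \<open>A three-term relation x - y - z is regrouped as x - (y + z), the two-term shape that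
  \<open>relation_cls\<close> handles.\<close>

lemma cls_additive_relation:
  assumes rel: "free_diff (free_diff (word [x]) (word [y])) (word [z]) \<in> tensor_relations R W"
    and letters: "x \<in> tensor_letters R W" "y \<in> tensor_letters R W" "z \<in> tensor_letters R W"
  shows "cls (word [x]) = cls (word [y]) \<oplus>\<^bsub>TR\<^esub> cls (word [z])"
proof -
  have "free_diff (free_diff (word [x]) (word [y])) (word [z]) =
      free_diff (word [x]) (\<lambda>w. word [y] w + word [z] w)"
    by (auto simp: free_diff_def)
  then have "cls (word [x]) = cls (\<lambda>w. word [y] w + word [z] w)"
    using rel letters FR.a_closed[of "word [y]" "word [z]"]
    by (intro relation_cls) (simp_all add: free_ring_simps(5))
  then show ?thesis using letters by (simp add: cls_add)
qed

lemma cls_R_add: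
  assumes "r \<in> carrier R" "s \<in> carrier R"
  shows "cls (word [Inl (r \<oplus>\<^bsub>R\<^esub> s)]) = cls (word [Inl r]) \<oplus>\<^bsub>TR\<^esub> cls (word [Inl s])"
proof (rule cls_additive_relation)
  show "free_diff (free_diff (word [Inl (r \<oplus>\<^bsub>R\<^esub> s)]) (word [Inl r])) (word [Inl s]) \<in> tensor_relations R W"
    unfolding tensor_relations_def using assms by blast
qed (use assms add_closed in simp_all)

lemma cls_W_add:
  assumes "v \<in> bcarrier W" "w \<in> bcarrier W"
  shows "cls (word [Inr (badd W v w)]) = cls (word [Inr v]) \<oplus>\<^bsub>TR\<^esub> cls (word [Inr w])"
proof (rule cls_additive_relation)
  show "free_diff (free_diff (word [Inr (badd W v w)]) (word [Inr v])) (word [Inr w]) \<in> tensor_relations R W"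
    unfolding tensor_relations_def using assms by blast
qed (use assms badd_closed in simp_all)

lemma letter_closed: "l \<in> tensor_letters R W \<Longrightarrow> cls (word [l]) \<in> carrier TR"
  by simp

end

section \<open>Modules over the tensor ring\<close>

text \<open>The axioms after the first are the six families of defining relations read as identities
  of operators, with products reversed because letters act on the right. Additivity is asked of
  every \<open>\<beta> l\<close>, so an instance must choose values outside the alphabet as
  well.\<close>

locale tensor_module = tensor_datum +
  fixes \<beta> :: "'a + 'b \<Rightarrow> 'x \<Rightarrow> 'x::ab_group_add"
  assumes act_additive: "\<And>l. additive (\<beta> l)"
    and act_one: "\<And>x. \<beta> (Inl \<one>\<^bsub>R\<^esub>) x = x"
    and act_R_mult: "\<And>r s x. \<lbrakk>r \<in> carrier R; s \<in> carrier R\<rbrakk> \<Longrightarrow> \<beta> (Inl (r \<otimes>\<^bsub>R\<^esub> s)) x = \<beta> (Inl s) (\<beta> (Inl r) x)"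
    and act_R_add: "\<And>r s x. \<lbrakk>r \<in> carrier R; s \<in> carrier R\<rbrakk> \<Longrightarrow> \<beta> (Inl (r \<oplus>\<^bsub>R\<^esub> s)) x = \<beta> (Inl r) x + \<beta> (Inl s) x"
    and act_W_add: "\<And>v w x. \<lbrakk>v \<in> bcarrier W; w \<in> bcarrier W\<rbrakk> \<Longrightarrow> \<beta> (Inr (badd W v w)) x = \<beta> (Inr v) x + \<beta> (Inr w) x"
    and act_W_left: "\<And>r w x. \<lbrakk>r \<in> carrier R; w \<in> bcarrier W\<rbrakk> \<Longrightarrow> \<beta> (Inr (bleft W r w)) x = \<beta> (Inr w) (\<beta> (Inl r) x)"
    and act_W_right: "\<And>r w x. \<lbrakk>r \<in> carrier R; w \<in> bcarrier W\<rbrakk> \<Longrightarrow> \<beta> (Inr (bright W w r)) x = \<beta> (Inl r) (\<beta> (Inr w) x)"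
begin

lemma free_act_free_diff:
  assumes "f \<in> carrier FR" "g \<in> carrier FR"
  shows "free_act \<beta> x (free_diff f g) = free_act \<beta> x f - free_act \<beta> x g"
proof -
  have "(\<lambda>w. - g w) \<in> carrier FR" using assms by (simp add: free_ring_simps)
  then show ?thesis
    using free_act_add[OF assms(1), of "\<lambda>w. - g w" \<beta> x] by (simp add: free_diff_def free_act_uminus)
qed

text \<open>The elements annihilating every vector form an ideal that contains the relations.
  Quantifying over all vectors is what makes it two-sided.\<close>

lemma free_act_ideal:
  assumes "f \<in> tensor_ideal R W" shows "free_act \<beta> x f = 0"
proof -
  let ?I = "{f \<in> carrier FR. \<forall>x. free_act \<beta> x f = 0}"
  have "ideal ?I FR"
  proof (rule idealI[OF ring_free_ring])
    show "subgroup ?I (add_monoid FR)"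
    proof (rule FR.add.subgroupI)
      show "?I \<noteq> {}" using FR.zero_closed by (auto simp: free_ring_simps(4) free_act_zero)
    next
      fix f assume "f \<in> ?I"
      moreover from this have "\<ominus>\<^bsub>FR\<^esub> f \<in> carrier FR" by simp
      ultimately show "\<ominus>\<^bsub>FR\<^esub> f \<in> ?I" by (simp add: free_ring_a_inv free_act_uminus)
    next
      fix f g assume "f \<in> ?I" "g \<in> ?I"
      moreover from this have "f \<oplus>\<^bsub>FR\<^esub> g \<in> carrier FR" by simp
      ultimately show "f \<oplus>\<^bsub>FR\<^esub> g \<in> ?I" 
        by (simp add: free_ring_simps(5) free_act_add[where G = "tensor_letters R W"])
    qed auto
  next
    fix f g assume "f \<in> ?I" "g \<in> carrier FR"
    then show "g \<otimes>\<^bsub>FR\<^esub> f \<in> ?I" "f \<otimes>\<^bsub>FR\<^esub> g \<in> ?I"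
      using additive.zero[OF additive_free_act[OF act_additive]]
      by (auto simp: free_act_mult[OF _ _ act_additive])
  qed
  moreover have "tensor_relations R W \<subseteq> ?I"
  proof
    fix f assume f: "f \<in> tensor_relations R W"
    have "free_act \<beta> x f = 0" for x
      using f unfolding tensor_relations_def
      by (elim UnE)
        (auto simp: free_act_free_diff free_diff_closed free_act_word one_closed mult_closed
          add_closed badd_closed bleft_closed bright_closed act_one act_R_mult act_R_add act_W_add
          act_W_left act_W_right)
    with f relations_closed show "f \<in> ?I" by auto
  qed
  ultimately have "tensor_ideal R W \<subseteq> ?I"
    unfolding tensor_ideal_def by (rule FR.genideal_minimal)
  with assms show ?thesis by auto
qed

text \<open>The representative is arbitrary: two of them differ by an element of the ideal, which
  acts as zero.\<close>

definition act :: "'x \<Rightarrow> (('a + 'b) list \<Rightarrow> int) set \<Rightarrow> 'x" where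
  "act x t = free_act \<beta> x (SOME f. f \<in> carrier FR \<and> cls f = t)"

lemma act_cls: assumes f: "f \<in> carrier FR" shows "act x (cls f) = free_act \<beta> x f"
proof -
  define g where "g = (SOME g. g \<in> carrier FR \<and> cls g = cls f)"
  have "\<exists>g. g \<in> carrier FR \<and> cls g = cls f" using f by auto
  then have g: "g \<in> carrier FR \<and> cls g = cls f" unfolding g_def by (rule someI_ex)
  then have "free_diff g f \<in> tensor_ideal R W" using cls_eq_iff f by blast
  then have "free_act \<beta> x g = free_act \<beta> x f"
    using free_act_ideal[of "free_diff g f" x] free_act_free_diff f g by simp
  then show ?thesis by (simp add: act_def g_def)
qed

lemma act_plus:
  assumes "s \<in> carrier TR" "t \<in> carrier TR" shows "act x (s \<oplus>\<^bsub>TR\<^esub> t) = act x s + act x t"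
proof -
  obtain f g where f: "f \<in> carrier FR" "s = cls f" and g: "g \<in> carrier FR" "t = cls g"
    using assms by (auto simp: carrier_TR)
  have "(\<lambda>w. f w + g w) \<in> carrier FR"
    using FR.a_closed[OF f(1) g(1)] by (simp add: free_ring_simps(5))
  then show ?thesis
    using cls_add[OF f(1) g(1), symmetric] f g by (simp add: act_cls free_act_add)
qed

lemma act_mult:
  assumes "s \<in> carrier TR" "t \<in> carrier TR" shows "act x (s \<otimes>\<^bsub>TR\<^esub> t) = act (act x s) t"
proof -
  obtain f g where f: "f \<in> carrier FR" "s = cls f" and g: "g \<in> carrier FR" "t = cls g"
    using assms by (auto simp: carrier_TR)
  then show ?thesis
    using cls_mult[OF f(1) g(1), symmetric] by (simp add: act_cls free_act_mult[OF _ _ act_additive])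
qed

lemma act_letter: "l \<in> tensor_letters R W \<Longrightarrow> act x (cls (word [l])) = \<beta> l x"
  by (simp add: act_cls free_act_word)

lemma act_unit: "act x \<one>\<^bsub>TR\<^esub> = x"
  by (simp add: cls_one[symmetric] act_cls free_act_word)

lemma act_zero: "act x \<zero>\<^bsub>TR\<^esub> = 0"
  using act_plus[of "\<zero>\<^bsub>TR\<^esub>" "\<zero>\<^bsub>TR\<^esub>" x] by simp

lemma additive_act: "t \<in> carrier TR \<Longrightarrow> additive (\<lambda>x. act x t)"
  by (auto simp: carrier_TR act_cls additive_free_act[OF act_additive])

end

section \<open>The grading of the tensor ring\<close>

text \<open>A relation rather than a function, because \<open>letter_degree\<close> is one: the zero
  of the bimodule has both degrees, and a letter with two non-zero components has none.\<close>

definition word_degree :: "('g \<Rightarrow> nat \<Rightarrow> bool) \<Rightarrow> 'g list \<Rightarrow> nat \<Rightarrow> bool" where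
  "word_degree dg w n \<longleftrightarrow> (\<exists>ks. list_all2 dg w ks \<and> sum_list ks = n)"

lemma word_degree_Nil [simp]: "word_degree dg [] n \<longleftrightarrow> n = 0"
  by (auto simp: word_degree_def)

lemma word_degree_Cons [simp]:
  "word_degree dg (l # w) n \<longleftrightarrow> (\<exists>k m. dg l k \<and> word_degree dg w m \<and> n = k + m)"
  unfolding word_degree_def by (fastforce simp: list_all2_Cons1)

lemma word_degree_append:
  "word_degree dg u m \<Longrightarrow> word_degree dg w n \<Longrightarrow> word_degree dg (u @ w) (m + n)"
  by (induction u arbitrary: m) (fastforce simp: add.assoc)+

text \<open>Carries sums of a record group over to sums of a type class. Additivity on a closed
  subset \<open>H\<close> suffices, since the maps in question are additive only on one homogeneous
  part.\<close>

lemma (in abelian_group) additive_finsum_sum: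
  assumes closed: "\<And>x y. \<lbrakk>x \<in> H; y \<in> H\<rbrakk> \<Longrightarrow> x \<oplus> y \<in> H" "\<zero> \<in> H" "H \<subseteq> carrier G"
    and h: "\<And>x y. \<lbrakk>x \<in> H; y \<in> H\<rbrakk> \<Longrightarrow> h (x \<oplus> y) = (h x + h y :: 'x::ab_group_add)"
    and f: "f \<in> A \<rightarrow> H"
  shows "finsum G f A \<in> H" "finite A \<Longrightarrow> h (finsum G f A) = (\<Sum>a\<in>A. h (f a))"
proof -
  have h0: "h \<zero> = 0" using h[of \<zero> \<zero>] closed(2) by simp
  have *: "finsum G f A \<in> H \<and> h (finsum G f A) = (\<Sum>a\<in>A. h (f a))" if "finite A"
    using that f
  proof (induction A)
    case (insert a A)
    moreover have "f a \<in> carrier G" "f \<in> A \<rightarrow> carrier G" using insert.prems closed(3) by auto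
    moreover have "f a \<in> H" "f \<in> A \<rightarrow> H" using insert.prems by auto
    ultimately show ?case using closed(1) h by (simp add: finsum_insert)
  qed (simp_all add: h0 closed)
  show "finsum G f A \<in> H"
    by (cases "finite A") (use * closed in auto)
  show "finite A \<Longrightarrow> h (finsum G f A) = (\<Sum>a\<in>A. h (f a))" using * by simp
qed

locale graded_tensor_datum = tensor_datum +
  fixes dg :: "'a + 'b \<Rightarrow> nat \<Rightarrow> bool"
begin

abbreviation Tpart where "Tpart \<equiv> tensor_part R W dg"

lemma Tpart_iff:
  "t \<in> Tpart n \<longleftrightarrow> (\<exists>f\<in>carrier FR. t = cls f \<and> (\<forall>w. f w \<noteq> 0 \<longrightarrow> word_degree dg w n))"
  by (auto simp: tensor_part_def word_degree_def)

lemma Tpart_carrier: "t \<in> Tpart n \<Longrightarrow> t \<in> carrier TR"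
  by (auto simp: Tpart_iff)

lemma Tpart_zero: "\<zero>\<^bsub>TR\<^esub> \<in> Tpart n"
  unfolding Tpart_iff using FR.zero_closed
  by (intro bexI[of _ "\<lambda>w. 0"]) (auto simp: cls_zero free_ring_simps(4))

lemma Tpart_add:
  assumes "s \<in> Tpart n" "t \<in> Tpart n" shows "s \<oplus>\<^bsub>TR\<^esub> t \<in> Tpart n"
proof -
  obtain f g where f: "f \<in> carrier FR" "s = cls f" "\<And>w. f w \<noteq> 0 \<Longrightarrow> word_degree dg w n"
    and g: "g \<in> carrier FR" "t = cls g" "\<And>w. g w \<noteq> 0 \<Longrightarrow> word_degree dg w n"
    using assms unfolding Tpart_iff by blast
  have "(\<lambda>w. f w + g w) \<in> carrier FR"
    using FR.a_closed[OF f(1) g(1)] by (simp add: free_ring_simps(5))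
  moreover have "s \<oplus>\<^bsub>TR\<^esub> t = cls (\<lambda>w. f w + g w)" using f g by (simp add: cls_add)
  moreover have "word_degree dg w n" if "f w + g w \<noteq> 0" for w
    using that f(3) g(3) by (cases "f w = 0") auto
  ultimately show ?thesis unfolding Tpart_iff by blast
qed

lemma Tpart_uminus:
  assumes "s \<in> Tpart n" shows "\<ominus>\<^bsub>TR\<^esub> s \<in> Tpart n"
proof -
  obtain f where f: "f \<in> carrier FR" "s = cls f" "\<And>w. f w \<noteq> 0 \<Longrightarrow> word_degree dg w n"
    using assms unfolding Tpart_iff by blast
  have "(\<lambda>w. - f w) \<in> carrier FR" using f by (simp add: free_ring_simps)
  moreover have "\<ominus>\<^bsub>TR\<^esub> s = cls (\<lambda>w. - f w)" using f by (simp add: cls_uminus)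
  ultimately show ?thesis using f(3) unfolding Tpart_iff by force
qed

lemma Tpart_word:
  assumes "w \<in> lists (tensor_letters R W)" "word_degree dg w n" shows "cls (word w) \<in> Tpart n"
proof -
  have "word w w' \<noteq> 0 \<Longrightarrow> w' = w" for w' by (simp add: word_def split: if_splits)
  then show ?thesis
    unfolding Tpart_iff using assms by (intro bexI[of _ "word w"]) (blast, simp)
qed

lemma Tpart_letter:
  assumes "l \<in> tensor_letters R W" "dg l n" shows "cls (word [l]) \<in> Tpart n"
  by (rule Tpart_word) (use assms in auto)

lemma Tpart_mult:
  assumes "s \<in> Tpart m" "t \<in> Tpart n" shows "s \<otimes>\<^bsub>TR\<^esub> t \<in> Tpart (m + n)"
proof -
  obtain f g where f: "f \<in> carrier FR" "s = cls f" "\<And>w. f w \<noteq> 0 \<Longrightarrow> word_degree dg w m"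
    and g: "g \<in> carrier FR" "t = cls g" "\<And>w. g w \<noteq> 0 \<Longrightarrow> word_degree dg w n"
    using assms unfolding Tpart_iff by blast
  have "s \<otimes>\<^bsub>TR\<^esub> t = cls (f \<otimes>\<^bsub>FR\<^esub> g)" using f g by (simp add: cls_mult)
  moreover have "word_degree dg w (m + n)" if "(f \<otimes>\<^bsub>FR\<^esub> g) w \<noteq> 0" for w
  proof -
    have "w \<in> (\<lambda>(u, v). u @ v) ` ({w. f w \<noteq> 0} \<times> {w. g w \<noteq> 0})"
      using that conv_support[of f g] by (auto simp: free_ring_simps(2))
    then show ?thesis using f(3) g(3) by (auto intro: word_degree_append)
  qed
  ultimately show ?thesis using f g unfolding Tpart_iff by blast
qed

text \<open>A homogeneous element has a representative whose words all have the right degree, and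
  \<open>free_ring_induct\<close> produces only words from the support of that
  representative.\<close>

lemma Tpart_induct [consumes 1, case_names zero add uminus word]:
  assumes t: "t \<in> Tpart n"
    and zero: "Q \<zero>\<^bsub>TR\<^esub>"
    and add: "\<And>s t. \<lbrakk>s \<in> Tpart n; t \<in> Tpart n; Q s; Q t\<rbrakk> \<Longrightarrow> Q (s \<oplus>\<^bsub>TR\<^esub> t)"
    and uminus: "\<And>s. \<lbrakk>s \<in> Tpart n; Q s\<rbrakk> \<Longrightarrow> Q (\<ominus>\<^bsub>TR\<^esub> s)"
    and word: "\<And>w. \<lbrakk>w \<in> lists (tensor_letters R W); word_degree dg w n\<rbrakk> \<Longrightarrow> Q (cls (word w))"
  shows "Q t"
proof -
  obtain f where f: "f \<in> carrier FR" "t = cls f" "\<And>w. f w \<noteq> 0 \<Longrightarrow> word_degree dg w n"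
    using t unfolding Tpart_iff by blast
  \<comment> \<open>Membership in the homogeneous part is carried along, since the cases
    \<open>add\<close> and \<open>uminus\<close> demand it.\<close>
  have "f \<in> carrier FR \<and> cls f \<in> Tpart n \<and> Q (cls f)" using f(1)
  proof (induction rule: free_ring_induct)
    case (add f g)
    then show ?case
      using assms(3)[of "cls f" "cls g"] Tpart_add[of "cls f" n "cls g"] FR.a_closed[of f g]
      by (simp add: cls_add free_ring_simps(5))
  next
    case (uminus g)
    moreover from this have "(\<lambda>w. - g w) \<in> carrier FR" by (simp add: free_ring_simps)
    ultimately show ?case using assms(4)[of "cls g"] Tpart_uminus[of "cls g" n] by (simp add: cls_uminus)
  next
    case (word w)
    then show ?case using assms(5)[of w] Tpart_word[of w n] f(3) by simp
  qed (use FR.zero_closed Tpart_zero zero in \<open>simp_all add: cls_zero free_ring_simps(4)\<close>)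
  then show ?thesis using f by simp
qed

lemma Tpart_finsum:
  "f \<in> A \<rightarrow> Tpart n \<Longrightarrow> finsum TR f A \<in> Tpart n"
  by (rule TR.additive_finsum_sum(1)[where h = "\<lambda>_. 0 :: int"])
     (auto intro: Tpart_add Tpart_zero Tpart_carrier)

lemma additive_Tpart_finsum:
  assumes "\<And>s t. \<lbrakk>s \<in> Tpart n; t \<in> Tpart n\<rbrakk> \<Longrightarrow> h (s \<oplus>\<^bsub>TR\<^esub> t) = (h s + h t :: 'x::ab_group_add)"
    and "f \<in> A \<rightarrow> Tpart n" "finite A"
  shows "h (finsum TR f A) = (\<Sum>a\<in>A. h (f a))"
  by (rule TR.additive_finsum_sum(2)[where H = "Tpart n"])
     (use assms in \<open>auto intro: Tpart_add Tpart_zero Tpart_carrier\<close>)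

lemma additive_Tpart_zero_uminus:
  assumes h: "\<And>s t. \<lbrakk>s \<in> Tpart n; t \<in> Tpart n\<rbrakk> \<Longrightarrow> h (s \<oplus>\<^bsub>TR\<^esub> t) = (h s + h t :: 'x::ab_group_add)"
  shows "h \<zero>\<^bsub>TR\<^esub> = 0" "s \<in> Tpart n \<Longrightarrow> h (\<ominus>\<^bsub>TR\<^esub> s) = - h s"
proof -
  show h0: "h \<zero>\<^bsub>TR\<^esub> = 0" using h[of "\<zero>\<^bsub>TR\<^esub>" "\<zero>\<^bsub>TR\<^esub>"] Tpart_zero by simp
  show "h (\<ominus>\<^bsub>TR\<^esub> s) = - h s" if s: "s \<in> Tpart n"
    using h[OF s Tpart_uminus[OF s]] h0 Tpart_carrier[OF s] by (simp add: TR.r_neg eq_neg_iff_add_eq_0 add.commute)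
qed

end

section \<open>The algebra $\Lambda$ and the dual bimodule\<close>

lemma extp_order_simps [simp]:
  "Zero \<le> x" "x \<le> Zero \<longleftrightarrow> x = Zero" "Zero < x \<longleftrightarrow> x \<noteq> Zero" "\<not> x < Zero"
  for x :: "'p::order extp"
  by (auto simp: less_eq_extp_def less_extp_def)

locale extendable_datum =
  fixes E :: "('k::field, 'a::ring_1, 'p::order) poset_datum"
  assumes extendable: "extendable E"
begin

lemma finite_Pm: "finite (Pm E)" and finite_Pum: "finite (Pum E)"
  using extendable by (simp_all add: extendable_def Pm_def Pum_def)

lemma Zero_Pm [simp]: "Zero \<notin> Pm E" by (auto simp: Pm_def)

lemma Pum_iff: "x \<in> Pum E \<longleftrightarrow> x = Zero \<or> x \<in> Pm E" by (simp add: Pum_def)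

lemma vector_space_scl: "vector_space (scl E)"
proof -
  obtain B where "finite_dimensional_vector_space (scl E) B"
    using extendable by (auto simp: extendable_def fd_algebra_def)
  then interpret finite_dimensional_vector_space "scl E" B .
  show ?thesis by (rule vector_space_axioms)
qed

sublocale vs: vector_space "scl E" by (rule vector_space_scl)

lemma scl_mult: "scl E k (a * b) = scl E k a * b" "scl E k (a * b) = a * scl E k b"
  using extendable unfolding extendable_def fd_algebra_def by metis+

lemma eps_idem: "x \<in> Pum E \<Longrightarrow> eps E x * eps E x = eps E x"
  using extendable by (auto simp: extendable_def eps_def Pum_def Pm_def)

lemma subspace_ext_sys:
  assumes "x \<in> Pum E" "y \<in> Pum E" "x \<le> y" shows "vs.subspace (ext_sys (sys E) x y)"
proof (cases "\<exists>p q. x = Pt p \<and> y = Pt q")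
  case True
  then show ?thesis
    using assms extendable
    by (auto simp: extendable_def mult_system_def Pum_def Pm_def less_eq_extp_def)
next
  case False
  then have "ext_sys (sys E) x y = UNIV \<or> ext_sys (sys E) x y = {0}"
    by (cases "(sys E, x, y)" rule: ext_sys.cases) auto
  then show ?thesis by (auto simp: vs.subspace_UNIV vs.subspace_single_0)
qed

lemma ext_sys_mult:
  assumes "x \<in> Pum E" "y \<in> Pum E" "z \<in> Pum E" "x \<le> y" "y \<le> z"
    and "r \<in> ext_sys (sys E) x y" "s \<in> ext_sys (sys E) y z"
  shows "r * s \<in> ext_sys (sys E) x z"
proof (cases "\<exists>p q. x = Pt p \<and> z = Pt q")
  case True
  then obtain p q p' where "x = Pt p" "z = Pt q" "y = Pt p'" "p \<le> p'" "p' \<le> q"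
    using assms by (auto simp: less_eq_extp_def)
  then show ?thesis
    using assms extendable
    by (auto simp: extendable_def mult_system_def Pum_def Pm_def less_eq_extp_def)
next
  case False
  then have "ext_sys (sys E) x z = UNIV"
    using assms by (cases x; cases z) (auto simp: less_eq_extp_def)
  then show ?thesis by simp
qed

lemma eps_in_ext_sys: "x \<in> Pum E \<Longrightarrow> eps E x \<in> ext_sys (sys E) x x"
  using extendable by (cases x) (auto simp: extendable_def eps_def Pum_def Pm_def)

text \<open>The family \<open>Rs\<close> extended by 0 to all pairs of indices, so that entries of
  matrices and sums over the whole poset need no side conditions.\<close>

definition Rx :: "'p extp \<Rightarrow> 'p extp \<Rightarrow> 'a set" where
  "Rx x y = (if x \<in> Pum E \<and> y \<in> Pum E \<and> x \<le> y then Rs E x y else {0})"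

lemma Rs_eq_Rx: "x \<in> Pum E \<Longrightarrow> y \<in> Pum E \<Longrightarrow> x \<le> y \<Longrightarrow> Rs E x y = Rx x y"
  by (simp add: Rx_def)

lemma Rx_0 [simp]: "0 \<in> Rx x y"
  using vs.subspace_0[OF subspace_ext_sys] by (auto simp: Rx_def Rs_def intro!: image_eqI[where x = 0])

lemma Rx_add: "r \<in> Rx x y \<Longrightarrow> s \<in> Rx x y \<Longrightarrow> r + s \<in> Rx x y"
  by (auto simp: Rx_def Rs_def distrib_left[symmetric] distrib_right[symmetric] split: if_splits
      intro!: imageI vs.subspace_add[OF subspace_ext_sys])

lemma Rx_scale: "r \<in> Rx x y \<Longrightarrow> scl E k r \<in> Rx x y"
  by (auto simp: Rx_def Rs_def scl_mult(1)[of k "eps E x * _"] scl_mult(2)[of k "eps E x"] split: if_splits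
      intro!: imageI vs.subspace_scale[OF subspace_ext_sys])

lemma Rx_uminus: "r \<in> Rx x y \<Longrightarrow> - r \<in> Rx x y"
  using Rx_scale[of r x y "-1"] by simp

lemma Rx_sum: "(\<And>i. i \<in> A \<Longrightarrow> f i \<in> Rx x y) \<Longrightarrow> sum f A \<in> Rx x y"
  by (induction A rule: infinite_finite_induct) (auto intro: Rx_add)

lemma Rx_mult:
  assumes "r \<in> Rx x y" "s \<in> Rx y z" shows "r * s \<in> Rx x z"
proof (cases "(x \<in> Pum E \<and> y \<in> Pum E \<and> x \<le> y) \<and> (z \<in> Pum E \<and> y \<le> z)")
  case True
  then obtain t t' where "t \<in> ext_sys (sys E) x y" "r = eps E x * t * eps E y"
      "t' \<in> ext_sys (sys E) y z" "s = eps E y * t' * eps E z"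
    using assms by (auto simp: Rx_def Rs_def)
  \<comment> \<open>The idempotents in the middle lie in the system at \<open>y\<close>, so the
    inner factor stays in the system.\<close>
  moreover from this have "t * eps E y * eps E y * t' \<in> ext_sys (sys E) x z"
    using True ext_sys_mult[of x y y t "eps E y"] ext_sys_mult[of x y y _ "eps E y"] ext_sys_mult[of x y z]
      eps_in_ext_sys[of y] by simp
  ultimately show ?thesis
    using True by (auto simp: Rx_def Rs_def mult.assoc intro!: image_eqI)
next
  case False
  then have "r = 0 \<or> s = 0" using assms by (auto simp: Rx_def split: if_splits)
  then show ?thesis by auto
qed

lemma Rx_unit:
  assumes "r \<in> Rx x y" shows "eps E x * r = r" "r * eps E y = r"
proof -
  have "eps E x * (eps E x * t) = eps E x * t" if "x \<in> Pum E" for t x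
    using that by (metis eps_idem mult.assoc)
  moreover have "t * eps E y * eps E y = t * eps E y" if "y \<in> Pum E" for t y
    using that by (metis eps_idem mult.assoc)
  ultimately show "eps E x * r = r" "r * eps E y = r"
    using assms by (auto simp: Rx_def Rs_def mult.assoc eps_idem split: if_splits)
qed

lemma eps_Rx: "x \<in> Pum E \<Longrightarrow> eps E x \<in> Rx x x"
  by (auto simp: Rx_def Rs_def eps_idem intro!: image_eqI[OF _ eps_in_ext_sys])

lemma Rx_eq_0: "r \<in> Rx x y \<Longrightarrow> \<not> (x \<in> Pum E \<and> y \<in> Pum E \<and> x \<le> y) \<Longrightarrow> r = 0"
  by (auto simp: Rx_def split: if_splits)

section \<open>Matrix calculus in \<open>\<Lambda>\<close>, \<open>S\<close> and
  \<open>J\<close>\<close>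

abbreviation \<Lambda> where "\<Lambda> \<equiv> Lam E"

lemma Lam_simps:
  "u \<in> carrier \<Lambda> \<longleftrightarrow> (\<forall>i j. u i j \<in> Rx i j)"
  "u \<otimes>\<^bsub>\<Lambda>\<^esub> w = (\<lambda>i j. \<Sum>l\<in>Pum E. u i l * w l j)"
  "\<one>\<^bsub>\<Lambda>\<^esub> = (\<lambda>i j. if i \<in> Pum E \<and> i = j then eps E i else 0)"
  "\<zero>\<^bsub>\<Lambda>\<^esub> = (\<lambda>i j. 0)"
  "u \<oplus>\<^bsub>\<Lambda>\<^esub> w = (\<lambda>i j. u i j + w i j)"
  "k \<odot>\<^bsub>\<Lambda>\<^esub> u = (\<lambda>i j. scl E k (u i j))"
  by (auto simp: Lam_def incidence_algebra_def Rx_def)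

lemma abelian_group_Lam: "abelian_group \<Lambda>"
proof (rule abelian_groupI)
  fix u assume "u \<in> carrier \<Lambda>"
  then have "(\<lambda>i j. - u i j) \<in> carrier \<Lambda>" by (simp add: Lam_simps Rx_uminus)
  then show "\<exists>w\<in>carrier \<Lambda>. w \<oplus>\<^bsub>\<Lambda>\<^esub> u = \<zero>\<^bsub>\<Lambda>\<^esub>"
    by (rule bexI[rotated]) (simp add: Lam_simps)
qed (auto simp: Lam_simps Rx_add algebra_simps)

sublocale Lam: abelian_group \<Lambda> by (rule abelian_group_Lam)

lemma Lam_a_inv: assumes "u \<in> carrier \<Lambda>" shows "\<ominus>\<^bsub>\<Lambda>\<^esub> u = (\<lambda>i j. - u i j)"
proof -
  have "(\<lambda>i j. - u i j) \<in> carrier \<Lambda>" using assms by (simp add: Lam_simps Rx_uminus)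
  then show ?thesis
    by (intro Lam.minus_equality) (use assms in \<open>auto simp: Lam_simps\<close>)
qed

lemma Lam_finsum:
  assumes "finite A" "\<And>p. p \<in> A \<Longrightarrow> f p \<in> carrier \<Lambda>"
  shows "(\<Oplus>\<^bsub>\<Lambda>\<^esub>p\<in>A. f p) = (\<lambda>i j. \<Sum>p\<in>A. f p i j)"
  using assms
proof (induction A)
  case (insert a A)
  then have "f \<in> A \<rightarrow> carrier \<Lambda>" "f a \<in> carrier \<Lambda>" by auto
  then show ?case using insert by (simp add: Lam.finsum_insert Lam_simps(5))
qed (simp add: Lam_simps)

lemma ei_carrier: "x \<in> Pum E \<Longrightarrow> ei E x \<in> carrier \<Lambda>"
  by (auto simp: Lam_simps ei_def mu_def eps_Rx)

lemma ehat_eq: "ehat E = (\<lambda>i j. if i \<in> Pm E \<and> i = j then eps E i else 0)"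
proof -
  have "ei E Zero \<in> carrier \<Lambda>" by (simp add: ei_carrier Pum_iff)
  then show ?thesis
    by (auto simp: ehat_def a_minus_def Lam_a_inv Lam_simps(3,5) ei_def mu_def Pum_iff fun_eq_iff)
qed

lemma Lam_mult_closed: "u \<in> carrier \<Lambda> \<Longrightarrow> w \<in> carrier \<Lambda> \<Longrightarrow> u \<otimes>\<^bsub>\<Lambda>\<^esub> w \<in> carrier \<Lambda>"
  by (auto simp: Lam_simps intro!: Rx_sum Rx_mult)

lemma Ss_iff: "s \<in> Ss E \<longleftrightarrow> (\<forall>i. s i i \<in> Rx i i) \<and> (\<forall>i j. i \<noteq> j \<longrightarrow> s i j = 0)"
  by (auto simp: Ss_def Lam_simps) (metis Rx_0)

lemma Ss_carrier: "s \<in> Ss E \<Longrightarrow> s \<in> carrier \<Lambda>" and Js_carrier: "u \<in> Js E \<Longrightarrow> u \<in> carrier \<Lambda>"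
  by (simp_all add: Ss_def Js_def)

lemma Ss_Rx: "s \<in> Ss E \<Longrightarrow> s i j \<in> Rx i j"
  by (simp add: Ss_def Lam_simps)

lemma Ss_off: "s \<in> Ss E \<Longrightarrow> i \<noteq> j \<Longrightarrow> s i j = 0"
  by (simp add: Ss_def)

lemma Js_Rx: "u \<in> Js E \<Longrightarrow> u i j \<in> Rx i j"
  by (simp add: Js_def Lam_simps)

lemma Js_iff: "u \<in> Js E \<longleftrightarrow> (\<forall>i j. u i j \<in> Rx i j) \<and> (\<forall>i. u i i = 0)"
  by (simp add: Js_def Lam_simps)

text \<open>Beyond strict triangularity, the column of a non-zero entry lies in \<open>Pm E\<close>,
  because nothing is strictly below \<open>Zero\<close>.\<close>

lemma Js_eq_0: "u \<in> Js E \<Longrightarrow> \<not> (i \<in> Pum E \<and> j \<in> Pm E \<and> i < j) \<Longrightarrow> u i j = 0"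
proof (cases "i \<in> Pum E \<and> j \<in> Pum E \<and> i \<le> j")
  case True
  moreover assume "u \<in> Js E" "\<not> (i \<in> Pum E \<and> j \<in> Pm E \<and> i < j)"
  ultimately have "i = j" by (cases "j = Zero") (auto simp: Pum_iff)
  then show ?thesis using \<open>u \<in> Js E\<close> by (simp add: Js_def)
qed (use Js_Rx Rx_eq_0 in blast)

lemma sum_single_Pum:
  "(\<And>l. l \<in> Pum E \<Longrightarrow> l \<noteq> i \<Longrightarrow> f l = 0) \<Longrightarrow> (i \<notin> Pum E \<Longrightarrow> f i = 0) \<Longrightarrow> (\<Sum>l\<in>Pum E. f l) = f i"
  for f :: "'p extp \<Rightarrow> 'b::comm_monoid_add"
  by (cases "i \<in> Pum E") (auto simp: sum.remove[OF finite_Pum] finite_Pum intro!: sum.neutral)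

lemma Ss_mult_left: assumes s: "s \<in> Ss E" shows "s \<otimes>\<^bsub>\<Lambda>\<^esub> u = (\<lambda>i j. s i i * u i j)"
proof (intro ext)
  fix i j
  have "s i i = 0" if "i \<notin> Pum E" using Rx_eq_0[OF Ss_Rx[OF s, of i i]] that by simp
  then show "(s \<otimes>\<^bsub>\<Lambda>\<^esub> u) i j = s i i * u i j"
    unfolding Lam_simps by (subst sum_single_Pum[of i]) (auto simp: Ss_off[OF s])
qed

lemma Ss_mult_right: assumes s: "s \<in> Ss E" shows "u \<otimes>\<^bsub>\<Lambda>\<^esub> s = (\<lambda>i j. u i j * s j j)"
proof (intro ext)
  fix i j
  have "s j j = 0" if "j \<notin> Pum E" using Rx_eq_0[OF Ss_Rx[OF s, of j j]] that by simp
  then show "(u \<otimes>\<^bsub>\<Lambda>\<^esub> s) i j = u i j * s j j"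
    unfolding Lam_simps by (subst sum_single_Pum[of j]) (auto simp: Ss_off[OF s])
qed

lemma Ss_mult: "s \<in> Ss E \<Longrightarrow> t \<in> Ss E \<Longrightarrow> s \<otimes>\<^bsub>\<Lambda>\<^esub> t \<in> Ss E"
  by (auto simp: Ss_mult_left Ss_iff intro: Rx_mult)

lemma Ss_add: "s \<in> Ss E \<Longrightarrow> t \<in> Ss E \<Longrightarrow> s \<oplus>\<^bsub>\<Lambda>\<^esub> t \<in> Ss E"
  by (auto simp: Lam_simps(5) Ss_iff Rx_add)

lemma Ss_zero: "\<zero>\<^bsub>\<Lambda>\<^esub> \<in> Ss E"
  by (auto simp: Lam_simps(4) Ss_iff)

lemma Ss_one: "\<one>\<^bsub>\<Lambda>\<^esub> \<in> Ss E"
  by (auto simp: Lam_simps(3) Ss_iff eps_Rx)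

lemma Ss_mu: "r \<in> Rx x x \<Longrightarrow> mu x x r \<in> Ss E"
  by (auto simp: mu_def Ss_iff)

lemma Ss_ei: "x \<in> Pum E \<Longrightarrow> ei E x \<in> Ss E"
  by (simp add: ei_def Ss_mu eps_Rx)

lemma Ss_smult: "s \<in> Ss E \<Longrightarrow> k \<odot>\<^bsub>\<Lambda>\<^esub> s \<in> Ss E"
  by (auto simp: Lam_simps(6) Ss_iff Rx_scale)

lemma Js_add: "u \<in> Js E \<Longrightarrow> w \<in> Js E \<Longrightarrow> u \<oplus>\<^bsub>\<Lambda>\<^esub> w \<in> Js E"
  by (auto simp: Lam_simps(5) Js_iff Rx_add)

lemma Js_zero: "\<zero>\<^bsub>\<Lambda>\<^esub> \<in> Js E"
  by (auto simp: Lam_simps(4) Js_iff)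

lemma Js_mult_left: "s \<in> Ss E \<Longrightarrow> u \<in> Js E \<Longrightarrow> s \<otimes>\<^bsub>\<Lambda>\<^esub> u \<in> Js E"
  by (auto simp: Ss_mult_left Js_iff intro: Rx_mult Ss_Rx)

lemma Js_mult_right: "s \<in> Ss E \<Longrightarrow> u \<in> Js E \<Longrightarrow> u \<otimes>\<^bsub>\<Lambda>\<^esub> s \<in> Js E"
  by (auto simp: Ss_mult_right Js_iff intro: Rx_mult Ss_Rx)

lemma Js_mult: assumes u: "u \<in> Js E" and w: "w \<in> Js E" shows "u \<otimes>\<^bsub>\<Lambda>\<^esub> w \<in> Js E"
proof -
  \<comment> \<open>Two non-zero factors would give both \<open>i < l\<close> and
    \<open>l < i\<close>.\<close>
  have "u i l * w l i = 0" for i l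
    using Js_eq_0[OF u, of i l] Js_eq_0[OF w, of l i] by (metis less_asym mult_zero_left mult_zero_right)
  then show ?thesis
    using Lam_mult_closed[OF Js_carrier[OF u] Js_carrier[OF w]] by (simp add: Js_def Lam_simps)
qed

lemma Js_mu: "r \<in> Rx x y \<Longrightarrow> x \<noteq> y \<Longrightarrow> mu x y r \<in> Js E"
  by (auto simp: mu_def Js_iff)

section \<open>Left linear forms on \<open>J\<close>\<close>

lemma Jdual_Ss: "\<gamma> \<in> Jdual E \<Longrightarrow> \<gamma> u \<in> Ss E" for u
  by (cases "u \<in> Js E") (auto simp: Jdual_def Ss_zero)

lemma Jdual_outside: "\<gamma> \<in> Jdual E \<Longrightarrow> u \<notin> Js E \<Longrightarrow> \<gamma> u = \<zero>\<^bsub>\<Lambda>\<^esub>"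
  by (auto simp: Jdual_def)

lemma Jdual_add: "\<gamma> \<in> Jdual E \<Longrightarrow> u \<in> Js E \<Longrightarrow> w \<in> Js E \<Longrightarrow> \<gamma> (u \<oplus>\<^bsub>\<Lambda>\<^esub> w) = \<gamma> u \<oplus>\<^bsub>\<Lambda>\<^esub> \<gamma> w"
  by (auto simp: Jdual_def)

lemma Jdual_left: "\<gamma> \<in> Jdual E \<Longrightarrow> s \<in> Ss E \<Longrightarrow> u \<in> Js E \<Longrightarrow> \<gamma> (s \<otimes>\<^bsub>\<Lambda>\<^esub> u) = s \<otimes>\<^bsub>\<Lambda>\<^esub> \<gamma> u"
  by (auto simp: Jdual_def)

lemma Jdual_zero: assumes \<gamma>: "\<gamma> \<in> Jdual E" shows "\<gamma> \<zero>\<^bsub>\<Lambda>\<^esub> = \<zero>\<^bsub>\<Lambda>\<^esub>"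
  using Jdual_add[OF \<gamma> Js_zero Js_zero] by (auto simp: Lam_simps fun_eq_iff)

lemma Jdual_finsum:
  assumes \<gamma>: "\<gamma> \<in> Jdual E" and "finite A" "\<And>p. p \<in> A \<Longrightarrow> f p \<in> Js E"
  shows "(\<lambda>i j. \<Sum>p\<in>A. f p i j) \<in> Js E" "\<gamma> (\<lambda>i j. \<Sum>p\<in>A. f p i j) = (\<lambda>i j. \<Sum>p\<in>A. \<gamma> (f p) i j)"
proof -
  have "(\<lambda>i j. \<Sum>p\<in>A. f p i j) \<in> Js E \<and>
      \<gamma> (\<lambda>i j. \<Sum>p\<in>A. f p i j) = (\<lambda>i j. \<Sum>p\<in>A. \<gamma> (f p) i j)"
    using assms(2,3)
  proof (induction A)
    case empty
    then show ?case using Js_zero Jdual_zero[OF \<gamma>] by (simp add: Lam_simps)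
  next
    case (insert a A)
    then show ?case
      using Js_add[of "f a" "\<lambda>i j. \<Sum>p\<in>A. f p i j"] Jdual_add[OF \<gamma>, of "f a" "\<lambda>i j. \<Sum>p\<in>A. f p i j"]
      by (simp add: Lam_simps(5))
  qed
  then show "(\<lambda>i j. \<Sum>p\<in>A. f p i j) \<in> Js E" "\<gamma> (\<lambda>i j. \<Sum>p\<in>A. f p i j) = (\<lambda>i j. \<Sum>p\<in>A. \<gamma> (f p) i j)"
    by auto
qed

lemma dual_l_apply: "u \<in> Js E \<Longrightarrow> dual_l E s \<gamma> u = \<gamma> (u \<otimes>\<^bsub>\<Lambda>\<^esub> s)"
  by (simp add: dual_l_def)

lemma dual_r_apply: "s \<in> Ss E \<Longrightarrow> dual_r E \<gamma> s u = (\<lambda>i j. \<gamma> u i j * s j j)"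
  by (simp add: dual_r_def Ss_mult_right)

lemma dual_l_Jdual:
  assumes s: "s \<in> Ss E" and \<gamma>: "\<gamma> \<in> Jdual E" shows "dual_l E s \<gamma> \<in> Jdual E"
proof -
  have "(u \<oplus>\<^bsub>\<Lambda>\<^esub> w) \<otimes>\<^bsub>\<Lambda>\<^esub> s = (u \<otimes>\<^bsub>\<Lambda>\<^esub> s) \<oplus>\<^bsub>\<Lambda>\<^esub> (w \<otimes>\<^bsub>\<Lambda>\<^esub> s)" for u w
    by (simp add: Ss_mult_right[OF s] Lam_simps(5) distrib_right)
  moreover have "(t \<otimes>\<^bsub>\<Lambda>\<^esub> u) \<otimes>\<^bsub>\<Lambda>\<^esub> s = t \<otimes>\<^bsub>\<Lambda>\<^esub> (u \<otimes>\<^bsub>\<Lambda>\<^esub> s)" if "t \<in> Ss E" for t u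
    by (simp add: Ss_mult_right[OF s] Ss_mult_left[OF that] mult.assoc)
  ultimately show ?thesis
    unfolding Jdual_def using s Jdual_Ss[OF \<gamma>] Jdual_add[OF \<gamma>] Jdual_left[OF \<gamma>]
    by (auto simp: dual_l_def Js_mult_left Js_mult_right Js_add)
qed

lemma dual_r_Jdual:
  assumes s: "s \<in> Ss E" and \<gamma>: "\<gamma> \<in> Jdual E" shows "dual_r E \<gamma> s \<in> Jdual E"
proof -
  have "(u \<oplus>\<^bsub>\<Lambda>\<^esub> w) \<otimes>\<^bsub>\<Lambda>\<^esub> s = (u \<otimes>\<^bsub>\<Lambda>\<^esub> s) \<oplus>\<^bsub>\<Lambda>\<^esub> (w \<otimes>\<^bsub>\<Lambda>\<^esub> s)" for u w
    by (simp add: Ss_mult_right[OF s] Lam_simps(5) distrib_right)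
  moreover have "(t \<otimes>\<^bsub>\<Lambda>\<^esub> u) \<otimes>\<^bsub>\<Lambda>\<^esub> s = t \<otimes>\<^bsub>\<Lambda>\<^esub> (u \<otimes>\<^bsub>\<Lambda>\<^esub> s)" if "t \<in> Ss E" for t u
    by (simp add: Ss_mult_right[OF s] Ss_mult_left[OF that] mult.assoc)
  moreover have "\<zero>\<^bsub>\<Lambda>\<^esub> \<otimes>\<^bsub>\<Lambda>\<^esub> s = \<zero>\<^bsub>\<Lambda>\<^esub>" by (simp add: Lam_simps)
  ultimately show ?thesis
    unfolding Jdual_def
    using s Jdual_outside[OF \<gamma>] Jdual_Ss[OF \<gamma>] Jdual_add[OF \<gamma>] Jdual_left[OF \<gamma>]
    by (auto simp: dual_r_def Ss_mult)
qed

lemma dual_zero_Jdual: "dual_zero \<in> Jdual E"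
  using Ss_zero by (auto simp: dual_zero_def Jdual_def Lam_simps Ss_mult_left)

lemma dual_add_Jdual:
  assumes \<gamma>: "\<gamma> \<in> Jdual E" "\<delta> \<in> Jdual E" shows "dual_add \<gamma> \<delta> \<in> Jdual E"
proof -
  have "dual_add \<gamma> \<delta> = (\<lambda>u. \<gamma> u \<oplus>\<^bsub>\<Lambda>\<^esub> \<delta> u)" by (simp add: dual_add_def Lam_simps(5))
  moreover have "s \<otimes>\<^bsub>\<Lambda>\<^esub> (u \<oplus>\<^bsub>\<Lambda>\<^esub> w) = (s \<otimes>\<^bsub>\<Lambda>\<^esub> u) \<oplus>\<^bsub>\<Lambda>\<^esub> (s \<otimes>\<^bsub>\<Lambda>\<^esub> w)" if "s \<in> Ss E" for s u w
    by (simp add: Ss_mult_left[OF that] Lam_simps(5) distrib_left)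
  moreover have "(u \<oplus>\<^bsub>\<Lambda>\<^esub> w) \<oplus>\<^bsub>\<Lambda>\<^esub> (u' \<oplus>\<^bsub>\<Lambda>\<^esub> w') = (u \<oplus>\<^bsub>\<Lambda>\<^esub> u') \<oplus>\<^bsub>\<Lambda>\<^esub> (w \<oplus>\<^bsub>\<Lambda>\<^esub> w')" for u w u' w'
    by (simp add: Lam_simps(5) algebra_simps)
  ultimately show ?thesis
    using \<gamma> unfolding Jdual_def by (auto simp: Ss_add)
qed

section \<open>The corners of the dual that carry the degrees 0 and 1\<close>

text \<open>\<open>C0\<close> and, below, \<open>Ch\<close> are the corners of the dual from which
  W_0 and W_1 are built, described by the diagonal places at which a form takes its values. This
  makes membership checkable without exhibiting a preimage.\<close>

definition C0 where "C0 = {\<gamma> \<in> Jdual E. \<forall>u x. x \<noteq> Zero \<longrightarrow> \<gamma> u x x = 0}"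
definition Ch where "Ch = {\<gamma> \<in> Jdual E. \<forall>u. \<gamma> u Zero Zero = 0}"

lemma Ss_ehat: "ehat E \<in> Ss E"
  by (auto simp: ehat_eq Ss_iff eps_Rx Pum_iff)

lemma Js_ehat: assumes u: "u \<in> Js E" shows "u \<otimes>\<^bsub>\<Lambda>\<^esub> ehat E = u"
proof -
  have "u i j * ehat E j j = u i j" for i j
    using Rx_unit(2)[OF Js_Rx[OF u, of i j]] Js_eq_0[OF u, of i j] by (auto simp: ehat_eq)
  then show ?thesis by (simp add: Ss_mult_right Ss_ehat)
qed

lemma Ss_diag_unit: "s \<in> Ss E \<Longrightarrow> s i j * eps E j = s i j"
  using Rx_unit(2)[OF Ss_Rx] .

text \<open>The left idempotent \<open>ehat E\<close> acts trivially: the left action multiplies the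
  argument on the right, and no element of \<open>J\<close> has an entry in column
  \<open>Zero\<close>.\<close>

lemma dual_corner_right:
  assumes e: "e \<in> Ss E"
  shows "dual_corner E (ehat E) e = (\<lambda>\<gamma>. dual_r E \<gamma> e) ` Jdual E"
proof -
  have "dual_l E (ehat E) (dual_r E \<gamma> e) = dual_r E \<gamma> e" if "\<gamma> \<in> Jdual E" for \<gamma>
    using Jdual_outside[OF dual_r_Jdual[OF e that]] by (auto simp: dual_l_def Js_ehat)
  then show ?thesis unfolding dual_corner_def by (auto intro!: exI)
qed

lemma dual_corner_0: "dual_corner E (ehat E) (ei E Zero) = C0"
proof -
  have e: "ei E Zero \<in> Ss E" by (simp add: Ss_ei Pum_iff)
  have "\<gamma> \<in> (\<lambda>\<gamma>. dual_r E \<gamma> (ei E Zero)) ` Jdual E" if "\<gamma> \<in> C0" for \<gamma>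
  proof (rule image_eqI[where x = \<gamma>])
    show "\<gamma> \<in> Jdual E" using that by (simp add: C0_def)
    then have "\<gamma> u i j * ei E Zero j j = \<gamma> u i j" for u i j
      using that Ss_diag_unit[OF Jdual_Ss[of \<gamma> u], of i j] Ss_off[OF Jdual_Ss[of \<gamma> u], of i j]
      by (cases "i = j") (auto simp: C0_def ei_def mu_def)
    then show "\<gamma> = dual_r E \<gamma> (ei E Zero)" by (simp add: dual_r_apply e fun_eq_iff)
  qed
  then show ?thesis
    unfolding dual_corner_right[OF e]
    by (auto simp: C0_def dual_r_Jdual e dual_r_apply) (simp add: ei_def mu_def)
qed

lemma dual_corner_h: "dual_corner E (ehat E) (ehat E) = Ch"
proof -
  note e = Ss_ehat
  have "\<gamma> \<in> (\<lambda>\<gamma>. dual_r E \<gamma> (ehat E)) ` Jdual E" if "\<gamma> \<in> Ch" for \<gamma>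
  proof (rule image_eqI[where x = \<gamma>])
    show J: "\<gamma> \<in> Jdual E" using that by (simp add: Ch_def)
    have "\<gamma> u i j * ehat E j j = \<gamma> u i j" for u i j
      using that Ss_diag_unit[OF Jdual_Ss[OF J, of u], of i j] Ss_off[OF Jdual_Ss[OF J, of u], of i j]
        Rx_eq_0[OF Ss_Rx[OF Jdual_Ss[OF J, of u], of i j]]
      by (cases "i = j"; cases "j = Zero") (auto simp: Ch_def ehat_eq Pum_iff)
    then show "\<gamma> = dual_r E \<gamma> (ehat E)" by (simp add: dual_r_apply e fun_eq_iff)
  qed
  then show ?thesis
    unfolding dual_corner_right[OF e]
    by (auto simp: Ch_def dual_r_Jdual e dual_r_apply) (simp add: ehat_eq)
qed

end

section \<open>The tensor ring of the ditalgebra\<close>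

context extendable_datum
begin

text \<open>Cutting \<open>s\<close> along its row \<open>Zero\<close> identifies \<open>S\<close>
  with R^e, as the pair of its parts under \<open>ehat E\<close> and e_0. The base can thus be
  handled as \<open>S\<close>, without pairs.\<close>

definition re_of :: "('a, 'p) lam \<Rightarrow> ('a, 'p) re" where
  "re_of s = (\<lambda>i j. if i = Zero then 0 else s i j, \<lambda>i j. if i = Zero then s i j else 0)"

definition tS :: "('a, 'p) lam \<Rightarrow> ('a, 'p) te" where
  "tS s = tR E (re_of s)"

lemma Re_simps:
  "(s, t) \<otimes>\<^bsub>Re E\<^esub> (s', t') = (s \<otimes>\<^bsub>\<Lambda>\<^esub> s', t \<otimes>\<^bsub>\<Lambda>\<^esub> t')"
  "(s, t) \<oplus>\<^bsub>Re E\<^esub> (s', t') = (s \<oplus>\<^bsub>\<Lambda>\<^esub> s', t \<oplus>\<^bsub>\<Lambda>\<^esub> t')"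
  "\<one>\<^bsub>Re E\<^esub> = (ehat E, ei E Zero)"
  by (simp_all add: Re_def)

lemma re_of_Ss: "s \<in> Ss E \<Longrightarrow> fst (re_of s) \<in> Ss E" "s \<in> Ss E \<Longrightarrow> snd (re_of s) \<in> Ss E"
  by (auto simp: re_of_def Ss_iff)

lemma ehat_mult: assumes s: "s \<in> Ss E" shows "ehat E \<otimes>\<^bsub>\<Lambda>\<^esub> s = fst (re_of s)"
proof (intro ext)
  fix i j
  show "(ehat E \<otimes>\<^bsub>\<Lambda>\<^esub> s) i j = fst (re_of s) i j"
    using Rx_unit(1)[OF Ss_Rx[OF s, of i j]] Rx_eq_0[OF Ss_Rx[OF s, of i j]]
    unfolding Ss_mult_left[OF Ss_ehat] by (auto simp: ehat_eq re_of_def Pum_iff)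
qed

lemma ei_mult: assumes s: "s \<in> Ss E" shows "ei E Zero \<otimes>\<^bsub>\<Lambda>\<^esub> s = snd (re_of s)"
proof (intro ext)
  fix i j
  have "ei E Zero \<in> Ss E" by (simp add: Ss_ei Pum_iff)
  then show "(ei E Zero \<otimes>\<^bsub>\<Lambda>\<^esub> s) i j = snd (re_of s) i j"
    using Rx_unit(1)[OF Ss_Rx[OF s, of i j]]
    by (auto simp: Ss_mult_left ei_def mu_def re_of_def)
qed

lemma carrier_Re: "carrier (Re E) = re_of ` Ss E"
proof -
  have "(fst (re_of s), snd (re_of t)) \<in> re_of ` Ss E" if "s \<in> Ss E" "t \<in> Ss E" for s t
    by (rule image_eqI[where x = "\<lambda>i j. if i = Zero then t i j else s i j"])
       (use that in \<open>auto simp: re_of_def Ss_iff intro!: ext\<close>)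
  moreover have "re_of ` Ss E \<subseteq> (\<lambda>s. fst (re_of s)) ` Ss E \<times> (\<lambda>s. snd (re_of s)) ` Ss E"
    by (intro image_subsetI) (simp add: mem_Times_iff)
  moreover have "carrier (Re E) = (\<lambda>s. fst (re_of s)) ` Ss E \<times> (\<lambda>s. snd (re_of s)) ` Ss E"
    by (simp add: Re_def ehat_mult ei_mult cong: image_cong)
  ultimately show ?thesis by (intro equalityI) auto
qed

lemma re_of_mult: assumes "s \<in> Ss E" "t \<in> Ss E" shows "re_of s \<otimes>\<^bsub>Re E\<^esub> re_of t = re_of (s \<otimes>\<^bsub>\<Lambda>\<^esub> t)"
proof -
  have "fst (re_of s) \<otimes>\<^bsub>\<Lambda>\<^esub> fst (re_of t) = fst (re_of (s \<otimes>\<^bsub>\<Lambda>\<^esub> t))"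
    "snd (re_of s) \<otimes>\<^bsub>\<Lambda>\<^esub> snd (re_of t) = snd (re_of (s \<otimes>\<^bsub>\<Lambda>\<^esub> t))"
    using assms by (auto simp: Ss_mult_left re_of_Ss) (auto simp: re_of_def fun_eq_iff)
  then show ?thesis by (metis Re_simps(1) prod.collapse)
qed

lemma re_of_add: "re_of s \<oplus>\<^bsub>Re E\<^esub> re_of t = re_of (s \<oplus>\<^bsub>\<Lambda>\<^esub> t)"
  by (auto simp: re_of_def Re_simps Lam_simps(5) fun_eq_iff)

lemma re_of_one: "\<one>\<^bsub>Re E\<^esub> = re_of \<one>\<^bsub>\<Lambda>\<^esub>"
  by (auto simp: re_of_def Re_simps Lam_simps(3) ehat_eq ei_def mu_def Pum_iff fun_eq_iff)

lemma C0_Jdual: "\<gamma> \<in> C0 \<Longrightarrow> \<gamma> \<in> Jdual E" and Ch_Jdual: "\<gamma> \<in> Ch \<Longrightarrow> \<gamma> \<in> Jdual E"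
  by (simp_all add: C0_def Ch_def)

lemma C0_zero: "dual_zero \<in> C0" and Ch_zero: "dual_zero \<in> Ch"
  using dual_zero_Jdual by (simp_all add: C0_def Ch_def dual_zero_def)

lemma C0_add: "\<gamma> \<in> C0 \<Longrightarrow> \<gamma>' \<in> C0 \<Longrightarrow> dual_add \<gamma> \<gamma>' \<in> C0"
  and Ch_add: "\<delta> \<in> Ch \<Longrightarrow> \<delta>' \<in> Ch \<Longrightarrow> dual_add \<delta> \<delta>' \<in> Ch"
  by (simp_all add: C0_def Ch_def dual_add_Jdual) (simp_all add: dual_add_def)

lemma C0_dual_l: "s \<in> Ss E \<Longrightarrow> \<gamma> \<in> C0 \<Longrightarrow> dual_l E s \<gamma> \<in> C0"
  and Ch_dual_l: "s \<in> Ss E \<Longrightarrow> \<delta> \<in> Ch \<Longrightarrow> dual_l E s \<delta> \<in> Ch"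
  by (simp_all add: C0_def Ch_def dual_l_Jdual) (simp_all add: dual_l_def Lam_simps(4))

lemma C0_dual_r: "s \<in> Ss E \<Longrightarrow> \<gamma> \<in> C0 \<Longrightarrow> dual_r E \<gamma> s \<in> C0"
  and Ch_dual_r: "s \<in> Ss E \<Longrightarrow> \<delta> \<in> Ch \<Longrightarrow> dual_r E \<delta> s \<in> Ch"
  by (simp_all add: C0_def Ch_def dual_r_Jdual) (simp_all add: dual_r_apply)

lemma We_simps:
  "bcarrier (We E) = C0 \<times> Ch"
  "badd (We E) (\<gamma>, \<delta>) (\<gamma>', \<delta>') = (dual_add \<gamma> \<gamma>', dual_add \<delta> \<delta>')"
  by (simp_all add: We_def dual_corner_0 dual_corner_h)

text \<open>Only the w_1 part of the scalar acts on the left, and nothing is lost: the action reads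
  columns of \<open>J\<close>, none of which is \<open>Zero\<close>.\<close>

lemma We_left:
  assumes s: "s \<in> Ss E" shows "bleft (We E) (re_of s) (\<gamma>, \<delta>) = (dual_l E s \<gamma>, dual_l E s \<delta>)"
proof -
  have "dual_l E (fst (re_of s)) \<gamma> = dual_l E s \<gamma>" for \<gamma>
  proof -
    have "u \<otimes>\<^bsub>\<Lambda>\<^esub> fst (re_of s) = u \<otimes>\<^bsub>\<Lambda>\<^esub> s" if "u \<in> Js E" for u
      using Js_eq_0[OF that, of _ Zero]
      by (auto simp: Ss_mult_right s re_of_Ss fun_eq_iff) (auto simp: re_of_def)
    then show ?thesis by (auto simp: dual_l_def)
  qed
  then show ?thesis by (simp add: We_def split_beta)
qed

text \<open>Each component of a letter meets one of the two parts of \<open>s\<close>; the other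
  part would meet diagonal places where forms of that corner vanish.\<close>

lemma We_right:
  assumes s: "s \<in> Ss E" and \<gamma>: "\<gamma> \<in> C0" and \<delta>: "\<delta> \<in> Ch"
  shows "bright (We E) (\<gamma>, \<delta>) (re_of s) = (dual_r E \<gamma> s, dual_r E \<delta> s)"
proof -
  have "\<gamma> u i j = 0" if "j \<noteq> Zero" for u i j
    using \<gamma> that Ss_off[OF Jdual_Ss[OF C0_Jdual[OF \<gamma>]], of i j] by (cases "i = j") (auto simp: C0_def)
  then have "dual_r E \<gamma> (snd (re_of s)) = dual_r E \<gamma> s"
    using s by (auto simp: dual_r_apply re_of_Ss fun_eq_iff) (auto simp: re_of_def)
  moreover have "\<delta> u i Zero = 0" for u i
    using \<delta> Ss_off[OF Jdual_Ss[OF Ch_Jdual[OF \<delta>]], of i Zero] by (cases "i = Zero") (auto simp: Ch_def)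
  then have "dual_r E \<delta> (fst (re_of s)) = dual_r E \<delta> s"
    using s by (auto simp: dual_r_apply re_of_Ss fun_eq_iff) (auto simp: re_of_def)
  ultimately show ?thesis by (simp add: We_def split_beta)
qed

lemma tensor_datum_Te: "tensor_datum (Re E) (We E)"
proof (rule tensor_datum.intro)
  show "\<one>\<^bsub>Re E\<^esub> \<in> carrier (Re E)" by (simp add: re_of_one carrier_Re Ss_one)
qed (auto simp: carrier_Re re_of_mult re_of_add We_simps We_left We_right Ss_mult Ss_add
      C0_add Ch_add C0_dual_l Ch_dual_l C0_dual_r Ch_dual_r)

end

sublocale extendable_datum \<subseteq> T: graded_tensor_datum "Re E" "We E" letter_degree
  by (intro graded_tensor_datum.intro tensor_datum_Te)

context extendable_datum
begin

lemma tS_eq: "tS s = T.cls (word [Inl (re_of s)])"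
  by (simp add: tS_def tR_def)

lemma re_of_carrier: "s \<in> Ss E \<Longrightarrow> re_of s \<in> carrier (Re E)"
  by (simp add: carrier_Re)

lemma tS_part: "s \<in> Ss E \<Longrightarrow> tS s \<in> T.Tpart 0"
  unfolding tS_eq by (rule T.Tpart_letter) (auto simp: re_of_carrier)

lemma w12_part: "\<gamma> \<in> C0 \<Longrightarrow> w12 E \<gamma> \<in> T.Tpart 0"
  unfolding w12_def by (rule T.Tpart_letter) (auto simp: We_simps Ch_zero)

lemma w1_part: "\<delta> \<in> Ch \<Longrightarrow> w1 E \<delta> \<in> T.Tpart 1"
  unfolding w1_def by (rule T.Tpart_letter) (auto simp: We_simps C0_zero)

lemma tS_mult: "s \<in> Ss E \<Longrightarrow> t \<in> Ss E \<Longrightarrow> tS (s \<otimes>\<^bsub>\<Lambda>\<^esub> t) = tS s \<otimes>\<^bsub>Te E\<^esub> tS t"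
  using T.cls_R_mult[of "re_of s" "re_of t"] by (simp add: tS_eq re_of_mult re_of_carrier)

lemma tS_add: "s \<in> Ss E \<Longrightarrow> t \<in> Ss E \<Longrightarrow> tS (s \<oplus>\<^bsub>\<Lambda>\<^esub> t) = tS s \<oplus>\<^bsub>Te E\<^esub> tS t"
  using T.cls_R_add[of "re_of s" "re_of t"] by (simp add: tS_eq re_of_add re_of_carrier)

lemma tS_one: "tS \<one>\<^bsub>\<Lambda>\<^esub> = \<one>\<^bsub>Te E\<^esub>"
  using T.cls_R_one by (simp add: tS_eq re_of_one)

lemma dual_l_zero: "dual_l E s dual_zero = dual_zero"
  by (auto simp: dual_l_def dual_zero_def Lam_simps(4))

lemma dual_r_zero: "dual_r E dual_zero s = dual_zero"
  by (auto simp: dual_r_def dual_zero_def Lam_simps(2))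

lemma dual_add_zero: "dual_add dual_zero dual_zero = (dual_zero :: ('a, 'p) dual)"
  by (auto simp: dual_add_def dual_zero_def)

lemma w12_left: "s \<in> Ss E \<Longrightarrow> \<gamma> \<in> C0 \<Longrightarrow> w12 E (dual_l E s \<gamma>) = tS s \<otimes>\<^bsub>Te E\<^esub> w12 E \<gamma>"
  using T.cls_W_left[of "re_of s" "(\<gamma>, dual_zero)"]
  by (simp add: tS_eq w12_def We_left We_simps re_of_carrier dual_l_zero Ch_zero)

lemma w12_right: "s \<in> Ss E \<Longrightarrow> \<gamma> \<in> C0 \<Longrightarrow> w12 E (dual_r E \<gamma> s) = w12 E \<gamma> \<otimes>\<^bsub>Te E\<^esub> tS s"
  using T.cls_W_right[of "re_of s" "(\<gamma>, dual_zero)"]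
  by (simp add: tS_eq w12_def We_right We_simps re_of_carrier dual_r_zero Ch_zero)

lemma w1_left: "s \<in> Ss E \<Longrightarrow> \<delta> \<in> Ch \<Longrightarrow> w1 E (dual_l E s \<delta>) = tS s \<otimes>\<^bsub>Te E\<^esub> w1 E \<delta>"
  using T.cls_W_left[of "re_of s" "(dual_zero, \<delta>)"]
  by (simp add: tS_eq w1_def We_left We_simps re_of_carrier dual_l_zero C0_zero)

lemma w1_right: "s \<in> Ss E \<Longrightarrow> \<delta> \<in> Ch \<Longrightarrow> w1 E (dual_r E \<delta> s) = w1 E \<delta> \<otimes>\<^bsub>Te E\<^esub> tS s"
  using T.cls_W_right[of "re_of s" "(dual_zero, \<delta>)"]
  by (simp add: tS_eq w1_def We_right We_simps re_of_carrier dual_r_zero C0_zero)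

lemma w12_add: "\<gamma> \<in> C0 \<Longrightarrow> \<gamma>' \<in> C0 \<Longrightarrow> w12 E (dual_add \<gamma> \<gamma>') = w12 E \<gamma> \<oplus>\<^bsub>Te E\<^esub> w12 E \<gamma>'"
  using T.cls_W_add[of "(\<gamma>, dual_zero)" "(\<gamma>', dual_zero)"]
  by (simp add: w12_def We_simps Ch_zero dual_add_zero)

lemma w1_add: "\<delta> \<in> Ch \<Longrightarrow> \<delta>' \<in> Ch \<Longrightarrow> w1 E (dual_add \<delta> \<delta>') = w1 E \<delta> \<oplus>\<^bsub>Te E\<^esub> w1 E \<delta>'"
  using T.cls_W_add[of "(dual_zero, \<delta>)" "(dual_zero, \<delta>')"]
  by (simp add: w1_def We_simps C0_zero dual_add_zero)

lemma loc_mu: "loc E x (mu x x r) = tS (mu x x r)"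
  by (auto simp: loc_def tS_def re_of_def mu_def Lam_simps(4) intro!: ext arg_cong[where f = "tR E"])

lemma loc_ei: "loc E x (ei E x) = tS (ei E x)"
  by (simp add: ei_def loc_mu)

lemma tR_C0: assumes \<gamma>: "\<gamma> \<in> C0" shows "tR E (\<zero>\<^bsub>\<Lambda>\<^esub>, \<gamma> u) = tS (\<gamma> u)"
proof -
  have "\<gamma> u i j = 0" if "i \<noteq> Zero" for i j
    using \<gamma> that Ss_off[OF Jdual_Ss[OF C0_Jdual[OF \<gamma>]], of i j] by (cases "i = j") (auto simp: C0_def)
  then show ?thesis
    by (auto simp: tS_def re_of_def Lam_simps(4) fun_eq_iff intro!: arg_cong[where f = "tR E"])
qed

lemma tR_Ch: assumes \<delta>: "\<delta> \<in> Ch" shows "tR E (\<delta> u, \<zero>\<^bsub>\<Lambda>\<^esub>) = tS (\<delta> u)"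
proof -
  have "\<delta> u Zero j = 0" for j
    using \<delta> Ss_off[OF Jdual_Ss[OF Ch_Jdual[OF \<delta>]], of Zero j] by (cases "j = Zero") (auto simp: Ch_def)
  then show ?thesis
    by (auto simp: tS_def re_of_def Lam_simps(4) fun_eq_iff intro!: arg_cong[where f = "tR E"])
qed

lemma De_simps [simp]:
  "carrier (De E d) = carrier (Te E)" "mult (De E d) = mult (Te E)" "one (De E d) = one (Te E)"
  "zero (De E d) = zero (Te E)" "add (De E d) = add (Te E)"
  "part (De E d) = T.Tpart" "diff (De E d) = d"
  by (simp_all add: De_def)

lemma base_De: "base (De E d) = tS ` Ss E"
  by (auto simp: De_def carrier_Re tS_def)

text \<open>Places the scalars inside the base, so that the vector space structure of a module is
  part of its \<open>S\<close>-module structure.\<close>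

lemma scalar_De: "k \<odot>\<^bsub>De E d\<^esub> \<one>\<^bsub>De E d\<^esub> = tS (k \<odot>\<^bsub>\<Lambda>\<^esub> \<one>\<^bsub>\<Lambda>\<^esub>)"
proof -
  have "re_of (k \<odot>\<^bsub>\<Lambda>\<^esub> \<one>\<^bsub>\<Lambda>\<^esub>) = (k \<odot>\<^bsub>\<Lambda>\<^esub> ehat E, k \<odot>\<^bsub>\<Lambda>\<^esub> ei E Zero)"
    by (auto simp: re_of_def Lam_simps ehat_eq ei_def mu_def Pum_iff fun_eq_iff)
  then have "k \<odot>\<^bsub>De E d\<^esub> \<one>\<^bsub>De E d\<^esub> = tS (k \<odot>\<^bsub>\<Lambda>\<^esub> \<one>\<^bsub>\<Lambda>\<^esub>) \<otimes>\<^bsub>Te E\<^esub> \<one>\<^bsub>Te E\<^esub>"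
    by (simp add: De_def tS_def)
  also have "\<dots> = tS (k \<odot>\<^bsub>\<Lambda>\<^esub> \<one>\<^bsub>\<Lambda>\<^esub>)"
    by (rule T.TR.r_one[OF T.Tpart_carrier[OF tS_part]]) (simp add: Ss_smult Ss_one)
  finally show ?thesis .
qed

text \<open>A letter with two non-zero components has no degree, so the words of a homogeneous
  representative use only these three kinds.\<close>

lemma letter_cases:
  assumes "l \<in> tensor_letters (Re E) (We E)" "letter_degree l n"
  obtains (base) s where "s \<in> Ss E" "n = 0" "T.cls (word [l]) = tS s" "l = Inl (re_of s)"
  | (w12) \<gamma> where "\<gamma> \<in> C0" "n = 0" "T.cls (word [l]) = w12 E \<gamma>" "l = Inr (\<gamma>, dual_zero)"
  | (w1) \<delta> where "\<delta> \<in> Ch" "n = 1" "T.cls (word [l]) = w1 E \<delta>" "l = Inr (dual_zero, \<delta>)"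
proof (cases l)
  case (Inl r)
  then show ?thesis using assms base by (auto simp: carrier_Re tS_eq)
next
  case (Inr w)
  then show ?thesis using assms w12 w1 by (cases w) (auto simp: We_simps w12_def w1_def)
qed

end

section \<open>Dual bases and the differential\<close>

locale dit_datum = extendable_datum +
  fixes B :: "'c extp \<Rightarrow> 'c extp \<Rightarrow> ('b, 'c) lam set"
    and gam :: "('b, 'c) lam \<Rightarrow> ('b, 'c) dual"
    and d :: "('b, 'c) te \<Rightarrow> ('b, 'c) te"
  assumes eps_nonzero: "\<And>x. x \<in> Pum E \<Longrightarrow> eps E x \<noteq> 0"
    and dual_basis: "dual_basis E B gam"
    and differential: "De_differential E B gam d"
begin

lemma Lam_corner:
  assumes u: "u \<in> Js E" and x: "x \<in> Pum E" and y: "y \<in> Pum E"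
  shows "ei E y \<otimes>\<^bsub>\<Lambda>\<^esub> u \<otimes>\<^bsub>\<Lambda>\<^esub> ei E x = mu y x (u y x)"
proof (intro ext)
  fix i j
  show "(ei E y \<otimes>\<^bsub>\<Lambda>\<^esub> u \<otimes>\<^bsub>\<Lambda>\<^esub> ei E x) i j = mu y x (u y x) i j"
    using Rx_unit[OF Js_Rx[OF u, of i j]]
    unfolding Ss_mult_right[OF Ss_ei[OF x]] Ss_mult_left[OF Ss_ei[OF y]] by (auto simp: ei_def mu_def)
qed

lemma B_pair_basis: "y \<in> Pum E \<Longrightarrow> x \<in> Pum E \<Longrightarrow> y < x \<Longrightarrow> pair_basis E y x (B y x)"
  using dual_basis by (simp add: dual_basis_def)

lemma finite_B: "y \<in> Pum E \<Longrightarrow> x \<in> Pum E \<Longrightarrow> y < x \<Longrightarrow> finite (B y x)"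
  using B_pair_basis by (fastforce simp: pair_basis_def Let_def)

lemma B_single:
  assumes "y \<in> Pum E" "x \<in> Pum E" "y < x" "p \<in> B y x"
  shows "p = mu y x (p y x)" "p \<in> Js E"
proof -
  obtain u where u: "u \<in> Js E" "p = ei E y \<otimes>\<^bsub>\<Lambda>\<^esub> u \<otimes>\<^bsub>\<Lambda>\<^esub> ei E x"
    using assms B_pair_basis[OF assms(1-3)] unfolding pair_basis_def Let_def by blast
  then have p: "p = mu y x (u y x)" using Lam_corner assms by simp
  then show "p = mu y x (p y x)" by (simp add: mu_def)
  show "p \<in> Js E" unfolding p using assms(3) by (intro Js_mu Js_Rx u) auto
qed

lemma gam_Jdual: "y \<in> Pum E \<Longrightarrow> x \<in> Pum E \<Longrightarrow> y < x \<Longrightarrow> p \<in> B y x \<Longrightarrow> gam p \<in> Jdual E"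
  using dual_basis by (simp add: dual_basis_def)

lemma gam_dual:
  assumes "y \<in> Pum E" "x \<in> Pum E" "y < x" "p \<in> B y x" "y' \<in> Pum E" "x' \<in> Pum E" "y' < x'" "q \<in> B y' x'"
  shows "gam p q = (if q = p then ei E y else \<zero>\<^bsub>\<Lambda>\<^esub>)"
  using dual_basis assms by (simp add: dual_basis_def)

text \<open>A zero basis element would force its own dual value \<open>ei E y\<close> to vanish,
  against \<open>eps_nonzero\<close>. A non-zero one is concentrated in a single entry, whose
  position determines \<open>y\<close> and \<open>x\<close>.\<close>

lemma B_unique:
  assumes "y \<in> Pum E" "x \<in> Pum E" "y < x" "p \<in> B y x" "y' \<in> Pum E" "x' \<in> Pum E" "y' < x'" "p \<in> B y' x'"
  shows "y' = y" "x' = x"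
proof -
  have "p \<noteq> \<zero>\<^bsub>\<Lambda>\<^esub>"
  proof
    assume "p = \<zero>\<^bsub>\<Lambda>\<^esub>"
    then have "ei E y = \<zero>\<^bsub>\<Lambda>\<^esub>"
      using gam_dual[OF assms(1-4) assms(1-4)] Jdual_zero[OF gam_Jdual[OF assms(1-4)]] by simp
    then have "eps E y = 0" by (auto simp: ei_def mu_def Lam_simps(4) fun_eq_iff split: if_splits)
    then show False using eps_nonzero[OF assms(1)] by simp
  qed
  moreover have "p = mu y x (p y x)" "p = mu y' x' (p y' x')"
    using B_single assms by blast+
  ultimately show "y' = y" "x' = x"
    by (auto simp: mu_def Lam_simps(4) fun_eq_iff) metis+
qed

text \<open>Expand \<open>r\<close> in the basis of its own corner and use left linearity of the
  form: each dual element returns its coefficient. A single family \<open>c\<close> serves all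
  \<open>p\<close>, including those of other corners.\<close>

lemma gam_mu:
  assumes yx': "y' \<in> Pum E" "x' \<in> Pum E" "y' < x'" and r: "r \<in> Rx y' x'"
  obtains c where "\<And>q. q \<in> B y' x' \<Longrightarrow> c q \<in> Rx y' y'" "r = (\<Sum>q\<in>B y' x'. c q * q y' x')"
    "\<And>y x p. \<lbrakk>y \<in> Pum E; x \<in> Pum E; y < x; p \<in> B y x\<rbrakk> \<Longrightarrow>
      gam p (mu y' x' r) = (if p \<in> B y' x' then mu y' y' (c p) else \<zero>\<^bsub>\<Lambda>\<^esub>)"
proof -
  have muJ: "mu y' x' r \<in> Js E" using Js_mu[OF r] yx' by auto
  have "mu y' x' r = ei E y' \<otimes>\<^bsub>\<Lambda>\<^esub> mu y' x' r \<otimes>\<^bsub>\<Lambda>\<^esub> ei E x'"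
    using Lam_corner[OF muJ] yx' by (simp add: mu_def)
  then obtain c where c: "\<And>q. if q \<in> B y' x' then c q \<in> Rs E y' y' else c q = 0"
      "mu y' x' r = (\<Oplus>\<^bsub>\<Lambda>\<^esub>q\<in>B y' x'. mu y' y' (c q) \<otimes>\<^bsub>\<Lambda>\<^esub> q)"
    using B_pair_basis[OF yx'] muJ unfolding pair_basis_def Let_def by blast
  have cR: "c q \<in> Rx y' y'" if "q \<in> B y' x'" for q
    using c(1)[of q] that yx' by (simp add: Rs_eq_Rx)
  have qJ: "q \<in> Js E" if "q \<in> B y' x'" for q using B_single yx' that by blast
  have cS: "mu y' y' (c q) \<in> Ss E" if "q \<in> B y' x'" for q using Ss_mu[OF cR[OF that]] .
  note fin = finite_B[OF yx']
  have sum: "mu y' x' r = (\<lambda>i j. \<Sum>q\<in>B y' x'. (mu y' y' (c q) \<otimes>\<^bsub>\<Lambda>\<^esub> q) i j)"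
    unfolding c(2) by (rule Lam_finsum[OF fin Js_carrier[OF Js_mult_left[OF cS qJ]]])
  have "r = mu y' x' r y' x'" by (simp add: mu_def)
  also have "\<dots> = (\<Sum>q\<in>B y' x'. c q * q y' x')"
    unfolding sum by (intro sum.cong refl) (simp add: Ss_mult_left[OF cS], simp add: mu_def)
  finally have r': "r = (\<Sum>q\<in>B y' x'. c q * q y' x')" .
  have "gam p (mu y' x' r) = (if p \<in> B y' x' then mu y' y' (c p) else \<zero>\<^bsub>\<Lambda>\<^esub>)"
    if yx: "y \<in> Pum E" "x \<in> Pum E" "y < x" "p \<in> B y x" for y x p
  proof -
  have "gam p (mu y' x' r) = (\<lambda>i j. \<Sum>q\<in>B y' x'. gam p (mu y' y' (c q) \<otimes>\<^bsub>\<Lambda>\<^esub> q) i j)"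
    unfolding sum by (rule Jdual_finsum(2)[OF gam_Jdual[OF yx] fin Js_mult_left[OF cS qJ]])
  also have "\<dots> = (\<lambda>i j. \<Sum>q\<in>B y' x'. (if q = p then mu y' y' (c p) i j else 0))"
  proof (intro ext sum.cong refl)
    fix i j q assume q: "q \<in> B y' x'"
    have step: "gam p (mu y' y' (c q) \<otimes>\<^bsub>\<Lambda>\<^esub> q) = mu y' y' (c q) \<otimes>\<^bsub>\<Lambda>\<^esub> gam p q"
      by (rule Jdual_left[OF gam_Jdual[OF yx] cS[OF q] qJ[OF q]])
    have "(mu y' y' (c q) \<otimes>\<^bsub>\<Lambda>\<^esub> gam p q) i j = (if q = p then mu y' y' (c p) i j else 0)"
    proof (cases "q = p")
      case True
      then have "y' = y" using B_unique[OF yx yx'] q by simp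
      moreover have "c q * eps E y = c q" using Rx_unit(2)[OF cR[OF q]] \<open>y' = y\<close> by simp
      ultimately show ?thesis
        using True gam_dual[OF yx yx' q] unfolding Ss_mult_left[OF cS[OF q]]
        by (auto simp: ei_def mu_def)
    next
      case False
      then show ?thesis
        using gam_dual[OF yx yx' q] unfolding Ss_mult_left[OF cS[OF q]] by (simp add: Lam_simps(4))
    qed
    then show "gam p (mu y' y' (c q) \<otimes>\<^bsub>\<Lambda>\<^esub> q) i j = (if q = p then mu y' y' (c p) i j else 0)"
      unfolding step .
  qed
  also have "\<dots> = (if p \<in> B y' x' then mu y' y' (c p) else \<zero>\<^bsub>\<Lambda>\<^esub>)"
    using fin by (auto simp: sum.delta Lam_simps(4))
  finally show ?thesis .
  qed
  then show ?thesis using that[of c] cR r' by blast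
qed

lemma gam_mu_self:
  assumes yx: "y \<in> Pum E" "x \<in> Pum E" "y < x" and r: "r \<in> Rx y x"
  obtains c where "r = (\<Sum>q\<in>B y x. c q * q y x)" "\<And>p. p \<in> B y x \<Longrightarrow> gam p (mu y x r) = mu y y (c p)"
  by (rule gam_mu[OF yx r]) (use yx that in simp)

lemma Js_decompose:
  assumes u: "u \<in> Js E"
  shows "u = (\<lambda>i j. \<Sum>z\<in>Pum E \<times> Pum E. mu (fst z) (snd z) (u (fst z) (snd z)) i j)"
    "z \<in> Pum E \<times> Pum E \<Longrightarrow> mu (fst z) (snd z) (u (fst z) (snd z)) \<in> Js E"
proof -
  show "u = (\<lambda>i j. \<Sum>z\<in>Pum E \<times> Pum E. mu (fst z) (snd z) (u (fst z) (snd z)) i j)"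
  proof (intro ext)
    fix i j
    have "(\<Sum>z\<in>Pum E \<times> Pum E. mu (fst z) (snd z) (u (fst z) (snd z)) i j) =
        (\<Sum>z\<in>Pum E \<times> Pum E. if z = (i, j) then u i j else 0)"
      by (intro sum.cong refl) (auto simp: mu_def)
    also have "\<dots> = u i j"
      using Rx_eq_0[OF Js_Rx[OF u, of i j]] finite_Pum by (subst sum.delta) auto
    finally show "u i j = (\<Sum>z\<in>Pum E \<times> Pum E. mu (fst z) (snd z) (u (fst z) (snd z)) i j)" by simp
  qed
  show "z \<in> Pum E \<times> Pum E \<Longrightarrow> mu (fst z) (snd z) (u (fst z) (snd z)) \<in> Js E"
  proof (cases "fst z = snd z")
    case True
    then have "mu (fst z) (snd z) (u (fst z) (snd z)) = \<zero>\<^bsub>\<Lambda>\<^esub>"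
      using u by (auto simp: Js_def mu_def Lam_simps(4))
    then show ?thesis using Js_zero by simp
  qed (rule Js_mu[OF Js_Rx[OF u]])
qed

text \<open>Entries in other corners expand in other bases, on which \<open>gam p\<close>
  vanishes.\<close>

lemma gam_local:
  assumes yx: "y \<in> Pum E" "x \<in> Pum E" "y < x" "p \<in> B y x" and u: "u \<in> Js E"
  shows "gam p u = gam p (mu y x (u y x))"
proof -
  let ?m = "\<lambda>z. mu (fst z) (snd z) (u (fst z) (snd z))"
  have z0: "gam p (?m z) = \<zero>\<^bsub>\<Lambda>\<^esub>" if z: "z \<in> Pum E \<times> Pum E" "z \<noteq> (y, x)" for z
  proof (cases "fst z < snd z")
    case True
    then show ?thesis
      using z gam_mu[OF _ _ True Js_Rx[OF u, of "fst z" "snd z"]] B_unique[OF yx _ _ True] yx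
      by (metis (no_types, lifting) SigmaE fst_conv snd_conv)
  next
    case False
    then have "u (fst z) (snd z) = 0" using Js_eq_0[OF u] by blast
    then have "?m z = \<zero>\<^bsub>\<Lambda>\<^esub>" by (simp add: mu_def Lam_simps(4))
    then show ?thesis using Jdual_zero[OF gam_Jdual[OF yx]] by simp
  qed
  have "gam p u = (\<lambda>i j. \<Sum>z\<in>Pum E \<times> Pum E. gam p (?m z) i j)"
  proof -
    have "gam p u = gam p (\<lambda>i j. \<Sum>z\<in>Pum E \<times> Pum E. ?m z i j)"
      using Js_decompose(1)[OF u] by (rule arg_cong)
    also have "\<dots> = (\<lambda>i j. \<Sum>z\<in>Pum E \<times> Pum E. gam p (?m z) i j)"
      by (rule Jdual_finsum(2)[OF gam_Jdual[OF yx] _ Js_decompose(2)[OF u]]) (simp_all add: finite_Pum)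
    finally show ?thesis .
  qed
  also have "\<dots> = (\<lambda>i j. \<Sum>z\<in>Pum E \<times> Pum E. if z = (y, x) then gam p (?m z) i j else 0)"
    using z0 by (intro ext sum.cong refl) (auto simp: Lam_simps(4))
  also have "\<dots> = gam p (mu y x (u y x))"
    using finite_Pum yx by (simp add: sum.delta)
  finally show ?thesis .
qed

lemma gam_value:
  assumes yx: "y \<in> Pum E" "x \<in> Pum E" "y < x" "p \<in> B y x"
  shows "gam p u = mu y y (gam p u y y)"
proof (cases "u \<in> Js E")
  case True
  obtain c where "\<And>p. p \<in> B y x \<Longrightarrow> gam p (mu y x (u y x)) = mu y y (c p)"
    using gam_mu_self[OF yx(1-3) Js_Rx[OF True, of y x]] by blast
  then show ?thesis using gam_local[OF yx True] yx by (simp add: mu_def)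
next
  case False
  then show ?thesis using Jdual_outside[OF gam_Jdual[OF yx] False] by (simp add: mu_def Lam_simps(4))
qed

text \<open>The dual basis identity, one corner at a time.\<close>

lemma gam_expand:
  assumes u: "u \<in> Js E" and yx: "y \<in> Pum E" "x \<in> Pum E" "y < x"
  shows "u y x = (\<Sum>p\<in>B y x. gam p u y y * p y x)"
proof -
  obtain c where "u y x = (\<Sum>q\<in>B y x. c q * q y x)"
    and c: "\<And>p. p \<in> B y x \<Longrightarrow> gam p (mu y x (u y x)) = mu y y (c p)"
    using gam_mu_self[OF yx Js_Rx[OF u, of y x]] by blast
  moreover have "gam p u y y = c p" if "p \<in> B y x" for p
    using gam_local[OF yx that u] c[OF that] by (simp add: mu_def)
  ultimately show ?thesis by simp
qed

definition B0 where "B0 = \<Union> {B Zero x |x. x \<in> Pm E}"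
definition Bh where "Bh = \<Union> {B y x |y x. y \<in> Pm E \<and> x \<in> Pm E \<and> y < x}"

lemma B0_eq: "B0 = (\<Union>x\<in>Pm E. B Zero x)"
  by (auto simp: B0_def)

lemma Bh_eq: "Bh = (\<Union>(y, x)\<in>{z \<in> Pm E \<times> Pm E. fst z < snd z}. B y x)"
  by (fastforce simp: Bh_def)

lemma Zero_less_Pm: "x \<in> Pm E \<Longrightarrow> Zero < x"
  using Zero_Pm by auto

lemma finite_B0: "finite B0"
  unfolding B0_eq using finite_Pm finite_B[of Zero] Zero_less_Pm by (auto simp: Pum_iff)

lemma finite_Bh: "finite Bh"
  unfolding Bh_eq using finite_Pm finite_B by (auto simp: Pum_iff intro!: finite_subset[OF _ finite_cartesian_product])

lemma BhE:
  assumes "p \<in> Bh" obtains y x where "y \<in> Pm E" "x \<in> Pm E" "y < x" "p \<in> B y x"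
  using assms by (auto simp: Bh_def)

lemma B0E:
  assumes "p \<in> B0" obtains x where "x \<in> Pm E" "Zero < x" "p \<in> B Zero x"
  using assms Zero_less_Pm by (auto simp: B0_def)

lemma gam_Ch: assumes "p \<in> Bh" shows "gam p \<in> Ch"
proof -
  obtain y x where yx: "y \<in> Pm E" "x \<in> Pm E" "y < x" "p \<in> B y x" using assms by (rule BhE)
  then have yx': "y \<in> Pum E" "x \<in> Pum E" "y < x" "p \<in> B y x" by (simp_all add: Pum_iff)
  have "gam p u Zero Zero = 0" for u
    using gam_value[OF yx', of u] yx Zero_Pm by (metis mu_def)
  then show ?thesis using gam_Jdual[OF yx'] by (simp add: Ch_def)
qed

lemma gam_C0: assumes "p \<in> B0" shows "gam p \<in> C0"
proof -
  obtain x where "x \<in> Pm E" "Zero < x" "p \<in> B Zero x" using assms by (rule B0E)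
  then have yx': "Zero \<in> Pum E" "x \<in> Pum E" "Zero < x" "p \<in> B Zero x" by (simp_all add: Pum_iff)
  have "gam p u x' x' = 0" if "x' \<noteq> Zero" for u x'
    using gam_value[OF yx', of u] that by (metis mu_def)
  then show ?thesis using gam_Jdual[OF yx'] by (simp add: C0_def)
qed

lemma Bh_Js: "p \<in> Bh \<Longrightarrow> p \<in> Js E"
  by (erule BhE) (use B_single(2) in \<open>auto simp: Pum_iff\<close>)

lemma B0_Js: "p \<in> B0 \<Longrightarrow> p \<in> Js E"
  using B_single(2)[of Zero _ p] by (auto elim!: B0E simp: Pum_iff)

text \<open>For an element supported in one row only part of the dual basis contributes:
  \<open>Bh\<close> for a row in \<open>Pm E\<close>, \<open>B0\<close> for the row
  \<open>Zero\<close>. These are the ranges of summation in the differential.\<close>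

lemma gam_expand_sum:
  assumes u: "u \<in> Js E" and z: "B' = Bh \<and> z \<in> Pm E \<or> B' = B0 \<and> z = Zero"
    and supp: "\<And>y x. u y x \<noteq> 0 \<Longrightarrow> y = z"
  shows "u = (\<lambda>i j. \<Sum>p\<in>B'. (gam p u \<otimes>\<^bsub>\<Lambda>\<^esub> p) i j)"
proof (intro ext)
  fix i j
  have zP: "z \<in> Pum E" and B': "B' = Bh \<or> B' = B0" using z by (auto simp: Pum_iff)
  have finB': "finite B'" using B' finite_Bh finite_B0 by auto
  have basis: "\<exists>y\<in>Pum E. \<exists>x\<in>Pum E. y < x \<and> p \<in> B y x" if "p \<in> B'" for p
  proof (cases "p \<in> Bh")
    case True
    then show ?thesis by (rule BhE) (auto simp: Pum_iff intro!: bexI)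
  next
    case False
    then have "p \<in> B0" using that B' by blast
    then show ?thesis by (rule B0E) (auto simp: Pum_iff intro!: bexI)
  qed
  have val: "(gam p u \<otimes>\<^bsub>\<Lambda>\<^esub> p) i j = gam p u i i * p i j" if "p \<in> B'" for p
  proof -
    have "gam p \<in> Jdual E" using basis[OF that] gam_Jdual by blast
    then show ?thesis by (simp add: Ss_mult_left Jdual_Ss)
  qed
  show "u i j = (\<Sum>p\<in>B'. (gam p u \<otimes>\<^bsub>\<Lambda>\<^esub> p) i j)"
  proof (cases "i = z \<and> j \<in> Pm E \<and> i < j")
    case True
    have sub: "B z j \<subseteq> B'"
      using True z by (auto simp: B0_eq Bh_def)
    have "(gam p u \<otimes>\<^bsub>\<Lambda>\<^esub> p) i j = 0" if p: "p \<in> B' - B z j" for p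
    proof -
      obtain y x where yx: "y \<in> Pum E" "x \<in> Pum E" "y < x" "p \<in> B y x" using basis p by blast
      then have "p i j = mu y x (p y x) i j" using B_single(1)[OF yx] by metis
      then show ?thesis using val p yx True by (auto simp: mu_def)
    qed
    then have "(\<Sum>p\<in>B'. (gam p u \<otimes>\<^bsub>\<Lambda>\<^esub> p) i j) = (\<Sum>p\<in>B z j. (gam p u \<otimes>\<^bsub>\<Lambda>\<^esub> p) i j)"
      using sub finB' by (intro sum.mono_neutral_right) auto
    also have "\<dots> = (\<Sum>p\<in>B z j. gam p u z z * p z j)"
      using sub val True by (intro sum.cong refl) auto
    also have "\<dots> = u z j" using gam_expand[OF u zP, of j, symmetric] True by (auto simp: Pum_iff)
    finally show ?thesis using True by simp
  next
    case False
    then have u0: "u i j = 0" using supp[of i j] Js_eq_0[OF u, of i j] by blast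
    have "(gam p u \<otimes>\<^bsub>\<Lambda>\<^esub> p) i j = 0" if p: "p \<in> B'" for p
    proof -
      obtain y x where yx: "y \<in> Pum E" "x \<in> Pum E" "y < x" "p \<in> B y x" using basis p by blast
      show ?thesis
      proof (cases "i = y \<and> j = x")
        case True
        then have "i \<noteq> z" using False yx by (auto simp: Pum_iff)
        then have "u y x = 0" using True supp by blast
        then have "gam p u = \<zero>\<^bsub>\<Lambda>\<^esub>"
          using gam_local[OF yx u] Jdual_zero[OF gam_Jdual[OF yx]] by (simp add: mu_def Lam_simps(4))
        then show ?thesis using val[OF p] by (simp add: Lam_simps(4))
      next
        case False
        have "p i j = mu y x (p y x) i j" using B_single(1)[OF yx] by metis
        then show ?thesis using val[OF p] False by (auto simp: mu_def)
      qed
    qed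
    then show ?thesis using u0 by simp
  qed
qed

section \<open>The differential on letters and products\<close>

lemma graded_derivation: "graded_derivation (De E d)"
  using differential by (simp add: De_differential_def Let_def)

lemma d_part: "t \<in> T.Tpart n \<Longrightarrow> d t \<in> T.Tpart (Suc n)"
  using graded_derivation unfolding graded_derivation_def De_simps by blast

lemma d_add: "s \<in> carrier (Te E) \<Longrightarrow> t \<in> carrier (Te E) \<Longrightarrow> d (s \<oplus>\<^bsub>Te E\<^esub> t) = d s \<oplus>\<^bsub>Te E\<^esub> d t"
  using graded_derivation unfolding graded_derivation_def De_simps by blast

lemma d_tS: "s \<in> Ss E \<Longrightarrow> d (tS s) = \<zero>\<^bsub>Te E\<^esub>"
  using graded_derivation unfolding graded_derivation_def De_simps base_De by blast

lemma d_mult_0: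
  "a \<in> T.Tpart 0 \<Longrightarrow> t \<in> carrier (Te E) \<Longrightarrow>
    d (a \<otimes>\<^bsub>Te E\<^esub> t) = d a \<otimes>\<^bsub>Te E\<^esub> t \<oplus>\<^bsub>Te E\<^esub> a \<otimes>\<^bsub>Te E\<^esub> d t"
  using graded_derivation unfolding graded_derivation_def De_simps by fastforce

text \<open>\<open>a_inv\<close> depends on the additive structure alone, which the two records
  share.\<close>

lemma a_inv_De: "\<ominus>\<^bsub>De E d\<^esub> x = \<ominus>\<^bsub>Te E\<^esub> x"
  by (simp add: a_inv_def m_inv_def)

lemma d_mult_1:
  "v \<in> T.Tpart 1 \<Longrightarrow> t \<in> carrier (Te E) \<Longrightarrow>
    d (v \<otimes>\<^bsub>Te E\<^esub> t) = d v \<otimes>\<^bsub>Te E\<^esub> t \<oplus>\<^bsub>Te E\<^esub> \<ominus>\<^bsub>Te E\<^esub> (v \<otimes>\<^bsub>Te E\<^esub> d t)"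
proof -
  have "\<And>n a b. \<lbrakk>a \<in> T.Tpart n; b \<in> carrier (Te E)\<rbrakk> \<Longrightarrow> d (a \<otimes>\<^bsub>Te E\<^esub> b) = d a \<otimes>\<^bsub>Te E\<^esub> b \<oplus>\<^bsub>Te E\<^esub>
      (if even n then a \<otimes>\<^bsub>Te E\<^esub> d b else \<ominus>\<^bsub>Te E\<^esub> (a \<otimes>\<^bsub>Te E\<^esub> d b))"
    using graded_derivation unfolding graded_derivation_def De_simps a_inv_De by blast
  from this[of v 1 t] show "v \<in> T.Tpart 1 \<Longrightarrow> t \<in> carrier (Te E) \<Longrightarrow> ?thesis" by simp
qed

lemma d_zero: "d \<zero>\<^bsub>Te E\<^esub> = \<zero>\<^bsub>Te E\<^esub>"
  using d_add[of "\<zero>\<^bsub>Te E\<^esub>" "\<zero>\<^bsub>Te E\<^esub>"] d_part[OF T.Tpart_zero, THEN T.Tpart_carrier]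
  by (metis T.TR.add.r_cancel_one' T.TR.zero_closed T.TR.l_zero)

lemma d_uminus: "s \<in> T.Tpart n \<Longrightarrow> d (\<ominus>\<^bsub>Te E\<^esub> s) = \<ominus>\<^bsub>Te E\<^esub> d s"
  using d_add[of "\<ominus>\<^bsub>Te E\<^esub> s" s] d_zero T.Tpart_carrier[of s n] T.Tpart_uminus[of s n]
    T.Tpart_carrier[OF d_part, of s n] T.Tpart_carrier[OF d_part, of "\<ominus>\<^bsub>Te E\<^esub> s" n]
  by (metis T.TR.add.inv_closed T.TR.l_neg T.TR.minus_equality)

lemma d_w12:
  "\<gamma> \<in> C0 \<Longrightarrow> d (w12 E \<gamma>) = \<ominus>\<^bsub>Te E\<^esub> (\<Oplus>\<^bsub>Te E\<^esub>p\<in>Bh. \<Oplus>\<^bsub>Te E\<^esub>q\<in>B0.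
     w1 E (gam p) \<otimes>\<^bsub>Te E\<^esub> w12 E (gam q) \<otimes>\<^bsub>Te E\<^esub> tS (\<gamma> (q \<otimes>\<^bsub>\<Lambda>\<^esub> p)))"
  using differential
  unfolding De_differential_def Let_def dual_corner_0 B0_def[symmetric] Bh_def[symmetric]
  by (simp add: tR_C0)

lemma d_w1:
  "\<delta> \<in> Ch \<Longrightarrow> d (w1 E \<delta>) = \<ominus>\<^bsub>Te E\<^esub> (\<Oplus>\<^bsub>Te E\<^esub>p\<in>Bh. \<Oplus>\<^bsub>Te E\<^esub>q\<in>Bh.
     w1 E (gam p) \<otimes>\<^bsub>Te E\<^esub> w1 E (gam q) \<otimes>\<^bsub>Te E\<^esub> tS (\<delta> (q \<otimes>\<^bsub>\<Lambda>\<^esub> p)))"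
  using differential
  unfolding De_differential_def Let_def dual_corner_h B0_def[symmetric] Bh_def[symmetric]
  by (simp add: tR_Ch)

text \<open>In the applications \<open>h\<close> evaluates a map of degree 1 at a fixed vector. The
  differential of a letter is evaluated term by term, every term staying in the part where
  \<open>h\<close> is additive.\<close>

lemma additive_d_w12:
  assumes h: "\<And>s t. \<lbrakk>s \<in> T.Tpart 1; t \<in> T.Tpart 1\<rbrakk> \<Longrightarrow> h (s \<oplus>\<^bsub>Te E\<^esub> t) = (h s + h t :: 'x::ab_group_add)"
    and \<gamma>: "\<gamma> \<in> C0"
  shows "h (d (w12 E \<gamma>)) = - (\<Sum>p\<in>Bh. \<Sum>q\<in>B0.
    h (w1 E (gam p) \<otimes>\<^bsub>Te E\<^esub> w12 E (gam q) \<otimes>\<^bsub>Te E\<^esub> tS (\<gamma> (q \<otimes>\<^bsub>\<Lambda>\<^esub> p))))"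
proof -
  have mem: "w1 E (gam p) \<otimes>\<^bsub>Te E\<^esub> w12 E (gam q) \<otimes>\<^bsub>Te E\<^esub> tS (\<gamma> (q \<otimes>\<^bsub>\<Lambda>\<^esub> p)) \<in> T.Tpart 1"
    if "p \<in> Bh" "q \<in> B0" for p q
    using T.Tpart_mult[OF T.Tpart_mult[OF w1_part[OF gam_Ch[OF that(1)]] w12_part[OF gam_C0[OF that(2)]]]
        tS_part[OF Jdual_Ss[OF C0_Jdual[OF \<gamma>]]]] by simp
  show ?thesis
    unfolding d_w12[OF \<gamma>] using mem
    by (subst T.additive_Tpart_zero_uminus(2)[where n = 1 and h = h, OF h]
          T.additive_Tpart_finsum[where n = 1 and h = h, OF h];
        auto intro!: T.Tpart_finsum sum.cong finite_Bh finite_B0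
          T.additive_Tpart_finsum[where n = 1 and h = h, OF h])+
qed

lemma additive_d_w1:
  assumes h: "\<And>s t. \<lbrakk>s \<in> T.Tpart 2; t \<in> T.Tpart 2\<rbrakk> \<Longrightarrow> h (s \<oplus>\<^bsub>Te E\<^esub> t) = (h s + h t :: 'x::ab_group_add)"
    and \<delta>: "\<delta> \<in> Ch"
  shows "h (d (w1 E \<delta>)) = - (\<Sum>p\<in>Bh. \<Sum>q\<in>Bh.
    h (w1 E (gam p) \<otimes>\<^bsub>Te E\<^esub> w1 E (gam q) \<otimes>\<^bsub>Te E\<^esub> tS (\<delta> (q \<otimes>\<^bsub>\<Lambda>\<^esub> p))))"
proof -
  have mem: "w1 E (gam p) \<otimes>\<^bsub>Te E\<^esub> w1 E (gam q) \<otimes>\<^bsub>Te E\<^esub> tS (\<delta> (q \<otimes>\<^bsub>\<Lambda>\<^esub> p)) \<in> T.Tpart 2"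
    if "p \<in> Bh" "q \<in> Bh" for p q
    using T.Tpart_mult[OF T.Tpart_mult[OF w1_part[OF gam_Ch[OF that(1)]] w1_part[OF gam_Ch[OF that(2)]]]
        tS_part[OF Jdual_Ss[OF Ch_Jdual[OF \<delta>]]]] by (simp add: numeral_2_eq_2)
  show ?thesis
    using mem finite_Bh T.Tpart_finsum[where n = 2 and A = Bh]
    by (simp add: d_w1[OF \<delta>] T.additive_Tpart_zero_uminus(2)[of 2 h] T.additive_Tpart_finsum[of 2 h] h)
qed

end

section \<open>The elements $\hat u_{0,x}$ and the maps $\phi_x$, $\chi_{y,x}$\<close>

text \<open>\<open>left_inverse\<close> and \<open>v_nonzero\<close> make left multiplication of
  v_{0,x} by R_0 injective; with \<open>v_generator\<close>, R_{0,x} is free of rank one with basis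
  v_{0,x}.\<close>

locale line_datum = dit_datum +
  fixes v :: "'c extp \<Rightarrow> 'b"
  assumes left_inverse: "\<And>c. c \<in> Rs E Zero Zero \<Longrightarrow> c \<noteq> 0 \<Longrightarrow> \<exists>c'. c' * c = eps E Zero"
    and v_nonzero: "\<And>x. x \<in> Pm E \<Longrightarrow> v x \<noteq> 0"
    and v_generator: "\<And>x. x \<in> Pm E \<Longrightarrow>
      v x \<in> Rs E Zero x \<and> Rs E Zero x = (\<lambda>c. c * v x) ` Rs E Zero Zero"
begin

lemma Zero_Pum: "Zero \<in> Pum E" and Pm_Pum: "x \<in> Pm E \<Longrightarrow> x \<in> Pum E"
  by (simp_all add: Pum_iff)

lemma Rs_Zero: "x \<in> Pum E \<Longrightarrow> Rs E Zero x = Rx Zero x"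
  by (simp add: Rs_eq_Rx Zero_Pum)

lemma v_Rx: "x \<in> Pm E \<Longrightarrow> v x \<in> Rx Zero x"
  using v_generator Rs_Zero Pm_Pum by blast

lemma Zero_Js: "x \<in> Pm E \<Longrightarrow> r \<in> Rx Zero x \<Longrightarrow> mu Zero x r \<in> Js E"
  by (rule Js_mu) auto

lemma mult_v_cancel:
  assumes "x \<in> Pm E" "c \<in> Rx Zero Zero" "c' \<in> Rx Zero Zero" "c * v x = c' * v x"
  shows "c = c'"
proof (rule ccontr)
  assume "c \<noteq> c'"
  moreover have "c - c' \<in> Rx Zero Zero"
    using Rx_add[OF assms(2) Rx_uminus[OF assms(3)]] by simp
  ultimately obtain a where "a * (c - c') = eps E Zero"
    using left_inverse[of "c - c'"] by (auto simp: Rs_Zero Zero_Pum)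
  then have "eps E Zero * v x = a * ((c - c') * v x)" by (metis mult.assoc)
  also have "(c - c') * v x = 0" using assms(4) by (simp add: left_diff_distrib)
  finally show False using Rx_unit(1)[OF v_Rx[OF assms(1)]] v_nonzero[OF assms(1)] by simp
qed

text \<open>The coordinate along v_{0,x}. Both maps of the theorem arise from it: \<open>phi\<close>
  is the coordinate of \<open>v x * z\<close>, and \<open>chi\<close> that of
  \<open>v y * r\<close>.\<close>

definition coef :: "'c extp \<Rightarrow> 'b \<Rightarrow> 'b" where
  "coef x r = (THE c. c \<in> Rx Zero Zero \<and> r = c * v x)"

lemma coef_unique: "x \<in> Pm E \<Longrightarrow> c \<in> Rx Zero Zero \<Longrightarrow> coef x (c * v x) = c"
  unfolding coef_def by (rule the_equality) (auto intro: mult_v_cancel)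

lemma coef_ex:
  assumes "x \<in> Pm E" "r \<in> Rx Zero x" obtains c where "c \<in> Rx Zero Zero" "r = c * v x" "coef x r = c"
proof -
  have "r \<in> (\<lambda>c. c * v x) ` Rs E Zero Zero" using assms v_generator Rs_Zero Pm_Pum by blast
  then obtain c where "c \<in> Rx Zero Zero" "r = c * v x" by (auto simp: Rs_Zero Zero_Pum)
  then show ?thesis using that coef_unique assms by blast
qed

lemma coef_Rx: "x \<in> Pm E \<Longrightarrow> r \<in> Rx Zero x \<Longrightarrow> coef x r \<in> Rx Zero Zero"
  and coef_mult_v: "x \<in> Pm E \<Longrightarrow> r \<in> Rx Zero x \<Longrightarrow> coef x r * v x = r"
  by (metis coef_ex)+

lemma coef_add:
  assumes "x \<in> Pm E" "r \<in> Rx Zero x" "s \<in> Rx Zero x" shows "coef x (r + s) = coef x r + coef x s"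
  using coef_unique[of x "coef x r + coef x s"] assms by (simp add: distrib_right coef_mult_v Rx_add coef_Rx)

lemma coef_mult:
  assumes "x \<in> Pm E" "r \<in> Rx Zero x" "c \<in> Rx Zero Zero" shows "coef x (c * r) = c * coef x r"
  using coef_unique[of x "c * coef x r"] assms Rx_mult[of c Zero Zero "coef x r" Zero]
  by (simp add: mult.assoc coef_mult_v coef_Rx)

lemma mu_Ss_mult: "r \<in> Rx x x \<Longrightarrow> mu x x r \<otimes>\<^bsub>\<Lambda>\<^esub> mu x y s = mu x y (r * s)"
  by (auto simp: Ss_mult_left Ss_mu fun_eq_iff) (auto simp: mu_def)

lemma mu_mult_Ss: "r \<in> Rx y y \<Longrightarrow> mu x y s \<otimes>\<^bsub>\<Lambda>\<^esub> mu y y r = mu x y (s * r)"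
  by (auto simp: Ss_mult_right Ss_mu fun_eq_iff) (auto simp: mu_def)

lemma mu_mult_right: "s \<in> Ss E \<Longrightarrow> mu x y r \<otimes>\<^bsub>\<Lambda>\<^esub> s = mu x y (r * s y y)"
  by (auto simp: Ss_mult_right fun_eq_iff) (auto simp: mu_def)

lemma mu_mult_left: "s \<in> Ss E \<Longrightarrow> s \<otimes>\<^bsub>\<Lambda>\<^esub> mu x y r = mu x y (s x x * r)"
  by (auto simp: Ss_mult_left fun_eq_iff) (auto simp: mu_def)

lemma C0_value: assumes \<gamma>: "\<gamma> \<in> C0" shows "\<gamma> u = mu Zero Zero (\<gamma> u Zero Zero)"
proof (intro ext)
  fix i j
  show "\<gamma> u i j = mu Zero Zero (\<gamma> u Zero Zero) i j"
    using \<gamma> Ss_off[OF Jdual_Ss[OF C0_Jdual[OF \<gamma>]], of i j u]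
    by (cases "i = j") (auto simp: C0_def mu_def)
qed

text \<open>Values of a form in \<open>C0\<close> are fixed by e_0 on the left; by left linearity
  this e_0 moves into the argument and removes every row but \<open>Zero\<close>.\<close>

lemma C0_row:
  assumes \<gamma>: "\<gamma> \<in> C0" and u: "u \<in> Js E" and x: "x \<in> Pm E"
  shows "\<gamma> (u \<otimes>\<^bsub>\<Lambda>\<^esub> ei E x) = \<gamma> (mu Zero x (u Zero x))"
proof -
  note \<gamma>J = C0_Jdual[OF \<gamma>] and S = Ss_ei[OF Zero_Pum] and x = Pm_Pum[OF x]
  have uJ: "u \<otimes>\<^bsub>\<Lambda>\<^esub> ei E x \<in> Js E" by (rule Js_mult_right[OF Ss_ei[OF x] u])
  have "ei E Zero \<otimes>\<^bsub>\<Lambda>\<^esub> (u \<otimes>\<^bsub>\<Lambda>\<^esub> ei E x) = mu Zero x (u Zero x)"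
    unfolding Lam_corner[OF u x Zero_Pum, symmetric] Ss_mult_left[OF S] Ss_mult_right[OF Ss_ei[OF x]]
    by (simp add: mult.assoc)
  then have "\<gamma> (mu Zero x (u Zero x)) = ei E Zero \<otimes>\<^bsub>\<Lambda>\<^esub> \<gamma> (u \<otimes>\<^bsub>\<Lambda>\<^esub> ei E x)"
    using Jdual_left[OF \<gamma>J S uJ] by simp
  also have "\<dots> = \<gamma> (u \<otimes>\<^bsub>\<Lambda>\<^esub> ei E x)"
  proof (subst (1 2) C0_value[OF \<gamma>], intro ext)
    fix i j
    show "(ei E Zero \<otimes>\<^bsub>\<Lambda>\<^esub> mu Zero Zero (\<gamma> (u \<otimes>\<^bsub>\<Lambda>\<^esub> ei E x) Zero Zero)) i j =
        mu Zero Zero (\<gamma> (u \<otimes>\<^bsub>\<Lambda>\<^esub> ei E x) Zero Zero) i j"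
      using Rx_unit(1)[OF Ss_Rx[OF Jdual_Ss[OF \<gamma>J, of "u \<otimes>\<^bsub>\<Lambda>\<^esub> ei E x"], of Zero Zero]] unfolding mu_mult_left[OF S]
      by (simp add: ei_def mu_def)
  qed
  finally show ?thesis by simp
qed

section \<open>A closed form for \<open>uhat\<close> and the action formulas for \<open>phi\<close>
  and \<open>chi\<close>\<close>

definition uh :: "'c extp \<Rightarrow> ('b, 'c) dual" where
  "uh x = (\<lambda>u. if u \<in> Js E then mu Zero Zero (coef x (u Zero x)) else \<zero>\<^bsub>\<Lambda>\<^esub>)"

lemma uh_C0: assumes x: "x \<in> Pm E" shows "uh x \<in> C0"
proof -
  have S: "mu Zero Zero (coef x (u Zero x)) \<in> Ss E" if "u \<in> Js E" for u
    by (rule Ss_mu[OF coef_Rx[OF x Js_Rx[OF that]]])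
  have "uh x (u \<oplus>\<^bsub>\<Lambda>\<^esub> w) = uh x u \<oplus>\<^bsub>\<Lambda>\<^esub> uh x w" if "u \<in> Js E" "w \<in> Js E" for u w
    using coef_add[OF x Js_Rx[OF that(1)] Js_Rx[OF that(2)]] Js_add[OF that] that
    by (auto simp: uh_def Lam_simps(5) mu_def fun_eq_iff)
  moreover have "uh x (s \<otimes>\<^bsub>\<Lambda>\<^esub> u) = s \<otimes>\<^bsub>\<Lambda>\<^esub> uh x u" if "s \<in> Ss E" "u \<in> Js E" for s u
    using coef_mult[OF x Js_Rx[OF that(2)] Ss_Rx[OF that(1)]] Js_mult_left[OF that] that
    by (simp add: uh_def Ss_mult_left[OF that(1), of u] mu_mult_left)
  ultimately show ?thesis using S Ss_zero by (auto simp: C0_def Jdual_def uh_def) (auto simp: mu_def Lam_simps(4))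
qed

lemma uh_mu: "x \<in> Pm E \<Longrightarrow> r \<in> Rx Zero x \<Longrightarrow> uh x (mu Zero x r) = mu Zero Zero (coef x r)"
  using Zero_Js[of x r] by (simp add: uh_def) (simp add: mu_def)

text \<open>A form in this corner depends on the entry at \<open>Zero\<close> and \<open>x\<close>
  alone, and left linearity over R_0 determines it from its value at the generator.\<close>

lemma uhat_eq: assumes x: "x \<in> Pm E" shows "uhat E v x = uh x"
  unfolding uhat_def
proof (rule the_equality)
  note xP = Pm_Pum[OF x]
  have "dual_l E (ei E x) (dual_r E (uh x) (ei E Zero)) = uh x"
  proof
    fix u
    show "dual_l E (ei E x) (dual_r E (uh x) (ei E Zero)) u = uh x u"
    proof (cases "u \<in> Js E")
      case True
      then have "u \<otimes>\<^bsub>\<Lambda>\<^esub> ei E x \<in> Js E" by (simp add: Js_mult_right Ss_ei xP)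
      moreover have "(u \<otimes>\<^bsub>\<Lambda>\<^esub> ei E x) Zero x = u Zero x"
        using Rx_unit(2)[OF Js_Rx[OF True, of Zero x]] unfolding Ss_mult_right[OF Ss_ei[OF xP]]
        by (simp add: ei_def mu_def)
      ultimately have "dual_l E (ei E x) (dual_r E (uh x) (ei E Zero)) u =
          mu Zero Zero (coef x (u Zero x)) \<otimes>\<^bsub>\<Lambda>\<^esub> ei E Zero"
        using True by (simp add: dual_l_def dual_r_def uh_def)
      also have "\<dots> = mu Zero Zero (coef x (u Zero x))"
        using Rx_unit(2)[OF coef_Rx[OF x Js_Rx[OF True]]] unfolding mu_mult_right[OF Ss_ei[OF Zero_Pum]]
        by (simp add: ei_def mu_def)
      finally show ?thesis using True by (simp add: uh_def)
    qed (simp add: dual_l_def uh_def)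
  qed
  moreover have "uh x (mu Zero x (v x)) = ei E Zero"
    using coef_unique[OF x eps_Rx[OF Zero_Pum]] Rx_unit(1)[OF v_Rx[OF x]]
    by (simp add: uh_mu x v_Rx ei_def)
  ultimately show "uh x \<in> dual_corner E (ei E x) (ei E Zero) \<and> uh x (mu Zero x (v x)) = ei E Zero"
    using C0_Jdual[OF uh_C0[OF x]] unfolding dual_corner_def by force
next
  fix \<gamma> assume \<gamma>: "\<gamma> \<in> dual_corner E (ei E x) (ei E Zero) \<and> \<gamma> (mu Zero x (v x)) = ei E Zero"
  note xP = Pm_Pum[OF x]
  obtain \<gamma>' where \<gamma>': "\<gamma>' \<in> Jdual E" "\<gamma> = dual_l E (ei E x) (dual_r E \<gamma>' (ei E Zero))"
    using \<gamma> by (auto simp: dual_corner_def)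
  define \<delta> where "\<delta> = dual_r E \<gamma>' (ei E Zero)"
  have \<delta>: "\<delta> \<in> C0"
    using \<gamma>'(1) by (auto simp: \<delta>_def C0_def dual_r_Jdual Ss_ei Zero_Pum dual_r_apply) (simp add: ei_def mu_def)
  have \<gamma>\<delta>: "\<gamma> u = \<delta> (mu Zero x (u Zero x))" if "u \<in> Js E" for u
    using \<gamma>'(2) C0_row[OF \<delta> that x] that by (simp add: \<delta>_def dual_l_def)
  have vJ: "mu Zero x (v x) \<in> Js E" by (rule Zero_Js[OF x v_Rx[OF x]])
  then have v1: "\<delta> (mu Zero x (v x)) = ei E Zero" using \<gamma> \<gamma>\<delta> by (simp add: mu_def)
  show "\<gamma> = uh x"
  proof
    fix u
    show "\<gamma> u = uh x u"
    proof (cases "u \<in> Js E")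
      case True
      note c = coef_Rx[OF x Js_Rx[OF True]]
      have "mu Zero x (u Zero x) = mu Zero Zero (coef x (u Zero x)) \<otimes>\<^bsub>\<Lambda>\<^esub> mu Zero x (v x)"
        using coef_mult_v[OF x Js_Rx[OF True]] by (simp add: mu_Ss_mult c)
      then have "\<gamma> u = mu Zero Zero (coef x (u Zero x)) \<otimes>\<^bsub>\<Lambda>\<^esub> ei E Zero"
        using \<gamma>\<delta>[OF True] Jdual_left[OF C0_Jdual[OF \<delta>] Ss_mu[OF c] vJ] v1 by simp
      also have "\<dots> = mu Zero Zero (coef x (u Zero x))"
        using Rx_unit(2)[OF c] unfolding mu_mult_right[OF Ss_ei[OF Zero_Pum]] by (simp add: ei_def mu_def)
      finally show ?thesis using True by (simp add: uh_def)
    qed (simp add: \<gamma>'(2) dual_l_def uh_def)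
  qed
qed

text \<open>The part of \<open>C0\<close> at \<open>x\<close> consists of right multiples of
  \<open>uh x\<close>, so the action of all of \<open>C0\<close> on M_x is known from that of
  \<open>uh x\<close>, hence from the stripe.\<close>

lemma dual_l_ei:
  assumes x: "x \<in> Pm E" and \<gamma>: "\<gamma> \<in> C0"
  shows "dual_l E (ei E x) \<gamma> = dual_r E (uh x) (\<gamma> (mu Zero x (v x)))"
proof
  fix u
  note S = Jdual_Ss[OF C0_Jdual[OF \<gamma>]]
  show "dual_l E (ei E x) \<gamma> u = dual_r E (uh x) (\<gamma> (mu Zero x (v x))) u"
  proof (cases "u \<in> Js E")
    case True
    note c = coef_Rx[OF x Js_Rx[OF True]]
    have vJ: "mu Zero x (v x) \<in> Js E" by (rule Zero_Js[OF x v_Rx[OF x]])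
    have "mu Zero x (u Zero x) = mu Zero Zero (coef x (u Zero x)) \<otimes>\<^bsub>\<Lambda>\<^esub> mu Zero x (v x)"
      using coef_mult_v[OF x Js_Rx[OF True]] by (simp add: mu_Ss_mult c)
    then show ?thesis
      using C0_row[OF \<gamma> True x] True Jdual_left[OF C0_Jdual[OF \<gamma>] Ss_mu[OF c] vJ]
      by (simp add: dual_l_def dual_r_def uh_def)
  qed (simp add: dual_l_def dual_r_def uh_def Lam_simps)
qed

text \<open>Turns the identity of forms that defines \<open>phi\<close> into an identity in
  \<open>A\<close>, the shape used when stripes are multiplied by the generators.\<close>

lemma phi_spec:
  assumes x: "x \<in> Pm E" and z: "z \<in> Rx x x"
  shows "phi E v x z \<in> Rx Zero Zero" "phi E v x z * v x = v x * z"
proof -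
  note c = coef_Rx[OF x Rx_mult[OF v_Rx[OF x] z]]
  have "phi E v x z = coef x (v x * z)"
    unfolding phi_def uhat_eq[OF x]
  proof (rule the_equality)
    have "dual_l E (mu x x z) (uh x) u = dual_r E (uh x) (mu Zero Zero (coef x (v x * z))) u" for u
    proof (cases "u \<in> Js E")
      case True
      note cu = coef_Rx[OF x Js_Rx[OF True]]
      have "(u \<otimes>\<^bsub>\<Lambda>\<^esub> mu x x z) Zero x = u Zero x * z"
        by (simp add: Ss_mult_right Ss_mu z) (simp add: mu_def)
      also have "\<dots> = coef x (u Zero x) * (v x * z)"
        using coef_mult_v[OF x Js_Rx[OF True]] by (metis mult.assoc)
      finally show ?thesis
        using True Js_mult_right[OF Ss_mu[OF z] True]
        by (simp add: dual_l_def dual_r_def uh_def mu_Ss_mult cu coef_mult x Rx_mult[OF v_Rx[OF x] z])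
    qed (simp add: dual_l_def dual_r_def uh_def Lam_simps)
    then show "coef x (v x * z) \<in> Rs E Zero Zero \<and>
        dual_l E (mu x x z) (uh x) = dual_r E (uh x) (mu Zero Zero (coef x (v x * z)))"
      using c by (auto simp: Rs_Zero Zero_Pum)
  next
    \<comment> \<open>Uniqueness: both forms are evaluated at the generator.\<close>
    fix a assume a: "a \<in> Rs E Zero Zero \<and> dual_l E (mu x x z) (uh x) = dual_r E (uh x) (mu Zero Zero a)"
    then have aR: "a \<in> Rx Zero Zero" by (simp add: Rs_Zero Zero_Pum)
    have vJ: "mu Zero x (v x) \<in> Js E" by (rule Zero_Js[OF x v_Rx[OF x]])
    have "dual_l E (mu x x z) (uh x) (mu Zero x (v x)) = mu Zero Zero (coef x (v x * z))"
      using vJ by (simp add: dual_l_def mu_mult_Ss z uh_mu x Rx_mult[OF v_Rx[OF x] z])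
    moreover have "dual_r E (uh x) (mu Zero Zero a) (mu Zero x (v x)) = mu Zero Zero a"
      using coef_unique[OF x eps_Rx[OF Zero_Pum]] Rx_unit(1)[OF v_Rx[OF x]] Rx_unit(1)[OF aR]
      by (simp add: dual_r_def uh_mu x v_Rx mu_Ss_mult eps_Rx Zero_Pum)
    ultimately have "mu Zero Zero (coef x (v x * z)) = (mu Zero Zero a :: ('b, 'c) lam)" using a by metis
    from fun_cong[OF fun_cong[OF this, of Zero], of Zero] show "a = coef x (v x * z)"
      by (simp add: mu_def)
  qed
  then show "phi E v x z \<in> Rx Zero Zero" "phi E v x z * v x = v x * z"
    using c coef_mult_v[OF x Rx_mult[OF v_Rx[OF x] z]] by simp_all
qed

lemma chi_spec:
  assumes y: "y \<in> Pm E" and x: "x \<in> Pm E" and r: "r \<in> Rx y x"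
  shows "chi E v y x r \<in> Rx Zero Zero" "chi E v y x r * v x = v y * r"
proof -
  note vr = Rx_mult[OF v_Rx[OF y] r]
  have "chi E v y x r = coef x (v y * r)"
    by (simp add: chi_def coef_def Rs_Zero Zero_Pum)
  then show "chi E v y x r \<in> Rx Zero Zero" "chi E v y x r * v x = v y * r"
    using coef_Rx[OF x vr] coef_mult_v[OF x vr] by simp_all
qed

end

section \<open>Modules and coordinates\<close>

locale dit_mod = line_datum +
  fixes aM :: "'m::ab_group_add \<Rightarrow> ('b, 'c) te \<Rightarrow> 'm"
  assumes dit_module: "dit_module (De E d) aM"
begin

lemma aM_add: "a \<in> T.Tpart 0 \<Longrightarrow> aM (m + m') a = aM m a + aM m' a"
  and aM_plus: "a \<in> T.Tpart 0 \<Longrightarrow> a' \<in> T.Tpart 0 \<Longrightarrow> aM m (a \<oplus>\<^bsub>Te E\<^esub> a') = aM m a + aM m a'"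
  and aM_mult: "a \<in> T.Tpart 0 \<Longrightarrow> a' \<in> T.Tpart 0 \<Longrightarrow> aM m (a \<otimes>\<^bsub>Te E\<^esub> a') = aM (aM m a) a'"
  and aM_one: "aM m \<one>\<^bsub>Te E\<^esub> = m"
  using dit_module by (simp_all add: dit_module_def)

text \<open>\<open>sm\<close> and \<open>om\<close> are the actions of the two kinds of generators
  of T_0; through them \<open>S\<close> and the forms in \<open>C0\<close> act without mention of
  classes of words.\<close>

definition sm :: "'m \<Rightarrow> ('b, 'c) lam \<Rightarrow> 'm" where "sm m s = aM m (tS s)"
definition om :: "'m \<Rightarrow> ('b, 'c) dual \<Rightarrow> 'm" where "om m \<gamma> = aM m (w12 E \<gamma>)"

lemma sm_add: "s \<in> Ss E \<Longrightarrow> sm (m + m') s = sm m s + sm m' s"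
  by (simp add: sm_def aM_add tS_part)

lemma additive_sm: "s \<in> Ss E \<Longrightarrow> additive (\<lambda>m. sm m s)"
  by (simp add: additive.intro sm_add)

lemma sm_plus: "s \<in> Ss E \<Longrightarrow> t \<in> Ss E \<Longrightarrow> sm m (s \<oplus>\<^bsub>\<Lambda>\<^esub> t) = sm m s + sm m t"
  by (simp add: sm_def tS_add aM_plus tS_part)

lemma sm_mult: "s \<in> Ss E \<Longrightarrow> t \<in> Ss E \<Longrightarrow> sm m (s \<otimes>\<^bsub>\<Lambda>\<^esub> t) = sm (sm m s) t"
  by (simp add: sm_def tS_mult aM_mult tS_part)

lemma sm_one: "sm m \<one>\<^bsub>\<Lambda>\<^esub> = m"
  by (simp add: sm_def tS_one aM_one)

lemma sm_zero: "sm m \<zero>\<^bsub>\<Lambda>\<^esub> = 0"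
  using sm_plus[OF Ss_zero Ss_zero, of m] by (simp add: Lam_simps)

lemma sm_sum:
  assumes "finite A" "\<And>a. a \<in> A \<Longrightarrow> f a \<in> Ss E"
  shows "(\<lambda>i j. \<Sum>a\<in>A. f a i j) \<in> Ss E" "sm m (\<lambda>i j. \<Sum>a\<in>A. f a i j) = (\<Sum>a\<in>A. sm m (f a))"
proof -
  have "(\<lambda>i j. \<Sum>a\<in>A. f a i j) \<in> Ss E \<and> sm m (\<lambda>i j. \<Sum>a\<in>A. f a i j) = (\<Sum>a\<in>A. sm m (f a))"
    using assms
  proof (induction A)
    case empty
    then show ?case using Ss_zero sm_zero by (simp add: Lam_simps)
  next
    case (insert a A)
    then show ?case
      using Ss_add[of "f a" "\<lambda>i j. \<Sum>a\<in>A. f a i j"] sm_plus[of "f a" "\<lambda>i j. \<Sum>a\<in>A. f a i j"]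
      by (simp add: Lam_simps(5))
  qed
  then show "(\<lambda>i j. \<Sum>a\<in>A. f a i j) \<in> Ss E" "sm m (\<lambda>i j. \<Sum>a\<in>A. f a i j) = (\<Sum>a\<in>A. sm m (f a))"
    by auto
qed

lemma om_add: "\<gamma> \<in> C0 \<Longrightarrow> om (m + m') \<gamma> = om m \<gamma> + om m' \<gamma>"
  by (simp add: om_def aM_add w12_part)

lemma additive_om: "\<gamma> \<in> C0 \<Longrightarrow> additive (\<lambda>m. om m \<gamma>)"
  by (simp add: additive.intro om_add)

lemma om_plus: "\<gamma> \<in> C0 \<Longrightarrow> \<gamma>' \<in> C0 \<Longrightarrow> om m (dual_add \<gamma> \<gamma>') = om m \<gamma> + om m \<gamma>'"
  by (simp add: om_def w12_add aM_plus w12_part)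

lemma om_left: "s \<in> Ss E \<Longrightarrow> \<gamma> \<in> C0 \<Longrightarrow> om m (dual_l E s \<gamma>) = om (sm m s) \<gamma>"
  by (simp add: om_def sm_def w12_left aM_mult w12_part tS_part)

lemma om_right: "s \<in> Ss E \<Longrightarrow> \<gamma> \<in> C0 \<Longrightarrow> om m (dual_r E \<gamma> s) = sm (om m \<gamma>) s"
  by (simp add: om_def sm_def w12_right aM_mult w12_part tS_part)

lemma comp_at_eq: "comp_at E aM x = range (\<lambda>m. sm m (ei E x))"
  by (simp add: comp_at_def loc_ei sm_def)

lemma lin_comb_eq: "lin_comb E aM x k \<beta> c = (\<Sum>i<k. sm (\<beta> i) (mu x x (c i)))"
  by (simp add: lin_comb_def loc_mu sm_def)

lemma ei_mult_ei:
  assumes "x \<in> Pum E" "y \<in> Pum E"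
  shows "ei E x \<otimes>\<^bsub>\<Lambda>\<^esub> ei E y = (if x = y then ei E x else \<zero>\<^bsub>\<Lambda>\<^esub>)"
  unfolding Ss_mult_left[OF Ss_ei[OF assms(1)]]
  by (auto simp: ei_def mu_def Lam_simps(4) eps_idem assms fun_eq_iff)

lemma comp_at_iff: "x \<in> Pum E \<Longrightarrow> m \<in> comp_at E aM x \<longleftrightarrow> sm m (ei E x) = m"
  unfolding comp_at_eq using sm_mult[OF Ss_ei Ss_ei, of x x] by (auto simp: ei_mult_ei) (metis rangeI)

lemma ei_mult_Ss: "x \<in> Pum E \<Longrightarrow> s \<in> Ss E \<Longrightarrow> ei E x \<otimes>\<^bsub>\<Lambda>\<^esub> s = mu x x (s x x)"
  "x \<in> Pum E \<Longrightarrow> s \<in> Ss E \<Longrightarrow> s \<otimes>\<^bsub>\<Lambda>\<^esub> ei E x = mu x x (s x x)"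
proof -
  assume x: "x \<in> Pum E" and s: "s \<in> Ss E"
  show "ei E x \<otimes>\<^bsub>\<Lambda>\<^esub> s = mu x x (s x x)"
    unfolding Ss_mult_left[OF Ss_ei[OF x]]
    using Rx_unit(1)[OF Ss_Rx[OF s]] Ss_off[OF s] by (auto simp: ei_def mu_def fun_eq_iff)
  show "s \<otimes>\<^bsub>\<Lambda>\<^esub> ei E x = mu x x (s x x)"
    unfolding Ss_mult_right[OF Ss_ei[OF x]]
    using Rx_unit(2)[OF Ss_Rx[OF s]] Ss_off[OF s] by (auto simp: ei_def mu_def fun_eq_iff)
qed

lemma one_decompose: "\<one>\<^bsub>\<Lambda>\<^esub> = (\<lambda>i j. \<Sum>x\<in>Pum E. ei E x i j)"
proof (intro ext)
  fix i j
  have "(\<Sum>x\<in>Pum E. ei E x i j) = (\<Sum>x\<in>Pum E. if x = i then if i = j then eps E i else 0 else 0)"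
    by (intro sum.cong refl) (auto simp: ei_def mu_def)
  also have "\<dots> = \<one>\<^bsub>\<Lambda>\<^esub> i j"
    using finite_Pum by (auto simp: Lam_simps(3))
  finally show "\<one>\<^bsub>\<Lambda>\<^esub> i j = (\<Sum>x\<in>Pum E. ei E x i j)" by simp
qed

lemma comp_decompose: "m = (\<Sum>x\<in>Pum E. sm m (ei E x))"
  using sm_sum(2)[OF finite_Pum Ss_ei, where m = m] sm_one[of m] by (simp add: one_decompose)

end

locale based_mod = dit_mod +
  fixes n :: "'c extp \<Rightarrow> nat" and b :: "'c extp \<Rightarrow> nat \<Rightarrow> 'd"
  assumes basis: "\<And>x. x \<in> Pum E \<Longrightarrow> basis_at E aM x (n x) (b x)"
begin

text \<open>Coordinates of the component of \<open>m\<close> at \<open>x\<close>. They are defined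
  for every \<open>m\<close>, which makes them additive and right \<open>S\<close>-linear on the
  whole module.\<close>

definition co :: "'c extp \<Rightarrow> 'd \<Rightarrow> nat \<Rightarrow> 'b" where
  "co x m = (THE c. c \<in> coeffs_at E x (n x) \<and> sm m (ei E x) = lin_comb E aM x (n x) (b x) c)"

lemma coeffs_iff: "x \<in> Pum E \<Longrightarrow> c \<in> coeffs_at E x k \<longleftrightarrow> (\<forall>i. if i < k then c i \<in> Rx x x else c i = 0)"
  by (simp add: coeffs_at_def Rs_eq_Rx)

lemma co_ex1:
  "x \<in> Pum E \<Longrightarrow> \<exists>!c. c \<in> coeffs_at E x (n x) \<and> sm m (ei E x) = lin_comb E aM x (n x) (b x) c"
  using basis unfolding basis_at_def comp_at_eq by blast

lemma co_spec:
  assumes x: "x \<in> Pum E"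
  shows "co x m i \<in> Rx x x" "n x \<le> i \<Longrightarrow> co x m i = 0"
    "sm m (ei E x) = (\<Sum>i<n x. sm (b x i) (mu x x (co x m i)))"
proof -
  have c: "co x m \<in> coeffs_at E x (n x) \<and> sm m (ei E x) = lin_comb E aM x (n x) (b x) (co x m)"
    unfolding co_def by (rule theI'[OF co_ex1[OF x]])
  then have *: "if i < n x then co x m i \<in> Rx x x else co x m i = 0" for i
    by (simp add: coeffs_iff x)
  from *[of i] show "co x m i \<in> Rx x x" by (cases "i < n x") auto
  from *[of i] show "n x \<le> i \<Longrightarrow> co x m i = 0" by auto
  from c show "sm m (ei E x) = (\<Sum>i<n x. sm (b x i) (mu x x (co x m i)))"
    unfolding lin_comb_eq by blast
qed

lemma co_unique:
  assumes x: "x \<in> Pum E" and c: "\<And>i. i < n x \<Longrightarrow> c i \<in> Rx x x"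
    and eq: "sm m (ei E x) = (\<Sum>i<n x. sm (b x i) (mu x x (c i)))" and i: "i < n x"
  shows "co x m i = c i"
proof -
  have "co x m = (\<lambda>i. if i < n x then c i else 0)"
    unfolding co_def
    by (rule the1_equality[OF co_ex1[OF x]])
      (use c eq in \<open>auto simp: coeffs_iff x lin_comb_eq\<close>)
  then show ?thesis using i by simp
qed

lemma mu_add: "r \<in> Rx x x \<Longrightarrow> s \<in> Rx x x \<Longrightarrow> sm m (mu x x (r + s)) = sm m (mu x x r) + sm m (mu x x s)"
  using sm_plus[OF Ss_mu Ss_mu, of r x s x m]
  by (simp add: Lam_simps(5)) (simp add: mu_def if_distrib if_distribR cong: if_cong)

lemma co_add: assumes x: "x \<in> Pum E" shows "co x (m + m') i = co x m i + co x m' i"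
proof (cases "i < n x")
  case True
  show ?thesis
    by (rule co_unique[OF x _ _ True, where c = "\<lambda>i. co x m i + co x m' i"])
      (simp_all add: co_spec(1) co_spec(3)[OF x, of m] co_spec(3)[OF x, of m'] x Rx_add sm_add Ss_ei
        mu_add sum.distrib)
qed (simp add: co_spec(2) x)

lemma additive_co: "x \<in> Pum E \<Longrightarrow> additive (\<lambda>m. co x m i)"
  by (simp add: additive.intro co_add)

lemma co_sm: assumes x: "x \<in> Pum E" and s: "s \<in> Ss E" shows "co x (sm m s) i = co x m i * s x x"
proof (cases "i < n x")
  case True
  have c: "co x m i * s x x \<in> Rx x x" for i by (rule Rx_mult[OF co_spec(1)[OF x] Ss_Rx[OF s]])
  have "sm (sm m s) (ei E x) = sm (sm m (ei E x)) (mu x x (s x x))"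
  proof -
    note S = Ss_mu[OF Ss_Rx[OF s, of x x]]
    have "sm (sm m s) (ei E x) = sm m (mu x x (s x x))"
      by (simp add: sm_mult[symmetric] Ss_ei x s ei_mult_Ss)
    also have "\<dots> = sm m (ei E x \<otimes>\<^bsub>\<Lambda>\<^esub> mu x x (s x x))"
      unfolding ei_mult_Ss(1)[OF x S] by (simp add: mu_def)
    finally show ?thesis by (simp add: sm_mult Ss_ei x S)
  qed
  also have "\<dots> = (\<Sum>i<n x. sm (sm (b x i) (mu x x (co x m i))) (mu x x (s x x)))"
    unfolding co_spec(3)[OF x, of m] by (rule additive.sum[OF additive_sm[OF Ss_mu[OF Ss_Rx[OF s]]]])
  also have "\<dots> = (\<Sum>i<n x. sm (b x i) (mu x x (co x m i * s x x)))"
    by (intro sum.cong refl) (simp add: sm_mult[symmetric] Ss_mu Ss_Rx s co_spec(1) x mu_Ss_mult)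
  finally show ?thesis by (intro co_unique[OF x c _ True])
qed (simp add: co_spec(2) x)

lemma b_comp: "x \<in> Pum E \<Longrightarrow> i < n x \<Longrightarrow> b x i \<in> comp_at E aM x"
  using basis by (auto simp: basis_at_def)

lemma b_ei: "x \<in> Pum E \<Longrightarrow> i < n x \<Longrightarrow> sm (b x i) (ei E x) = b x i"
  using b_comp comp_at_iff by blast

lemma co_b:
  assumes x: "x \<in> Pum E" and y: "y \<in> Pum E" and j: "j < n y"
  shows "co x (b y j) i = (if x = y \<and> i = j then eps E x else 0)"
proof (cases "i < n x")
  case True
  show ?thesis
  proof (rule co_unique[OF x _ _ True, where c = "\<lambda>i. if x = y \<and> i = j then eps E x else 0"])
    fix i show "(if x = y \<and> i = j then eps E x else 0) \<in> Rx x x" using eps_Rx[OF x] by auto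
  next
    have z: "mu z z 0 = \<zero>\<^bsub>\<Lambda>\<^esub>" for z :: "'c extp" by (simp add: mu_def Lam_simps(4))
    show "sm (b y j) (ei E x) = (\<Sum>i<n x. sm (b x i) (mu x x (if x = y \<and> i = j then eps E x else 0)))"
    proof (cases "x = y")
      case True
      have "(\<Sum>i<n x. sm (b x i) (mu x x (if x = y \<and> i = j then eps E x else 0))) =
          (\<Sum>i<n x. if i = j then sm (b x j) (ei E x) else 0)"
        using True by (intro sum.cong refl) (auto simp: z sm_zero ei_def)
      then show ?thesis using True j by simp
    next
      case False
      have "sm (b y j) (ei E x) = sm (sm (b y j) (ei E y)) (ei E x)" using b_ei[OF y j] by simp
      also have "\<dots> = 0" using False by (simp add: sm_mult[symmetric] Ss_ei x y ei_mult_ei sm_zero)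
      finally show ?thesis using False by (simp add: z sm_zero)
    qed
  qed
qed (use j in \<open>auto simp: co_spec(2) x\<close>)

lemma co_b_sm:
  assumes "x \<in> Pum E" "y \<in> Pum E" "j < n y" "s \<in> Ss E"
  shows "co x (sm (b y j) s) i = (if x = y \<and> i = j then s y y else 0)"
  using assms Rx_unit(1)[OF Ss_Rx[OF assms(4), of x x]] by (auto simp: co_sm co_b)

lemma decompose: "m = (\<Sum>x\<in>Pum E. \<Sum>i<n x. sm (b x i) (mu x x (co x m i)))"
  using comp_decompose[of m] by (simp add: co_spec(3) cong: sum.cong)

lemma co_eqI: assumes "\<And>x i. x \<in> Pum E \<Longrightarrow> i < n x \<Longrightarrow> co x m i = co x m' i" shows "m = m'"
proof -
  have "(\<Sum>x\<in>Pum E. \<Sum>i<n x. sm (b x i) (mu x x (co x m i))) =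
      (\<Sum>x\<in>Pum E. \<Sum>i<n x. sm (b x i) (mu x x (co x m' i)))"
    by (intro sum.cong refl) (simp add: assms)
  then show ?thesis using decompose[of m] decompose[of m'] by simp
qed

lemma co_sum_sum:
  assumes x: "x \<in> Pum E" and Y: "Y \<subseteq> Pum E" and s: "\<And>y j. y \<in> Y \<Longrightarrow> j < n y \<Longrightarrow> s y j \<in> Ss E" and i: "i < n x"
  shows "co x (\<Sum>y\<in>Y. \<Sum>j<n y. sm (b y j) (s y j)) i = (if x \<in> Y then s x i x x else 0)"
proof -
  have "finite Y" using Y finite_Pum finite_subset by blast
  have "co x (\<Sum>y\<in>Y. \<Sum>j<n y. sm (b y j) (s y j)) i = (\<Sum>y\<in>Y. \<Sum>j<n y. co x (sm (b y j) (s y j)) i)"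
    by (simp add: additive.sum[OF additive_co[OF x]])
  also have "\<dots> = (\<Sum>y\<in>Y. if y = x then (\<Sum>j<n y. if j = i then s x i x x else 0) else 0)"
    using Y s x by (intro sum.cong refl) (auto simp: co_b_sm subset_iff intro!: sum.cong sum.neutral)
  also have "\<dots> = (if x \<in> Y then s x i x x else 0)"
    using \<open>finite Y\<close> i by (simp add: sum.delta)
  finally show ?thesis .
qed

section \<open>Rows in \<open>J\<close> and the matrix of a module\<close>

text \<open>Line \<open>j\<close> of block row \<open>y\<close> of a matrix, applied to the
  coordinates of \<open>m\<close> but kept apart by columns: this is the element of \<open>J\<close>
  to which forms are applied. The diagonal block is left out, being the business of f^0.\<close>

definition row :: "('c extp \<Rightarrow> nat \<Rightarrow> 'c extp \<Rightarrow> nat \<Rightarrow> 'b) \<Rightarrow> 'c extp \<Rightarrow> nat \<Rightarrow> 'd \<Rightarrow> ('b, 'c) lam" where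
  "row F y j m = (\<lambda>a x. if a = y \<and> x \<in> Pm E \<and> y < x then \<Sum>i<n x. F y j x i * co x m i else 0)"

lemma row_Js: "(\<And>x i. F y j x i \<in> Rx y x) \<Longrightarrow> row F y j m \<in> Js E"
  by (auto simp: Js_iff row_def Pm_Pum intro!: Rx_sum Rx_mult co_spec(1))

lemma row_add: "row F y j (m + m') = row F y j m \<oplus>\<^bsub>\<Lambda>\<^esub> row F y j m'"
  by (auto simp: row_def Lam_simps(5) fun_eq_iff co_add Pm_Pum distrib_left sum.distrib)

lemma row_sm: "s \<in> Ss E \<Longrightarrow> row F y j (sm m s) = row F y j m \<otimes>\<^bsub>\<Lambda>\<^esub> s"
  by (auto simp: row_def Ss_mult_right fun_eq_iff co_sm Pm_Pum sum_distrib_right mult.assoc)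

lemma row_supp: "row F y j m a x \<noteq> 0 \<Longrightarrow> a = y"
  by (auto simp: row_def split: if_splits)

text \<open>The matrix over \<open>A\<close> named in the overview: the stripe multiplied by
  v_{0,x}. Being 0 outside the index ranges, it has entries in \<open>Rx Zero x\<close> for all
  indices.\<close>

definition Mt :: "nat \<Rightarrow> 'c extp \<Rightarrow> nat \<Rightarrow> 'b" where
  "Mt k x i = (if x \<in> Pm E \<and> i < n x \<and> k < n Zero then co Zero (om (b x i) (uh x)) k * v x else 0)"

lemma Mt_Rx: "Mt k x i \<in> Rx Zero x"
  by (auto simp: Mt_def intro!: Rx_mult[OF co_spec(1)] Zero_Pum v_Rx)

lemma om_uh:
  assumes x: "x \<in> Pm E" shows "om m (uh x) = sm (om m (uh x)) (ei E Zero)"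
proof -
  have "dual_r E (uh x) (ei E Zero) = uh x"
  proof
    fix u
    have "ei E Zero Zero Zero = eps E Zero" by (simp add: ei_def mu_def)
    then show "dual_r E (uh x) (ei E Zero) u = uh x u"
      using Rx_unit(2)[OF Ss_Rx[OF Jdual_Ss[OF C0_Jdual[OF uh_C0[OF x]]]], of u Zero Zero]
      C0_value[OF uh_C0[OF x], of u] mu_mult_right[OF Ss_ei[OF Zero_Pum], of Zero Zero "uh x u Zero Zero"]
      unfolding dual_r_def by simp
  qed
  then show ?thesis using om_right[OF Ss_ei[OF Zero_Pum] uh_C0[OF x], of m] by simp
qed

text \<open>On a basis vector of M_x the form may be cut down to its part at \<open>x\<close>, which
  is a right multiple of \<open>uh x\<close> by \<open>dual_l_ei\<close>.\<close>

lemma om_b: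
  assumes x: "x \<in> Pm E" and i: "i < n x" and \<gamma>: "\<gamma> \<in> C0"
  shows "om (b x i) \<gamma> = (\<Sum>k<n Zero. sm (b Zero k) (\<gamma> (mu Zero x (Mt k x i))))"
proof -
  note S = Jdual_Ss[OF C0_Jdual[OF \<gamma>], of "mu Zero x (v x)"]
  have "om (b x i) \<gamma> = om (b x i) (dual_l E (ei E x) \<gamma>)"
    using om_left[OF Ss_ei \<gamma>, of x "b x i"] b_ei[OF Pm_Pum[OF x] i] Pm_Pum[OF x] by simp
  also have "\<dots> = sm (om (b x i) (uh x)) (\<gamma> (mu Zero x (v x)))"
    by (simp add: dual_l_ei x \<gamma> om_right S uh_C0)
  also have "om (b x i) (uh x) = sm (om (b x i) (uh x)) (ei E Zero)" by (rule om_uh[OF x])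
  also have "sm \<dots> (\<gamma> (mu Zero x (v x))) =
      (\<Sum>k<n Zero. sm (sm (b Zero k) (mu Zero Zero (co Zero (om (b x i) (uh x)) k))) (\<gamma> (mu Zero x (v x))))"
    unfolding co_spec(3)[OF Zero_Pum] by (rule additive.sum[OF additive_sm[OF S]])
  also have "\<dots> = (\<Sum>k<n Zero. sm (b Zero k) (\<gamma> (mu Zero x (Mt k x i))))"
  proof (intro sum.cong refl)
    fix k assume k: "k \<in> {..<n Zero}"
    have c: "co Zero (om (b x i) (uh x)) k \<in> Rx Zero Zero" by (rule co_spec(1)[OF Zero_Pum])
    have "\<gamma> (mu Zero x (Mt k x i)) =
        mu Zero Zero (co Zero (om (b x i) (uh x)) k) \<otimes>\<^bsub>\<Lambda>\<^esub> \<gamma> (mu Zero x (v x))"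
      using Jdual_left[OF C0_Jdual[OF \<gamma>] Ss_mu[OF c] Zero_Js[OF x v_Rx[OF x]]] x i k
      by (simp add: mu_Ss_mult c Mt_def)
    then show "sm (sm (b Zero k) (mu Zero Zero (co Zero (om (b x i) (uh x)) k))) (\<gamma> (mu Zero x (v x))) =
        sm (b Zero k) (\<gamma> (mu Zero x (Mt k x i)))"
      by (simp add: sm_mult Ss_mu c S)
  qed
  finally show ?thesis .
qed

text \<open>The matrix determines the action of W_0: row \<open>Zero\<close> is applied to
  \<open>m\<close>, and \<open>\<gamma>\<close> turns it into coefficients for the basis of
  M_0.\<close>

lemma om_eq:
  assumes \<gamma>: "\<gamma> \<in> C0"
  shows "om m \<gamma> = (\<Sum>k<n Zero. sm (b Zero k) (\<gamma> (row (\<lambda>_. Mt) Zero k m)))"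
proof -
  have J: "mu Zero x (Mt k x i * co x m i) \<in> Js E" if "x \<in> Pm E" for x i k
    by (rule Zero_Js[OF that Rx_mult[OF Mt_Rx co_spec(1)[OF Pm_Pum[OF that]]]])
  have row: "row (\<lambda>_. Mt) Zero k m = (\<lambda>a y. \<Sum>z\<in>Sigma (Pm E) (\<lambda>x. {..<n x}). mu Zero (fst z) (Mt k (fst z) (snd z) * co (fst z) m (snd z)) a y)" for k
  proof (intro ext)
    fix a y
    have "(\<Sum>z\<in>Sigma (Pm E) (\<lambda>x. {..<n x}). mu Zero (fst z) (Mt k (fst z) (snd z) * co (fst z) m (snd z)) a y) =
        (\<Sum>x\<in>Pm E. \<Sum>i<n x. mu Zero x (Mt k x i * co x m i) a y)"
      using finite_Pm by (simp add: sum.Sigma split_beta)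
    also have "\<dots> = (\<Sum>x\<in>Pm E. if x = y then (if a = Zero then \<Sum>i<n y. Mt k y i * co y m i else 0) else 0)"
      by (intro sum.cong refl) (auto simp: mu_def)
    also have "\<dots> = row (\<lambda>_. Mt) Zero k m a y"
      using finite_Pm by (auto simp: row_def)
    finally show "row (\<lambda>_. Mt) Zero k m a y = (\<Sum>z\<in>Sigma (Pm E) (\<lambda>x. {..<n x}). mu Zero (fst z) (Mt k (fst z) (snd z) * co (fst z) m (snd z)) a y)" by simp
  qed
  \<comment> \<open>Forms annihilate M_0, because \<open>J\<close> has nothing in column
    \<open>Zero\<close>; this removes \<open>Zero\<close> from the sum over components.\<close>
  have om0: "om (sm m' (mu Zero Zero r)) \<gamma> = 0" if r: "r \<in> Rx Zero Zero" for m' r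
  proof -
    have "dual_l E (mu Zero Zero r) \<gamma> = dual_zero"
    proof
      fix u
      have "u \<otimes>\<^bsub>\<Lambda>\<^esub> mu Zero Zero r = \<zero>\<^bsub>\<Lambda>\<^esub>" if "u \<in> Js E"
        using Js_eq_0[OF that, of _ Zero] unfolding Ss_mult_right[OF Ss_mu[OF r]]
        by (auto simp: mu_def Lam_simps(4) fun_eq_iff)
      then show "dual_l E (mu Zero Zero r) \<gamma> u = dual_zero u"
        using Jdual_zero[OF C0_Jdual[OF \<gamma>]] by (simp add: dual_l_def dual_zero_def Lam_simps(4))
    qed
    then have "om (sm m' (mu Zero Zero r)) \<gamma> = om m' dual_zero" using om_left[OF Ss_mu[OF r] \<gamma>, of m'] by simp
    also have "\<dots> = 0" using om_plus[OF C0_zero C0_zero, of m'] by (simp add: dual_add_zero)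
    finally show ?thesis .
  qed
  have "om m \<gamma> = (\<Sum>x\<in>Pum E. \<Sum>i<n x. om (sm (b x i) (mu x x (co x m i))) \<gamma>)"
    by (subst decompose[of m]) (simp add: additive.sum[OF additive_om[OF \<gamma>]])
  also have "\<dots> = (\<Sum>x\<in>Pm E. \<Sum>i<n x. om (sm (b x i) (mu x x (co x m i))) \<gamma>)"
    unfolding Pum_def using finite_Pm by (simp add: om0 co_spec(1) Zero_Pum)
  also have "\<dots> = (\<Sum>x\<in>Pm E. \<Sum>i<n x. \<Sum>k<n Zero. sm (b Zero k) (\<gamma> (mu Zero x (Mt k x i * co x m i))))"
  proof (intro sum.cong refl)
    fix x i assume x: "x \<in> Pm E" and i: "i \<in> {..<n x}"
    note c = co_spec(1)[OF Pm_Pum[OF x], of m i]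
    have "om (sm (b x i) (mu x x (co x m i))) \<gamma> = om (b x i) (dual_l E (mu x x (co x m i)) \<gamma>)"
      using om_left[OF Ss_mu[OF c] \<gamma>] by simp
    also have "\<dots> = (\<Sum>k<n Zero. sm (b Zero k) (\<gamma> (mu Zero x (Mt k x i * co x m i))))"
      using i Zero_Js[OF x Mt_Rx]
      by (simp add: om_b x C0_dual_l \<gamma> Ss_mu c dual_l_apply mu_mult_Ss)
    finally show "om (sm (b x i) (mu x x (co x m i))) \<gamma> = (\<Sum>k<n Zero. sm (b Zero k) (\<gamma> (mu Zero x (Mt k x i * co x m i))))" .
  qed
  also have "\<dots> = (\<Sum>z\<in>Sigma (Pm E) (\<lambda>x. {..<n x}). \<Sum>k<n Zero. sm (b Zero k) (\<gamma> (mu Zero (fst z) (Mt k (fst z) (snd z) * co (fst z) m (snd z)))))"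
    by (rule trans[OF sum.Sigma]) (use finite_Pm in \<open>auto simp: split_beta\<close>)
  also have "\<dots> = (\<Sum>k<n Zero. \<Sum>z\<in>Sigma (Pm E) (\<lambda>x. {..<n x}). sm (b Zero k) (\<gamma> (mu Zero (fst z) (Mt k (fst z) (snd z) * co (fst z) m (snd z)))))"
    by (rule sum.swap)
  also have "\<dots> = (\<Sum>k<n Zero. sm (b Zero k) (\<gamma> (row (\<lambda>_. Mt) Zero k m)))"
  proof (rule sum.cong[OF refl])
    fix k
    have fin: "finite (Sigma (Pm E) (\<lambda>x. {..<n x}))" using finite_Pm by simp
    have J': "mu Zero (fst z) (Mt k (fst z) (snd z) * co (fst z) m (snd z)) \<in> Js E"
      if "z \<in> Sigma (Pm E) (\<lambda>x. {..<n x})" for z using that J by auto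
    define f where "f z = (mu Zero (fst z) (Mt k (fst z) (snd z) * co (fst z) m (snd z)) :: ('b, 'c) lam)" for z
    have "(\<Sum>z\<in>Sigma (Pm E) (\<lambda>x. {..<n x}). sm (b Zero k) (\<gamma> (f z))) =
        sm (b Zero k) (\<lambda>i j. \<Sum>z\<in>Sigma (Pm E) (\<lambda>x. {..<n x}). \<gamma> (f z) i j)"
      by (rule sm_sum(2)[where f = "\<lambda>z. \<gamma> (f z)", OF fin Jdual_Ss[OF C0_Jdual[OF \<gamma>]], symmetric])
    also have "(\<lambda>i j. \<Sum>z\<in>Sigma (Pm E) (\<lambda>x. {..<n x}). \<gamma> (f z) i j) = \<gamma> (row (\<lambda>_. Mt) Zero k m)"
      unfolding row f_def[symmetric]
      by (rule Jdual_finsum(2)[where f = f, OF C0_Jdual[OF \<gamma>] fin, symmetric]) (use J' f_def in simp)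
    finally show "(\<Sum>z\<in>Sigma (Pm E) (\<lambda>x. {..<n x}). sm (b Zero k) (\<gamma> (mu Zero (fst z) (Mt k (fst z) (snd z) * co (fst z) m (snd z))))) =
        sm (b Zero k) (\<gamma> (row (\<lambda>_. Mt) Zero k m))"
      unfolding f_def .
  qed
  finally show ?thesis .
qed

end

section \<open>Morphisms and their composition\<close>

context line_datum
begin

text \<open>What is left of f^1 after restriction to the letters w_1 \<open>\<delta>\<close>. These
  generate T_1 as a T_0-bimodule, so no information is lost.\<close>

definition bimod_map where
  "bimod_map aM aN f \<longleftrightarrow> (\<forall>\<delta>\<in>Ch. additive (f \<delta>) \<and>
     (\<forall>\<delta>'\<in>Ch. \<forall>m. f (dual_add \<delta> \<delta>') m = f \<delta> m + f \<delta>' m) \<and>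
     (\<forall>s\<in>Ss E. \<forall>m. f (dual_l E s \<delta>) m = f \<delta> (aM m (tS s)) \<and> f (dual_r E \<delta> s) m = aN (f \<delta> m) (tS s)))"

text \<open>Scalars are central in \<open>\<Lambda>\<close>, hence commute with every letter and
  every word. This yields the \<open>K\<close>-linearity required of f^1.\<close>

lemma scalar_commute:
  assumes "t \<in> T.Tpart n"
  shows "tS (k \<odot>\<^bsub>\<Lambda>\<^esub> \<one>\<^bsub>\<Lambda>\<^esub>) \<otimes>\<^bsub>Te E\<^esub> t = t \<otimes>\<^bsub>Te E\<^esub> tS (k \<odot>\<^bsub>\<Lambda>\<^esub> \<one>\<^bsub>\<Lambda>\<^esub>)"
proof -
  define \<kappa> where "\<kappa> = k \<odot>\<^bsub>\<Lambda>\<^esub> \<one>\<^bsub>\<Lambda>\<^esub>"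
  have \<kappa>: "\<kappa> \<in> Ss E" by (simp add: \<kappa>_def Ss_smult Ss_one)
  note c = T.Tpart_carrier[OF tS_part[OF \<kappa>]]
  have com: "\<kappa> \<otimes>\<^bsub>\<Lambda>\<^esub> u = u \<otimes>\<^bsub>\<Lambda>\<^esub> \<kappa>" if u: "u \<in> carrier \<Lambda>" for u
  proof (intro ext)
    fix i j
    have uR: "u i j \<in> Rx i j" using u by (simp add: Lam_simps)
    have "scl E k (eps E i) * u i j = u i j * scl E k (eps E j)"
      using Rx_unit[OF uR] by (simp add: scl_mult[symmetric])
    then show "(\<kappa> \<otimes>\<^bsub>\<Lambda>\<^esub> u) i j = (u \<otimes>\<^bsub>\<Lambda>\<^esub> \<kappa>) i j"
      using Rx_eq_0[OF uR] unfolding Ss_mult_left[OF \<kappa>] Ss_mult_right[OF \<kappa>] by (auto simp: \<kappa>_def Lam_simps)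
  qed
  \<comment> \<open>On \<open>J\<close> the scalar passes from the right of the argument to its
    left, and out of the form by left linearity.\<close>
  have lr: "dual_l E \<kappa> \<gamma> = dual_r E \<gamma> \<kappa>" if \<gamma>: "\<gamma> \<in> Jdual E" for \<gamma>
  proof
    fix u
    show "dual_l E \<kappa> \<gamma> u = dual_r E \<gamma> \<kappa> u"
      using com[OF Js_carrier, of u] com[OF Ss_carrier[OF Jdual_Ss[OF \<gamma>]], of u] Jdual_left[OF \<gamma> \<kappa>, of u]
        Jdual_outside[OF \<gamma>, of u]
      by (cases "u \<in> Js E") (auto simp: dual_l_def dual_r_def Lam_simps(2,4))
  qed
  have letter: "tS \<kappa> \<otimes>\<^bsub>Te E\<^esub> T.cls (word [l]) = T.cls (word [l]) \<otimes>\<^bsub>Te E\<^esub> tS \<kappa>"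
    if "l \<in> tensor_letters (Re E) (We E)" "letter_degree l i" for l i
    using that
  proof (cases rule: letter_cases)
    case (base s)
    then show ?thesis using tS_mult[OF \<kappa>, of s] tS_mult[OF _ \<kappa>, of s] com[OF Ss_carrier, of s] by simp
  next
    case (w12 \<gamma>)
    then show ?thesis
      using w12_left[OF \<kappa>, of \<gamma>] w12_right[OF \<kappa>, of \<gamma>] lr[OF C0_Jdual, of \<gamma>] by simp
  next
    case (w1 \<delta>)
    then show ?thesis
      using w1_left[OF \<kappa>, of \<delta>] w1_right[OF \<kappa>, of \<delta>] lr[OF Ch_Jdual, of \<delta>] by simp
  qed
  have "tS \<kappa> \<otimes>\<^bsub>Te E\<^esub> t = t \<otimes>\<^bsub>Te E\<^esub> tS \<kappa>"
    using assms
  proof (induction rule: T.Tpart_induct)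
    case (add s t)
    then show ?case using c T.Tpart_carrier[of s n] T.Tpart_carrier[of t n]
      by (simp add: T.TR.l_distr T.TR.r_distr)
  next
    case (uminus s)
    then show ?case using c T.Tpart_carrier[of s n] by (simp add: T.TR.l_minus T.TR.r_minus)
  next
    case (word w)
    then show ?case
    proof (induction w arbitrary: n)
      case Nil
      then show ?case using c by (simp add: T.cls_one)
    next
      case (Cons l w)
      then obtain i m where l: "l \<in> tensor_letters (Re E) (We E)" "letter_degree l i"
        and w: "w \<in> lists (tensor_letters (Re E) (We E))" "word_degree letter_degree w m" by auto
      have "T.cls (word (l # w)) = T.cls (word [l]) \<otimes>\<^bsub>Te E\<^esub> T.cls (word w)"
        using T.cls_append[of "[l]" w] l w by simp
      moreover have "T.cls (word [l]) \<in> carrier (Te E)" "T.cls (word w) \<in> carrier (Te E)"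
        using l w T.Tpart_carrier[OF T.Tpart_word[OF w]] T.letter_closed by auto
      moreover have "tS \<kappa> \<otimes>\<^bsub>Te E\<^esub> T.cls (word w) = T.cls (word w) \<otimes>\<^bsub>Te E\<^esub> tS \<kappa>"
        using Cons.IH w by blast
      ultimately show ?case
        using letter[OF l] c by (metis T.TR.m_assoc)
    qed
  qed (use c in simp)
  then show ?thesis by (simp add: \<kappa>_def)
qed

text \<open>A word of degree 2 is cut after its first letter of degree 1; the letters of degree 0
  before it are absorbed into the left factor. This makes the choice in \<open>tensor_terms\<close>
  a choice from a non-empty set.\<close>

lemma Tpart2_decompose:
  assumes "t \<in> T.Tpart 2"
  shows "\<exists>vs. set vs \<subseteq> T.Tpart 1 \<times> T.Tpart 1 \<and>
    t = foldr (\<lambda>(v', v'') s. (v' \<otimes>\<^bsub>Te E\<^esub> v'') \<oplus>\<^bsub>Te E\<^esub> s) vs \<zero>\<^bsub>Te E\<^esub>"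
proof -
  define S where "S vs = foldr (\<lambda>(v', v'') s. (v' \<otimes>\<^bsub>Te E\<^esub> v'') \<oplus>\<^bsub>Te E\<^esub> s) vs \<zero>\<^bsub>Te E\<^esub>" for vs
  define ok where "ok vs \<longleftrightarrow> set vs \<subseteq> T.Tpart 1 \<times> T.Tpart 1" for vs
  have S_simps: "S [] = \<zero>\<^bsub>Te E\<^esub>" "S ((v', v'') # vs) = (v' \<otimes>\<^bsub>Te E\<^esub> v'') \<oplus>\<^bsub>Te E\<^esub> S vs" for v' v'' vs
    by (simp_all add: S_def)
  have closed: "S vs \<in> carrier (Te E)" if "ok vs" for vs
    using that
  proof (induction vs)
    case (Cons p vs)
    then show ?case
      using T.Tpart_carrier[of "fst p" 1] T.Tpart_carrier[of "snd p" 1]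
      by (cases p) (auto simp: S_simps ok_def)
  qed (simp add: S_simps)
  have append: "S (us @ vs) = S us \<oplus>\<^bsub>Te E\<^esub> S vs" if "ok us" "ok vs" for us vs
    using that(1)
  proof (induction us)
    case Nil
    then show ?case using closed[OF that(2)] by (simp add: S_simps)
  next
    case (Cons p us)
    then show ?case
      using closed[OF that(2)] closed[of us] T.Tpart_carrier[of "fst p" 1] T.Tpart_carrier[of "snd p" 1]
      by (cases p) (auto simp: S_simps ok_def T.TR.a_assoc)
  qed
  have minus: "S (map (\<lambda>(v', v''). (\<ominus>\<^bsub>Te E\<^esub> v', v'')) vs) = \<ominus>\<^bsub>Te E\<^esub> S vs" if "ok vs" for vs
    using that
  proof (induction vs)
    case (Cons p vs)
    then show ?case
      using closed[of vs] T.Tpart_carrier[of "fst p" 1] T.Tpart_carrier[of "snd p" 1]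
      by (cases p) (auto simp: S_simps ok_def T.TR.minus_add T.TR.l_minus)
  qed (simp add: S_simps)
  have left: "S (map (\<lambda>(v', v''). (a \<otimes>\<^bsub>Te E\<^esub> v', v'')) vs) = a \<otimes>\<^bsub>Te E\<^esub> S vs"
    if "ok vs" "a \<in> carrier (Te E)" for a vs
    using that
  proof (induction vs)
    case (Cons p vs)
    then show ?case
      using closed[of vs] T.Tpart_carrier[of "fst p" 1] T.Tpart_carrier[of "snd p" 1]
      by (cases p) (auto simp: S_simps ok_def T.TR.r_distr T.TR.m_assoc)
  qed (simp add: S_simps)
  have "\<exists>vs. ok vs \<and> t = S vs"
    using assms
  proof (induction rule: T.Tpart_induct)
    case zero
    then show ?case using S_simps(1) by (intro exI[of _ "[]"]) (simp add: ok_def)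
  next
    case (add s t)
    then obtain us vs where "ok us" "s = S us" "ok vs" "t = S vs" by blast
    then show ?case by (intro exI[of _ "us @ vs"]) (auto simp: append, auto simp: ok_def)
  next
    case (uminus s)
    then obtain vs where "ok vs" "s = S vs" by blast
    then show ?case
      by (intro exI[of _ "map (\<lambda>(v', v''). (\<ominus>\<^bsub>Te E\<^esub> v', v'')) vs"])
        (auto simp: minus, auto simp: ok_def intro!: T.Tpart_uminus)
  next
    case (word w)
    then show ?case
    proof (induction w)
      case (Cons l w)
      then obtain i m where l: "l \<in> tensor_letters (Re E) (We E)" "letter_degree l i" and im: "2 = i + m"
        and w: "w \<in> lists (tensor_letters (Re E) (We E))" "word_degree letter_degree w m" by auto
      have lw: "T.cls (word (l # w)) = T.cls (word [l]) \<otimes>\<^bsub>Te E\<^esub> T.cls (word w)"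
        using T.cls_append[of "[l]" w] l w by simp
      have i: "i = 0 \<or> i = 1" using l by (cases rule: letter_cases) auto
      show ?case
      proof (cases "i = 0")
        case True
        then obtain vs where vs: "ok vs" "T.cls (word w) = S vs" using Cons.IH w im by auto
        have a: "T.cls (word [l]) \<in> T.Tpart 0" using T.Tpart_letter[of l] l True by simp
        have "ok (map (\<lambda>(v', v''). (T.cls (word [l]) \<otimes>\<^bsub>Te E\<^esub> v', v'')) vs)"
          using vs(1) T.Tpart_mult[OF a, of _ 1] by (auto simp: ok_def)
        then show ?thesis
          using left[OF vs(1) T.Tpart_carrier[OF a]] vs(2) lw by metis
      next
        case False
        then have "T.cls (word [l]) \<in> T.Tpart 1" "T.cls (word w) \<in> T.Tpart 1"
          using i im l w T.Tpart_letter[of l] T.Tpart_word[OF w] by auto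
        then show ?thesis
          using lw T.Tpart_carrier
          by (intro exI[of _ "[(T.cls (word [l]), T.cls (word w))]"]) (auto simp: S_simps ok_def)
      qed
    qed simp
  qed
  then show ?thesis by (simp add: S_def ok_def)
qed

end

section \<open>Extending bimodule maps from the letters to T_1 and T_2\<close>

locale triple = line_datum E B gam d v +
  M: dit_mod E B gam d v aM + N: dit_mod E B gam d v aN + L: dit_mod E B gam d v aL
  for E :: "('k::field, 'a::ring_1, 'p::order) poset_datum"
    and B gam d v
    and aM :: "'m::ab_group_add \<Rightarrow> ('a, 'p) te \<Rightarrow> 'm"
    and aN :: "'n::ab_group_add \<Rightarrow> ('a, 'p) te \<Rightarrow> 'n"
    and aL :: "'l::ab_group_add \<Rightarrow> ('a, 'p) te \<Rightarrow> 'l" +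
  fixes f :: "('a, 'p) dual \<Rightarrow> 'm \<Rightarrow> 'n" and g :: "('a, 'p) dual \<Rightarrow> 'n \<Rightarrow> 'l"
  assumes f: "bimod_map aM aN f" and g: "bimod_map aN aL g"
begin

text \<open>The tensor ring acts on the sum of three modules: degree-0 letters act diagonally, while
  degree-1 letters map the first summand to the second and the second to the third. Reading off
  components extends bimodule maps from the letters to \<open>T\<^sub>1\<close> and gives meaning to their
  composite on \<open>T\<^sub>2\<close>, without a normal form for elements of the tensor ring.\<close>

definition \<beta> :: "('a, 'p) re + ('a, 'p) we \<Rightarrow> 'm \<times> 'n \<times> 'l \<Rightarrow> 'm \<times> 'n \<times> 'l" where
  "\<beta> = (\<lambda>l (m, n, k). if l \<notin> tensor_letters (Re E) (We E) then 0 else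
     (case l of Inl r \<Rightarrow> (aM m (tR E r), aN n (tR E r), aL k (tR E r))
      | Inr (\<gamma>, \<delta>) \<Rightarrow> (M.om m \<gamma>, N.om n \<gamma> + f \<delta> m, L.om k \<gamma> + g \<delta> n)))"

lemma \<beta>_base: "s \<in> Ss E \<Longrightarrow> \<beta> (Inl (re_of s)) (m, n, k) = (M.sm m s, N.sm n s, L.sm k s)"
  by (simp add: \<beta>_def re_of_carrier tS_def[symmetric] M.sm_def N.sm_def L.sm_def)

lemma \<beta>_W: "\<gamma> \<in> C0 \<Longrightarrow> \<delta> \<in> Ch \<Longrightarrow>
    \<beta> (Inr (\<gamma>, \<delta>)) (m, n, k) = (M.om m \<gamma>, N.om n \<gamma> + f \<delta> m, L.om k \<gamma> + g \<delta> n)"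
  by (simp add: \<beta>_def We_simps)

lemma f_simps:
  assumes "\<delta> \<in> Ch"
  shows "additive (f \<delta>)" "\<delta>' \<in> Ch \<Longrightarrow> f (dual_add \<delta> \<delta>') m = f \<delta> m + f \<delta>' m"
    "s \<in> Ss E \<Longrightarrow> f (dual_l E s \<delta>) m = f \<delta> (M.sm m s)"
    "s \<in> Ss E \<Longrightarrow> f (dual_r E \<delta> s) m = N.sm (f \<delta> m) s"
  using f assms by (auto simp: bimod_map_def M.sm_def N.sm_def)

lemma g_simps:
  assumes "\<delta> \<in> Ch"
  shows "additive (g \<delta>)" "\<delta>' \<in> Ch \<Longrightarrow> g (dual_add \<delta> \<delta>') m = g \<delta> m + g \<delta>' m"
    "s \<in> Ss E \<Longrightarrow> g (dual_l E s \<delta>) m = g \<delta> (N.sm m s)"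
    "s \<in> Ss E \<Longrightarrow> g (dual_r E \<delta> s) m = L.sm (g \<delta> m) s"
  using g assms by (auto simp: bimod_map_def L.sm_def N.sm_def)

lemma additive_\<beta>: "additive (\<beta> l)"
proof (rule additive.intro)
  fix x y :: "'m \<times> 'n \<times> 'l"
  obtain m n k m' n' k' where xy: "x = (m, n, k)" "y = (m', n', k')" by (cases x; cases y) auto
  show "\<beta> l (x + y) = \<beta> l x + \<beta> l y"
  proof (cases "l \<in> tensor_letters (Re E) (We E)")
    case True
    show ?thesis
    proof (cases l)
      case (Inl r)
      then obtain s where "s \<in> Ss E" "l = Inl (re_of s)" using True by (auto simp: carrier_Re)
      then show ?thesis by (simp add: xy \<beta>_base M.sm_add N.sm_add L.sm_add)
    next
      case (Inr w)
      then obtain \<gamma> \<delta> where "\<gamma> \<in> C0" "\<delta> \<in> Ch" "l = Inr (\<gamma>, \<delta>)" using True by (auto simp: We_simps)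
      then show ?thesis
        using additive.add[OF f_simps(1)] additive.add[OF g_simps(1)]
        by (simp add: xy \<beta>_W M.om_add N.om_add L.om_add)
    qed
  qed (simp add: xy \<beta>_def)
qed

lemma tensor_module_\<beta>: "tensor_module (Re E) (We E) \<beta>"
proof (intro tensor_module.intro tensor_datum_Te tensor_module_axioms.intro additive_\<beta>)
  fix x :: "'m \<times> 'n \<times> 'l"
  obtain m n k where x: "x = (m, n, k)" by (cases x) auto
  show "\<beta> (Inl \<one>\<^bsub>Re E\<^esub>) x = x"
    by (simp add: x re_of_one \<beta>_base Ss_one M.sm_one N.sm_one L.sm_one)
  fix r s assume rs: "r \<in> carrier (Re E)" "s \<in> carrier (Re E)"
  then obtain r' s' where rs': "r' \<in> Ss E" "r = re_of r'" "s' \<in> Ss E" "s = re_of s'"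
    by (auto simp: carrier_Re)
  show "\<beta> (Inl (r \<otimes>\<^bsub>Re E\<^esub> s)) x = \<beta> (Inl s) (\<beta> (Inl r) x)"
    using rs' by (simp add: x re_of_mult \<beta>_base Ss_mult M.sm_mult N.sm_mult L.sm_mult)
  show "\<beta> (Inl (r \<oplus>\<^bsub>Re E\<^esub> s)) x = \<beta> (Inl r) x + \<beta> (Inl s) x"
    using rs' by (simp add: x re_of_add \<beta>_base Ss_add M.sm_plus N.sm_plus L.sm_plus)
next
  fix w w' and x :: "'m \<times> 'n \<times> 'l"
  assume w: "w \<in> bcarrier (We E)" "w' \<in> bcarrier (We E)"
  then obtain \<gamma> \<delta> \<gamma>' \<delta>' where w': "w = (\<gamma>, \<delta>)" "w' = (\<gamma>', \<delta>')" "\<gamma> \<in> C0" "\<delta> \<in> Ch" "\<gamma>' \<in> C0" "\<delta>' \<in> Ch"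
    by (auto simp: We_simps)
  obtain m n k where x: "x = (m, n, k)" by (cases x) auto
  show "\<beta> (Inr (badd (We E) w w')) x = \<beta> (Inr w) x + \<beta> (Inr w') x"
    using w' by (simp add: x We_simps \<beta>_W C0_add Ch_add f_simps(2) g_simps(2) M.om_plus N.om_plus L.om_plus)
next
  fix r w and x :: "'m \<times> 'n \<times> 'l"
  assume "r \<in> carrier (Re E)" "w \<in> bcarrier (We E)"
  then obtain s \<gamma> \<delta> where w: "s \<in> Ss E" "r = re_of s" "w = (\<gamma>, \<delta>)" "\<gamma> \<in> C0" "\<delta> \<in> Ch"
    by (auto simp: We_simps carrier_Re)
  obtain m n k where x: "x = (m, n, k)" by (cases x) auto
  show "\<beta> (Inr (bleft (We E) r w)) x = \<beta> (Inr w) (\<beta> (Inl r) x)"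
    using w by (simp add: x We_left \<beta>_W \<beta>_base C0_dual_l Ch_dual_l f_simps(3) g_simps(3) M.om_left N.om_left L.om_left)
  show "\<beta> (Inr (bright (We E) w r)) x = \<beta> (Inl r) (\<beta> (Inr w) x)"
    using w by (simp add: x We_right \<beta>_W \<beta>_base C0_dual_r Ch_dual_r f_simps(4) g_simps(4) M.om_right N.om_right
        L.om_right N.sm_add L.sm_add)
qed

sublocale X: tensor_module "Re E" "We E" \<beta>
  by (rule tensor_module_\<beta>)

lemma act_add: "t \<in> carrier (Te E) \<Longrightarrow> X.act (x + y) t = X.act x t + X.act y t"
  by (rule additive.add[OF X.additive_act])

lemma act_uminus:
  assumes "t \<in> carrier (Te E)" shows "X.act x (\<ominus>\<^bsub>Te E\<^esub> t) = - X.act x t"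
  using X.act_plus[of "\<ominus>\<^bsub>Te E\<^esub> t" t x] assms X.act_zero
  by (simp add: T.TR.l_neg eq_neg_iff_add_eq_0)

lemma aM_0: "a \<in> T.Tpart 0 \<Longrightarrow> aM 0 a = 0" and aN_0: "a \<in> T.Tpart 0 \<Longrightarrow> aN 0 a = 0"
  and aL_0: "a \<in> T.Tpart 0 \<Longrightarrow> aL 0 a = 0"
  using M.aM_add[of a 0 0] N.aM_add[of a 0 0] L.aM_add[of a 0 0] by simp_all

lemma act_w1: "\<delta> \<in> Ch \<Longrightarrow> X.act (m, n, k) (w1 E \<delta>) = (0, f \<delta> m, g \<delta> n)"
proof -
  assume \<delta>: "\<delta> \<in> Ch"
  have "M.om m dual_zero = 0" "N.om n dual_zero = 0" "L.om k dual_zero = 0"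
    using M.om_plus[OF C0_zero C0_zero, of m] N.om_plus[OF C0_zero C0_zero, of n]
      L.om_plus[OF C0_zero C0_zero, of k] by (simp_all add: dual_add_zero)
  then show ?thesis using \<delta> unfolding w1_def
    by (subst X.act_letter) (simp_all add: We_simps C0_zero \<beta>_W)
qed

lemma act_deg0_letter:
  assumes "l \<in> tensor_letters (Re E) (We E)" "letter_degree l 0"
  shows "X.act (m, n, k) (T.cls (word [l])) =
    (aM m (T.cls (word [l])), aN n (T.cls (word [l])), aL k (T.cls (word [l])))"
  using assms
proof (cases rule: letter_cases)
  case (base s)
  then show ?thesis using X.act_letter[OF assms(1)]
    by (simp add: \<beta>_base M.sm_def N.sm_def L.sm_def)
next
  case (w12 \<gamma>)
  have "f dual_zero m = 0" "g dual_zero n = 0"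
    using f_simps(2)[OF Ch_zero Ch_zero, of m] g_simps(2)[OF Ch_zero Ch_zero, of n]
    by (simp_all add: dual_add_zero)
  then show ?thesis using w12 X.act_letter[OF assms(1)]
    by (simp add: \<beta>_W Ch_zero M.om_def N.om_def L.om_def)
qed simp

lemma act_deg0:
  assumes "a \<in> T.Tpart 0" shows "X.act (m, n, k) a = (aM m a, aN n a, aL k a)"
proof -
  have "\<forall>m n k. X.act (m, n, k) a = (aM m a, aN n a, aL k a)"
    using assms
  proof (induction rule: T.Tpart_induct)
    case zero
    show ?case
      using M.aM_plus[OF T.Tpart_zero T.Tpart_zero] N.aM_plus[OF T.Tpart_zero T.Tpart_zero]
        L.aM_plus[OF T.Tpart_zero T.Tpart_zero]
      by (simp add: X.act_zero zero_prod_def)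
  next
    case (add s t)
    then show ?case using T.Tpart_carrier[of s 0] T.Tpart_carrier[of t 0]
      by (simp add: X.act_plus M.aM_plus N.aM_plus L.aM_plus)
  next
    case (uminus s)
    have z: "s \<oplus>\<^bsub>Te E\<^esub> \<ominus>\<^bsub>Te E\<^esub> s = \<zero>\<^bsub>Te E\<^esub>" using uminus(1) T.Tpart_carrier by (simp add: T.TR.r_neg)
    note u = T.Tpart_uminus[OF uminus(1)]
    have "aM m (\<ominus>\<^bsub>Te E\<^esub> s) = - aM m s" "aN n (\<ominus>\<^bsub>Te E\<^esub> s) = - aN n s" "aL k (\<ominus>\<^bsub>Te E\<^esub> s) = - aL k s" for m n k
      using M.aM_plus[OF uminus(1) u, of m] N.aM_plus[OF uminus(1) u, of n] L.aM_plus[OF uminus(1) u, of k]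
        M.aM_plus[OF T.Tpart_zero T.Tpart_zero, of m] N.aM_plus[OF T.Tpart_zero T.Tpart_zero, of n]
        L.aM_plus[OF T.Tpart_zero T.Tpart_zero, of k]
      by (simp_all add: z eq_neg_iff_add_eq_0 add.commute)
    then show ?case using uminus T.Tpart_carrier[of s 0] by (simp add: act_uminus)
  next
    case (word w)
    then show ?case
    proof (induction w)
      case Nil
      then show ?case by (simp add: T.cls_one X.act_unit M.aM_one N.aM_one L.aM_one)
    next
      case (Cons l w)
      then have l: "l \<in> tensor_letters (Re E) (We E)" "letter_degree l 0"
        and w: "w \<in> lists (tensor_letters (Re E) (We E))" "word_degree letter_degree w 0" by auto
      have lw: "T.cls (word (l # w)) = T.cls (word [l]) \<otimes>\<^bsub>Te E\<^esub> T.cls (word w)"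
        using T.cls_append[of "[l]" w] l w by simp
      note lp = T.Tpart_letter[OF l] and wp = T.Tpart_word[OF w]
      have IH: "\<forall>m n k. X.act (m, n, k) (T.cls (word w)) =
          (aM m (T.cls (word w)), aN n (T.cls (word w)), aL k (T.cls (word w)))"
        using Cons.IH w by blast
      show ?case
        using IH act_deg0_letter[OF l]
        by (simp add: lw X.act_mult T.Tpart_carrier[OF lp] T.Tpart_carrier[OF wp]
            M.aM_mult[OF lp wp] N.aM_mult[OF lp wp] L.aM_mult[OF lp wp] del: T.cls_closed)
    qed
  qed
  then show ?thesis by blast
qed

definition F where "F t m = fst (snd (X.act (m, 0, 0) t))"
definition G where "G t n = snd (snd (X.act (0, n, 0) t))"
definition GF where "GF t m = snd (snd (X.act (m, 0, 0) t))"

lemma F_left: "a \<in> T.Tpart 0 \<Longrightarrow> t \<in> carrier (Te E) \<Longrightarrow> F (a \<otimes>\<^bsub>Te E\<^esub> t) m = F t (aM m a)"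
  and G_left: "a \<in> T.Tpart 0 \<Longrightarrow> t \<in> carrier (Te E) \<Longrightarrow> G (a \<otimes>\<^bsub>Te E\<^esub> t) n = G t (aN n a)"
  and GF_left: "a \<in> T.Tpart 0 \<Longrightarrow> t \<in> carrier (Te E) \<Longrightarrow> GF (a \<otimes>\<^bsub>Te E\<^esub> t) m = GF t (aM m a)"
  by (simp_all add: F_def G_def GF_def X.act_mult T.Tpart_carrier act_deg0 aM_0 aN_0 aL_0)

lemma F_plus: "s \<in> carrier (Te E) \<Longrightarrow> t \<in> carrier (Te E) \<Longrightarrow> F (s \<oplus>\<^bsub>Te E\<^esub> t) m = F s m + F t m"
  and G_plus: "s \<in> carrier (Te E) \<Longrightarrow> t \<in> carrier (Te E) \<Longrightarrow> G (s \<oplus>\<^bsub>Te E\<^esub> t) n = G s n + G t n"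
  and GF_plus: "s \<in> carrier (Te E) \<Longrightarrow> t \<in> carrier (Te E) \<Longrightarrow> GF (s \<oplus>\<^bsub>Te E\<^esub> t) m = GF s m + GF t m"
  by (simp_all add: F_def G_def GF_def X.act_plus)

lemma F_uminus: "t \<in> carrier (Te E) \<Longrightarrow> F (\<ominus>\<^bsub>Te E\<^esub> t) m = - F t m"
  and G_uminus: "t \<in> carrier (Te E) \<Longrightarrow> G (\<ominus>\<^bsub>Te E\<^esub> t) n = - G t n"
  by (simp_all add: F_def G_def act_uminus)

lemma F_add: "t \<in> carrier (Te E) \<Longrightarrow> F t (m + m') = F t m + F t m'"
  and G_add: "t \<in> carrier (Te E) \<Longrightarrow> G t (n + n') = G t n + G t n'"
  using act_add[of t "(m, 0, 0)" "(m', 0, 0)"] act_add[of t "(0, n, 0)" "(0, n', 0)"]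
  by (simp_all add: F_def G_def)

lemma F_w1: "\<delta> \<in> Ch \<Longrightarrow> F (w1 E \<delta>) m = f \<delta> m" and G_w1: "\<delta> \<in> Ch \<Longrightarrow> G (w1 E \<delta>) n = g \<delta> n"
  by (simp_all add: F_def G_def act_w1)

lemma act_deg1:
  assumes "t \<in> T.Tpart 1" shows "X.act (m, n, k) t = (0, F t m, G t n)"
proof -
  have "\<forall>m n k. X.act (m, n, k) t = (0, F t m, G t n)"
    using assms
  proof (induction rule: T.Tpart_induct)
    case zero
    show ?case by (simp add: X.act_zero F_def G_def zero_prod_def)
  next
    case (add s t)
    then show ?case using T.Tpart_carrier[of s 1] T.Tpart_carrier[of t 1]
      by (simp add: X.act_plus F_plus G_plus)
  next
    case (uminus s)
    then show ?case using T.Tpart_carrier[of s 1] by (simp add: act_uminus F_uminus G_uminus)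
  next
    case (word w)
    then show ?case
    proof (induction w)
      case (Cons l w)
      then obtain i m' where l: "l \<in> tensor_letters (Re E) (We E)" "letter_degree l i" and im: "1 = i + m'"
        and w: "w \<in> lists (tensor_letters (Re E) (We E))" "word_degree letter_degree w m'" by auto
      have lw: "T.cls (word (l # w)) = T.cls (word [l]) \<otimes>\<^bsub>Te E\<^esub> T.cls (word w)"
        using T.cls_append[of "[l]" w] l w by simp
      note lp = T.Tpart_letter[OF l] and wp = T.Tpart_word[OF w]
      note car = T.Tpart_carrier[OF lp] T.Tpart_carrier[OF wp]
      show ?case
      proof (cases "i = 0")
        case True
        then have IH: "X.act (m, n, k) (T.cls (word w)) = (0, F (T.cls (word w)) m, G (T.cls (word w)) n)" for m n k
          using Cons.IH w im by auto
        have lp0: "T.cls (word [l]) \<in> T.Tpart 0" using lp True by simp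
        show ?thesis
          by (simp add: lw X.act_mult car act_deg0[OF lp0] IH F_left[OF lp0 car(2)] G_left[OF lp0 car(2)]
              del: T.cls_closed)
      next
        case False
        with l have i: "i = 1" by (cases rule: letter_cases) auto
        then have wp0: "T.cls (word w) \<in> T.Tpart 0" using wp im by auto
        show ?thesis
          using l unfolding i
        proof (cases rule: letter_cases)
          case (w1 \<delta>)
          then have "T.cls (word (l # w)) = w1 E \<delta> \<otimes>\<^bsub>Te E\<^esub> T.cls (word w)"
            "w1 E \<delta> \<in> carrier (Te E)"
            using lw car by auto
          then show ?thesis
            using car(2) w1(1) by (simp add: F_def G_def X.act_mult act_w1 act_deg0[OF wp0] aM_0[OF wp0]
                aN_0[OF wp0] aL_0[OF wp0] del: T.cls_closed)
        qed auto
      qed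
    qed simp
  qed
  then show ?thesis by blast
qed

lemma F_right: "t \<in> T.Tpart 1 \<Longrightarrow> a \<in> T.Tpart 0 \<Longrightarrow> F (t \<otimes>\<^bsub>Te E\<^esub> a) m = aN (F t m) a"
  using T.Tpart_carrier[of t 1] T.Tpart_carrier[of a 0]
  by (simp add: F_def[of "t \<otimes>\<^bsub>Te E\<^esub> a"] X.act_mult act_deg0 act_deg1)

lemma GF_mult: "s \<in> T.Tpart 1 \<Longrightarrow> t \<in> T.Tpart 1 \<Longrightarrow> GF (s \<otimes>\<^bsub>Te E\<^esub> t) m = G t (F s m)"
  using T.Tpart_carrier[of s 1] T.Tpart_carrier[of t 1]
  by (simp add: GF_def[of "s \<otimes>\<^bsub>Te E\<^esub> t"] X.act_mult act_deg1)

lemma GF_terms: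
  assumes "set vs \<subseteq> T.Tpart 1 \<times> T.Tpart 1"
  shows "X.act (m, 0, 0) (foldr (\<lambda>(v', v'') s. (v' \<otimes>\<^bsub>Te E\<^esub> v'') \<oplus>\<^bsub>Te E\<^esub> s) vs \<zero>\<^bsub>Te E\<^esub>) =
      (0, 0, \<Sum>(v', v'')\<leftarrow>vs. G v'' (F v' m))"
    "foldr (\<lambda>(v', v'') s. (v' \<otimes>\<^bsub>Te E\<^esub> v'') \<oplus>\<^bsub>Te E\<^esub> s) vs \<zero>\<^bsub>Te E\<^esub> \<in> carrier (Te E)"
  using assms
proof (induction vs)
  case Nil
  {
    case 1 then show ?case by (simp add: X.act_zero zero_prod_def)
  next
    case 2 then show ?case by simp
  }
next
  case (Cons p vs)
  obtain v' v'' where p: "p = (v', v'')" by (cases p)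
  {
    case 1
    then have v: "v' \<in> T.Tpart 1" "v'' \<in> T.Tpart 1" and vs: "set vs \<subseteq> T.Tpart 1 \<times> T.Tpart 1" using p by auto
    note c = T.Tpart_carrier[OF v(1)] T.Tpart_carrier[OF v(2)]
    have "F v'' 0 = 0" using F_add[OF c(2), of 0 0] by simp
    then show ?case
      using Cons.IH[OF vs] c by (simp add: p X.act_plus X.act_mult act_deg1[OF v(1)] act_deg1[OF v(2)])
  next
    case 2
    then have v: "v' \<in> T.Tpart 1" "v'' \<in> T.Tpart 1" and vs: "set vs \<subseteq> T.Tpart 1 \<times> T.Tpart 1" using p by auto
    then show ?case using Cons.IH(2)[OF vs] T.Tpart_carrier by (simp add: p)
  }
qed

lemma act_deg2: assumes "t \<in> T.Tpart 2" shows "X.act (m, 0, 0) t = (0, 0, GF t m)"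
  using Tpart2_decompose[OF assms] GF_terms(1) by (auto simp: GF_def)

lemma GF_right: "t \<in> T.Tpart 2 \<Longrightarrow> a \<in> T.Tpart 0 \<Longrightarrow> GF (t \<otimes>\<^bsub>Te E\<^esub> a) m = aL (GF t m) a"
  using T.Tpart_carrier[of t 2] T.Tpart_carrier[of a 0]
  by (simp add: GF_def[of "t \<otimes>\<^bsub>Te E\<^esub> a"] X.act_mult act_deg0 act_deg2)

text \<open>Every expression by products of degree-1 elements gives the same value, since that value
  is a component of the action of \<open>t\<close> itself.\<close>

lemma GF_tensor_terms:
  assumes t: "t \<in> T.Tpart 2"
  shows "(\<Sum>(v', v'')\<leftarrow>tensor_terms (De E d) t. G v'' (F v' m)) = GF t m"
    "set (tensor_terms (De E d) t) \<subseteq> T.Tpart 1 \<times> T.Tpart 1"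
proof -
  let ?vs = "tensor_terms (De E d) t"
  have "set ?vs \<subseteq> T.Tpart 1 \<times> T.Tpart 1 \<and>
      t = foldr (\<lambda>(v', v'') s. (v' \<otimes>\<^bsub>Te E\<^esub> v'') \<oplus>\<^bsub>Te E\<^esub> s) ?vs \<zero>\<^bsub>Te E\<^esub>"
    using someI_ex[OF Tpart2_decompose[OF t]] by (simp add: tensor_terms_def)
  then show "set ?vs \<subseteq> T.Tpart 1 \<times> T.Tpart 1" "(\<Sum>(v', v'')\<leftarrow>?vs. G v'' (F v' m)) = GF t m"
    using GF_terms(1)[of ?vs m] by (auto simp: GF_def)
qed

end

section \<open>Testing identities on the letters of degree 1\<close>

context line_datum
begin

text \<open>Words of degree 1 are letters w_1 \<open>\<delta>\<close> surrounded by letters of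
  degree 0. Multiplication need only preserve vanishing: the defect of a composite is not visibly a
  bimodule map, but its vanishing is preserved.\<close>

lemma deg1_zero:
  assumes "t \<in> T.Tpart 1"
    and add: "\<And>s t m. s \<in> T.Tpart 1 \<Longrightarrow> t \<in> T.Tpart 1 \<Longrightarrow> C (s \<oplus>\<^bsub>Te E\<^esub> t) m = (C s m + C t m :: 'x::ab_group_add)"
    and left: "\<And>a t m. a \<in> T.Tpart 0 \<Longrightarrow> t \<in> T.Tpart 1 \<Longrightarrow> (\<And>m. C t m = 0) \<Longrightarrow> C (a \<otimes>\<^bsub>Te E\<^esub> t) m = 0"
    and right: "\<And>a t m. a \<in> T.Tpart 0 \<Longrightarrow> t \<in> T.Tpart 1 \<Longrightarrow> (\<And>m. C t m = 0) \<Longrightarrow> C (t \<otimes>\<^bsub>Te E\<^esub> a) m = 0"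
    and w1: "\<And>\<delta> m. \<delta> \<in> Ch \<Longrightarrow> C (w1 E \<delta>) m = 0"
  shows "C t m = 0"
proof -
  have "\<forall>m. C t m = 0"
    using assms(1)
  proof (induction rule: T.Tpart_induct)
    case zero
    show ?case using T.additive_Tpart_zero_uminus(1)[where h = "\<lambda>t. C t _", OF add] by blast
  next
    case (add s t)
    then show ?case using assms(2) by simp
  next
    case (uminus s)
    then show ?case using T.additive_Tpart_zero_uminus(2)[where h = "\<lambda>t. C t _", OF assms(2)] by simp
  next
    case (word w)
    then show ?case
    proof (induction w)
      case (Cons l w)
      then obtain i m' where l: "l \<in> tensor_letters (Re E) (We E)" "letter_degree l i" and im: "1 = i + m'"
        and w: "w \<in> lists (tensor_letters (Re E) (We E))" "word_degree letter_degree w m'" by auto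
      have lw: "T.cls (word (l # w)) = T.cls (word [l]) \<otimes>\<^bsub>Te E\<^esub> T.cls (word w)"
        using T.cls_append[of "[l]" w] l w by simp
      note lp = T.Tpart_letter[OF l] and wp = T.Tpart_word[OF w]
      show ?case
      proof (cases "i = 0")
        case True
        then have "\<forall>m. C (T.cls (word w)) m = 0" using Cons.IH w im by auto
        then show ?thesis using left lp wp True im by (simp add: lw)
      next
        case False
        with l have i: "i = 1" by (cases rule: letter_cases) auto
        have "\<forall>m. C (T.cls (word [l])) m = 0"
          using l unfolding i by (cases rule: letter_cases) (auto simp: w1)
        then show ?thesis using right lp wp i im by (simp add: lw)
      qed
    qed simp
  qed
  then show ?thesis by blast
qed

lemma dit_morphism_iff:
  "dit_morphism (De E d) aM aN (f0, f1) \<longleftrightarrow>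
     (\<forall>m m'. f0 (m + m') = f0 m + f0 m') \<and>
     (\<forall>m. \<forall>s\<in>Ss E. f0 (aM m (tS s)) = aN (f0 m) (tS s)) \<and>
     (\<forall>v\<in>T.Tpart 1. \<forall>m m'. f1 v (m + m') = f1 v m + f1 v m') \<and>
     (\<forall>v\<in>T.Tpart 1. \<forall>k m. f1 v (aM m (tS (k \<odot>\<^bsub>\<Lambda>\<^esub> \<one>\<^bsub>\<Lambda>\<^esub>))) = aN (f1 v m) (tS (k \<odot>\<^bsub>\<Lambda>\<^esub> \<one>\<^bsub>\<Lambda>\<^esub>))) \<and>
     (\<forall>v\<in>T.Tpart 1. \<forall>v'\<in>T.Tpart 1. \<forall>m. f1 (v \<oplus>\<^bsub>Te E\<^esub> v') m = f1 v m + f1 v' m) \<and>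
     (\<forall>v\<in>T.Tpart 1. \<forall>a\<in>T.Tpart 0. \<forall>m. f1 (a \<otimes>\<^bsub>Te E\<^esub> v) m = f1 v (aM m a)) \<and>
     (\<forall>v\<in>T.Tpart 1. \<forall>a\<in>T.Tpart 0. \<forall>m. f1 (v \<otimes>\<^bsub>Te E\<^esub> a) m = aN (f1 v m) a) \<and>
     (\<forall>a\<in>T.Tpart 0. \<forall>m. aN (f0 m) a = f0 (aM m a) + f1 (d a) m)"
  unfolding dit_morphism_def prod.case kact_def base_De De_simps scalar_De[unfolded De_simps] by simp

lemma morphism_bimod_map:
  assumes "dit_morphism (De E d) aM aN (f0, f1)"
  shows "bimod_map aM aN (\<lambda>\<delta>. f1 (w1 E \<delta>))"
proof -
  note f = assms[unfolded dit_morphism_iff]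
  show ?thesis
    unfolding bimod_map_def
  proof (intro ballI conjI allI)
    fix \<delta> assume \<delta>: "\<delta> \<in> Ch"
    show "additive (f1 (w1 E \<delta>))" using f w1_part[OF \<delta>] by (simp add: additive.intro)
    show "f1 (w1 E (dual_add \<delta> \<delta>')) m = f1 (w1 E \<delta>) m + f1 (w1 E \<delta>') m" if "\<delta>' \<in> Ch" for \<delta>' m
      using f w1_part[OF \<delta>] w1_part[OF that] by (simp add: w1_add \<delta> that)
    show "f1 (w1 E (dual_l E s \<delta>)) m = f1 (w1 E \<delta>) (aM m (tS s))" if "s \<in> Ss E" for s m
      using f w1_part[OF \<delta>] tS_part[OF that] by (simp add: w1_left \<delta> that)
    show "f1 (w1 E (dual_r E \<delta> s)) m = aN (f1 (w1 E \<delta>) m) (tS s)" if "s \<in> Ss E" for s m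
      using f w1_part[OF \<delta>] tS_part[OF that] by (simp add: w1_right \<delta> that)
  qed
qed

end

context triple
begin

lemma F_eq_morphism:
  assumes "dit_morphism (De E d) aM aN (f0, f1)" "\<And>\<delta> m. \<delta> \<in> Ch \<Longrightarrow> f1 (w1 E \<delta>) m = f \<delta> m" "t \<in> T.Tpart 1"
  shows "f1 t m = F t m"
proof -
  note h = assms(1)[unfolded dit_morphism_iff]
  have "f1 t m - F t m = 0"
    by (rule deg1_zero[OF assms(3), where C = "\<lambda>t m. f1 t m - F t m"])
      (use h assms(2) T.Tpart_carrier[of _ 1] in \<open>simp_all add: F_plus F_left F_right F_w1\<close>)
  then show ?thesis by simp
qed

lemma G_right: "t \<in> T.Tpart 1 \<Longrightarrow> a \<in> T.Tpart 0 \<Longrightarrow> G (t \<otimes>\<^bsub>Te E\<^esub> a) m = aL (G t m) a"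
  using T.Tpart_carrier[of t 1] T.Tpart_carrier[of a 0]
  by (simp add: G_def[of "t \<otimes>\<^bsub>Te E\<^esub> a"] X.act_mult act_deg0 act_deg1)

lemma G_eq_morphism:
  assumes "dit_morphism (De E d) aN aL (g0, g1)" "\<And>\<delta> m. \<delta> \<in> Ch \<Longrightarrow> g1 (w1 E \<delta>) m = g \<delta> m" "t \<in> T.Tpart 1"
  shows "g1 t m = G t m"
proof -
  note h = assms(1)[unfolded dit_morphism_iff]
  have "g1 t m - G t m = 0"
    by (rule deg1_zero[OF assms(3), where C = "\<lambda>t m. g1 t m - G t m"])
      (use h assms(2) T.Tpart_carrier[of _ 1] in \<open>simp_all add: G_plus G_left G_right G_w1\<close>)
  then show ?thesis by simp
qed

text \<open>Compatibility with \<open>d\<close> is tested on letters of degree 0. For letters in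
  \<open>S\<close> it is linearity, as \<open>d\<close> vanishes there, so only W_0 imposes a
  condition; the Leibniz rule extends it to words.\<close>

lemma morphismI:
  assumes add: "\<And>m m'. f0 (m + m') = f0 m + f0 m'"
    and sm: "\<And>s m. s \<in> Ss E \<Longrightarrow> f0 (M.sm m s) = N.sm (f0 m) s"
    and om: "\<And>\<gamma> m. \<gamma> \<in> C0 \<Longrightarrow> N.om (f0 m) \<gamma> = f0 (M.om m \<gamma>) + F (d (w12 E \<gamma>)) m"
  shows "dit_morphism (De E d) aM aN (f0, F)"
proof -
  have d0: "d t \<in> T.Tpart 1" if "t \<in> T.Tpart 0" for t using d_part[OF that] by simp
  have F0: "F \<zero>\<^bsub>Te E\<^esub> m = 0" for m by (simp add: F_def X.act_zero)
  have "\<forall>m. aN (f0 m) a = f0 (aM m a) + F (d a) m" if "a \<in> T.Tpart 0" for a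
    using that
  proof (induction rule: T.Tpart_induct)
    case zero
    have "aN n \<zero>\<^bsub>Te E\<^esub> = 0" "aM m \<zero>\<^bsub>Te E\<^esub> = 0" for m n
      using M.aM_plus[OF T.Tpart_zero T.Tpart_zero, of m] N.aM_plus[OF T.Tpart_zero T.Tpart_zero, of n]
      by simp_all
    then show ?case using add[of 0 0] by (simp add: d_zero F0)
  next
    case (add s t)
    then show ?case
      using T.Tpart_carrier[OF add(1)] T.Tpart_carrier[OF add(2)] T.Tpart_carrier[OF d0[OF add(1)]]
        T.Tpart_carrier[OF d0[OF add(2)]]
      by (simp add: M.aM_plus N.aM_plus d_add F_plus assms(1))
  next
    case (uminus s)
    note u = T.Tpart_uminus[OF uminus(1)]
    have z: "s \<oplus>\<^bsub>Te E\<^esub> \<ominus>\<^bsub>Te E\<^esub> s = \<zero>\<^bsub>Te E\<^esub>" using uminus(1) T.Tpart_carrier by (simp add: T.TR.r_neg)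
    have "aM m (\<ominus>\<^bsub>Te E\<^esub> s) = - aM m s" "aN n (\<ominus>\<^bsub>Te E\<^esub> s) = - aN n s" for m n
      using M.aM_plus[OF uminus(1) u, of m] N.aM_plus[OF uminus(1) u, of n]
        M.aM_plus[OF T.Tpart_zero T.Tpart_zero, of m] N.aM_plus[OF T.Tpart_zero T.Tpart_zero, of n]
      by (simp_all add: z eq_neg_iff_add_eq_0 add.commute)
    moreover have "f0 (- m) = - f0 m" for m
      using additive.minus[OF additive.intro[of f0, OF assms(1)]] by simp
    ultimately show ?case
      using uminus T.Tpart_carrier[OF d0[OF uminus(1)]] by (simp add: d_uminus F_uminus)
  next
    case (word w)
    then show ?case
    proof (induction w)
      case Nil
      then show ?case using d_tS[OF Ss_one] by (simp add: T.cls_one M.aM_one N.aM_one tS_one F0)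
    next
      case (Cons l w)
      then have l: "l \<in> tensor_letters (Re E) (We E)" "letter_degree l 0"
        and w: "w \<in> lists (tensor_letters (Re E) (We E))" "word_degree letter_degree w 0" by auto
      have IH: "\<forall>m. aN (f0 m) (T.cls (word w)) = f0 (aM m (T.cls (word w))) + F (d (T.cls (word w))) m"
        using Cons.IH w by blast
      have lw: "T.cls (word (l # w)) = T.cls (word [l]) \<otimes>\<^bsub>Te E\<^esub> T.cls (word w)"
        using T.cls_append[of "[l]" w] l w by simp
      define a where "a = T.cls (word [l])"
      define b where "b = T.cls (word w)"
      have a: "a \<in> T.Tpart 0" and b: "b \<in> T.Tpart 0"
        using T.Tpart_letter[OF l] T.Tpart_word[OF w] by (simp_all add: a_def b_def)
      have la: "aN (f0 m) a = f0 (aM m a) + F (d a) m" for m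
        using l
      proof (cases rule: letter_cases)
        case (base s)
        then show ?thesis using sm[of s m] by (simp add: a_def d_tS F0 M.sm_def N.sm_def)
      next
        case (w12 \<gamma>)
        then show ?thesis using om[of \<gamma> m] by (simp add: a_def M.om_def N.om_def)
      qed simp
      note ca = T.Tpart_carrier[OF a] T.Tpart_carrier[OF b] T.Tpart_carrier[OF d0[OF a]] T.Tpart_carrier[OF d0[OF b]]
      \<comment> \<open>Moving f^0 past \<open>a\<close> and then past \<open>b\<close> leaves two
        error terms, which are the two terms of the Leibniz rule.\<close>
      have "aN (f0 m) (a \<otimes>\<^bsub>Te E\<^esub> b) = f0 (aM m (a \<otimes>\<^bsub>Te E\<^esub> b)) + F (d (a \<otimes>\<^bsub>Te E\<^esub> b)) m" for m
        using ca IH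
        by (simp add: N.aM_mult[OF a b] M.aM_mult[OF a b] la N.aM_add[OF b] d_mult_0[OF a] F_plus
            F_left[OF a] F_right[OF d0[OF a] b] b_def[symmetric])
      then show ?case by (simp add: lw a_def b_def)
    qed
  qed
  \<comment> \<open>A scalar is an element of T_0 that commutes with \<open>v\<close>, so the left
    and right bimodule laws combine.\<close>
  moreover have "F v (M.sm m (k \<odot>\<^bsub>\<Lambda>\<^esub> \<one>\<^bsub>\<Lambda>\<^esub>)) = N.sm (F v m) (k \<odot>\<^bsub>\<Lambda>\<^esub> \<one>\<^bsub>\<Lambda>\<^esub>)" if v: "v \<in> T.Tpart 1" for v k m
  proof -
    have s: "tS (k \<odot>\<^bsub>\<Lambda>\<^esub> \<one>\<^bsub>\<Lambda>\<^esub>) \<in> T.Tpart 0" by (rule tS_part[OF Ss_smult[OF Ss_one]])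
    show ?thesis
      using F_left[OF s T.Tpart_carrier[OF v], of m] F_right[OF v s, of m] scalar_commute[OF v, of k]
      by (simp add: M.sm_def N.sm_def)
  qed
  ultimately show ?thesis
    unfolding dit_morphism_iff
    using assms(1,2) T.Tpart_carrier[of _ 1]
    by (auto simp: M.sm_def N.sm_def F_add F_plus F_left F_right)
qed

text \<open>The defect of the composite from zero on T_1. Multiplying by \<open>a\<close> in T_0
  creates a Leibniz term with \<open>d a\<close>: on the left it is cancelled by the compatibility
  of the first morphism with \<open>d\<close>, on the right by that of the second.\<close>

lemma comp_zero:
  assumes mf: "dit_morphism (De E d) aM aN (f0, F)" and mg: "dit_morphism (De E d) aN aL (g0, G)"
    and w1: "\<And>\<delta> m. \<delta> \<in> Ch \<Longrightarrow> g \<delta> (f0 m) + g0 (f \<delta> m) - GF (d (w1 E \<delta>)) m = 0"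
    and t: "t \<in> T.Tpart 1"
  shows "G t (f0 m) + g0 (F t m) - GF (d t) m = 0"
proof (rule deg1_zero[OF t, where C = "\<lambda>t m. G t (f0 m) + g0 (F t m) - GF (d t) m"])
  note hf = mf[unfolded dit_morphism_iff] and hg = mg[unfolded dit_morphism_iff]
  have d0: "d t \<in> T.Tpart 1" if "t \<in> T.Tpart 0" for t using d_part[OF that] by simp
  have d1: "d t \<in> T.Tpart 2" if "t \<in> T.Tpart 1" for t using d_part[OF that] by (simp add: numeral_2_eq_2)
  note car = T.Tpart_carrier
  show "G (s \<oplus>\<^bsub>Te E\<^esub> t) (f0 m) + g0 (F (s \<oplus>\<^bsub>Te E\<^esub> t) m) - GF (d (s \<oplus>\<^bsub>Te E\<^esub> t)) m =
      (G s (f0 m) + g0 (F s m) - GF (d s) m) + (G t (f0 m) + g0 (F t m) - GF (d t) m)"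
    if "s \<in> T.Tpart 1" "t \<in> T.Tpart 1" for s t m
    using hg car[OF that(1)] car[OF that(2)] car[OF d1[OF that(1)]] car[OF d1[OF that(2)]]
    by (simp add: F_plus G_plus GF_plus d_add)
  show "G (a \<otimes>\<^bsub>Te E\<^esub> t) (f0 m) + g0 (F (a \<otimes>\<^bsub>Te E\<^esub> t) m) - GF (d (a \<otimes>\<^bsub>Te E\<^esub> t)) m = 0"
    if a: "a \<in> T.Tpart 0" and t: "t \<in> T.Tpart 1" and IH: "\<And>m. G t (f0 m) + g0 (F t m) - GF (d t) m = 0" for a t m
  proof -
    have "aN (f0 m) a = f0 (aM m a) + F (d a) m" using hf a by blast
    moreover have "GF (d (a \<otimes>\<^bsub>Te E\<^esub> t)) m = G t (F (d a) m) + GF (d t) (aM m a)"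
      using car[OF a] car[OF t] car[OF d0[OF a]] car[OF d1[OF t]]
      by (simp add: d_mult_0[OF a] GF_plus GF_mult[OF d0[OF a] t] GF_left[OF a])
    ultimately show ?thesis
      using IH[of "aM m a"] car[OF t] by (simp add: G_left[OF a] F_left[OF a] G_add algebra_simps)
  qed
  show "G (t \<otimes>\<^bsub>Te E\<^esub> a) (f0 m) + g0 (F (t \<otimes>\<^bsub>Te E\<^esub> a) m) - GF (d (t \<otimes>\<^bsub>Te E\<^esub> a)) m = 0"
    if a: "a \<in> T.Tpart 0" and t: "t \<in> T.Tpart 1" and IH: "\<And>m. G t (f0 m) + g0 (F t m) - GF (d t) m = 0" for a t m
  proof -
    have g: "aL (g0 (F t m)) a = g0 (aN (F t m) a) + G (d a) (F t m)" using hg a by blast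
    have GFneg: "GF (\<ominus>\<^bsub>Te E\<^esub> s) m = - GF s m" if "s \<in> carrier (Te E)" for s
      using that by (simp add: GF_def act_uminus)
    have m: "GF (d (t \<otimes>\<^bsub>Te E\<^esub> a)) m = aL (GF (d t) m) a - G (d a) (F t m)"
      using car[OF a] car[OF t] car[OF d0[OF a]] car[OF d1[OF t]]
      by (simp add: d_mult_1[OF t] GF_plus GFneg GF_mult[OF t d0[OF a]] GF_right[OF d1[OF t] a])
    have "GF (d t) m = G t (f0 m) + g0 (F t m)" using IH[of m] by simp
    then have "aL (GF (d t) m) a = aL (G t (f0 m)) a + aL (g0 (F t m)) a" by (simp add: L.aM_add[OF a])
    then show ?thesis
      using g m by (simp add: G_right[OF t a] F_right[OF t a])
  qed
  show "G (w1 E \<delta>) (f0 m) + g0 (F (w1 E \<delta>) m) - GF (d (w1 E \<delta>)) m = 0" if "\<delta> \<in> Ch" for \<delta> m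
    using w1[OF that] by (simp add: F_w1[OF that] G_w1[OF that])
qed

lemma dit_comp_snd:
  assumes t: "t \<in> T.Tpart 1"
  shows "snd (dit_comp (De E d) (g0, G) (f0, F)) t m = G t (f0 m) + g0 (F t m) - GF (d t) m"
proof -
  have "d t \<in> T.Tpart 2" using d_part[OF t] by (simp add: numeral_2_eq_2)
  from GF_tensor_terms(1)[OF this, of m] show ?thesis by (simp add: dit_comp_def)
qed

end

section \<open>Morphisms from matrices\<close>

context line_datum
begin

text \<open>The dual basis identity is applied twice: summing over \<open>q\<close> rebuilds
  \<open>U p\<close>, and summing over \<open>p\<close> rebuilds each \<open>u a\<close>. Left
  linearity moves the coefficients into \<open>\<delta>\<close>. The two alternatives for
  \<open>B'\<close> and \<open>z\<close> cover both formulas for the differential.\<close>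

lemma dual_pair_sum:
  assumes \<delta>: "\<delta> \<in> Jdual E" and z: "B' = Bh \<and> z \<in> Pm E \<or> B' = B0 \<and> z = Zero" and fin: "finite A"
    and r: "\<And>a. a \<in> A \<Longrightarrow> r a \<in> Js E" "\<And>a i l. a \<in> A \<Longrightarrow> r a i l \<noteq> 0 \<Longrightarrow> i = z"
    and u: "\<And>a. a \<in> A \<Longrightarrow> u a \<in> Js E" "\<And>a. a \<in> A \<Longrightarrow> zz a \<in> Pm E"
      "\<And>a y x. a \<in> A \<Longrightarrow> u a y x \<noteq> 0 \<Longrightarrow> y = zz a"
    and U: "\<And>p. p \<in> Bh \<Longrightarrow> U p = (\<lambda>i l. \<Sum>a\<in>A. (r a \<otimes>\<^bsub>\<Lambda>\<^esub> gam p (u a)) i l)"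
  shows "(\<lambda>i j. \<Sum>p\<in>Bh. \<Sum>q\<in>B'. (gam q (U p) \<otimes>\<^bsub>\<Lambda>\<^esub> \<delta> (q \<otimes>\<^bsub>\<Lambda>\<^esub> p)) i j) =
    \<delta> (\<lambda>i j. \<Sum>a\<in>A. (r a \<otimes>\<^bsub>\<Lambda>\<^esub> u a) i j)"
proof -
  have finB': "finite B'" using z finite_Bh finite_B0 by auto
  have gamS: "gam p w \<in> Ss E" if "p \<in> Bh \<or> p \<in> B'" for p w
    using that z gam_Ch[of p] gam_C0[of p] by (auto intro: Jdual_Ss C0_Jdual Ch_Jdual)
  have BJ: "p \<in> Js E" if "p \<in> Bh \<or> p \<in> B'" for p
    using that z Bh_Js[of p] B0_Js[of p] by auto
  have UJ: "U p \<in> Js E" if p: "p \<in> Bh" for p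
    unfolding U[OF p]
    by (rule Jdual_finsum(1)[OF \<delta> fin]) (use gamS p r in \<open>auto intro: Js_mult_right\<close>)
  have Uz: "i = z" if p: "p \<in> Bh" and "U p i l \<noteq> 0" for p i l
  proof -
    have "(\<Sum>a\<in>A. r a i l * gam p (u a) l l) \<noteq> 0"
      using that(2) unfolding U[OF p] by (simp add: Ss_mult_right gamS p)
    then obtain a where "a \<in> A" "r a i l * gam p (u a) l l \<noteq> 0" by (rule sum.not_neutral_contains_not_neutral)
    then show ?thesis using r(2)[of a i l] by (cases "r a i l = 0") auto
  qed
  have step: "gam q (U p) \<otimes>\<^bsub>\<Lambda>\<^esub> \<delta> (q \<otimes>\<^bsub>\<Lambda>\<^esub> p) = \<delta> ((gam q (U p) \<otimes>\<^bsub>\<Lambda>\<^esub> q) \<otimes>\<^bsub>\<Lambda>\<^esub> p)"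
    and mem: "(gam q (U p) \<otimes>\<^bsub>\<Lambda>\<^esub> q) \<otimes>\<^bsub>\<Lambda>\<^esub> p \<in> Js E" if "p \<in> Bh" "q \<in> B'" for p q
  proof -
    have S: "gam q (U p) \<in> Ss E" using gamS that by blast
    have "gam q (U p) \<otimes>\<^bsub>\<Lambda>\<^esub> (q \<otimes>\<^bsub>\<Lambda>\<^esub> p) = (gam q (U p) \<otimes>\<^bsub>\<Lambda>\<^esub> q) \<otimes>\<^bsub>\<Lambda>\<^esub> p"
      unfolding Ss_mult_left[OF S] by (simp add: Lam_simps(2) sum_distrib_left mult.assoc)
    moreover have "\<delta> (gam q (U p) \<otimes>\<^bsub>\<Lambda>\<^esub> (q \<otimes>\<^bsub>\<Lambda>\<^esub> p)) = gam q (U p) \<otimes>\<^bsub>\<Lambda>\<^esub> \<delta> (q \<otimes>\<^bsub>\<Lambda>\<^esub> p)"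
      by (rule Jdual_left[OF \<delta> S Js_mult]) (use BJ that in blast)+
    ultimately show "gam q (U p) \<otimes>\<^bsub>\<Lambda>\<^esub> \<delta> (q \<otimes>\<^bsub>\<Lambda>\<^esub> p) = \<delta> ((gam q (U p) \<otimes>\<^bsub>\<Lambda>\<^esub> q) \<otimes>\<^bsub>\<Lambda>\<^esub> p)"
      by simp
    show "(gam q (U p) \<otimes>\<^bsub>\<Lambda>\<^esub> q) \<otimes>\<^bsub>\<Lambda>\<^esub> p \<in> Js E"
      using Js_mult[OF Js_mult_left[OF S BJ] BJ] that by blast
  qed
  \<comment> \<open>First collapse: inside the product with \<open>p\<close>, the sum of
    \<open>gam q (U p) \<otimes> q\<close> is \<open>U p\<close>.\<close>
  have inner: "(\<lambda>i j. \<Sum>q\<in>B'. (gam q (U p) \<otimes>\<^bsub>\<Lambda>\<^esub> \<delta> (q \<otimes>\<^bsub>\<Lambda>\<^esub> p)) i j) = \<delta> (U p \<otimes>\<^bsub>\<Lambda>\<^esub> p)" if p: "p \<in> Bh" for p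
  proof -
    have "(\<lambda>i j. \<Sum>q\<in>B'. (gam q (U p) \<otimes>\<^bsub>\<Lambda>\<^esub> \<delta> (q \<otimes>\<^bsub>\<Lambda>\<^esub> p)) i j) =
        (\<lambda>i j. \<Sum>q\<in>B'. \<delta> ((gam q (U p) \<otimes>\<^bsub>\<Lambda>\<^esub> q) \<otimes>\<^bsub>\<Lambda>\<^esub> p) i j)"
      using step[OF p] by simp
    also have "\<dots> = \<delta> (\<lambda>i j. \<Sum>q\<in>B'. ((gam q (U p) \<otimes>\<^bsub>\<Lambda>\<^esub> q) \<otimes>\<^bsub>\<Lambda>\<^esub> p) i j)"
      by (rule Jdual_finsum(2)[where f = "\<lambda>q. (gam q (U p) \<otimes>\<^bsub>\<Lambda>\<^esub> q) \<otimes>\<^bsub>\<Lambda>\<^esub> p", OF \<delta> finB' mem[OF p], symmetric])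
    also have "(\<lambda>i j. \<Sum>q\<in>B'. ((gam q (U p) \<otimes>\<^bsub>\<Lambda>\<^esub> q) \<otimes>\<^bsub>\<Lambda>\<^esub> p) i j) = U p \<otimes>\<^bsub>\<Lambda>\<^esub> p"
    proof (intro ext)
      fix i j
      have "(\<Sum>q\<in>B'. ((gam q (U p) \<otimes>\<^bsub>\<Lambda>\<^esub> q) \<otimes>\<^bsub>\<Lambda>\<^esub> p) i j) =
          (\<Sum>l\<in>Pum E. (\<Sum>q\<in>B'. (gam q (U p) \<otimes>\<^bsub>\<Lambda>\<^esub> q) i l) * p l j)"
        unfolding Lam_simps(2)[of "gam _ (U p) \<otimes>\<^bsub>\<Lambda>\<^esub> _" p]
        by (subst sum.swap) (simp add: sum_distrib_right)
      also have "\<dots> = (\<Sum>l\<in>Pum E. U p i l * p l j)"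
        by (intro sum.cong refl arg_cong2[where f = "(*)"]
            fun_cong[OF fun_cong[OF gam_expand_sum[OF UJ[OF p] z Uz[OF p]]], symmetric])
      finally show "(\<Sum>q\<in>B'. ((gam q (U p) \<otimes>\<^bsub>\<Lambda>\<^esub> q) \<otimes>\<^bsub>\<Lambda>\<^esub> p) i j) = (U p \<otimes>\<^bsub>\<Lambda>\<^esub> p) i j"
        by (simp add: Lam_simps(2))
    qed
    finally show ?thesis .
  qed
  have "(\<lambda>i j. \<Sum>p\<in>Bh. \<Sum>q\<in>B'. (gam q (U p) \<otimes>\<^bsub>\<Lambda>\<^esub> \<delta> (q \<otimes>\<^bsub>\<Lambda>\<^esub> p)) i j) =
      (\<lambda>i j. \<Sum>p\<in>Bh. \<delta> (U p \<otimes>\<^bsub>\<Lambda>\<^esub> p) i j)"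
    by (intro ext sum.cong refl fun_cong[OF fun_cong[OF inner]])
  also have "\<dots> = \<delta> (\<lambda>i j. \<Sum>p\<in>Bh. (U p \<otimes>\<^bsub>\<Lambda>\<^esub> p) i j)"
    by (rule Jdual_finsum(2)[where f = "\<lambda>p. U p \<otimes>\<^bsub>\<Lambda>\<^esub> p", OF \<delta> finite_Bh, symmetric])
      (use Js_mult[OF UJ Bh_Js] in blast)
  \<comment> \<open>Second collapse: insert the shape of \<open>U p\<close> and expand each
    \<open>u a\<close> in \<open>Bh\<close>, which suffices because its row lies in
    \<open>Pm E\<close>.\<close>
  also have "(\<lambda>i j. \<Sum>p\<in>Bh. (U p \<otimes>\<^bsub>\<Lambda>\<^esub> p) i j) = (\<lambda>i j. \<Sum>a\<in>A. (r a \<otimes>\<^bsub>\<Lambda>\<^esub> u a) i j)"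
  proof (intro ext)
    fix i j
    have "(\<Sum>p\<in>Bh. (U p \<otimes>\<^bsub>\<Lambda>\<^esub> p) i j) =
        (\<Sum>p\<in>Bh. \<Sum>l\<in>Pum E. \<Sum>a\<in>A. r a i l * (gam p (u a) l l * p l j))"
    proof (rule sum.cong[OF refl])
      fix p assume p: "p \<in> Bh"
      have "U p i l = (\<Sum>a\<in>A. r a i l * gam p (u a) l l)" for l
        unfolding U[OF p] by (simp add: Ss_mult_right gamS p)
      then show "(U p \<otimes>\<^bsub>\<Lambda>\<^esub> p) i j = (\<Sum>l\<in>Pum E. \<Sum>a\<in>A. r a i l * (gam p (u a) l l * p l j))"
        by (simp add: Lam_simps(2) sum_distrib_right mult.assoc)
    qed
    also have "\<dots> = (\<Sum>a\<in>A. \<Sum>l\<in>Pum E. \<Sum>p\<in>Bh. r a i l * (gam p (u a) l l * p l j))"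
    proof -
      have "(\<Sum>p\<in>Bh. \<Sum>l\<in>Pum E. \<Sum>a\<in>A. f p l a) = (\<Sum>a\<in>A. \<Sum>l\<in>Pum E. \<Sum>p\<in>Bh. f p l a)" for f :: "_ \<Rightarrow> _ \<Rightarrow> _ \<Rightarrow> 'b"
      proof -
        have "(\<Sum>p\<in>Bh. \<Sum>l\<in>Pum E. \<Sum>a\<in>A. f p l a) = (\<Sum>l\<in>Pum E. \<Sum>p\<in>Bh. \<Sum>a\<in>A. f p l a)"
          by (rule sum.swap)
        also have "\<dots> = (\<Sum>l\<in>Pum E. \<Sum>a\<in>A. \<Sum>p\<in>Bh. f p l a)"
          by (intro sum.cong refl sum.swap)
        also have "\<dots> = (\<Sum>a\<in>A. \<Sum>l\<in>Pum E. \<Sum>p\<in>Bh. f p l a)" by (rule sum.swap)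
        finally show ?thesis .
      qed
      then show ?thesis .
    qed
    also have "\<dots> = (\<Sum>a\<in>A. (r a \<otimes>\<^bsub>\<Lambda>\<^esub> u a) i j)"
    proof (rule sum.cong[OF refl])
      fix a assume a: "a \<in> A"
      have z': "Bh = Bh \<and> zz a \<in> Pm E \<or> Bh = B0 \<and> zz a = Zero" using u(2)[OF a] by simp
      have "u a l j = (\<Sum>p\<in>Bh. (gam p (u a) \<otimes>\<^bsub>\<Lambda>\<^esub> p) l j)" for l
        by (rule fun_cong[OF fun_cong[OF gam_expand_sum[OF u(1)[OF a] z' u(3)[OF a]]]])
      then have "u a l j = (\<Sum>p\<in>Bh. gam p (u a) l l * p l j)" for l
        by (simp add: Ss_mult_left gamS)
      then show "(\<Sum>l\<in>Pum E. \<Sum>p\<in>Bh. r a i l * (gam p (u a) l l * p l j)) = (r a \<otimes>\<^bsub>\<Lambda>\<^esub> u a) i j"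
        by (simp add: Lam_simps(2) sum_distrib_left)
    qed
    finally show "(\<Sum>p\<in>Bh. (U p \<otimes>\<^bsub>\<Lambda>\<^esub> p) i j) = (\<Sum>a\<in>A. (r a \<otimes>\<^bsub>\<Lambda>\<^esub> u a) i j)" .
  qed
  finally show ?thesis .
qed

lemma dit_morphism_cong:
  assumes "\<And>t m. t \<in> T.Tpart 1 \<Longrightarrow> h t m = h' t m"
  shows "dit_morphism (De E d) aM aN (f0, h) \<longleftrightarrow> dit_morphism (De E d) aM aN (f0, h')"
proof -
  have "s \<oplus>\<^bsub>Te E\<^esub> t \<in> T.Tpart 1" if "s \<in> T.Tpart 1" "t \<in> T.Tpart 1" for s t
    using that by (rule T.Tpart_add)
  moreover have "a \<otimes>\<^bsub>Te E\<^esub> t \<in> T.Tpart 1" "t \<otimes>\<^bsub>Te E\<^esub> a \<in> T.Tpart 1" "d a \<in> T.Tpart 1"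
    if "a \<in> T.Tpart 0" "t \<in> T.Tpart 1" for a t
    using T.Tpart_mult[OF that] T.Tpart_mult[OF that(2,1)] d_part[OF that(1)] by simp_all
  moreover have "d a \<in> T.Tpart 1" if "a \<in> T.Tpart 0" for a using d_part[OF that] by simp
  ultimately show ?thesis unfolding dit_morphism_iff by (simp add: assms cong: ball_cong)
qed

end

context triple
begin

text \<open>Replaces arbitrary second components by the canonical extensions of their values on
  letters, for which the sum over \<open>tensor_terms\<close> is the value
  \<open>GF\<close>.\<close>

lemma dit_comp_zero:
  assumes mf: "dit_morphism (De E d) aM aN (f0, f1)" and mg: "dit_morphism (De E d) aN aL (g0, g1)"
    and f1: "\<And>\<delta> m. \<delta> \<in> Ch \<Longrightarrow> f1 (w1 E \<delta>) m = f \<delta> m"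
    and g1: "\<And>\<delta> n. \<delta> \<in> Ch \<Longrightarrow> g1 (w1 E \<delta>) n = g \<delta> n"
    and w1: "\<And>\<delta> m. \<delta> \<in> Ch \<Longrightarrow> g \<delta> (f0 m) + g0 (f \<delta> m) - GF (d (w1 E \<delta>)) m = 0"
    and t: "t \<in> T.Tpart 1"
  shows "snd (dit_comp (De E d) (g0, g1) (f0, f1)) t m = 0"
proof -
  have F: "f1 t m = F t m" if "t \<in> T.Tpart 1" for t m by (rule F_eq_morphism[OF mf f1 that])
  have G: "g1 t m = G t m" if "t \<in> T.Tpart 1" for t m by (rule G_eq_morphism[OF mg g1 that])
  have "dit_morphism (De E d) aM aN (f0, F)" "dit_morphism (De E d) aN aL (g0, G)"
    using mf mg dit_morphism_cong[where h = f1 and h' = F, OF F] dit_morphism_cong[where h = g1 and h' = G, OF G]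
    by blast+
  from dit_comp_snd[OF t, of g0 f0 m] comp_zero[OF this w1 t, of m]
  have "snd (dit_comp (De E d) (g0, G) (f0, F)) t m = 0" by (rule trans)
  moreover have "(\<Sum>(v', v'')\<leftarrow>tensor_terms (De E d) (d t). g1 v'' (f1 v' m)) =
      (\<Sum>(v', v'')\<leftarrow>tensor_terms (De E d) (d t). G v'' (F v' m))"
  proof (intro arg_cong[where f = sum_list] map_cong refl)
    fix p assume "p \<in> set (tensor_terms (De E d) (d t))"
    then have "p \<in> T.Tpart 1 \<times> T.Tpart 1"
      using GF_tensor_terms(2)[of "d t"] d_part[OF t] by (auto simp: numeral_2_eq_2)
    then show "(case p of (v', v'') \<Rightarrow> g1 v'' (f1 v' m)) = (case p of (v', v'') \<Rightarrow> G v'' (F v' m))"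
      using F G by auto
  qed
  ultimately show ?thesis using F[OF t] G[OF t] by (simp add: dit_comp_def)
qed

end

context dit_mod
begin

lemma sm_pair_sum:
  assumes \<delta>: "\<delta> \<in> Jdual E" and z: "B' = Bh \<and> z \<in> Pm E \<or> B' = B0 \<and> z = Zero" and fin: "finite A"
    and r: "\<And>a. a \<in> A \<Longrightarrow> r a \<in> Js E" "\<And>a i l. a \<in> A \<Longrightarrow> r a i l \<noteq> 0 \<Longrightarrow> i = z"
    and u: "\<And>a. a \<in> A \<Longrightarrow> u a \<in> Js E" "\<And>a. a \<in> A \<Longrightarrow> zz a \<in> Pm E"
      "\<And>a y x. a \<in> A \<Longrightarrow> u a y x \<noteq> 0 \<Longrightarrow> y = zz a"
    and U: "\<And>p. p \<in> Bh \<Longrightarrow> U p = (\<lambda>i l. \<Sum>a\<in>A. (r a \<otimes>\<^bsub>\<Lambda>\<^esub> gam p (u a)) i l)"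
  shows "(\<Sum>p\<in>Bh. \<Sum>q\<in>B'. sm (sm m (gam q (U p))) (\<delta> (q \<otimes>\<^bsub>\<Lambda>\<^esub> p))) =
    sm m (\<delta> (\<lambda>i j. \<Sum>a\<in>A. (r a \<otimes>\<^bsub>\<Lambda>\<^esub> u a) i j))"
proof -
  have finB': "finite B'" using z finite_Bh finite_B0 by auto
  have gamS: "gam q w \<in> Ss E" if "q \<in> B'" for q w
    using that z gam_Ch[of q] gam_C0[of q] by (auto intro: Jdual_Ss C0_Jdual Ch_Jdual)
  have S: "gam q (U p) \<otimes>\<^bsub>\<Lambda>\<^esub> \<delta> (q \<otimes>\<^bsub>\<Lambda>\<^esub> p) \<in> Ss E" if "q \<in> B'" for p q
    using that by (intro Ss_mult gamS Jdual_Ss[OF \<delta>])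
  have "(\<Sum>p\<in>Bh. \<Sum>q\<in>B'. sm (sm m (gam q (U p))) (\<delta> (q \<otimes>\<^bsub>\<Lambda>\<^esub> p))) =
      (\<Sum>p\<in>Bh. \<Sum>q\<in>B'. sm m (gam q (U p) \<otimes>\<^bsub>\<Lambda>\<^esub> \<delta> (q \<otimes>\<^bsub>\<Lambda>\<^esub> p)))"
    by (intro sum.cong refl) (simp add: sm_mult gamS Jdual_Ss[OF \<delta>])
  also have "\<dots> = (\<Sum>p\<in>Bh. sm m (\<lambda>i j. \<Sum>q\<in>B'. (gam q (U p) \<otimes>\<^bsub>\<Lambda>\<^esub> \<delta> (q \<otimes>\<^bsub>\<Lambda>\<^esub> p)) i j))"
    by (intro sum.cong refl sm_sum(2)[where f = "\<lambda>q. gam q (U _) \<otimes>\<^bsub>\<Lambda>\<^esub> \<delta> (q \<otimes>\<^bsub>\<Lambda>\<^esub> _)", symmetric] finB' S)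
  also have "\<dots> = sm m (\<lambda>i j. \<Sum>p\<in>Bh. \<Sum>q\<in>B'. (gam q (U p) \<otimes>\<^bsub>\<Lambda>\<^esub> \<delta> (q \<otimes>\<^bsub>\<Lambda>\<^esub> p)) i j)"
    by (rule sm_sum(2)[where f = "\<lambda>p i j. \<Sum>q\<in>B'. (gam q (U p) \<otimes>\<^bsub>\<Lambda>\<^esub> \<delta> (q \<otimes>\<^bsub>\<Lambda>\<^esub> p)) i j", OF finite_Bh, symmetric])
      (rule sm_sum(1)[where f = "\<lambda>q. gam q (U _) \<otimes>\<^bsub>\<Lambda>\<^esub> \<delta> (q \<otimes>\<^bsub>\<Lambda>\<^esub> _)", OF finB' S])
  also have "(\<lambda>i j. \<Sum>p\<in>Bh. \<Sum>q\<in>B'. (gam q (U p) \<otimes>\<^bsub>\<Lambda>\<^esub> \<delta> (q \<otimes>\<^bsub>\<Lambda>\<^esub> p)) i j) =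
      \<delta> (\<lambda>i j. \<Sum>a\<in>A. (r a \<otimes>\<^bsub>\<Lambda>\<^esub> u a) i j)"
    by (rule dual_pair_sum[OF assms])
  finally show ?thesis .
qed

end

context based_mod
begin

lemma row_sum:
  assumes "finite A" shows "row F y j (\<Sum>a\<in>A. f a) = (\<lambda>i l. \<Sum>a\<in>A. row F y j (f a) i l)"
  using assms
proof (induction A)
  case empty
  have "co x 0 i = 0" if "x \<in> Pm E" for x i
    using additive.zero[OF additive_co[OF Pm_Pum[OF that]]] .
  then show ?case by (auto simp: row_def fun_eq_iff)
qed (simp add: row_add Lam_simps(5))

lemma row_b:
  assumes y': "y' \<in> Pum E" and i: "i < n y'" and F: "\<And>x i. F y j x i \<in> Rx y x"
  shows "row F y j (b y' i) = (if y' \<in> Pm E \<and> y < y' then mu y y' (F y j y' i) else \<zero>\<^bsub>\<Lambda>\<^esub>)"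
proof (intro ext)
  fix a x
  have "(\<Sum>i'<n x. F y j x i' * co x (b y' i) i') = (if x = y' then F y j y' i else 0)" if x: "x \<in> Pm E"
  proof -
    have "(\<Sum>i'<n x. F y j x i' * co x (b y' i) i') = (\<Sum>i'<n x. if i' = i then (if x = y' then F y j y' i else 0) else 0)"
      using Rx_unit(2)[OF F, of x i] by (intro sum.cong refl) (auto simp: co_b Pm_Pum x y' i)
    then show ?thesis using i by auto
  qed
  then show "row F y j (b y' i) a x = (if y' \<in> Pm E \<and> y < y' then mu y y' (F y j y' i) else \<zero>\<^bsub>\<Lambda>\<^esub>) a x"
    by (auto simp: row_def mu_def Lam_simps(4))
qed

end

section \<open>From a matrix to a morphism\<close>

text \<open>A single family carries F_0 in its block at \<open>Zero\<close> and \<open>F\<close> in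
  the blocks indexed by \<open>Pm E\<close>.\<close>

locale matrix_pair = line_datum E B gam d v +
  M: based_mod E B gam d v aM nM bM + N: based_mod E B gam d v aN nN bN
  for E :: "('k::field, 'a::ring_1, 'p::order) poset_datum"
    and B gam d v
    and aM :: "'m::ab_group_add \<Rightarrow> ('a, 'p) te \<Rightarrow> 'm" and nM bM
    and aN :: "'n::ab_group_add \<Rightarrow> ('a, 'p) te \<Rightarrow> 'n" and nN bN +
  fixes F :: "'p extp \<Rightarrow> nat \<Rightarrow> 'p extp \<Rightarrow> nat \<Rightarrow> 'a"
  assumes F_Rx: "F y j x i \<in> Rx y x"
begin

definition f0 where
  "f0 m = (\<Sum>y\<in>Pum E. \<Sum>j<nN y. N.sm (bN y j) (mu y y (\<Sum>i<nM y. F y j y i * M.co y m i)))"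

text \<open>The expansion of f^1 along the dual basis, without reference to a basis of
  \<open>J\<close>: the form is applied to the strictly upper row, and its value acts on the basis
  vector of that row.\<close>

definition f1 where
  "f1 \<delta> m = (\<Sum>y\<in>Pm E. \<Sum>j<nN y. N.sm (bN y j) (\<delta> (M.row F y j m)))"

lemma f0_coeff: "y \<in> Pum E \<Longrightarrow> (\<Sum>i<nM y. F y j y i * M.co y m i) \<in> Rx y y"
  by (intro Rx_sum Rx_mult[OF F_Rx] M.co_spec(1))

lemma f0_add: "f0 (m + m') = f0 m + f0 m'"
  unfolding f0_def
  by (simp add: M.co_add distrib_left sum.distrib N.mu_add f0_coeff cong: sum.cong)

lemma f0_sm: assumes s: "s \<in> Ss E" shows "f0 (M.sm m s) = N.sm (f0 m) s"
proof -
  have "N.sm (f0 m) s = (\<Sum>y\<in>Pum E. \<Sum>j<nN y. N.sm (N.sm (bN y j) (mu y y (\<Sum>i<nM y. F y j y i * M.co y m i))) s)"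
    unfolding f0_def by (simp add: additive.sum[OF N.additive_sm[OF s]])
  also have "\<dots> = f0 (M.sm m s)"
    unfolding f0_def
    by (intro sum.cong refl)
      (simp add: N.sm_mult[symmetric] Ss_mu f0_coeff s mu_mult_right M.co_sm sum_distrib_right mult.assoc)
  finally show ?thesis by simp
qed

lemma co_f0:
  assumes x: "x \<in> Pum E" and k: "k < nN x" shows "N.co x (f0 m) k = (\<Sum>i<nM x. F x k x i * M.co x m i)"
  unfolding f0_def
  by (subst N.co_sum_sum[OF x subset_refl _ k]) (simp_all add: Ss_mu f0_coeff x, simp add: mu_def)

lemma f0_b:
  assumes x: "x \<in> Pum E" and i: "i < nM x"
  shows "f0 (bM x i) = (\<Sum>j<nN x. N.sm (bN x j) (mu x x (F x j x i)))"
proof (rule N.co_eqI)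
  fix y k assume y: "y \<in> Pum E" and k: "k < nN y"
  have "(\<Sum>i'<nM y. F y k y i' * M.co y (bM x i) i') = (\<Sum>i'<nM y. if i' = i then (if y = x then F y k x i else 0) else 0)"
    using Rx_unit(2)[OF F_Rx] by (intro sum.cong refl) (auto simp: M.co_b y x i)
  also have "\<dots> = (if y = x then F y k x i else 0)" using i by auto
  finally have "N.co y (f0 (bM x i)) k = (if y = x then F y k x i else 0)" by (simp add: co_f0 y k)
  moreover have "N.co y (\<Sum>z\<in>{x}. \<Sum>j<nN z. N.sm (bN z j) (mu z z (F z j z i))) k = (if y \<in> {x} then mu y y (F y k y i) y y else 0)"
    by (rule N.co_sum_sum[OF y _ _ k]) (simp_all add: x Ss_mu F_Rx)
  ultimately show "N.co y (f0 (bM x i)) k = N.co y (\<Sum>j<nN x. N.sm (bN x j) (mu x x (F x j x i))) k"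
    by (auto simp: mu_def)
qed

lemma bimod_map_f1: "bimod_map aM aN f1"
  unfolding bimod_map_def
proof (intro ballI conjI allI)
  fix \<delta> assume \<delta>: "\<delta> \<in> Ch"
  note J = Ch_Jdual[OF \<delta>] and rJ = M.row_Js[of F, OF F_Rx]
  show "additive (f1 \<delta>)"
    by (rule additive.intro)
      (simp add: f1_def M.row_add Jdual_add[OF J rJ rJ] N.sm_plus Jdual_Ss[OF J] sum.distrib)
  show "f1 (dual_add \<delta> \<delta>') m = f1 \<delta> m + f1 \<delta>' m" if "\<delta>' \<in> Ch" for \<delta>' m
  proof -
    have "dual_add \<delta> \<delta>' u = \<delta> u \<oplus>\<^bsub>\<Lambda>\<^esub> \<delta>' u" for u by (simp add: dual_add_def Lam_simps(5))
    then show ?thesis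
      using that by (simp add: f1_def N.sm_plus Jdual_Ss J Ch_Jdual sum.distrib)
  qed
  show "f1 (dual_l E s \<delta>) m = f1 \<delta> (aM m (tS s))" if "s \<in> Ss E" for s m
    using that by (simp add: f1_def dual_l_apply rJ M.row_sm M.sm_def[symmetric])
  show "f1 (dual_r E \<delta> s) m = aN (f1 \<delta> m) (tS s)" if s: "s \<in> Ss E" for s m
  proof -
    have "aN (f1 \<delta> m) (tS s) = (\<Sum>y\<in>Pm E. \<Sum>j<nN y. N.sm (N.sm (bN y j) (\<delta> (M.row F y j m))) s)"
      unfolding f1_def N.sm_def[symmetric, of _ s] by (simp add: additive.sum[OF N.additive_sm[OF s]])
    then show ?thesis by (simp add: f1_def dual_r_def N.sm_mult Jdual_Ss J s)
  qed
qed

text \<open>The product of the strictly upper parts of \<open>H\<close> and \<open>F\<close>,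
  applied to \<open>m\<close> and kept as a row in \<open>J\<close>. It is what the differential
  contributes.\<close>

definition W where
  "W H z k m = (\<lambda>i l. \<Sum>a\<in>Sigma (Pm E) (\<lambda>y. {..<nN y}).
     (N.row H z k (bN (fst a) (snd a)) \<otimes>\<^bsub>\<Lambda>\<^esub> M.row F (fst a) (snd a) m) i l)"

lemma W_Js: "(\<And>x i. H z k x i \<in> Rx z x) \<Longrightarrow> W H z k m \<in> Js E"
  unfolding W_def
  by (rule Jdual_finsum(1)[OF dual_zero_Jdual]) (use finite_Pm in \<open>auto intro!: Js_mult N.row_Js M.row_Js F_Rx\<close>)

lemma row_f1:
  assumes "p \<in> Bh"
  shows "N.row H z k (f1 (gam p) m) = (\<lambda>i l. \<Sum>a\<in>Sigma (Pm E) (\<lambda>y. {..<nN y}).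
    (N.row H z k (bN (fst a) (snd a)) \<otimes>\<^bsub>\<Lambda>\<^esub> gam p (M.row F (fst a) (snd a) m)) i l)"
proof -
  have "f1 (gam p) m = (\<Sum>a\<in>Sigma (Pm E) (\<lambda>y. {..<nN y}). N.sm (bN (fst a) (snd a)) (gam p (M.row F (fst a) (snd a) m)))"
    unfolding f1_def by (subst sum.Sigma) (use finite_Pm in \<open>auto simp: split_beta\<close>)
  then show ?thesis
    using finite_Pm by (simp add: N.row_sum N.row_sm Jdual_Ss Ch_Jdual gam_Ch assms)
qed

text \<open>By \<open>row_f1\<close> the rows of \<open>f1 (gam p) m\<close> have the shape required
  for collapsing the sums over \<open>p\<close> and \<open>q\<close>.\<close>

lemma sm_W:
  assumes \<delta>: "\<delta> \<in> Jdual E" and z: "B' = Bh \<and> z \<in> Pm E \<or> B' = B0 \<and> z = Zero"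
    and H: "\<And>x i. H z k x i \<in> Rx z x" and L: "dit_mod E B gam d v aL"
  shows "(\<Sum>p\<in>Bh. \<Sum>q\<in>B'. dit_mod.sm E aL (dit_mod.sm E aL l (gam q (N.row H z k (f1 (gam p) m)))) (\<delta> (q \<otimes>\<^bsub>\<Lambda>\<^esub> p))) =
    dit_mod.sm E aL l (\<delta> (W H z k m))"
  unfolding W_def
  by (rule dit_mod.sm_pair_sum[OF L \<delta> z, where zz = fst])
    (use finite_Pm in \<open>auto intro!: N.row_Js M.row_Js H F_Rx row_f1 dest: N.row_supp M.row_supp\<close>)

text \<open>In the product of the row of \<open>H\<close> with \<open>F\<close>, the term
  \<open>y = x\<close> uses the diagonal block of \<open>F\<close> and comes from \<open>f0\<close>,
  while the terms with \<open>z < y < x\<close> come from \<open>W\<close>. The term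
  \<open>y = z\<close> is absent; for \<open>z = Zero\<close> there is no such term, and otherwise
  the diagonal block of \<open>H\<close> supplies it elsewhere.\<close>

lemma row_f0_W:
  assumes H: "\<And>x i. H z k x i \<in> Rx z x"
  shows "N.row H z k (f0 m) i x + W H z k m i x =
    (if i = z \<and> x \<in> Pm E \<and> z < x then
      \<Sum>y\<in>Pm E - {z}. \<Sum>j<nN y. H z k y j * (\<Sum>i<nM x. F y j x i * M.co x m i) else 0)"
proof -
  define f where "f y = (\<Sum>j<nN y. H z k y j * (\<Sum>i<nM x. F y j x i * M.co x m i))" for y
  have f_zero: "f y = 0" if "\<not> (z \<le> y \<and> y \<le> x)" for y
    unfolding f_def
  proof (intro sum.neutral ballI)
    fix j
    have "H z k y j = 0 \<or> (\<forall>i. F y j x i = 0)"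
      using that Rx_eq_0[OF H[of y j]] Rx_eq_0[OF F_Rx[of y j x]] by blast
    then show "H z k y j * (\<Sum>i<nM x. F y j x i * M.co x m i) = 0" by auto
  qed
  have W: "W H z k m i x = (\<Sum>y\<in>Pm E. if i = z \<and> x \<in> Pm E \<and> z < y \<and> y < x then f y else 0)"
  proof -
    have "W H z k m i x = (\<Sum>y\<in>Pm E. \<Sum>j<nN y. (N.row H z k (bN y j) \<otimes>\<^bsub>\<Lambda>\<^esub> M.row F y j m) i x)"
      unfolding W_def by (subst sum.Sigma) (use finite_Pm in \<open>auto simp: split_beta\<close>)
    also have "\<dots> = (\<Sum>y\<in>Pm E. if i = z \<and> x \<in> Pm E \<and> z < y \<and> y < x then f y else 0)"
    proof (rule sum.cong[OF refl])
      fix y assume y: "y \<in> Pm E"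
      have "(N.row H z k (bN y j) \<otimes>\<^bsub>\<Lambda>\<^esub> M.row F y j m) i x =
          (if i = z \<and> x \<in> Pm E \<and> z < y \<and> y < x then H z k y j * (\<Sum>i<nM x. F y j x i * M.co x m i) else 0)"
        if j: "j < nN y" for j
      proof -
        have "(N.row H z k (bN y j) \<otimes>\<^bsub>\<Lambda>\<^esub> M.row F y j m) i x =
            (\<Sum>l\<in>Pum E. if l = y then (if i = z \<and> x \<in> Pm E \<and> z < y \<and> y < x then H z k y j * (\<Sum>i<nM x. F y j x i * M.co x m i) else 0) else 0)"
          unfolding Lam_simps(2) N.row_b[where F = H, OF Pm_Pum[OF y] j H]
          by (intro sum.cong refl) (auto simp: mu_def y M.row_def Lam_simps(4))
        then show ?thesis using finite_Pum Pm_Pum[OF y] by auto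
      qed
      then show "(\<Sum>j<nN y. (N.row H z k (bN y j) \<otimes>\<^bsub>\<Lambda>\<^esub> M.row F y j m) i x) =
          (if i = z \<and> x \<in> Pm E \<and> z < y \<and> y < x then f y else 0)"
        by (auto simp: f_def)
    qed
    finally show ?thesis .
  qed
  show ?thesis
  proof (cases "i = z \<and> x \<in> Pm E \<and> z < x")
    case True
    then have x: "x \<in> Pm E" and zx: "z \<noteq> x" by auto
    have "N.row H z k (f0 m) i x = f x"
      using True by (auto simp: N.row_def f_def co_f0[OF Pm_Pum[OF x]] intro!: sum.cong)
    moreover have "W H z k m i x = (\<Sum>y\<in>Pm E - {z} - {x}. f y)"
    proof -
      have "W H z k m i x = (\<Sum>y\<in>Pm E. if z < y \<and> y < x then f y else 0)"
        unfolding W using True by simp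
      also have "\<dots> = (\<Sum>y\<in>Pm E - {z} - {x}. if z < y \<and> y < x then f y else 0)"
        using finite_Pm by (intro sum.mono_neutral_right) auto
      also have "\<dots> = (\<Sum>y\<in>Pm E - {z} - {x}. f y)"
        by (intro sum.cong refl) (use f_zero in \<open>auto simp: less_le\<close>)
      finally show ?thesis .
    qed
    moreover have "(\<Sum>y\<in>Pm E - {z}. f y) = f x + (\<Sum>y\<in>Pm E - {z} - {x}. f y)"
      using finite_Pm x zx by (intro sum.remove) auto
    ultimately show ?thesis using True by (simp add: f_def)
  next
    case False
    then have "W H z k m i x = 0" unfolding W by (intro sum.neutral) (auto dest: less_trans)
    moreover have "N.row H z k (f0 m) i x = 0" using False by (auto simp: N.row_def)
    ultimately show ?thesis using False by auto
  qed
qed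

end

context matrix_pair
begin

text \<open>The diagonal blocks enter the forms by left linearity; this is the product of the
  diagonal of \<open>F\<close> with strictly upper rows.\<close>

lemma f0_sum:
  assumes Y: "Y \<subseteq> Pum E" and \<delta>: "\<delta> \<in> Jdual E" and u: "\<And>y j. u y j \<in> Js E"
  shows "f0 (\<Sum>y\<in>Y. \<Sum>j<nM y. M.sm (bM y j) (\<delta> (u y j))) =
    (\<Sum>y\<in>Y. \<Sum>k<nN y. N.sm (bN y k) (\<delta> (\<lambda>a x. \<Sum>j<nM y. (mu y y (F y k y j) \<otimes>\<^bsub>\<Lambda>\<^esub> u y j) a x)))"
proof -
  have S: "mu y y (F y k y j) \<in> Ss E" for y k j by (rule Ss_mu[OF F_Rx])
  have "f0 (\<Sum>y\<in>Y. \<Sum>j<nM y. M.sm (bM y j) (\<delta> (u y j))) = (\<Sum>y\<in>Y. \<Sum>j<nM y. N.sm (f0 (bM y j)) (\<delta> (u y j)))"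
    by (simp add: additive.sum[OF additive.intro[of f0, OF f0_add]] f0_sm Jdual_Ss[OF \<delta>])
  also have "\<dots> = (\<Sum>y\<in>Y. \<Sum>j<nM y. \<Sum>k<nN y. N.sm (bN y k) (\<delta> (mu y y (F y k y j) \<otimes>\<^bsub>\<Lambda>\<^esub> u y j)))"
  proof (intro sum.cong refl)
    fix y j assume "y \<in> Y" and j: "j \<in> {..<nM y}"
    then have y: "y \<in> Pum E" using Y by blast
    have "N.sm (f0 (bM y j)) (\<delta> (u y j)) = (\<Sum>k<nN y. N.sm (N.sm (bN y k) (mu y y (F y k y j))) (\<delta> (u y j)))"
      using j by (simp add: f0_b y additive.sum[OF N.additive_sm[OF Jdual_Ss[OF \<delta>]]])
    then show "N.sm (f0 (bM y j)) (\<delta> (u y j)) = (\<Sum>k<nN y. N.sm (bN y k) (\<delta> (mu y y (F y k y j) \<otimes>\<^bsub>\<Lambda>\<^esub> u y j)))"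
      by (simp add: N.sm_mult[symmetric] S Jdual_Ss[OF \<delta>] Jdual_left[OF \<delta> S u])
  qed
  also have "\<dots> = (\<Sum>y\<in>Y. \<Sum>k<nN y. \<Sum>j<nM y. N.sm (bN y k) (\<delta> (mu y y (F y k y j) \<otimes>\<^bsub>\<Lambda>\<^esub> u y j)))"
    by (intro sum.cong refl sum.swap)
  also have "\<dots> = (\<Sum>y\<in>Y. \<Sum>k<nN y. N.sm (bN y k) (\<delta> (\<lambda>a x. \<Sum>j<nM y. (mu y y (F y k y j) \<otimes>\<^bsub>\<Lambda>\<^esub> u y j) a x)))"
  proof (intro sum.cong refl)
    fix y k
    define g where "g j = mu y y (F y k y j) \<otimes>\<^bsub>\<Lambda>\<^esub> u y j" for j
    have "(\<Sum>j<nM y. N.sm (bN y k) (\<delta> (g j))) = N.sm (bN y k) (\<lambda>a x. \<Sum>j<nM y. \<delta> (g j) a x)"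
      by (rule N.sm_sum(2)[where f = "\<lambda>j. \<delta> (g j)", symmetric]) (simp_all add: Jdual_Ss[OF \<delta>])
    also have "(\<lambda>a x. \<Sum>j<nM y. \<delta> (g j) a x) = \<delta> (\<lambda>a x. \<Sum>j<nM y. g j a x)"
      by (rule Jdual_finsum(2)[where f = g, OF \<delta>, symmetric]) (simp_all add: g_def Js_mult_left S u)
    finally show "(\<Sum>j<nM y. N.sm (bN y k) (\<delta> (mu y y (F y k y j) \<otimes>\<^bsub>\<Lambda>\<^esub> u y j))) =
        N.sm (bN y k) (\<delta> (\<lambda>a x. \<Sum>j<nM y. (mu y y (F y k y j) \<otimes>\<^bsub>\<Lambda>\<^esub> u y j) a x))"
      unfolding g_def .
  qed
  finally show ?thesis .
qed

text \<open>The matrix equation is the compatibility with \<open>d\<close> on W_0, the only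
  condition that \<open>morphismI\<close> leaves beyond \<open>S\<close>-linearity.\<close>

lemma morphism_exists:
  assumes eq: "\<And>k x i. \<lbrakk>k < nN Zero; x \<in> Pm E; i < nM x\<rbrakk> \<Longrightarrow>
    (\<Sum>j<nM Zero. F Zero k Zero j * M.Mt j x i) = (\<Sum>y\<in>Pm E. \<Sum>j<nN y. N.Mt k y j * F y j x i)"
  shows "\<exists>h. dit_morphism (De E d) aM aN (f0, h) \<and> (\<forall>\<delta>\<in>Ch. \<forall>m. h (w1 E \<delta>) m = f1 \<delta> m)"
proof -
  \<comment> \<open>Only the extension of \<open>f1\<close> to T_1 is wanted, so the second map of
    the triple is taken to be 0.\<close>
  have "bimod_map aN aN (\<lambda>_ _. 0)"
    unfolding bimod_map_def using additive.zero[OF N.additive_sm] by (auto simp: N.sm_def additive_def)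
  then interpret X: triple E B gam d v aM aN aN f1 "\<lambda>_ _. 0"
    by (intro triple.intro triple_axioms.intro M.dit_mod_axioms N.dit_mod_axioms bimod_map_f1 line_datum_axioms)
  let ?H = "\<lambda>_. N.Mt"
  have om: "N.om (f0 m) \<gamma> = f0 (M.om m \<gamma>) + X.F (d (w12 E \<gamma>)) m" if \<gamma>: "\<gamma> \<in> C0" for \<gamma> m
  proof -
    note \<gamma>J = C0_Jdual[OF \<gamma>]
    have z: "B0 = Bh \<and> Zero \<in> Pm E \<or> B0 = B0 \<and> (Zero :: 'p extp) = Zero" by simp
    have "X.F (w1 E (gam p) \<otimes>\<^bsub>Te E\<^esub> w12 E (gam q) \<otimes>\<^bsub>Te E\<^esub> tS (\<gamma> (q \<otimes>\<^bsub>\<Lambda>\<^esub> p))) m =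
        (\<Sum>k<nN Zero. N.sm (N.sm (bN Zero k) (gam q (N.row ?H Zero k (f1 (gam p) m)))) (\<gamma> (q \<otimes>\<^bsub>\<Lambda>\<^esub> p)))"
      if p: "p \<in> Bh" and q: "q \<in> B0" for p q
    proof -
      note P = w1_part[OF gam_Ch[OF p]] w12_part[OF gam_C0[OF q]] tS_part[OF Jdual_Ss[OF \<gamma>J]]
      have PQ: "w1 E (gam p) \<otimes>\<^bsub>Te E\<^esub> w12 E (gam q) \<in> T.Tpart 1" using T.Tpart_mult[OF P(1,2)] by simp
      have "X.F (w1 E (gam p) \<otimes>\<^bsub>Te E\<^esub> w12 E (gam q) \<otimes>\<^bsub>Te E\<^esub> tS (\<gamma> (q \<otimes>\<^bsub>\<Lambda>\<^esub> p))) m =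
          N.sm (N.om (f1 (gam p) m) (gam q)) (\<gamma> (q \<otimes>\<^bsub>\<Lambda>\<^esub> p))"
        by (simp add: X.F_right[OF PQ P(3)] X.F_right[OF P(1,2)] X.F_w1 gam_Ch p N.sm_def N.om_def)
      then show ?thesis
        by (simp add: N.om_eq gam_C0 q additive.sum[OF N.additive_sm[OF Jdual_Ss[OF \<gamma>J]]])
    qed
    then have "X.F (d (w12 E \<gamma>)) m = - (\<Sum>p\<in>Bh. \<Sum>q\<in>B0. \<Sum>k<nN Zero.
        N.sm (N.sm (bN Zero k) (gam q (N.row ?H Zero k (f1 (gam p) m)))) (\<gamma> (q \<otimes>\<^bsub>\<Lambda>\<^esub> p)))"
      by (subst additive_d_w12[where h = "\<lambda>t. X.F t m", OF X.F_plus \<gamma>]) (simp_all add: T.Tpart_carrier)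
    also have "(\<Sum>p\<in>Bh. \<Sum>q\<in>B0. \<Sum>k<nN Zero.
        N.sm (N.sm (bN Zero k) (gam q (N.row ?H Zero k (f1 (gam p) m)))) (\<gamma> (q \<otimes>\<^bsub>\<Lambda>\<^esub> p))) =
      (\<Sum>k<nN Zero. \<Sum>p\<in>Bh. \<Sum>q\<in>B0.
        N.sm (N.sm (bN Zero k) (gam q (N.row ?H Zero k (f1 (gam p) m)))) (\<gamma> (q \<otimes>\<^bsub>\<Lambda>\<^esub> p)))"
      by (subst sum.swap[of _ "{..<nN Zero}"]) (intro sum.cong refl sum.swap)
    also have "\<dots> = (\<Sum>k<nN Zero. N.sm (bN Zero k) (\<gamma> (W ?H Zero k m)))"
      by (intro sum.cong refl sm_W[OF \<gamma>J z N.Mt_Rx N.dit_mod_axioms])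
    finally have F: "X.F (d (w12 E \<gamma>)) m = - (\<Sum>k<nN Zero. N.sm (bN Zero k) (\<gamma> (W ?H Zero k m)))" .
    have rJ: "M.row (\<lambda>_. M.Mt) Zero j m \<in> Js E" for j by (rule M.row_Js[OF M.Mt_Rx])
    define V where "V k = (\<lambda>a x. \<Sum>j<nM Zero. (mu Zero Zero (F Zero k Zero j) \<otimes>\<^bsub>\<Lambda>\<^esub> M.row (\<lambda>_. M.Mt) Zero j m) a x)" for k
    have V: "f0 (M.om m \<gamma>) = (\<Sum>k<nN Zero. N.sm (bN Zero k) (\<gamma> (V k)))"
      using f0_sum[of "{Zero}" \<gamma> "\<lambda>_ j. M.row (\<lambda>_. M.Mt) Zero j m", OF _ \<gamma>J rJ]
      by (simp add: M.om_eq[OF \<gamma>] Zero_Pum V_def)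
    \<comment> \<open>Both sides are rows in \<open>J\<close>: the left one is row \<open>k\<close>
      of the product of N's matrix with \<open>F\<close>, the right one that of F_0 with M's matrix,
      each applied to \<open>m\<close>.\<close>
    have YW: "N.row ?H Zero k (f0 m) \<oplus>\<^bsub>\<Lambda>\<^esub> W ?H Zero k m = V k" if k: "k < nN Zero" for k
    proof (intro ext)
      fix i x
      have "V k i x = (if i = Zero \<and> x \<in> Pm E \<and> Zero < x then \<Sum>j<nM Zero. F Zero k Zero j * (\<Sum>i<nM x. M.Mt j x i * M.co x m i) else 0)"
        unfolding V_def Ss_mult_left[OF Ss_mu[OF F_Rx]] by (auto simp: M.row_def mu_def)
      moreover have "(\<Sum>j<nM Zero. F Zero k Zero j * (\<Sum>i<nM x. M.Mt j x i * M.co x m i)) =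
          (\<Sum>y\<in>Pm E. \<Sum>j<nN y. N.Mt k y j * (\<Sum>i<nM x. F y j x i * M.co x m i))" if x: "x \<in> Pm E"
      proof -
        have "(\<Sum>j<nM Zero. F Zero k Zero j * (\<Sum>i<nM x. M.Mt j x i * M.co x m i)) =
            (\<Sum>i<nM x. (\<Sum>j<nM Zero. F Zero k Zero j * M.Mt j x i) * M.co x m i)"
          by (simp add: sum_distrib_left sum_distrib_right mult.assoc) (rule sum.swap)
        also have "\<dots> = (\<Sum>i<nM x. (\<Sum>y\<in>Pm E. \<Sum>j<nN y. N.Mt k y j * F y j x i) * M.co x m i)"
          by (intro sum.cong refl) (simp add: eq k x)
        also have "\<dots> = (\<Sum>y\<in>Pm E. \<Sum>j<nN y. N.Mt k y j * (\<Sum>i<nM x. F y j x i * M.co x m i))"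
          by (simp add: sum_distrib_left sum_distrib_right mult.assoc)
             (subst sum.swap, intro sum.cong refl sum.swap)
        finally show ?thesis .
      qed
      moreover have "(N.row ?H Zero k (f0 m) \<oplus>\<^bsub>\<Lambda>\<^esub> W ?H Zero k m) i x = N.row ?H Zero k (f0 m) i x + W ?H Zero k m i x"
        by (simp add: Lam_simps(5))
      moreover have "Pm E - {Zero} = Pm E" by simp
      ultimately show "(N.row ?H Zero k (f0 m) \<oplus>\<^bsub>\<Lambda>\<^esub> W ?H Zero k m) i x = V k i x"
        by (simp only: row_f0_W[of ?H Zero k, OF N.Mt_Rx]) simp
    qed
    have "N.sm (bN Zero k) (\<gamma> (N.row ?H Zero k (f0 m))) + N.sm (bN Zero k) (\<gamma> (W ?H Zero k m)) = N.sm (bN Zero k) (\<gamma> (V k))"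
      if k: "k < nN Zero" for k
    proof -
      have "N.row ?H Zero k (f0 m) \<in> Js E" "W ?H Zero k m \<in> Js E"
        by (rule N.row_Js[OF N.Mt_Rx], rule W_Js[OF N.Mt_Rx])
      from Jdual_add[OF \<gamma>J this] show ?thesis
        by (simp add: YW[OF k] N.sm_plus[symmetric] Jdual_Ss[OF \<gamma>J])
    qed
    then have "N.om (f0 m) \<gamma> + (\<Sum>k<nN Zero. N.sm (bN Zero k) (\<gamma> (W ?H Zero k m))) = f0 (M.om m \<gamma>)"
      unfolding V N.om_eq[OF \<gamma>] sum.distrib[symmetric] by simp
    then show ?thesis unfolding F by (simp add: eq_diff_eq)
  qed
  have "dit_morphism (De E d) aM aN (f0, X.F)"
    by (rule X.morphismI[OF f0_add f0_sm om])
  then show ?thesis using X.F_w1 by blast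
qed

end

section \<open>Composition of morphisms given by inverse matrices\<close>

text \<open>One-sided: the product in the other order is covered by a second interpretation with the
  roles exchanged.\<close>

locale inverse_pair =
  MN: matrix_pair E B gam d v aM nM bM aN nN bN F + NM: matrix_pair E B gam d v aN nN bN aM nM bM G
  for E :: "('k::field, 'a::ring_1, 'p::order) poset_datum"
    and B gam d v
    and aM :: "'m::ab_group_add \<Rightarrow> ('a, 'p) te \<Rightarrow> 'm" and nM bM
    and aN :: "'n::ab_group_add \<Rightarrow> ('a, 'p) te \<Rightarrow> 'n" and nN bN F G +
  assumes GF: "\<And>z x k i. \<lbrakk>z \<in> Pm E; x \<in> Pm E; k < nM z; i < nM x\<rbrakk> \<Longrightarrow>
      (\<Sum>y\<in>Pm E. \<Sum>j<nN y. G z k y j * F y j x i) = (if z = x \<and> k = i then eps E x else 0)"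
    and GF_Zero: "\<And>k i. \<lbrakk>k < nM Zero; i < nM Zero\<rbrakk> \<Longrightarrow>
      (\<Sum>j<nN Zero. G Zero k Zero j * F Zero j Zero i) = (if k = i then eps E Zero else 0)"
begin

text \<open>A diagonal block of a product of triangular matrices is the product of the diagonal
  blocks, since \<open>x \<le> y \<le> x\<close> forces \<open>y = x\<close>.\<close>

lemma GF_diag:
  assumes x: "x \<in> Pum E" and "k < nM x" "i < nM x"
  shows "(\<Sum>j<nN x. G x k x j * F x j x i) = (if k = i then eps E x else 0)"
proof (cases "x = Zero")
  case True
  then show ?thesis using GF_Zero assms by simp
next
  case False
  then have xP: "x \<in> Pm E" using x by (simp add: MN.Pum_iff)
  have "(\<Sum>y\<in>Pm E. \<Sum>j<nN y. G x k y j * F y j x i) = (\<Sum>y\<in>{x}. \<Sum>j<nN y. G x k y j * F y j x i)"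
  proof (intro sum.mono_neutral_right ballI sum.neutral)
    fix y j assume "y \<in> Pm E - {x}"
    then have "\<not> (x \<le> y \<and> y \<le> x)" by auto
    then have "G x k y j = 0 \<or> F y j x i = 0"
      using MN.Rx_eq_0[OF NM.F_Rx[of x k y j]] MN.Rx_eq_0[OF MN.F_Rx[of y j x i]] by blast
    then show "G x k y j * F y j x i = 0" by auto
  qed (use xP MN.finite_Pm in auto)
  then show ?thesis using GF[OF xP xP assms(2,3)] by simp
qed

lemma comp_fst: "NM.f0 (MN.f0 m) = m"
proof (rule MN.M.co_eqI)
  fix x k assume x: "x \<in> Pum E" and k: "k < nM x"
  have "MN.M.co x (NM.f0 (MN.f0 m)) k = (\<Sum>j<nN x. G x k x j * (\<Sum>i<nM x. F x j x i * MN.M.co x m i))"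
    by (simp add: NM.co_f0 MN.co_f0 x k cong: sum.cong_simp)
  also have "\<dots> = (\<Sum>i<nM x. (\<Sum>j<nN x. G x k x j * F x j x i) * MN.M.co x m i)"
    by (simp add: sum_distrib_left sum_distrib_right mult.assoc) (rule sum.swap)
  also have "\<dots> = (\<Sum>i<nM x. if i = k then MN.M.co x m k else 0)"
    using MN.Rx_unit(1)[OF MN.M.co_spec(1)[OF x]] by (intro sum.cong refl) (auto simp: GF_diag x k)
  finally show "MN.M.co x (NM.f0 (MN.f0 m)) k = MN.M.co x m k" using k by simp
qed

text \<open>Evaluated on a letter, the second component of the composite is made of forms applied to
  the strictly upper rows of \<open>G\<close> times \<open>F\<close>, and these rows vanish.\<close>

lemma comp_is_id:
  assumes f: "dit_morphism (De E d) aM aN (MN.f0, f1)" and g: "dit_morphism (De E d) aN aM (NM.f0, g1)"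
    and f1: "\<And>\<delta> m. \<delta> \<in> MN.Ch \<Longrightarrow> f1 (w1 E \<delta>) m = MN.f1 \<delta> m"
    and g1: "\<And>\<delta> n. \<delta> \<in> MN.Ch \<Longrightarrow> g1 (w1 E \<delta>) n = NM.f1 \<delta> n"
  shows "dit_is_id (De E d) (dit_comp (De E d) (NM.f0, g1) (MN.f0, f1))"
proof -
  interpret X: triple E B gam d v aM aN aM MN.f1 NM.f1
    by (intro triple.intro triple_axioms.intro MN.M.dit_mod_axioms MN.N.dit_mod_axioms MN.bimod_map_f1
        NM.bimod_map_f1 MN.line_datum_axioms)
  have w1: "NM.f1 \<delta> (MN.f0 m) + NM.f0 (MN.f1 \<delta> m) - X.GF (d (w1 E \<delta>)) m = 0" if \<delta>: "\<delta> \<in> MN.Ch" for \<delta> m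
  proof -
    note \<delta>J = MN.Ch_Jdual[OF \<delta>]
    have "X.GF (w1 E (gam p) \<otimes>\<^bsub>Te E\<^esub> w1 E (gam q) \<otimes>\<^bsub>Te E\<^esub> MN.tS (\<delta> (q \<otimes>\<^bsub>MN.\<Lambda>\<^esub> p))) m =
        (\<Sum>z\<in>Pm E. \<Sum>k<nM z. MN.M.sm (MN.M.sm (bM z k) (gam q (MN.N.row G z k (MN.f1 (gam p) m)))) (\<delta> (q \<otimes>\<^bsub>MN.\<Lambda>\<^esub> p)))"
      if p: "p \<in> MN.Bh" and q: "q \<in> MN.Bh" for p q
    proof -
      note P = MN.w1_part[OF MN.gam_Ch[OF p]] MN.w1_part[OF MN.gam_Ch[OF q]] MN.tS_part[OF MN.Jdual_Ss[OF \<delta>J]]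
      have PQ: "w1 E (gam p) \<otimes>\<^bsub>Te E\<^esub> w1 E (gam q) \<in> MN.T.Tpart 2"
        using MN.T.Tpart_mult[OF P(1,2)] by (simp add: numeral_2_eq_2)
      have "X.GF (w1 E (gam p) \<otimes>\<^bsub>Te E\<^esub> w1 E (gam q) \<otimes>\<^bsub>Te E\<^esub> MN.tS (\<delta> (q \<otimes>\<^bsub>MN.\<Lambda>\<^esub> p))) m =
          MN.M.sm (NM.f1 (gam q) (MN.f1 (gam p) m)) (\<delta> (q \<otimes>\<^bsub>MN.\<Lambda>\<^esub> p))"
        by (simp add: X.GF_right[OF PQ P(3)] X.GF_mult[OF P(1,2)] X.F_w1 X.G_w1 MN.gam_Ch p q MN.M.sm_def)
      then show ?thesis
        by (simp add: NM.f1_def additive.sum[OF MN.M.additive_sm[OF MN.Jdual_Ss[OF \<delta>J]]])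
    qed
    then have "X.GF (d (w1 E \<delta>)) m = - (\<Sum>p\<in>MN.Bh. \<Sum>q\<in>MN.Bh. \<Sum>z\<in>Pm E. \<Sum>k<nM z.
        MN.M.sm (MN.M.sm (bM z k) (gam q (MN.N.row G z k (MN.f1 (gam p) m)))) (\<delta> (q \<otimes>\<^bsub>MN.\<Lambda>\<^esub> p)))"
      by (subst MN.additive_d_w1[where h = "\<lambda>t. X.GF t m", OF X.GF_plus \<delta>]) (simp_all add: MN.T.Tpart_carrier)
    also have "(\<Sum>p\<in>MN.Bh. \<Sum>q\<in>MN.Bh. \<Sum>z\<in>Pm E. \<Sum>k<nM z.
        MN.M.sm (MN.M.sm (bM z k) (gam q (MN.N.row G z k (MN.f1 (gam p) m)))) (\<delta> (q \<otimes>\<^bsub>MN.\<Lambda>\<^esub> p))) =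
      (\<Sum>z\<in>Pm E. \<Sum>k<nM z. \<Sum>p\<in>MN.Bh. \<Sum>q\<in>MN.Bh.
        MN.M.sm (MN.M.sm (bM z k) (gam q (MN.N.row G z k (MN.f1 (gam p) m)))) (\<delta> (q \<otimes>\<^bsub>MN.\<Lambda>\<^esub> p)))"
    proof -
      have "(\<Sum>p\<in>MN.Bh. \<Sum>q\<in>MN.Bh. \<Sum>z\<in>Pm E. \<Sum>k<nM z. h p q z k) =
          (\<Sum>z\<in>Pm E. \<Sum>k<nM z. \<Sum>p\<in>MN.Bh. \<Sum>q\<in>MN.Bh. h p q z k)"
        for h :: "_ \<Rightarrow> _ \<Rightarrow> _ \<Rightarrow> _ \<Rightarrow> 'm"
      proof -
        have "(\<Sum>p\<in>MN.Bh. \<Sum>q\<in>MN.Bh. \<Sum>z\<in>Pm E. \<Sum>k<nM z. h p q z k) =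
            (\<Sum>p\<in>MN.Bh. \<Sum>z\<in>Pm E. \<Sum>q\<in>MN.Bh. \<Sum>k<nM z. h p q z k)"
          by (intro sum.cong refl sum.swap)
        also have "\<dots> = (\<Sum>z\<in>Pm E. \<Sum>p\<in>MN.Bh. \<Sum>k<nM z. \<Sum>q\<in>MN.Bh. h p q z k)"
          by (subst sum.swap) (intro sum.cong refl sum.swap)
        also have "\<dots> = (\<Sum>z\<in>Pm E. \<Sum>k<nM z. \<Sum>p\<in>MN.Bh. \<Sum>q\<in>MN.Bh. h p q z k)"
          by (intro sum.cong refl sum.swap)
        finally show ?thesis .
      qed
      then show ?thesis .
    qed
    also have "\<dots> = (\<Sum>z\<in>Pm E. \<Sum>k<nM z. MN.M.sm (bM z k) (\<delta> (MN.W G z k m)))"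
      by (intro sum.cong refl MN.sm_W[OF \<delta>J _ NM.F_Rx MN.M.dit_mod_axioms]) simp
    finally have GFd: "X.GF (d (w1 E \<delta>)) m = - (\<Sum>z\<in>Pm E. \<Sum>k<nM z. MN.M.sm (bM z k) (\<delta> (MN.W G z k m)))" .
    have rJ: "MN.M.row F z j m \<in> Js E" for z j by (rule MN.M.row_Js[OF MN.F_Rx])
    define V where "V z k = (\<lambda>a x. \<Sum>j<nN z. (mu z z (G z k z j) \<otimes>\<^bsub>MN.\<Lambda>\<^esub> MN.M.row F z j m) a x)" for z k
    have S: "mu z z (G z k z j) \<in> Ss E" for z k j by (rule MN.Ss_mu[OF NM.F_Rx])
    have VJ: "V z k \<in> Js E" for z k
      unfolding V_def by (rule MN.Jdual_finsum(1)[OF \<delta>J]) (auto intro: MN.Js_mult_left S rJ)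
    have V: "NM.f0 (MN.f1 \<delta> m) = (\<Sum>z\<in>Pm E. \<Sum>k<nM z. MN.M.sm (bM z k) (\<delta> (V z k)))"
    proof -
      have "Pm E \<subseteq> Pum E" by (auto simp: MN.Pum_iff)
      from NM.f0_sum[where u = "\<lambda>z j. MN.M.row F z j m", OF this \<delta>J rJ] show ?thesis
        by (simp add: MN.f1_def V_def)
    qed
    \<comment> \<open>The first two summands give the terms with \<open>y \<noteq> z\<close> of the
      product, \<open>V\<close> the term \<open>y = z\<close>; for \<open>z < x\<close> the total is
      an off-diagonal block of the identity.\<close>
    have zero: "(MN.N.row G z k (MN.f0 m) \<oplus>\<^bsub>MN.\<Lambda>\<^esub> MN.W G z k m) \<oplus>\<^bsub>MN.\<Lambda>\<^esub> V z k = \<zero>\<^bsub>MN.\<Lambda>\<^esub>"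
      if z: "z \<in> Pm E" and k: "k < nM z" for z k
    proof (intro ext)
      fix i x
      define f where "f y = (\<Sum>j<nN y. G z k y j * (\<Sum>i<nM x. F y j x i * MN.M.co x m i))" for y
      have Vi: "V z k i x = (if i = z \<and> x \<in> Pm E \<and> z < x then f z else 0)"
        unfolding V_def MN.Ss_mult_left[OF S] by (auto simp: MN.M.row_def mu_def f_def)
      have "(\<Sum>y\<in>Pm E - {z}. f y) + f z = 0" if x: "x \<in> Pm E" and zx: "z < x"
      proof -
        have "(\<Sum>y\<in>Pm E - {z}. f y) + f z = (\<Sum>y\<in>Pm E. f y)"
          using sum.remove[OF MN.finite_Pm z, of f] by (simp add: add.commute)
        also have "\<dots> = (\<Sum>i<nM x. (\<Sum>y\<in>Pm E. \<Sum>j<nN y. G z k y j * F y j x i) * MN.M.co x m i)"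
          unfolding f_def by (simp add: sum_distrib_left sum_distrib_right mult.assoc)
             (subst (2) sum.swap, intro sum.cong refl sum.swap)
        also have "\<dots> = 0" using zx by (intro sum.neutral ballI) (auto simp: GF z x k)
        finally show ?thesis .
      qed
      then show "((MN.N.row G z k (MN.f0 m) \<oplus>\<^bsub>MN.\<Lambda>\<^esub> MN.W G z k m) \<oplus>\<^bsub>MN.\<Lambda>\<^esub> V z k) i x = \<zero>\<^bsub>MN.\<Lambda>\<^esub> i x"
        unfolding MN.Lam_simps(4,5) MN.row_f0_W[OF NM.F_Rx] Vi f_def by auto
    qed
    have "MN.M.sm (bM z k) (\<delta> (MN.N.row G z k (MN.f0 m))) + MN.M.sm (bM z k) (\<delta> (MN.W G z k m)) +
        MN.M.sm (bM z k) (\<delta> (V z k)) = 0" if z: "z \<in> Pm E" and k: "k < nM z" for z k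
    proof -
      note J1 = MN.N.row_Js[of G, OF NM.F_Rx] and J2 = MN.W_Js[of G, OF NM.F_Rx]
      have "MN.M.sm (bM z k) (\<delta> (MN.N.row G z k (MN.f0 m))) + MN.M.sm (bM z k) (\<delta> (MN.W G z k m)) +
          MN.M.sm (bM z k) (\<delta> (V z k)) =
          MN.M.sm (bM z k) (\<delta> ((MN.N.row G z k (MN.f0 m) \<oplus>\<^bsub>MN.\<Lambda>\<^esub> MN.W G z k m) \<oplus>\<^bsub>MN.\<Lambda>\<^esub> V z k))"
        by (simp add: MN.Jdual_add[OF \<delta>J] MN.Js_add J1 J2 VJ MN.M.sm_plus MN.Ss_add MN.Jdual_Ss[OF \<delta>J])
      then show ?thesis by (simp add: zero z k MN.Jdual_zero[OF \<delta>J] MN.M.sm_zero)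
    qed
    then have "(\<Sum>z\<in>Pm E. \<Sum>k<nM z. MN.M.sm (bM z k) (\<delta> (MN.N.row G z k (MN.f0 m))) +
        MN.M.sm (bM z k) (\<delta> (MN.W G z k m)) + MN.M.sm (bM z k) (\<delta> (V z k))) = 0" by simp
    then have "NM.f1 \<delta> (MN.f0 m) + (\<Sum>z\<in>Pm E. \<Sum>k<nM z. MN.M.sm (bM z k) (\<delta> (MN.W G z k m))) +
        NM.f0 (MN.f1 \<delta> m) = 0"
      unfolding V by (simp add: NM.f1_def sum.distrib)
    then show ?thesis unfolding GFd by (simp add: algebra_simps)
  qed
  have "snd (dit_comp (De E d) (NM.f0, g1) (MN.f0, f1)) t m = 0" if "t \<in> MN.T.Tpart 1" for t m
    by (rule X.dit_comp_zero[OF f g f1 g1 w1 that])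
  then show ?thesis by (simp add: dit_is_id_def dit_comp_def comp_fst fun_eq_iff)
qed

end

section \<open>Inverting block triangular matrices\<close>

context line_datum
begin

text \<open>Back substitution along the poset: the blocks of an upward closed set \<open>U\<close>
  are solved before a new minimal element is added. The rows and columns of all blocks share the
  index set \<open>I\<close>, with \<open>\<tau>\<close> naming the block, and \<open>D\<close>
  inverts the diagonal blocks.\<close>

lemma upper_solve:
  fixes I :: "'i set" and \<tau> :: "'i \<Rightarrow> 'c extp"
  assumes fin: "finite I" and \<tau>: "\<And>a. a \<in> I \<Longrightarrow> \<tau> a \<in> Pm E"
    and A: "\<And>a e. \<lbrakk>a \<in> I; e \<in> I\<rbrakk> \<Longrightarrow> A a e \<in> Rx (\<tau> a) (\<tau> e)"
    and D: "\<And>a e. \<lbrakk>a \<in> I; e \<in> I\<rbrakk> \<Longrightarrow> D a e \<in> Rx (\<tau> a) (\<tau> e)"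
    and AD: "\<And>a e. \<lbrakk>a \<in> I; e \<in> I; \<tau> a = \<tau> e\<rbrakk> \<Longrightarrow>
      (\<Sum>c\<in>{c \<in> I. \<tau> c = \<tau> a}. A a c * D c e) = (if a = e then eps E (\<tau> a) else 0)"
    and b: "\<And>a. a \<in> I \<Longrightarrow> b a \<in> Rx (\<tau> a) x"
  shows "\<exists>c. (\<forall>a\<in>I. c a \<in> Rx (\<tau> a) x) \<and> (\<forall>a\<in>I. (\<Sum>e\<in>I. A a e * c e) = b a)"
proof -
  have solve_on: "\<exists>c. (\<forall>a\<in>I. c a \<in> Rx (\<tau> a) x) \<and> (\<forall>a\<in>I. \<tau> a \<notin> U \<longrightarrow> c a = 0) \<and>
      (\<forall>a\<in>I. \<tau> a \<in> U \<longrightarrow> (\<Sum>e\<in>I. A a e * c e) = b a)"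
    if "finite U" "U \<subseteq> Pm E" "\<And>y z. \<lbrakk>y \<in> U; z \<in> Pm E; y \<le> z\<rbrakk> \<Longrightarrow> z \<in> U" for U
    using that
  proof (induction U rule: finite_psubset_induct)
    case (psubset U)
    show ?case
    proof (cases "U = {}")
      case True
      then show ?thesis by (intro exI[of _ "\<lambda>_. 0"]) auto
    next
      case False
      \<comment> \<open>Removing a minimal element keeps \<open>U\<close> upward closed.\<close>
      obtain y0 where y0: "y0 \<in> U" and min: "\<And>y. y \<in> U \<Longrightarrow> y \<le> y0 \<Longrightarrow> y = y0"
        using finite_has_minimal[OF psubset(1) False] by blast
      have up: "z \<in> U - {y0}" if "y \<in> U - {y0}" "z \<in> Pm E" "y \<le> z" for y z
        using that psubset.prems(2) min by blast
      have sub: "U - {y0} \<subset> U" "U - {y0} \<subseteq> Pm E" using y0 psubset.prems(1) by auto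
      obtain c where cc: "(\<forall>a\<in>I. c a \<in> Rx (\<tau> a) x) \<and> (\<forall>a\<in>I. \<tau> a \<notin> U - {y0} \<longrightarrow> c a = 0) \<and>
          (\<forall>a\<in>I. \<tau> a \<in> U - {y0} \<longrightarrow> (\<Sum>e\<in>I. A a e * c e) = b a)"
        using psubset.IH[OF sub up] by (rule exE)
      then have c: "\<And>a. a \<in> I \<Longrightarrow> c a \<in> Rx (\<tau> a) x" "\<And>a. \<lbrakk>a \<in> I; \<tau> a \<notin> U - {y0}\<rbrakk> \<Longrightarrow> c a = 0"
        "\<And>a. \<lbrakk>a \<in> I; \<tau> a \<in> U - {y0}\<rbrakk> \<Longrightarrow> (\<Sum>e\<in>I. A a e * c e) = b a"
        by simp_all
      define I0 where "I0 = {a \<in> I. \<tau> a = y0}"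
      \<comment> \<open>The residue left by the blocks already solved; applying the diagonal inverse
        to it gives the unknowns of block \<open>y0\<close>.\<close>
      define R where "R l = b l - (\<Sum>e\<in>I. A l e * c e)" for l
      define c' where "c' a = (if \<tau> a = y0 then \<Sum>l\<in>I0. D a l * R l else c a)" for a
      have R: "R l \<in> Rx (\<tau> l) x" if "l \<in> I" for l
        unfolding R_def using Rx_add[OF b[OF that] Rx_uminus[OF Rx_sum[OF Rx_mult[OF A[OF that] c(1)]]]] by simp
      have c'R: "c' a \<in> Rx (\<tau> a) x" if "a \<in> I" for a
        unfolding c'_def using c(1) that by (auto intro!: Rx_sum Rx_mult[OF D R] simp: I0_def)
      have split: "(\<Sum>e\<in>I. A a e * c' e) = (\<Sum>e\<in>I. A a e * c e) + (\<Sum>e\<in>I0. A a e * c' e)" for a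
      proof -
        have "(\<Sum>e\<in>I. A a e * c' e) = (\<Sum>e\<in>I. A a e * c e + (if e \<in> I0 then A a e * c' e else 0))"
          by (intro sum.cong refl) (auto simp: I0_def c'_def c(2))
        also have "\<dots> = (\<Sum>e\<in>I. A a e * c e) + (\<Sum>e\<in>I. if e \<in> I0 then A a e * c' e else 0)"
          by (rule sum.distrib)
        also have "(\<Sum>e\<in>I. if e \<in> I0 then A a e * c' e else 0) = (\<Sum>e\<in>I0. A a e * c' e)"
          using fin by (intro sum.mono_neutral_cong_right) (auto simp: I0_def)
        finally show ?thesis .
      qed
      have "(\<Sum>e\<in>I. A a e * c' e) = b a" if a: "a \<in> I" "\<tau> a \<in> U" for a
      proof (cases "\<tau> a = y0")
        case True
        have "(\<Sum>e\<in>I0. A a e * c' e) = (\<Sum>e\<in>I0. \<Sum>l\<in>I0. A a e * D e l * R l)"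
          by (intro sum.cong refl) (auto simp: I0_def c'_def sum_distrib_left mult.assoc)
        also have "\<dots> = (\<Sum>l\<in>I0. (\<Sum>e\<in>I0. A a e * D e l) * R l)"
          by (subst sum.swap) (simp add: sum_distrib_right)
        also have "\<dots> = (\<Sum>l\<in>I0. if l = a then R a else 0)"
        proof (rule sum.cong[OF refl])
          fix l assume "l \<in> I0"
          then have "(\<Sum>e\<in>I0. A a e * D e l) = (if a = l then eps E (\<tau> a) else 0)"
            using AD[of a l] a True by (simp add: I0_def)
          then show "(\<Sum>e\<in>I0. A a e * D e l) * R l = (if l = a then R a else 0)"
            using Rx_unit(1)[OF R[OF a(1)]] by auto
        qed
        also have "\<dots> = R a" using fin a True by (simp add: I0_def)
        finally show ?thesis unfolding split by (simp add: R_def)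
      next
        case False
        \<comment> \<open>The new unknowns do not disturb the solved equations: a block of
          \<open>U\<close> other than the minimal \<open>y0\<close> is not below
          \<open>y0\<close>.\<close>
        have "A a e = 0" if "e \<in> I0" for e
          using that False min[OF a(2)] Rx_eq_0[OF A[OF a(1), of e]] by (auto simp: I0_def)
        then show ?thesis unfolding split using c(3)[OF a(1)] a False by simp
      qed
      moreover have "c' a = 0" if "a \<in> I" "\<tau> a \<notin> U" for a
        using that y0 c(2)[of a] by (auto simp: c'_def)
      ultimately show ?thesis using c'R by (intro exI[of _ c']) blast
    qed
  qed
  have "\<exists>c. (\<forall>a\<in>I. c a \<in> Rx (\<tau> a) x) \<and> (\<forall>a\<in>I. \<tau> a \<notin> Pm E \<longrightarrow> c a = 0) \<and>
      (\<forall>a\<in>I. \<tau> a \<in> Pm E \<longrightarrow> (\<Sum>e\<in>I. A a e * c e) = b a)"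
    by (rule solve_on[OF finite_Pm subset_refl])
  then show ?thesis using \<tau> by auto
qed

lemma upper_right_inverse:
  fixes I :: "'i set" and \<tau> :: "'i \<Rightarrow> 'c extp"
  assumes fin: "finite I" and \<tau>: "\<And>a. a \<in> I \<Longrightarrow> \<tau> a \<in> Pm E"
    and A: "\<And>a e. \<lbrakk>a \<in> I; e \<in> I\<rbrakk> \<Longrightarrow> A a e \<in> Rx (\<tau> a) (\<tau> e)"
    and D: "\<And>a e. \<lbrakk>a \<in> I; e \<in> I\<rbrakk> \<Longrightarrow> D a e \<in> Rx (\<tau> a) (\<tau> e)"
    and AD: "\<And>a e. \<lbrakk>a \<in> I; e \<in> I; \<tau> a = \<tau> e\<rbrakk> \<Longrightarrow>
      (\<Sum>c\<in>{c \<in> I. \<tau> c = \<tau> a}. A a c * D c e) = (if a = e then eps E (\<tau> a) else 0)"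
  obtains H where "\<And>a e. \<lbrakk>a \<in> I; e \<in> I\<rbrakk> \<Longrightarrow> H a e \<in> Rx (\<tau> a) (\<tau> e)"
    "\<And>a e. \<lbrakk>a \<in> I; e \<in> I\<rbrakk> \<Longrightarrow> (\<Sum>c\<in>I. A a c * H c e) = (if a = e then eps E (\<tau> a) else 0)"
proof -
  have "\<exists>c. (\<forall>a\<in>I. c a \<in> Rx (\<tau> a) (\<tau> e)) \<and>
      (\<forall>a\<in>I. (\<Sum>l\<in>I. A a l * c l) = (if a = e then eps E (\<tau> a) else 0))" if "e \<in> I" for e
    by (rule upper_solve[OF fin \<tau> A D AD]) (use \<tau> Pm_Pum eps_Rx in auto)
  then have "\<forall>e\<in>I. \<exists>c. (\<forall>a\<in>I. c a \<in> Rx (\<tau> a) (\<tau> e)) \<and>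
      (\<forall>a\<in>I. (\<Sum>l\<in>I. A a l * c l) = (if a = e then eps E (\<tau> a) else 0))" by blast
  from bchoice[OF this] obtain H where "\<forall>e\<in>I. (\<forall>a\<in>I. H e a \<in> Rx (\<tau> a) (\<tau> e)) \<and>
      (\<forall>a\<in>I. (\<Sum>l\<in>I. A a l * H e l) = (if a = e then eps E (\<tau> a) else 0))" ..
  then show ?thesis by (intro that[of "\<lambda>a e. H e a"]) auto
qed

text \<open>A right inverse \<open>H\<close> has the diagonal blocks of \<open>D\<close>, so it
  satisfies the same hypotheses as \<open>A\<close> and has a right inverse \<open>K\<close>. Then K
  = (A H) K = A (H K) = A, and \<open>H\<close> is two-sided.\<close>

lemma upper_inverse:
  fixes I :: "'i set" and \<tau> :: "'i \<Rightarrow> 'c extp"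
  assumes fin: "finite I" and \<tau>: "\<And>a. a \<in> I \<Longrightarrow> \<tau> a \<in> Pm E"
    and A: "\<And>a e. \<lbrakk>a \<in> I; e \<in> I\<rbrakk> \<Longrightarrow> A a e \<in> Rx (\<tau> a) (\<tau> e)"
    and D: "\<And>a e. \<lbrakk>a \<in> I; e \<in> I\<rbrakk> \<Longrightarrow> D a e \<in> Rx (\<tau> a) (\<tau> e)"
    and AD: "\<And>a e. \<lbrakk>a \<in> I; e \<in> I; \<tau> a = \<tau> e\<rbrakk> \<Longrightarrow>
      (\<Sum>c\<in>{c \<in> I. \<tau> c = \<tau> a}. A a c * D c e) = (if a = e then eps E (\<tau> a) else 0)"
    and DA: "\<And>a e. \<lbrakk>a \<in> I; e \<in> I; \<tau> a = \<tau> e\<rbrakk> \<Longrightarrow>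
      (\<Sum>c\<in>{c \<in> I. \<tau> c = \<tau> a}. D a c * A c e) = (if a = e then eps E (\<tau> a) else 0)"
  obtains H where "\<And>a e. \<lbrakk>a \<in> I; e \<in> I\<rbrakk> \<Longrightarrow> H a e \<in> Rx (\<tau> a) (\<tau> e)"
    "\<And>a e. \<lbrakk>a \<in> I; e \<in> I\<rbrakk> \<Longrightarrow> (\<Sum>c\<in>I. A a c * H c e) = (if a = e then eps E (\<tau> a) else 0)"
    "\<And>a e. \<lbrakk>a \<in> I; e \<in> I\<rbrakk> \<Longrightarrow> (\<Sum>c\<in>I. H a c * A c e) = (if a = e then eps E (\<tau> a) else 0)"
proof -
  obtain H where H: "\<And>a e. \<lbrakk>a \<in> I; e \<in> I\<rbrakk> \<Longrightarrow> H a e \<in> Rx (\<tau> a) (\<tau> e)"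
    and AH: "\<And>a e. \<lbrakk>a \<in> I; e \<in> I\<rbrakk> \<Longrightarrow> (\<Sum>c\<in>I. A a c * H c e) = (if a = e then eps E (\<tau> a) else 0)"
    using upper_right_inverse[OF fin \<tau> A D AD] by blast
  \<comment> \<open>Within one block, \<open>H\<close> is a right inverse and \<open>D\<close> a
    left inverse of the diagonal block of \<open>A\<close>, hence they agree.\<close>
  have diag: "H a e = D a e" if ae: "a \<in> I" "e \<in> I" "\<tau> a = \<tau> e" for a e
  proof -
    let ?J = "{c \<in> I. \<tau> c = \<tau> a}"
    have finJ: "finite ?J" using fin by simp
    have AH': "(\<Sum>c\<in>?J. A l c * H c e) = (if l = e then eps E (\<tau> a) else 0)" if l: "l \<in> ?J" for l
    proof -
      have "(\<Sum>c\<in>?J. A l c * H c e) = (\<Sum>c\<in>I. A l c * H c e)"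
      proof (intro sum.mono_neutral_left fin ballI)
        fix c assume c: "c \<in> I - ?J"
        then have "\<not> (\<tau> l \<le> \<tau> c \<and> \<tau> c \<le> \<tau> e)" using l ae by auto
        then have "A l c = 0 \<or> H c e = 0" using Rx_eq_0[OF A[of l c]] Rx_eq_0[OF H[of c e]] c l ae by blast
        then show "A l c * H c e = 0" by auto
      qed auto
      then show ?thesis using AH[of l e] l ae by auto
    qed
    have "H a e = (\<Sum>c\<in>?J. if c = a then H a e else 0)" using finJ ae by simp
    also have "\<dots> = (\<Sum>c\<in>?J. (\<Sum>l\<in>?J. D a l * A l c) * H c e)"
    proof (rule sum.cong[OF refl])
      fix c assume "c \<in> ?J"
      then have "(\<Sum>l\<in>?J. D a l * A l c) = (if a = c then eps E (\<tau> a) else 0)"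
        using DA[of a c] ae by simp
      then show "(if c = a then H a e else 0) = (\<Sum>l\<in>?J. D a l * A l c) * H c e"
        using Rx_unit(1)[OF H[OF ae(1,2)]] by auto
    qed
    also have "\<dots> = (\<Sum>l\<in>?J. D a l * (\<Sum>c\<in>?J. A l c * H c e))"
      by (simp add: sum_distrib_left sum_distrib_right mult.assoc) (rule sum.swap)
    also have "\<dots> = (\<Sum>l\<in>?J. if l = e then D a e else 0)"
      using AH' Rx_unit(2)[OF D[OF ae(1,2)]] ae(3) by (intro sum.cong refl) auto
    also have "\<dots> = D a e" using finJ ae by simp
    finally show ?thesis .
  qed
  have HA: "(\<Sum>c\<in>{c \<in> I. \<tau> c = \<tau> a}. H a c * A c e) = (if a = e then eps E (\<tau> a) else 0)"
    if "a \<in> I" "e \<in> I" "\<tau> a = \<tau> e" for a e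
  proof -
    have "(\<Sum>c\<in>{c \<in> I. \<tau> c = \<tau> a}. H a c * A c e) = (\<Sum>c\<in>{c \<in> I. \<tau> c = \<tau> a}. D a c * A c e)"
      using diag that by (intro sum.cong refl) auto
    then show ?thesis using DA[OF that] by simp
  qed
  obtain K where K: "\<And>a e. \<lbrakk>a \<in> I; e \<in> I\<rbrakk> \<Longrightarrow> K a e \<in> Rx (\<tau> a) (\<tau> e)"
    and HK: "\<And>a e. \<lbrakk>a \<in> I; e \<in> I\<rbrakk> \<Longrightarrow> (\<Sum>c\<in>I. H a c * K c e) = (if a = e then eps E (\<tau> a) else 0)"
    using upper_right_inverse[OF fin \<tau> H A HA] by blast
  have "K a e = A a e" if ae: "a \<in> I" "e \<in> I" for a e
  proof -
    have "K a e = (\<Sum>c\<in>I. if c = a then K a e else 0)" using fin ae by simp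
    also have "\<dots> = (\<Sum>c\<in>I. (\<Sum>l\<in>I. A a l * H l c) * K c e)"
      using AH[OF ae(1)] Rx_unit(1)[OF K[OF ae]] by (intro sum.cong refl) auto
    also have "\<dots> = (\<Sum>l\<in>I. A a l * (\<Sum>c\<in>I. H l c * K c e))"
      by (simp add: sum_distrib_left sum_distrib_right mult.assoc) (rule sum.swap)
    also have "\<dots> = (\<Sum>l\<in>I. if l = e then A a e else 0)"
      using HK[OF _ ae(2)] Rx_unit(2)[OF A[OF ae]] by (intro sum.cong refl) auto
    also have "\<dots> = A a e" using fin ae by simp
    finally show ?thesis .
  qed
  then show ?thesis using that[of H] H AH HK by simp
qed

end

section \<open>Matrices from morphisms\<close>

locale based_pair = line_datum E B gam d v +
  M: based_mod E B gam d v aM nM bM + N: based_mod E B gam d v aN nN bN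
  for E :: "('k::field, 'a::ring_1, 'p::order) poset_datum"
    and B gam d v
    and aM :: "'m::ab_group_add \<Rightarrow> ('a, 'p) te \<Rightarrow> 'm" and nM bM
    and aN :: "'n::ab_group_add \<Rightarrow> ('a, 'p) te \<Rightarrow> 'n" and nN bN
begin

lemma co_linear:
  assumes add: "\<And>m m'. f0 (m + m') = f0 m + f0 m'"
    and sm: "\<And>s m. s \<in> Ss E \<Longrightarrow> f0 (M.sm m s) = N.sm (f0 m) s" and x: "x \<in> Pum E"
  shows "N.co x (f0 m) k = (\<Sum>i<nM x. N.co x (f0 (bM x i)) k * M.co x m i)"
proof -
  have S: "mu y y (M.co y m i) \<in> Ss E" if "y \<in> Pum E" for y i by (rule Ss_mu[OF M.co_spec(1)[OF that]])
  have "f0 m = (\<Sum>y\<in>Pum E. \<Sum>i<nM y. N.sm (f0 (bM y i)) (mu y y (M.co y m i)))"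
    by (subst M.decompose[of m]) (simp add: additive.sum[OF additive.intro[of f0, OF add]] sm S)
  then have "N.co x (f0 m) k = (\<Sum>y\<in>Pum E. \<Sum>i<nM y. N.co x (N.sm (f0 (bM y i)) (mu y y (M.co y m i))) k)"
    by (simp add: additive.sum[OF N.additive_co[OF x]])
  also have "\<dots> = (\<Sum>y\<in>Pum E. if y = x then \<Sum>i<nM x. N.co x (f0 (bM x i)) k * M.co x m i else 0)"
  proof (rule sum.cong[OF refl])
    fix y assume y: "y \<in> Pum E"
    show "(\<Sum>i<nM y. N.co x (N.sm (f0 (bM y i)) (mu y y (M.co y m i))) k) =
        (if y = x then \<Sum>i<nM x. N.co x (f0 (bM x i)) k * M.co x m i else 0)"
      unfolding N.co_sm[OF x S[OF y]] by (auto simp: mu_def)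
  qed
  also have "\<dots> = (\<Sum>i<nM x. N.co x (f0 (bM x i)) k * M.co x m i)"
    using finite_Pum x by simp
  finally show ?thesis .
qed

text \<open>The size \<open>r\<close> is left free: the lemma is applied to all bases that a
  component admits, in both directions.\<close>

lemma basis_transport:
  assumes add: "\<And>m m'. f0 (m + m') = f0 m + f0 m'"
    and sm: "\<And>s m. s \<in> Ss E \<Longrightarrow> f0 (M.sm m s) = N.sm (f0 m) s"
    and bij: "bij f0" and x: "x \<in> Pum E" and basis: "basis_at E aM x r c"
  shows "basis_at E aN x r (f0 \<circ> c)"
proof -
  have e: "f0 (M.sm m (ei E x)) = N.sm (f0 m) (ei E x)" for m by (rule sm[OF Ss_ei[OF x]])
  have comp: "f0 m \<in> comp_at E aN x \<longleftrightarrow> m \<in> comp_at E aM x" for m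
    unfolding M.comp_at_iff[OF x] N.comp_at_iff[OF x] e[symmetric] using bij by (simp add: bij_def inj_eq)
  have lin: "f0 (lin_comb E aM x r c k) = lin_comb E aN x r (f0 \<circ> c) k" if "k \<in> coeffs_at E x r" for k
  proof -
    have "mu x x (k i) \<in> Ss E" if "i < r" for i
      using \<open>k \<in> coeffs_at E x r\<close> that by (intro Ss_mu) (auto simp: M.coeffs_iff x)
    then show ?thesis
      unfolding M.lin_comb_eq N.lin_comb_eq additive.sum[OF additive.intro[of f0, OF add]] by (simp add: sm)
  qed
  show ?thesis
    unfolding basis_at_def
  proof (intro conjI ballI allI impI)
    show "(f0 \<circ> c) i \<in> comp_at E aN x" if "i < r" for i
      using basis that by (simp add: basis_at_def comp)
    fix m' assume m': "m' \<in> comp_at E aN x"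
    obtain m where m: "m' = f0 m" using bij by (metis bij_pointE)
    then have "m \<in> comp_at E aM x" using m' comp by simp
    then have "\<exists>!k. k \<in> coeffs_at E x r \<and> m = lin_comb E aM x r c k"
      using basis by (simp add: basis_at_def)
    moreover have "m' = lin_comb E aN x r (f0 \<circ> c) k \<longleftrightarrow> m = lin_comb E aM x r c k" if "k \<in> coeffs_at E x r" for k
      unfolding m lin[OF that, symmetric] using bij by (simp add: bij_def inj_eq)
    ultimately show "\<exists>!k. k \<in> coeffs_at E x r \<and> m' = lin_comb E aN x r (f0 \<circ> c) k"
      by (metis (no_types, lifting))
  qed
qed

section \<open>The matrix of a morphism\<close>

text \<open>The diagonal is the matrix of f^0. Above it, the coordinates of the values of f^1 on the
  dual elements become the coefficients of the basis elements \<open>p\<close>, so that applying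
  \<open>gam p\<close> to an entry recovers the coordinate.\<close>

definition fmat where
  "fmat f0 f1 y j x i = (if y = x \<and> x \<in> Pum E then N.co x (f0 (bM x i)) j
     else if y < x \<and> y \<in> Pm E \<and> x \<in> Pm E then
       \<Sum>p\<in>B y x. N.co y (f1 (w1 E (gam p)) (bM x i)) j * p y x
     else 0)"

lemma fmat_Rx: "fmat f0 f1 y j x i \<in> Rx y x"
  using B_single(2)[of y x, THEN Js_Rx]
  by (auto simp: fmat_def Pum_iff intro!: Rx_sum Rx_mult[OF N.co_spec(1)] N.co_spec(1))

text \<open>The compatibility with \<open>d\<close> is evaluated at one element of W_0, the letter
  of \<open>uh x\<close>, and at one basis vector of M_x; the coordinates in N_0, multiplied by
  v_{0,x}, are the entries of the equation.\<close>

lemma fmat_morphism: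
  assumes f: "dit_morphism (De E d) aM aN (f0, f1)" and k: "k < nN Zero" and x: "x \<in> Pm E" and i: "i < nM x"
  shows "(\<Sum>j<nM Zero. fmat f0 f1 Zero k Zero j * M.Mt j x i) =
    (\<Sum>y\<in>Pm E. \<Sum>j<nN y. N.Mt k y j * fmat f0 f1 y j x i)"
proof -
  note h = f[unfolded dit_morphism_iff]
  have add: "f0 (m + m') = f0 m + f0 m'" for m m' using conjunct1[OF h] by simp
  have sm: "f0 (M.sm m s) = N.sm (f0 m) s" if "s \<in> Ss E" for m s using h that by (simp add: M.sm_def N.sm_def)
  note bm = morphism_bimod_map[OF f, unfolded bimod_map_def]
  define F where "F = fmat f0 f1"
  define bb where "bb = bM x i"
  note \<gamma> = uh_C0[OF x] and \<gamma>J = C0_Jdual[OF uh_C0[OF x]] and xP = Pm_Pum[OF x]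
  let ?H = "\<lambda>_. N.Mt"
  let ?A = "Sigma (Pm E) (\<lambda>y. {..<nN y})"
  have finA: "finite ?A" using finite_Pm by simp
  \<comment> \<open>The strictly upper part of the column of \<open>F\<close> at \<open>x\<close>
    and \<open>i\<close>, each entry at its own place in \<open>J\<close>.\<close>
  define u where "u a = mu (fst a) x (if fst a < x then F (fst a) (snd a) x i else 0)" for a
  have uJ: "u a \<in> Js E" for a
  proof (cases "fst a < x")
    case True
    then show ?thesis unfolding u_def F_def by (intro Js_mu) (auto simp: fmat_Rx)
  next
    case False
    then have "u a = \<zero>\<^bsub>\<Lambda>\<^esub>" by (simp add: u_def mu_def Lam_simps(4))
    then show ?thesis using Js_zero by simp
  qed
  \<comment> \<open>The entries were assembled from coordinates of f^1, and the dual elements return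
    these coordinates.\<close>
  have gu: "gam p (u a) = (if p \<in> B (fst a) x \<and> fst a < x then mu (fst a) (fst a) (N.co (fst a) (f1 (w1 E (gam p)) bb) (snd a)) else \<zero>\<^bsub>\<Lambda>\<^esub>)"
    if p: "y \<in> Pm E" "z \<in> Pm E" "y < z" "p \<in> B y z" and a: "a \<in> ?A" for p y z a
  proof -
    have p': "y \<in> Pum E" "z \<in> Pum E" "y < z" "p \<in> B y z" using p by (simp_all add: Pum_iff)
    have aP: "fst a \<in> Pm E" using a by auto
    have loc: "gam p (u a) = gam p (mu y z (u a y z))" by (rule gam_local[OF p' uJ])
    show ?thesis
    proof (cases "fst a = y \<and> z = x")
      case True
      then have yx: "fst a \<in> Pum E" "x \<in> Pum E" "fst a < x" using p' by auto
      define c where "c q = N.co (fst a) (f1 (w1 E (gam q)) bb) (snd a)" for q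
      have cR: "c q \<in> Rx (fst a) (fst a)" for q unfolding c_def by (rule N.co_spec(1)[OF yx(1)])
      have u_eq: "u a = (\<lambda>i j. \<Sum>q\<in>B (fst a) x. (mu (fst a) (fst a) (c q) \<otimes>\<^bsub>\<Lambda>\<^esub> q) i j)"
      proof (intro ext)
        fix i' j
        have "(\<Sum>q\<in>B (fst a) x. (mu (fst a) (fst a) (c q) \<otimes>\<^bsub>\<Lambda>\<^esub> q) i' j) =
            (\<Sum>q\<in>B (fst a) x. mu (fst a) x (c q * q (fst a) x) i' j)"
        proof (rule sum.cong[OF refl])
          fix q assume q: "q \<in> B (fst a) x"
          have "q i' j = mu (fst a) x (q (fst a) x) i' j" by (rule fun_cong[OF fun_cong[OF B_single(1)[OF yx q]]])
          then show "(mu (fst a) (fst a) (c q) \<otimes>\<^bsub>\<Lambda>\<^esub> q) i' j = mu (fst a) x (c q * q (fst a) x) i' j"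
            unfolding Ss_mult_left[OF Ss_mu[OF cR]] by (auto simp: mu_def)
        qed
        then show "u a i' j = (\<Sum>q\<in>B (fst a) x. (mu (fst a) (fst a) (c q) \<otimes>\<^bsub>\<Lambda>\<^esub> q) i' j)"
          using yx aP x by (auto simp: u_def F_def fmat_def mu_def c_def bb_def)
      qed
      have "gam p (u a) = (\<lambda>i j. \<Sum>q\<in>B (fst a) x. gam p (mu (fst a) (fst a) (c q) \<otimes>\<^bsub>\<Lambda>\<^esub> q) i j)"
        unfolding u_eq
        by (rule Jdual_finsum(2)[where f = "\<lambda>q. mu (fst a) (fst a) (c q) \<otimes>\<^bsub>\<Lambda>\<^esub> q", OF gam_Jdual[OF p'] finite_B[OF yx]])
          (rule Js_mult_left[OF Ss_mu[OF cR] B_single(2)[OF yx]])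
      also have "\<dots> = (\<lambda>i j. \<Sum>q\<in>B (fst a) x. if q = p then mu (fst a) (fst a) (c p) i j else 0)"
      proof (intro ext sum.cong refl)
        fix i j q assume q: "q \<in> B (fst a) x"
        have e: "gam p (mu (fst a) (fst a) (c q) \<otimes>\<^bsub>\<Lambda>\<^esub> q) = mu (fst a) (fst a) (c q) \<otimes>\<^bsub>\<Lambda>\<^esub> gam p q"
          by (rule Jdual_left[OF gam_Jdual[OF p'] Ss_mu[OF cR] B_single(2)[OF yx q]])
        have "(mu (fst a) (fst a) (c q) \<otimes>\<^bsub>\<Lambda>\<^esub> gam p q) i j = (if q = p then mu (fst a) (fst a) (c p) i j else 0)"
          using gam_dual[OF p' yx q] True Rx_unit(2)[OF cR[of q]]
          unfolding Ss_mult_left[OF Ss_mu[OF cR]] by (auto simp: ei_def mu_def Lam_simps(4))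
        then show "gam p (mu (fst a) (fst a) (c q) \<otimes>\<^bsub>\<Lambda>\<^esub> q) i j = (if q = p then mu (fst a) (fst a) (c p) i j else 0)"
          using e by simp
      qed
      also have "\<dots> = mu (fst a) (fst a) (c p)"
        using p True finite_B[OF yx] by auto
      finally show ?thesis using p True by (simp add: c_def)
    next
      case False
      then have "u a y z = 0" by (auto simp: u_def mu_def)
      then have "mu y z (u a y z) = \<zero>\<^bsub>\<Lambda>\<^esub>" by (simp add: mu_def Lam_simps(4))
      then have "gam p (u a) = \<zero>\<^bsub>\<Lambda>\<^esub>" using loc Jdual_zero[OF gam_Jdual[OF p']] by simp
      moreover have "\<not> (p \<in> B (fst a) x \<and> fst a < x)"
        using B_unique[OF p', of "fst a" x] False aP xP by (auto simp: Pum_iff)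
      ultimately show ?thesis by auto
    qed
  qed
  \<comment> \<open>Puts f^1 into the form that a matrix would give it, the shape needed for
    \<open>N.sm_pair_sum\<close>.\<close>
  have nn: "f1 (w1 E (gam p)) bb = (\<Sum>a\<in>?A. N.sm (bN (fst a) (snd a)) (gam p (u a)))" if pB: "p \<in> Bh" for p
  proof -
    obtain y z where p: "y \<in> Pm E" "z \<in> Pm E" "y < z" "p \<in> B y z" using pB by (rule BhE)
    have p': "y \<in> Pum E" "z \<in> Pum E" "y < z" "p \<in> B y z" using p by (simp_all add: Pum_iff)
    note gC = gam_Ch[OF pB] and gJ = gam_Jdual[OF p']
    have r: "dual_r E (gam p) (ei E y) = gam p"
    proof
      fix w
      show "dual_r E (gam p) (ei E y) w = gam p w"
        using Rx_unit(2)[OF Ss_Rx[OF Jdual_Ss[OF gJ]], of w y y] gam_value[OF p', of w]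
          mu_mult_right[OF Ss_ei[OF p'(1)], of y y "gam p w y y"]
        unfolding dual_r_def by (simp add: ei_def) (simp add: mu_def)
    qed
    have "f1 (w1 E (gam p)) bb = N.sm (f1 (w1 E (gam p)) bb) (ei E y)"
      using bm gC Ss_ei[OF p'(1)] r by (metis N.sm_def)
    also have "\<dots> = (\<Sum>j<nN y. N.sm (bN y j) (mu y y (N.co y (f1 (w1 E (gam p)) bb) j)))"
      by (rule N.co_spec(3)[OF p'(1)])
    finally have e: "f1 (w1 E (gam p)) bb = (\<Sum>j<nN y. N.sm (bN y j) (mu y y (N.co y (f1 (w1 E (gam p)) bb) j)))" .
    have "(\<Sum>a\<in>?A. N.sm (bN (fst a) (snd a)) (gam p (u a))) = (\<Sum>y'\<in>Pm E. \<Sum>j<nN y'. N.sm (bN y' j) (gam p (u (y', j))))"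
      by (subst sum.Sigma) (use finite_Pm in \<open>auto simp: split_beta\<close>)
    also have "\<dots> = (\<Sum>y'\<in>Pm E. if y' = y then (if z = x then f1 (w1 E (gam p)) bb else 0) else 0)"
    proof (rule sum.cong[OF refl])
      fix y' assume y': "y' \<in> Pm E"
      have "gam p (u (y', j)) = (if y' = y \<and> z = x then mu y y (N.co y (f1 (w1 E (gam p)) bb) j) else \<zero>\<^bsub>\<Lambda>\<^esub>)"
        if "j < nN y'" for j
      proof -
        have "p \<in> B y' x \<and> y' < x \<longleftrightarrow> y' = y \<and> z = x"
          using B_unique[OF p' Pm_Pum[OF y'] xP] p by blast
        then show ?thesis using gu[OF p, of "(y', j)"] that y' by auto
      qed
      then show "(\<Sum>j<nN y'. N.sm (bN y' j) (gam p (u (y', j)))) = (if y' = y then if z = x then f1 (w1 E (gam p)) bb else 0 else 0)"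
        using e by (auto simp: N.sm_zero)
    qed
    also have "\<dots> = (if z = x then f1 (w1 E (gam p)) bb else 0)" using finite_Pm p by simp
    finally have sum: "(\<Sum>a\<in>?A. N.sm (bN (fst a) (snd a)) (gam p (u a))) = (if z = x then f1 (w1 E (gam p)) bb else 0)" .
    show ?thesis
    proof (cases "z = x")
      case False
      \<comment> \<open>A dual element ending at \<open>z\<close> absorbs e_z on the left, and e_z
        annihilates a basis vector of another component; so f^1 vanishes here.\<close>
      have "dual_l E (ei E z) (gam p) = gam p"
      proof
        fix w
        show "dual_l E (ei E z) (gam p) w = gam p w"
        proof (cases "w \<in> Js E")
          case True
          have "(w \<otimes>\<^bsub>\<Lambda>\<^esub> ei E z) y z = w y z"
            using Rx_unit(2)[OF Js_Rx[OF True, of y z]] unfolding Ss_mult_right[OF Ss_ei[OF p'(2)]]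
            by (simp add: ei_def mu_def)
          then show ?thesis
            using gam_local[OF p' True] gam_local[OF p' Js_mult_right[OF Ss_ei[OF p'(2)] True]] True
            by (simp add: dual_l_apply)
        qed (simp add: dual_l_def Jdual_outside[OF gJ])
      qed
      then have "f1 (w1 E (gam p)) bb = f1 (w1 E (gam p)) (M.sm bb (ei E z))"
        using bm gC Ss_ei[OF p'(2)] by (metis M.sm_def)
      also have "M.sm bb (ei E z) = M.sm (M.sm bb (ei E x)) (ei E z)"
        using M.b_ei[OF xP i] by (simp add: bb_def)
      also have "\<dots> = 0" using False by (simp add: M.sm_mult[symmetric] Ss_ei xP p' M.ei_mult_ei M.sm_zero)
      also have "f1 (w1 E (gam p)) 0 = 0"
        using bm gC additive.zero by (metis (no_types, lifting))
      finally show ?thesis using sum False by simp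
    qed (use sum in simp)
  qed
  \<comment> \<open>Row \<open>k\<close> of N's matrix times the column \<open>u\<close>: the
    contribution of the differential.\<close>
  define Z where "Z k = (\<lambda>i j. \<Sum>a\<in>?A. (N.row ?H Zero k (bN (fst a) (snd a)) \<otimes>\<^bsub>\<Lambda>\<^esub> u a) i j)" for k
  have fd: "f1 (d (w12 E (uh x))) bb = - (\<Sum>k<nN Zero. N.sm (bN Zero k) (uh x (Z k)))"
  proof -
    have "f1 (w1 E (gam p) \<otimes>\<^bsub>Te E\<^esub> w12 E (gam q) \<otimes>\<^bsub>Te E\<^esub> tS (uh x (q \<otimes>\<^bsub>\<Lambda>\<^esub> p))) bb =
        (\<Sum>k<nN Zero. N.sm (N.sm (bN Zero k) (gam q (N.row ?H Zero k (f1 (w1 E (gam p)) bb)))) (uh x (q \<otimes>\<^bsub>\<Lambda>\<^esub> p)))"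
      if p: "p \<in> Bh" and q: "q \<in> B0" for p q
    proof -
      note P = w1_part[OF gam_Ch[OF p]] w12_part[OF gam_C0[OF q]] tS_part[OF Jdual_Ss[OF \<gamma>J]]
      have PQ: "w1 E (gam p) \<otimes>\<^bsub>Te E\<^esub> w12 E (gam q) \<in> T.Tpart 1" using T.Tpart_mult[OF P(1,2)] by simp
      have "f1 (w1 E (gam p) \<otimes>\<^bsub>Te E\<^esub> w12 E (gam q) \<otimes>\<^bsub>Te E\<^esub> tS (uh x (q \<otimes>\<^bsub>\<Lambda>\<^esub> p))) bb =
          N.sm (N.om (f1 (w1 E (gam p)) bb) (gam q)) (uh x (q \<otimes>\<^bsub>\<Lambda>\<^esub> p))"
        using h PQ P by (simp add: N.sm_def N.om_def)
      then show ?thesis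
        by (simp add: N.om_eq gam_C0 q additive.sum[OF N.additive_sm[OF Jdual_Ss[OF \<gamma>J]]])
    qed
    then have "f1 (d (w12 E (uh x))) bb = - (\<Sum>p\<in>Bh. \<Sum>q\<in>B0. \<Sum>k<nN Zero.
        N.sm (N.sm (bN Zero k) (gam q (N.row ?H Zero k (f1 (w1 E (gam p)) bb)))) (uh x (q \<otimes>\<^bsub>\<Lambda>\<^esub> p)))"
      by (subst additive_d_w12[where h = "\<lambda>t. f1 t bb", OF _ \<gamma>]) (use h in simp_all)
    also have "(\<Sum>p\<in>Bh. \<Sum>q\<in>B0. \<Sum>k<nN Zero.
        N.sm (N.sm (bN Zero k) (gam q (N.row ?H Zero k (f1 (w1 E (gam p)) bb)))) (uh x (q \<otimes>\<^bsub>\<Lambda>\<^esub> p))) =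
      (\<Sum>k<nN Zero. \<Sum>p\<in>Bh. \<Sum>q\<in>B0.
        N.sm (N.sm (bN Zero k) (gam q (N.row ?H Zero k (f1 (w1 E (gam p)) bb)))) (uh x (q \<otimes>\<^bsub>\<Lambda>\<^esub> p)))"
      by (subst sum.swap[of _ "{..<nN Zero}"]) (intro sum.cong refl sum.swap)
    also have "\<dots> = (\<Sum>k<nN Zero. N.sm (bN Zero k) (uh x (Z k)))"
    proof (rule sum.cong[OF refl])
      fix k
      have z: "B0 = Bh \<and> Zero \<in> Pm E \<or> B0 = B0 \<and> (Zero :: 'p extp) = Zero" by simp
      show "(\<Sum>p\<in>Bh. \<Sum>q\<in>B0. N.sm (N.sm (bN Zero k) (gam q (N.row ?H Zero k (f1 (w1 E (gam p)) bb)))) (uh x (q \<otimes>\<^bsub>\<Lambda>\<^esub> p))) =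
          N.sm (bN Zero k) (uh x (Z k))"
        unfolding Z_def
      proof (rule N.sm_pair_sum[OF \<gamma>J z finA _ _ uJ, where zz = fst])
        fix p assume p: "p \<in> Bh"
        show "N.row ?H Zero k (f1 (w1 E (gam p)) bb) =
            (\<lambda>i l. \<Sum>a\<in>?A. (N.row ?H Zero k (bN (fst a) (snd a)) \<otimes>\<^bsub>\<Lambda>\<^esub> gam p (u a)) i l)"
          unfolding nn[OF p] by (simp add: N.row_sum[OF finA] N.row_sm Jdual_Ss Ch_Jdual gam_Ch p)
      qed (auto intro!: N.row_Js N.Mt_Rx dest: N.row_supp simp: u_def mu_def split: if_splits)
    qed
    finally show ?thesis .
  qed
  \<comment> \<open>The compatibility condition. Its three terms are computed separately: the
    diagonal term of the right-hand product, the left-hand side of the claim, and minus the terms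
    with \<open>y < x\<close>.\<close>
  have om: "N.om (f0 bb) (uh x) = f0 (M.om bb (uh x)) + f1 (d (w12 E (uh x))) bb"
    using h w12_part[OF \<gamma>] by (simp add: N.om_def M.om_def)
  have co0: "N.co Zero (\<Sum>k<nN Zero. N.sm (bN Zero k) (uh x (w k))) k = uh x (w k) Zero Zero" for w
    using N.co_sum_sum[OF Zero_Pum, of "{Zero}" "\<lambda>_ k. uh x (w k)" k] k by (simp add: Zero_Pum Jdual_Ss[OF \<gamma>J])
  have uh0: "uh x w Zero Zero * v x = w Zero x" if "w \<in> Js E" for w
    using that coef_mult_v[OF x Js_Rx[OF that]] by (simp add: uh_def) (simp add: mu_def)
  have ZJ: "Z k \<in> Js E" for k
    unfolding Z_def by (rule Jdual_finsum(1)[OF \<gamma>J finA]) (intro Js_mult N.row_Js N.Mt_Rx uJ)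
  have "N.co Zero (N.om (f0 bb) (uh x)) k * v x = (\<Sum>j<nN x. N.Mt k x j * F x j x i)"
    unfolding N.om_eq[OF \<gamma>] co0 uh0[OF N.row_Js[of ?H, OF N.Mt_Rx]]
    using x Zero_less_Pm[OF x] xP by (simp add: N.row_def F_def fmat_def bb_def)
  moreover have "N.co Zero (f0 (M.om bb (uh x))) k * v x = (\<Sum>j<nM Zero. F Zero k Zero j * M.Mt j x i)"
    using co_linear[of f0 Zero "M.om bb (uh x)" k, OF add sm Zero_Pum] x i
    by (simp add: sum_distrib_right mult.assoc F_def fmat_def Zero_Pum M.Mt_def bb_def)
  moreover have "N.co Zero (f1 (d (w12 E (uh x))) bb) k * v x = - (\<Sum>y\<in>Pm E. \<Sum>j<nN y. if y < x then N.Mt k y j * F y j x i else 0)"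
  proof -
    have "N.co Zero (f1 (d (w12 E (uh x))) bb) k = - uh x (Z k) Zero Zero"
      unfolding fd using co0[of Z] by (simp add: additive.minus[OF N.additive_co[OF Zero_Pum]])
    moreover have "Z k Zero x = (\<Sum>y\<in>Pm E. \<Sum>j<nN y. if y < x then N.Mt k y j * F y j x i else 0)"
    proof -
      have "Z k Zero x = (\<Sum>y\<in>Pm E. \<Sum>j<nN y. (N.row ?H Zero k (bN y j) \<otimes>\<^bsub>\<Lambda>\<^esub> u (y, j)) Zero x)"
        unfolding Z_def by (subst sum.Sigma) (use finite_Pm in \<open>auto simp: split_beta\<close>)
      also have "\<dots> = (\<Sum>y\<in>Pm E. \<Sum>j<nN y. if y < x then N.Mt k y j * F y j x i else 0)"
      proof (intro sum.cong refl)
        fix y j assume y: "y \<in> Pm E" and j: "j \<in> {..<nN y}"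
        have "(N.row ?H Zero k (bN y j) \<otimes>\<^bsub>\<Lambda>\<^esub> u (y, j)) Zero x =
            (\<Sum>l\<in>Pum E. if l = y then if y < x then N.Mt k y j * F y j x i else 0 else 0)"
          unfolding Lam_simps(2) using j Zero_less_Pm[OF y] y
          by (subst N.row_b[of y j ?H Zero k, OF Pm_Pum[OF y] _ N.Mt_Rx]) (auto simp: mu_def u_def intro!: sum.cong)
        then show "(N.row ?H Zero k (bN y j) \<otimes>\<^bsub>\<Lambda>\<^esub> u (y, j)) Zero x = (if y < x then N.Mt k y j * F y j x i else 0)"
          using finite_Pum Pm_Pum[OF y] by simp
      qed
      finally show ?thesis .
    qed
    ultimately show ?thesis using uh0[OF ZJ[of k]] by simp
  qed
  ultimately have "(\<Sum>j<nN x. N.Mt k x j * F x j x i) = (\<Sum>j<nM Zero. F Zero k Zero j * M.Mt j x i) -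
      (\<Sum>y\<in>Pm E. \<Sum>j<nN y. if y < x then N.Mt k y j * F y j x i else 0)"
    using arg_cong[OF om, of "\<lambda>m. N.co Zero m k * v x"] by (simp add: N.co_add Zero_Pum distrib_right)
  \<comment> \<open>Blocks with \<open>y\<close> not below or equal to \<open>x\<close> vanish, so
    the product splits into its diagonal term and the terms with \<open>y < x\<close>.\<close>
  moreover have "(\<Sum>y\<in>Pm E. \<Sum>j<nN y. N.Mt k y j * F y j x i) =
      (\<Sum>j<nN x. N.Mt k x j * F x j x i) + (\<Sum>y\<in>Pm E. \<Sum>j<nN y. if y < x then N.Mt k y j * F y j x i else 0)"
  proof -
    have "(\<Sum>y\<in>Pm E. \<Sum>j<nN y. N.Mt k y j * F y j x i) =
        (\<Sum>y\<in>Pm E. (if y = x then \<Sum>j<nN x. N.Mt k x j * F x j x i else 0) +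
          (\<Sum>j<nN y. if y < x then N.Mt k y j * F y j x i else 0))"
    proof (rule sum.cong[OF refl])
      fix y assume "y \<in> Pm E"
      show "(\<Sum>j<nN y. N.Mt k y j * F y j x i) = (if y = x then \<Sum>j<nN x. N.Mt k x j * F x j x i else 0) +
          (\<Sum>j<nN y. if y < x then N.Mt k y j * F y j x i else 0)"
        by (cases "y = x"; cases "y < x") (auto simp: F_def fmat_def)
    qed
    then show ?thesis using finite_Pm x by (simp add: sum.distrib)
  qed
  ultimately show ?thesis unfolding F_def[symmetric] by simp
qed

end

section \<open>Translation to matrices\<close>

lemma mats_iff: "A \<in> mats n k X \<longleftrightarrow> A \<in> carrier_mat n k \<and> (\<forall>i<n. \<forall>j<k. A $$ (i, j) \<in> X)"
  unfolding mats_def by (auto dest!: elements_matD)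

lemma index_mult_sum:
  "A \<in> carrier_mat n k \<Longrightarrow> B \<in> carrier_mat k m \<Longrightarrow> i < n \<Longrightarrow> j < m \<Longrightarrow>
    (A * B) $$ (i, j) = (\<Sum>l<k. A $$ (i, l) * B $$ (l, j))"
  by (simp add: scalar_prod_def atLeast0LessThan)

lemma eq_mat_iff_entries:
  "A \<in> carrier_mat n k \<Longrightarrow> B \<in> carrier_mat n k \<Longrightarrow> A = B \<longleftrightarrow> (\<forall>i<n. \<forall>j<k. A $$ (i, j) = B $$ (i, j))"
  by (auto simp: mat_eq_iff)

lemma nonsingular_iff:
  "nonsingular n X u A \<longleftrightarrow> A \<in> mats n n X \<and> (\<exists>A'\<in>mats n n X.
     (\<forall>i<n. \<forall>j<n. (\<Sum>l<n. A $$ (i, l) * A' $$ (l, j)) = (if i = j then u else 0)) \<and>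
     (\<forall>i<n. \<forall>j<n. (\<Sum>l<n. A' $$ (i, l) * A $$ (l, j)) = (if i = j then u else 0)))"
proof -
  have "A * A' = u \<cdot>\<^sub>m 1\<^sub>m n \<longleftrightarrow> (\<forall>i<n. \<forall>j<n. (\<Sum>l<n. A $$ (i, l) * A' $$ (l, j)) = (if i = j then u else 0))"
    if "A \<in> carrier_mat n n" "A' \<in> carrier_mat n n" for A A' :: "'a mat"
    using that by (auto simp: mat_eq_iff index_mult_sum[OF that] simp del: index_mult_mat(1))
  then show ?thesis
    unfolding nonsingular_def by (intro conj_cong bex_cong refl) (simp_all add: mats_iff)
qed

context based_mod
begin

lemma stripe_carrier: "stripe E v aM b x \<in> carrier_mat (dimv E aM Zero) (dimv E aM x)"
  by (simp add: stripe_def)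

lemma stripe_entry:
  assumes x: "x \<in> Pm E" and dim: "\<And>y. y \<in> Pum E \<Longrightarrow> dimv E aM y = n y" and k: "k < n Zero" and i: "i < n x"
  shows "stripe E v aM b x $$ (k, i) = co Zero (om (b x i) (uh x)) k"
proof -
  have "stripe E v aM b x $$ (k, i) = (THE c. c \<in> coeffs_at E Zero (n Zero) \<and>
      om (b x i) (uh x) = lin_comb E aM Zero (n Zero) (b Zero) c) k"
    using k i dim[OF Zero_Pum] dim[OF Pm_Pum[OF x]] by (simp add: stripe_def uhat_eq[OF x] om_def)
  then show ?thesis by (simp add: co_def om_uh[OF x, symmetric])
qed

lemma stripe_mult_v:
  assumes "x \<in> Pm E" "\<And>y. y \<in> Pum E \<Longrightarrow> dimv E aM y = n y" "k < n Zero" "i < n x"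
  shows "stripe E v aM b x $$ (k, i) * v x = Mt k x i" "stripe E v aM b x $$ (k, i) \<in> Rx Zero Zero"
  using assms co_spec(1)[OF Zero_Pum] by (simp_all add: stripe_entry Mt_def)

end

section \<open>The stripe equation as an equation of triangular matrices\<close>

locale square_pair = based_pair E B gam d v aM n bM aN n bN
  for E :: "('k::field, 'a::ring_1, 'p::order) poset_datum"
    and B gam d v
    and aM :: "'m::ab_group_add \<Rightarrow> ('a, 'p) te \<Rightarrow> 'm" and n bM
    and aN :: "'n::ab_group_add \<Rightarrow> ('a, 'p) te \<Rightarrow> 'n" and bN +
  assumes dimM: "\<And>x. x \<in> Pum E \<Longrightarrow> dimv E aM x = n x"
    and dimN: "\<And>x. x \<in> Pum E \<Longrightarrow> dimv E aN x = n x"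
begin

text \<open>Assembles the block triangular matrix \<open>T\<close> of the overview; the value 0
  outside the index ranges puts every entry in \<open>Rx y x\<close>.\<close>

definition upper where
  "upper T1 T2 y j x i = (if y = x \<and> x \<in> Pm E \<and> j < n x \<and> i < n x then T1 x $$ (j, i)
     else if y < x \<and> y \<in> Pm E \<and> x \<in> Pm E \<and> j < n y \<and> i < n x then T2 y x $$ (j, i) else 0)"

lemma upper_Rx:
  assumes T1: "\<And>x. x \<in> Pm E \<Longrightarrow> T1 x \<in> mats (n x) (n x) (Rs E x x)"
    and T2: "\<And>y x. y \<in> Pm E \<Longrightarrow> x \<in> Pm E \<Longrightarrow> y < x \<Longrightarrow> T2 y x \<in> mats (n y) (n x) (Rs E y x)"
  shows "upper T1 T2 y j x i \<in> Rx y x"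
  using T1[of x] T2[of y x] Rs_eq_Rx[of x x] Rs_eq_Rx[of y x] by (auto simp: upper_def mats_iff Pm_Pum)

text \<open>Entries of both sides lie in R_0 and may be multiplied by v_{0,x} on the right, which is
  injective. By \<open>phi_spec\<close> and \<open>chi_spec\<close> this replaces the images under
  the two maps by the original entries.\<close>

lemma stripe_eq_iff:
  assumes x: "x \<in> Pm E" and T0: "T0 \<in> mats (n Zero) (n Zero) (Rs E Zero Zero)"
    and T1: "\<And>x. x \<in> Pm E \<Longrightarrow> T1 x \<in> mats (n x) (n x) (Rs E x x)"
    and T2: "\<And>y x. y \<in> Pm E \<Longrightarrow> x \<in> Pm E \<Longrightarrow> y < x \<Longrightarrow> T2 y x \<in> mats (n y) (n x) (Rs E y x)"
  shows "stripe E v aM bM x = T0 * stripe E v aN bN x * map_mat (phi E v x) (T1 x) +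
      mat (n Zero) (n x) (\<lambda>(j, i). \<Sum>y\<in>{y \<in> Pm E. y < x}.
        (T0 * stripe E v aN bN y * map_mat (chi E v y x) (T2 y x)) $$ (j, i)) \<longleftrightarrow>
    (\<forall>k<n Zero. \<forall>i<n x. M.Mt k x i =
      (\<Sum>l<n Zero. T0 $$ (k, l) * (\<Sum>y\<in>Pm E. \<Sum>j<n y. N.Mt l y j * upper T1 T2 y j x i)))"
    (is "?S = ?R \<longleftrightarrow> _")
proof -
  note xP = Pm_Pum[OF x]
  have S: "?S \<in> carrier_mat (n Zero) (n x)" using M.stripe_carrier[of x] dimM[OF Zero_Pum] dimM[OF xP] by simp
  have SN: "stripe E v aN bN y \<in> carrier_mat (n Zero) (n y)" if "y \<in> Pm E" for y
    using N.stripe_carrier[of y] dimN[OF Zero_Pum] dimN[OF Pm_Pum[OF that]] by simp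
  have T0c: "T0 \<in> carrier_mat (n Zero) (n Zero)" using T0 by (simp add: mats_iff)
  have T0R: "T0 $$ (k, l) \<in> Rx Zero Zero" if "k < n Zero" "l < n Zero" for k l
    using T0 that by (simp add: mats_iff Rs_Zero Zero_Pum)
  have T1c: "T1 x \<in> carrier_mat (n x) (n x)" using T1[OF x] by (simp add: mats_iff)
  have T1R: "T1 x $$ (j, i) \<in> Rx x x" if "j < n x" "i < n x" for j i
    using T1[OF x] that by (simp add: mats_iff Rs_eq_Rx xP)
  have T2c: "T2 y x \<in> carrier_mat (n y) (n x)" if "y \<in> Pm E" "y < x" for y
    using T2[OF that(1) x that(2)] by (simp add: mats_iff)
  have T2R: "T2 y x $$ (j, i) \<in> Rx y x" if "y \<in> Pm E" "y < x" "j < n y" "i < n x" for y j i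
    using T2[OF that(1) x that(2)] that by (simp add: mats_iff Rs_eq_Rx xP Pm_Pum)
  have R: "?R \<in> carrier_mat (n Zero) (n x)" using T0c SN[OF x] T1c by simp
  have prod: "(T0 * stripe E v aN bN y * map_mat h A) $$ (k, i) =
      (\<Sum>j<n y. (\<Sum>l<n Zero. T0 $$ (k, l) * stripe E v aN bN y $$ (l, j)) * h (A $$ (j, i)))"
    if y: "y \<in> Pm E" and A: "A \<in> carrier_mat (n y) (n x)" and k: "k < n Zero" and i: "i < n x" for y A h k i
  proof -
    have "T0 * stripe E v aN bN y \<in> carrier_mat (n Zero) (n y)" using T0c SN[OF y] by simp
    then have "(T0 * stripe E v aN bN y * map_mat h A) $$ (k, i) =
        (\<Sum>j<n y. (T0 * stripe E v aN bN y) $$ (k, j) * map_mat h A $$ (j, i))"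
      using A k i by (intro index_mult_sum) auto
    also have "\<dots> = (\<Sum>j<n y. (\<Sum>l<n Zero. T0 $$ (k, l) * stripe E v aN bN y $$ (l, j)) * h (A $$ (j, i)))"
      by (intro sum.cong refl arg_cong2[where f = "(*)"] index_mult_sum[OF T0c SN[OF y] k])
        (use A i in auto)
    finally show ?thesis .
  qed
  \<comment> \<open>Treats both kinds of summand at once: \<open>a j\<close> is an entry of
    \<open>T\<close>, and \<open>c j\<close> its image under \<open>phi\<close> or
    \<open>chi\<close>.\<close>
  have part: "(\<Sum>j<n y. (\<Sum>l<n Zero. T0 $$ (k, l) * stripe E v aN bN y $$ (l, j)) * c j) * v x =
      (\<Sum>l<n Zero. T0 $$ (k, l) * (\<Sum>j<n y. N.Mt l y j * a j))"
      "(\<Sum>j<n y. (\<Sum>l<n Zero. T0 $$ (k, l) * stripe E v aN bN y $$ (l, j)) * c j) \<in> Rx Zero Zero"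
    if y: "y \<in> Pm E" and k: "k < n Zero" and c: "\<And>j. j < n y \<Longrightarrow> c j \<in> Rx Zero Zero" "\<And>j. j < n y \<Longrightarrow> c j * v x = v y * a j"
    for y k a c
  proof -
    have "(\<Sum>j<n y. (\<Sum>l<n Zero. T0 $$ (k, l) * stripe E v aN bN y $$ (l, j)) * c j) * v x =
        (\<Sum>j<n y. \<Sum>l<n Zero. T0 $$ (k, l) * (N.Mt l y j * a j))"
      unfolding sum_distrib_right
    proof (intro sum.cong refl)
      fix j l assume j: "j \<in> {..<n y}" and l: "l \<in> {..<n Zero}"
      have "T0 $$ (k, l) * stripe E v aN bN y $$ (l, j) * c j * v x =
          T0 $$ (k, l) * (stripe E v aN bN y $$ (l, j) * v y * a j)"
        using c(2)[of j] j by (simp add: mult.assoc)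
      then show "T0 $$ (k, l) * stripe E v aN bN y $$ (l, j) * c j * v x = T0 $$ (k, l) * (N.Mt l y j * a j)"
        using N.stripe_mult_v(1)[OF y dimN, of l j] j l by simp
    qed
    also have "\<dots> = (\<Sum>l<n Zero. T0 $$ (k, l) * (\<Sum>j<n y. N.Mt l y j * a j))"
      by (subst sum.swap) (simp add: sum_distrib_left)
    finally show "(\<Sum>j<n y. (\<Sum>l<n Zero. T0 $$ (k, l) * stripe E v aN bN y $$ (l, j)) * c j) * v x =
        (\<Sum>l<n Zero. T0 $$ (k, l) * (\<Sum>j<n y. N.Mt l y j * a j))" .
    show "(\<Sum>j<n y. (\<Sum>l<n Zero. T0 $$ (k, l) * stripe E v aN bN y $$ (l, j)) * c j) \<in> Rx Zero Zero"
      using N.stripe_mult_v(2)[OF y dimN] c(1) T0R[OF k] by (auto intro!: Rx_sum Rx_mult[where y = Zero])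
  qed
  have entry: "?R $$ (k, i) * v x = (\<Sum>l<n Zero. T0 $$ (k, l) * (\<Sum>y\<in>Pm E. \<Sum>j<n y. N.Mt l y j * upper T1 T2 y j x i))"
    and entryR: "?R $$ (k, i) \<in> Rx Zero Zero" if k: "k < n Zero" and i: "i < n x" for k i
  proof -
    let ?P = "\<lambda>y c. \<Sum>j<n y. (\<Sum>l<n Zero. T0 $$ (k, l) * stripe E v aN bN y $$ (l, j)) * c j"
    let ?L = "{y \<in> Pm E. y < x}"
    have Rki: "?R $$ (k, i) = ?P x (\<lambda>j. phi E v x (T1 x $$ (j, i))) + (\<Sum>y\<in>?L. ?P y (\<lambda>j. chi E v y x (T2 y x $$ (j, i))))"
      using k i R T1c prod[OF x T1c k i, of "phi E v x"] prod[OF _ T2c k i] by simp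
    have phi: "phi E v x (T1 x $$ (j, i)) \<in> Rx Zero Zero" "phi E v x (T1 x $$ (j, i)) * v x = v x * upper T1 T2 x j x i" if "j < n x" for j
      using phi_spec[OF x T1R[OF that i]] that i x by (simp_all add: upper_def)
    have chi: "chi E v y x (T2 y x $$ (j, i)) \<in> Rx Zero Zero" "chi E v y x (T2 y x $$ (j, i)) * v x = v y * upper T1 T2 y j x i"
      if "y \<in> ?L" "j < n y" for y j
      using chi_spec[OF _ x T2R[of y j i]] that i x by (auto simp: upper_def)
    have p1: "?P x (\<lambda>j. phi E v x (T1 x $$ (j, i))) * v x = (\<Sum>l<n Zero. T0 $$ (k, l) * (\<Sum>j<n x. N.Mt l x j * upper T1 T2 x j x i))"
      "?P x (\<lambda>j. phi E v x (T1 x $$ (j, i))) \<in> Rx Zero Zero"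
      by (rule part(1)[OF x k]; erule phi) (rule part(2)[OF x k]; erule phi)
    have p2: "?P y (\<lambda>j. chi E v y x (T2 y x $$ (j, i))) * v x = (\<Sum>l<n Zero. T0 $$ (k, l) * (\<Sum>j<n y. N.Mt l y j * upper T1 T2 y j x i))"
      "?P y (\<lambda>j. chi E v y x (T2 y x $$ (j, i))) \<in> Rx Zero Zero" if y: "y \<in> ?L" for y
      using y by (auto intro!: part[OF _ k] chi)
    show "?R $$ (k, i) \<in> Rx Zero Zero"
      unfolding Rki by (rule Rx_add[OF p1(2) Rx_sum[OF p2(2)]])
    have "?R $$ (k, i) * v x = (\<Sum>l<n Zero. T0 $$ (k, l) * (\<Sum>j<n x. N.Mt l x j * upper T1 T2 x j x i)) +
        (\<Sum>y\<in>?L. \<Sum>l<n Zero. T0 $$ (k, l) * (\<Sum>j<n y. N.Mt l y j * upper T1 T2 y j x i))"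
      unfolding Rki distrib_right p1(1) sum_distrib_right[of _ ?L]
      by (intro arg_cong2[where f = "(+)"] sum.cong refl p2(1))
    also have "\<dots> = (\<Sum>y\<in>insert x ?L. \<Sum>l<n Zero. T0 $$ (k, l) * (\<Sum>j<n y. N.Mt l y j * upper T1 T2 y j x i))"
      using finite_Pm by simp
    \<comment> \<open>All other blocks of \<open>upper T1 T2\<close> in column \<open>x\<close> are
      0.\<close>
    also have "\<dots> = (\<Sum>y\<in>Pm E. \<Sum>l<n Zero. T0 $$ (k, l) * (\<Sum>j<n y. N.Mt l y j * upper T1 T2 y j x i))"
      using finite_Pm x by (intro sum.mono_neutral_left) (auto simp: upper_def)
    also have "\<dots> = (\<Sum>l<n Zero. T0 $$ (k, l) * (\<Sum>y\<in>Pm E. \<Sum>j<n y. N.Mt l y j * upper T1 T2 y j x i))"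
      by (subst sum.swap) (simp add: sum_distrib_left)
    finally show "?R $$ (k, i) * v x = (\<Sum>l<n Zero. T0 $$ (k, l) * (\<Sum>y\<in>Pm E. \<Sum>j<n y. N.Mt l y j * upper T1 T2 y j x i))" .
  qed
  have "?S = ?R \<longleftrightarrow> (\<forall>k<n Zero. \<forall>i<n x. ?S $$ (k, i) = ?R $$ (k, i))"
    by (rule eq_mat_iff_entries[OF S R])
  \<comment> \<open>Here v_{0,x} is cancelled, which requires both entries to lie in R_0.\<close>
  also have "\<dots> \<longleftrightarrow> (\<forall>k<n Zero. \<forall>i<n x. ?S $$ (k, i) * v x = ?R $$ (k, i) * v x)"
  proof (intro all_cong1 imp_cong refl iffI)
    fix k i assume k: "k < n Zero" and i: "i < n x" and eq: "?S $$ (k, i) * v x = ?R $$ (k, i) * v x"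
    have "?S $$ (k, i) \<in> Rx Zero Zero" by (rule M.stripe_mult_v(2)[OF x _ k i]) (rule dimM)
    from mult_v_cancel[OF x this entryR[OF k i] eq] show "?S $$ (k, i) = ?R $$ (k, i)" .
  qed (rule arg_cong)
  also have "\<dots> \<longleftrightarrow> (\<forall>k<n Zero. \<forall>i<n x. M.Mt k x i =
      (\<Sum>l<n Zero. T0 $$ (k, l) * (\<Sum>y\<in>Pm E. \<Sum>j<n y. N.Mt l y j * upper T1 T2 y j x i)))"
  proof (intro all_cong1 imp_cong refl)
    fix k i assume k: "k < n Zero" and i: "i < n x"
    have "?S $$ (k, i) * v x = M.Mt k x i" by (rule M.stripe_mult_v(1)[OF x _ k i]) (rule dimM)
    then show "(?S $$ (k, i) * v x = ?R $$ (k, i) * v x) \<longleftrightarrow> M.Mt k x i =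
        (\<Sum>l<n Zero. T0 $$ (k, l) * (\<Sum>y\<in>Pm E. \<Sum>j<n y. N.Mt l y j * upper T1 T2 y j x i))"
      using entry[OF k i] by (rule arg_cong2)
  qed
  finally show ?thesis .
qed

section \<open>From equivalent matrices to an isomorphism\<close>

definition matrix_equivalent where
  "matrix_equivalent T0 T1 T2 \<longleftrightarrow>
     nonsingular (n Zero) (Rs E Zero Zero) (eps E Zero) T0 \<and>
     (\<forall>x\<in>Pm E. nonsingular (n x) (Rs E x x) (eps E x) (T1 x)) \<and>
     (\<forall>y\<in>Pm E. \<forall>x\<in>Pm E. y < x \<longrightarrow> T2 y x \<in> mats (n y) (n x) (Rs E y x)) \<and>
     (\<forall>x\<in>Pm E. stripe E v aM bM x =
        T0 * stripe E v aN bN x * map_mat (phi E v x) (T1 x) +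
        mat (n Zero) (n x) (\<lambda>(j, i). \<Sum>y\<in>{y \<in> Pm E. y < x}.
          (T0 * stripe E v aN bN y * map_mat (chi E v y x) (T2 y x)) $$ (j, i)))"

lemma isomorphic_if_equivalent:
  assumes eqv: "matrix_equivalent T0 T1 T2"
  shows "dit_isomorphic (De E d) aM aN"
proof -
  have T1m: "T1 x \<in> mats (n x) (n x) (Rs E x x)" if "x \<in> Pm E" for x
    using eqv that by (simp add: matrix_equivalent_def nonsingular_iff)
  have T2m: "T2 y x \<in> mats (n y) (n x) (Rs E y x)" if "y \<in> Pm E" "x \<in> Pm E" "y < x" for y x
    using eqv that by (simp add: matrix_equivalent_def)
  have T0m: "T0 \<in> mats (n Zero) (n Zero) (Rs E Zero Zero)"
    using eqv by (simp add: matrix_equivalent_def nonsingular_iff)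
  obtain T0' where T0'm: "T0' \<in> mats (n Zero) (n Zero) (Rs E Zero Zero)"
    and T00': "\<And>i j. i < n Zero \<Longrightarrow> j < n Zero \<Longrightarrow> (\<Sum>l<n Zero. T0 $$ (i, l) * T0' $$ (l, j)) = (if i = j then eps E Zero else 0)"
    and T0'0: "\<And>i j. i < n Zero \<Longrightarrow> j < n Zero \<Longrightarrow> (\<Sum>l<n Zero. T0' $$ (i, l) * T0 $$ (l, j)) = (if i = j then eps E Zero else 0)"
  proof -
    have "nonsingular (n Zero) (Rs E Zero Zero) (eps E Zero) T0" using eqv by (simp add: matrix_equivalent_def)
    then show ?thesis unfolding nonsingular_iff using that by (elim conjE bexE) presburger
  qed
  have "\<forall>x\<in>Pm E. \<exists>A'. A' \<in> mats (n x) (n x) (Rs E x x) \<and>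
     (\<forall>i<n x. \<forall>j<n x. (\<Sum>l<n x. T1 x $$ (i, l) * A' $$ (l, j)) = (if i = j then eps E x else 0)) \<and>
     (\<forall>i<n x. \<forall>j<n x. (\<Sum>l<n x. A' $$ (i, l) * T1 x $$ (l, j)) = (if i = j then eps E x else 0))"
    using eqv unfolding matrix_equivalent_def nonsingular_iff by blast
  from bchoice[OF this] obtain T1' where T1': "\<forall>x\<in>Pm E. T1' x \<in> mats (n x) (n x) (Rs E x x) \<and>
     (\<forall>i<n x. \<forall>j<n x. (\<Sum>l<n x. T1 x $$ (i, l) * T1' x $$ (l, j)) = (if i = j then eps E x else 0)) \<and>
     (\<forall>i<n x. \<forall>j<n x. (\<Sum>l<n x. T1' x $$ (i, l) * T1 x $$ (l, j)) = (if i = j then eps E x else 0))" ..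
  \<comment> \<open>The basis positions of all components over \<open>Pm E\<close>, so that the
    blocks form one square matrix to be inverted.\<close>
  define I where "I = Sigma (Pm E) (\<lambda>x. {..<n x})"
  have finI: "finite I" using finite_Pm by (simp add: I_def)
  define A where "A a e = upper T1 T2 (fst a) (snd a) (fst e) (snd e)" for a e
  \<comment> \<open>The block diagonal matrix of the inverses of the \<open>T1 x\<close>.\<close>
  define D where "D a e = (if fst a = fst e then T1' (fst a) $$ (snd a, snd e) else 0)" for a e
  have A_Rx: "A a e \<in> Rx (fst a) (fst e)" for a e unfolding A_def by (rule upper_Rx[OF T1m T2m])
  have D_Rx: "D a e \<in> Rx (fst a) (fst e)" if "a \<in> I" "e \<in> I" for a e
    using that T1' Rs_eq_Rx[of "fst a" "fst a"] by (auto simp: D_def I_def mats_iff Pm_Pum)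
  have block: "(\<Sum>c\<in>{c \<in> I. fst c = fst a}. f c) = (\<Sum>l<n (fst a). f (fst a, l))" if "a \<in> I" for a and f :: "_ \<Rightarrow> 'a"
  proof -
    have "{c \<in> I. fst c = fst a} = Pair (fst a) ` {..<n (fst a)}" using that by (auto simp: I_def)
    then show ?thesis by (simp add: sum.reindex inj_on_def)
  qed
  have AD: "(\<Sum>c\<in>{c \<in> I. fst c = fst a}. A a c * D c e) = (if a = e then eps E (fst a) else 0)"
    "(\<Sum>c\<in>{c \<in> I. fst c = fst a}. D a c * A c e) = (if a = e then eps E (fst a) else 0)"
    if "a \<in> I" "e \<in> I" "fst a = fst e" for a e
    using that T1' unfolding block[OF that(1)]
    by (auto simp: A_def D_def upper_def I_def prod_eq_iff)
  obtain H where H_Rx: "\<And>a e. \<lbrakk>a \<in> I; e \<in> I\<rbrakk> \<Longrightarrow> H a e \<in> Rx (fst a) (fst e)"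
    and AH: "\<And>a e. \<lbrakk>a \<in> I; e \<in> I\<rbrakk> \<Longrightarrow> (\<Sum>c\<in>I. A a c * H c e) = (if a = e then eps E (fst a) else 0)"
    and HA: "\<And>a e. \<lbrakk>a \<in> I; e \<in> I\<rbrakk> \<Longrightarrow> (\<Sum>c\<in>I. H a c * A c e) = (if a = e then eps E (fst a) else 0)"
    by (rule upper_inverse[where I = I and \<tau> = fst and A = A and D = D])
      (rule finI, fastforce simp: I_def, rule A_Rx, erule (1) D_Rx, erule (2) AD(1), erule (2) AD(2), rule that)
  \<comment> \<open>A morphism needs F_0 on the left of M's matrix, whereas \<open>T0\<close> stands
    on the left of N's; hence \<open>T0'\<close> at \<open>Zero\<close> here and \<open>T0\<close>
    at \<open>Zero\<close> in the inverse \<open>G\<close>.\<close>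
  define F where "F y j x i = (if y = Zero \<and> x = Zero then (if j < n Zero \<and> i < n Zero then T0' $$ (j, i) else 0)
    else upper T1 T2 y j x i)" for y j x i
  define G where "G y j x i = (if y = Zero \<and> x = Zero then (if j < n Zero \<and> i < n Zero then T0 $$ (j, i) else 0)
    else if (y, j) \<in> I \<and> (x, i) \<in> I then H (y, j) (x, i) else 0)" for y j x i
  have F_Rx: "F y j x i \<in> Rx y x" for y j x i
    using T0'm upper_Rx[OF T1m T2m] by (auto simp: F_def mats_iff Rs_Zero Zero_Pum)
  have G_Rx: "G y j x i \<in> Rx y x" for y j x i
    using T0m H_Rx[of "(y, j)" "(x, i)"] by (auto simp: G_def mats_iff Rs_Zero Zero_Pum)
  have F_A: "F y j x i = A (y, j) (x, i)" if "y \<in> Pm E" for y j x i using that by (auto simp: F_def A_def)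
  have G_H: "G y j x i = H (y, j) (x, i)" if "(y, j) \<in> I" "(x, i) \<in> I" for y j x i
    using that by (auto simp: G_def I_def)
  have sumI: "(\<Sum>y\<in>Pm E. \<Sum>j<n y. f (y, j)) = (\<Sum>c\<in>I. f c)" for f :: "_ \<Rightarrow> 'a"
    unfolding I_def by (subst sum.Sigma) (use finite_Pm in \<open>auto simp: split_beta\<close>)
  have FG: "(\<Sum>y\<in>Pm E. \<Sum>j<n y. F z k y j * G y j x i) = (if z = x \<and> k = i then eps E x else 0)"
    and GF: "(\<Sum>y\<in>Pm E. \<Sum>j<n y. G z k y j * F y j x i) = (if z = x \<and> k = i then eps E x else 0)"
    if "z \<in> Pm E" "x \<in> Pm E" "k < n z" "i < n x" for z x k i
  proof -
    have zk: "(z, k) \<in> I" and xi: "(x, i) \<in> I" using that by (auto simp: I_def)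
    have "(\<Sum>y\<in>Pm E. \<Sum>j<n y. F z k y j * G y j x i) = (\<Sum>y\<in>Pm E. \<Sum>j<n y. A (z, k) (y, j) * H (y, j) (x, i))"
      using that xi by (intro sum.cong refl) (auto simp: F_A G_H I_def)
    also have "\<dots> = (\<Sum>c\<in>I. A (z, k) c * H c (x, i))" by (rule sumI)
    finally show "(\<Sum>y\<in>Pm E. \<Sum>j<n y. F z k y j * G y j x i) = (if z = x \<and> k = i then eps E x else 0)"
      using AH[OF zk xi] by auto
    have "(\<Sum>y\<in>Pm E. \<Sum>j<n y. G z k y j * F y j x i) = (\<Sum>y\<in>Pm E. \<Sum>j<n y. H (z, k) (y, j) * A (y, j) (x, i))"
      using that zk by (intro sum.cong refl) (auto simp: F_A G_H I_def)
    also have "\<dots> = (\<Sum>c\<in>I. H (z, k) c * A c (x, i))" by (rule sumI)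
    finally show "(\<Sum>y\<in>Pm E. \<Sum>j<n y. G z k y j * F y j x i) = (if z = x \<and> k = i then eps E x else 0)"
      using HA[OF zk xi] by auto
  qed
  have F0: "F Zero k Zero j = T0' $$ (k, j)" and G0: "G Zero k Zero j = T0 $$ (k, j)" if "k < n Zero" "j < n Zero" for k j
    using that by (simp_all add: F_def G_def)
  have GF0: "(\<Sum>j<n Zero. G Zero k Zero j * F Zero j Zero i) = (if k = i then eps E Zero else 0)"
    and FG0: "(\<Sum>j<n Zero. F Zero k Zero j * G Zero j Zero i) = (if k = i then eps E Zero else 0)"
    if "k < n Zero" "i < n Zero" for k i
    using T00'[OF that] T0'0[OF that] that by (simp_all add: F0 G0)
  have mF: "matrix_pair E B gam d v aM n bM aN n bN F"
    by (intro matrix_pair.intro matrix_pair_axioms.intro based_mod.intro line_datum_axioms M.based_mod_axioms N.based_mod_axioms F_Rx)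
  have mG: "matrix_pair E B gam d v aN n bN aM n bM G"
    by (intro matrix_pair.intro matrix_pair_axioms.intro line_datum_axioms M.based_mod_axioms N.based_mod_axioms G_Rx)
  interpret P: inverse_pair E B gam d v aM n bM aN n bN F G
    by (intro inverse_pair.intro inverse_pair_axioms.intro mF mG GF GF0)
  interpret Q: inverse_pair E B gam d v aN n bN aM n bM G F
    by (intro inverse_pair.intro inverse_pair_axioms.intro mF mG FG FG0)
  have Mt: "M.Mt k x i = (\<Sum>l<n Zero. T0 $$ (k, l) * (\<Sum>y\<in>Pm E. \<Sum>j<n y. N.Mt l y j * F y j x i))"
    if "x \<in> Pm E" "k < n Zero" "i < n x" for k x i
  proof -
    have "(\<Sum>y\<in>Pm E. \<Sum>j<n y. N.Mt l y j * F y j x i) = (\<Sum>y\<in>Pm E. \<Sum>j<n y. N.Mt l y j * upper T1 T2 y j x i)" for l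
      by (intro sum.cong refl) (auto simp: F_def)
    then show ?thesis
      using eqv that stripe_eq_iff[OF that(1) T0m T1m T2m] unfolding matrix_equivalent_def by simp
  qed
  \<comment> \<open>The triangular form of the stripe equation, multiplied by \<open>T0'\<close> on
    the left.\<close>
  have eqF: "(\<Sum>j<n Zero. F Zero k Zero j * M.Mt j x i) = (\<Sum>y\<in>Pm E. \<Sum>j<n y. N.Mt k y j * F y j x i)"
    if k: "k < n Zero" and x: "x \<in> Pm E" and i: "i < n x" for k x i
  proof -
    define q where "q l = (\<Sum>y\<in>Pm E. \<Sum>j<n y. N.Mt l y j * F y j x i)" for l
    have qR: "q l \<in> Rx Zero x" for l unfolding q_def by (intro Rx_sum Rx_mult[OF N.Mt_Rx F_Rx])
    have "(\<Sum>j<n Zero. F Zero k Zero j * M.Mt j x i) = (\<Sum>j<n Zero. \<Sum>l<n Zero. T0' $$ (k, j) * T0 $$ (j, l) * q l)"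
      using k x i by (intro sum.cong refl) (simp add: F0 Mt q_def[symmetric] sum_distrib_left mult.assoc)
    also have "\<dots> = (\<Sum>l<n Zero. (\<Sum>j<n Zero. T0' $$ (k, j) * T0 $$ (j, l)) * q l)"
      by (subst sum.swap) (simp add: sum_distrib_right)
    also have "\<dots> = (\<Sum>l<n Zero. if l = k then q k else 0)"
      using T0'0[OF k] Rx_unit(1)[OF qR] by (intro sum.cong refl) auto
    also have "\<dots> = q k" using k by simp
    finally show ?thesis by (simp add: q_def)
  qed
  \<comment> \<open>M's matrix is \<open>T0\<close> times N's matrix times \<open>F\<close>;
    multiplying by \<open>G\<close> on the right cancels \<open>F\<close>.\<close>
  have eqG: "(\<Sum>j<n Zero. G Zero k Zero j * N.Mt j x i) = (\<Sum>y\<in>Pm E. \<Sum>j<n y. M.Mt k y j * G y j x i)"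
    if k: "k < n Zero" and x: "x \<in> Pm E" and i: "i < n x" for k x i
  proof -
    have "(\<Sum>y\<in>Pm E. \<Sum>j<n y. M.Mt k y j * G y j x i) =
        (\<Sum>y\<in>Pm E. \<Sum>j<n y. (\<Sum>l<n Zero. T0 $$ (k, l) * (\<Sum>c\<in>I. N.Mt l (fst c) (snd c) * F (fst c) (snd c) y j)) * G y j x i)"
      using k by (intro sum.cong refl) (simp add: Mt sumI[symmetric])
    also have "\<dots> = (\<Sum>e\<in>I. (\<Sum>l<n Zero. T0 $$ (k, l) * (\<Sum>c\<in>I. N.Mt l (fst c) (snd c) * F (fst c) (snd c) (fst e) (snd e))) * G (fst e) (snd e) x i)"
      by (simp add: sumI[symmetric])
    also have "\<dots> = (\<Sum>e\<in>I. \<Sum>l<n Zero. \<Sum>c\<in>I. T0 $$ (k, l) * (N.Mt l (fst c) (snd c) * (F (fst c) (snd c) (fst e) (snd e) * G (fst e) (snd e) x i)))"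
      by (simp add: sum_distrib_left sum_distrib_right mult.assoc)
    also have "\<dots> = (\<Sum>l<n Zero. \<Sum>e\<in>I. \<Sum>c\<in>I. T0 $$ (k, l) * (N.Mt l (fst c) (snd c) * (F (fst c) (snd c) (fst e) (snd e) * G (fst e) (snd e) x i)))"
      by (rule sum.swap)
    also have "\<dots> = (\<Sum>l<n Zero. \<Sum>c\<in>I. \<Sum>e\<in>I. T0 $$ (k, l) * (N.Mt l (fst c) (snd c) * (F (fst c) (snd c) (fst e) (snd e) * G (fst e) (snd e) x i)))"
      by (intro sum.cong refl sum.swap)
    also have "\<dots> = (\<Sum>l<n Zero. T0 $$ (k, l) * (\<Sum>c\<in>I. N.Mt l (fst c) (snd c) * (\<Sum>e\<in>I. F (fst c) (snd c) (fst e) (snd e) * G (fst e) (snd e) x i)))"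
      by (simp add: sum_distrib_left)
    also have "\<dots> = (\<Sum>l<n Zero. G Zero k Zero l * N.Mt l x i)"
    proof (intro sum.cong refl arg_cong2[where f = "(*)"])
      fix l assume l: "l \<in> {..<n Zero}"
      show "T0 $$ (k, l) = G Zero k Zero l" using k l by (simp add: G0)
      have "(\<Sum>c\<in>I. N.Mt l (fst c) (snd c) * (\<Sum>e\<in>I. F (fst c) (snd c) (fst e) (snd e) * G (fst e) (snd e) x i)) =
          (\<Sum>c\<in>I. if c = (x, i) then N.Mt l x i else 0)"
      proof (rule sum.cong[OF refl])
        fix c assume c: "c \<in> I"
        have "(\<Sum>e\<in>I. F (fst c) (snd c) (fst e) (snd e) * G (fst e) (snd e) x i) =
            (\<Sum>y\<in>Pm E. \<Sum>j<n y. F (fst c) (snd c) y j * G y j x i)"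
          by (simp add: sumI[symmetric])
        then have "(\<Sum>e\<in>I. F (fst c) (snd c) (fst e) (snd e) * G (fst e) (snd e) x i) = (if c = (x, i) then eps E x else 0)"
          using FG[of "fst c" x "snd c" i] c x i by (auto simp: I_def prod_eq_iff)
        then show "N.Mt l (fst c) (snd c) * (\<Sum>e\<in>I. F (fst c) (snd c) (fst e) (snd e) * G (fst e) (snd e) x i) =
            (if c = (x, i) then N.Mt l x i else 0)"
          using Rx_unit(2)[OF N.Mt_Rx] by auto
      qed
      also have "\<dots> = N.Mt l x i" using finI x i by (simp add: I_def)
      finally show "(\<Sum>c\<in>I. N.Mt l (fst c) (snd c) * (\<Sum>e\<in>I. F (fst c) (snd c) (fst e) (snd e) * G (fst e) (snd e) x i)) = N.Mt l x i" .
    qed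
    finally show ?thesis by simp
  qed
  obtain f1 where f: "dit_morphism (De E d) aM aN (P.MN.f0, f1)" and f1: "\<And>\<delta> m. \<delta> \<in> Ch \<Longrightarrow> f1 (w1 E \<delta>) m = P.MN.f1 \<delta> m"
    using P.MN.morphism_exists[OF eqF] by blast
  obtain g1 where g: "dit_morphism (De E d) aN aM (P.NM.f0, g1)" and g1: "\<And>\<delta> m. \<delta> \<in> Ch \<Longrightarrow> g1 (w1 E \<delta>) m = P.NM.f1 \<delta> m"
    using P.NM.morphism_exists[OF eqG] by blast
  show ?thesis
    unfolding dit_isomorphic_def using f g P.comp_is_id[OF f g f1 g1] Q.comp_is_id[OF g f g1 f1] by blast
qed

end

section \<open>From an isomorphism to equivalent matrices\<close>

context based_pair
begin

lemma morphism_linear: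
  assumes "dit_morphism (De E d) aM aN (f0, f1)"
  shows "f0 (m + m') = f0 m + f0 m'" "s \<in> Ss E \<Longrightarrow> f0 (M.sm m s) = N.sm (f0 m) s"
  using assms[unfolded dit_morphism_iff] by (simp_all add: M.sm_def N.sm_def)

lemma isomorphicE:
  assumes "dit_isomorphic (De E d) aM aN"
  obtains f0 f1 g0 g1 where "dit_morphism (De E d) aM aN (f0, f1)" "dit_morphism (De E d) aN aM (g0, g1)"
    "\<And>m. g0 (f0 m) = m" "\<And>m. f0 (g0 m) = m"
proof -
  obtain f g where "dit_morphism (De E d) aM aN f" "dit_morphism (De E d) aN aM g"
    "dit_is_id (De E d) (dit_comp (De E d) g f)" "dit_is_id (De E d) (dit_comp (De E d) f g)"
    using assms unfolding dit_isomorphic_def by blast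
  then show ?thesis
    using that[of "fst f" "snd f" "fst g" "snd g"] by (simp add: dit_is_id_def dit_comp_def fun_eq_iff)
qed

text \<open>An isomorphism carries bases of each size in both directions, so the predicates inside
  the two definite descriptions coincide.\<close>

lemma dimv_isomorphic:
  assumes iso: "dit_isomorphic (De E d) aM aN" and x: "x \<in> Pum E"
  shows "dimv E aM x = dimv E aN x"
proof -
  interpret R: based_pair E B gam d v aN nN bN aM nM bM
    by (intro based_pair.intro line_datum_axioms M.based_mod_axioms N.based_mod_axioms)
  obtain f0 f1 g0 g1 where f: "dit_morphism (De E d) aM aN (f0, f1)" and g: "dit_morphism (De E d) aN aM (g0, g1)"
    and gf: "\<And>m. g0 (f0 m) = m" and fg: "\<And>m. f0 (g0 m) = m"
    using isomorphicE[OF iso] by metis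
  have "bij f0" using gf fg by (metis bijI')
  have "bij g0" using gf fg by (metis bijI')
  have "(\<lambda>r. \<exists>b. basis_at E aM x r b) = (\<lambda>r. \<exists>b. basis_at E aN x r b)"
    using basis_transport[OF morphism_linear[OF f] \<open>bij f0\<close> x]
      R.basis_transport[OF R.morphism_linear[OF g] \<open>bij g0\<close> x] by blast
  then show ?thesis by (simp add: dimv_def)
qed

end

context square_pair
begin

lemma nonsingularI:
  assumes x: "x \<in> Pum E" and h: "\<And>i j. h i j \<in> Rx x x" and h': "\<And>i j. h' i j \<in> Rx x x"
    and hh': "\<And>i j. i < n x \<Longrightarrow> j < n x \<Longrightarrow> (\<Sum>l<n x. h i l * h' l j) = (if i = j then eps E x else 0)"
    and h'h: "\<And>i j. i < n x \<Longrightarrow> j < n x \<Longrightarrow> (\<Sum>l<n x. h' i l * h l j) = (if i = j then eps E x else 0)"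
  shows "nonsingular (n x) (Rs E x x) (eps E x) (mat (n x) (n x) (\<lambda>(i, j). h i j))"
  unfolding nonsingular_iff
proof (intro conjI bexI[of _ "mat (n x) (n x) (\<lambda>(i, j). h' i j)"])
qed (use assms in \<open>auto simp: mats_iff Rs_eq_Rx\<close>)

lemma equivalent_if_isomorphic:
  assumes iso: "dit_isomorphic (De E d) aM aN"
  shows "\<exists>T0 T1 T2. matrix_equivalent T0 T1 T2"
proof -
  interpret R: based_pair E B gam d v aN n bN aM n bM
    by (intro based_pair.intro line_datum_axioms M.based_mod_axioms N.based_mod_axioms)
  obtain f0 f1 g0 g1 where f: "dit_morphism (De E d) aM aN (f0, f1)" and g: "dit_morphism (De E d) aN aM (g0, g1)"
    and gf: "\<And>m. g0 (f0 m) = m" and fg: "\<And>m. f0 (g0 m) = m"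
    using isomorphicE[OF iso] by metis
  define fm where "fm x j i = N.co x (f0 (bM x i)) j" for x j i
  define gm where "gm x j i = M.co x (g0 (bN x i)) j" for x j i
  have fm_Rx: "fm x j i \<in> Rx x x" and gm_Rx: "gm x j i \<in> Rx x x" if "x \<in> Pum E" for x j i
    unfolding fm_def gm_def by (rule N.co_spec(1)[OF that], rule M.co_spec(1)[OF that])
  have gf_sum: "(\<Sum>l<n x. gm x k l * fm x l i) = (if k = i then eps E x else 0)"
    and fg_sum: "(\<Sum>l<n x. fm x k l * gm x l i) = (if k = i then eps E x else 0)" if x: "x \<in> Pum E" and i: "i < n x" for x k i
    using R.co_linear[OF R.morphism_linear[OF g] x, of "f0 (bM x i)" k] M.co_b[OF x x i, of k]
      co_linear[OF morphism_linear[OF f] x, of "g0 (bN x i)" k] N.co_b[OF x x i, of k]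
    by (simp_all add: fm_def gm_def gf fg)
  \<comment> \<open>F_0 comes from f^0, and \<open>T0\<close> has to be its inverse, which is the
    matrix of g^0 at \<open>Zero\<close>.\<close>
  define T0 where "T0 = mat (n Zero) (n Zero) (\<lambda>(k, j). gm Zero k j)"
  define T1 where "T1 x = mat (n x) (n x) (\<lambda>(j, i). fm x j i)" for x
  define T2 where "T2 y x = mat (n y) (n x) (\<lambda>(j, i). fmat f0 f1 y j x i)" for y x
  have T0: "nonsingular (n Zero) (Rs E Zero Zero) (eps E Zero) T0"
    unfolding T0_def by (rule nonsingularI[of Zero, OF Zero_Pum gm_Rx fm_Rx gf_sum fg_sum]) (auto simp: Zero_Pum)
  have T1: "nonsingular (n x) (Rs E x x) (eps E x) (T1 x)" if "x \<in> Pm E" for x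
    unfolding T1_def by (rule nonsingularI[OF _ fm_Rx gm_Rx fg_sum gf_sum]) (use that in \<open>auto simp: Pm_Pum\<close>)
  have T2: "T2 y x \<in> mats (n y) (n x) (Rs E y x)" if "y \<in> Pm E" "x \<in> Pm E" "y < x" for y x
    using that fmat_Rx by (simp add: mats_iff T2_def Rs_eq_Rx Pm_Pum)
  have "M.Mt k x i = (\<Sum>l<n Zero. T0 $$ (k, l) * (\<Sum>y\<in>Pm E. \<Sum>j<n y. N.Mt l y j * upper T1 T2 y j x i))"
    if x: "x \<in> Pm E" and k: "k < n Zero" and i: "i < n x" for x k i
  proof -
    have "(\<Sum>l<n Zero. T0 $$ (k, l) * (\<Sum>y\<in>Pm E. \<Sum>j<n y. N.Mt l y j * upper T1 T2 y j x i)) =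
        (\<Sum>l<n Zero. \<Sum>j<n Zero. gm Zero k l * fm Zero l j * M.Mt j x i)"
    proof (rule sum.cong[OF refl])
      fix l assume "l \<in> {..<n Zero}"
      then have l: "l < n Zero" by simp
      \<comment> \<open>Inside the index ranges \<open>upper T1 T2\<close> is
        \<open>fmat f0 f1\<close>, so \<open>fmat_morphism\<close> applies.\<close>
      have "(\<Sum>y\<in>Pm E. \<Sum>j<n y. N.Mt l y j * upper T1 T2 y j x i) = (\<Sum>y\<in>Pm E. \<Sum>j<n y. N.Mt l y j * fmat f0 f1 y j x i)"
        using x i by (intro sum.cong refl) (auto simp: upper_def fmat_def T1_def T2_def fm_def Pm_Pum)
      also have "\<dots> = (\<Sum>j<n Zero. fm Zero l j * M.Mt j x i)"
        by (simp add: fmat_morphism[OF f l x i, symmetric]) (simp add: fmat_def fm_def Zero_Pum)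
      finally show "T0 $$ (k, l) * (\<Sum>y\<in>Pm E. \<Sum>j<n y. N.Mt l y j * upper T1 T2 y j x i) =
          (\<Sum>j<n Zero. gm Zero k l * fm Zero l j * M.Mt j x i)"
        using k l by (simp add: T0_def sum_distrib_left mult.assoc)
    qed
    also have "\<dots> = (\<Sum>j<n Zero. (\<Sum>l<n Zero. gm Zero k l * fm Zero l j) * M.Mt j x i)"
      by (subst sum.swap) (simp add: sum_distrib_right)
    \<comment> \<open>The matrices of g^0 and f^0 at \<open>Zero\<close> cancel.\<close>
    also have "\<dots> = (\<Sum>j<n Zero. if j = k then M.Mt k x i else 0)"
      using Rx_unit(1)[OF M.Mt_Rx, of k x i] by (intro sum.cong refl) (simp add: gf_sum Zero_Pum)
    also have "\<dots> = M.Mt k x i" using k by simp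
    finally show ?thesis by simp
  qed
  moreover have "T0 \<in> mats (n Zero) (n Zero) (Rs E Zero Zero)" "\<And>x. x \<in> Pm E \<Longrightarrow> T1 x \<in> mats (n x) (n x) (Rs E x x)"
    using T0 T1 by (simp_all add: nonsingular_iff)
  ultimately have "stripe E v aM bM x = T0 * stripe E v aN bN x * map_mat (phi E v x) (T1 x) +
      mat (n Zero) (n x) (\<lambda>(j, i). \<Sum>y\<in>{y \<in> Pm E. y < x}.
        (T0 * stripe E v aN bN y * map_mat (chi E v y x) (T2 y x)) $$ (j, i))" if "x \<in> Pm E" for x
    using that T2 by (subst stripe_eq_iff) auto
  then have "matrix_equivalent T0 T1 T2"
    unfolding matrix_equivalent_def using T0 T1 T2 by blast
  then show ?thesis by blast
qed

end

lemma field_sub_ring: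
  assumes "field (sub_ring X u)"
  shows "u \<noteq> 0" "c \<in> X \<Longrightarrow> c \<noteq> 0 \<Longrightarrow> \<exists>c'. c' * c = u"
proof -
  interpret field "sub_ring X u" by (rule assms)
  show "u \<noteq> 0" using one_not_zero by (simp add: sub_ring_def)
  assume "c \<in> X" "c \<noteq> 0"
  then have "c \<in> Units (sub_ring X u)" unfolding field_Units by (simp add: sub_ring_def)
  then show "\<exists>c'. c' * c = u" by (auto simp: Units_def sub_ring_def)
qed

theorem theorem36:
  fixes E :: "('k::field, 'a::ring_1, 'p::order) poset_datum"
    and v :: "'p extp \<Rightarrow> 'a"
    and B :: "'p extp \<Rightarrow> 'p extp \<Rightarrow> ('a, 'p) lam set"
    and gam :: "('a, 'p) lam \<Rightarrow> ('a, 'p) dual"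
    and d :: "('a, 'p) te \<Rightarrow> ('a, 'p) te"
    and aM :: "'m::ab_group_add \<Rightarrow> ('a, 'p) te \<Rightarrow> 'm"
    and aN :: "'n::ab_group_add \<Rightarrow> ('a, 'p) te \<Rightarrow> 'n"
    and bM :: "'p extp \<Rightarrow> nat \<Rightarrow> 'm"
    and bN :: "'p extp \<Rightarrow> nat \<Rightarrow> 'n"
  assumes "extendable E"
    and "\<And>x. x \<in> Pum E \<Longrightarrow> field (sub_ring (Rs E x x) (eps E x))"
    and "\<And>x. x \<in> Pum E \<Longrightarrow>
           \<exists>r\<in>Rs E Zero x. r \<noteq> 0 \<and> Rs E Zero x = (\<lambda>c. c * r) ` Rs E Zero Zero"
    and "\<And>x. x \<in> Pm E \<Longrightarrow>
           v x \<in> Rs E Zero x \<and> Rs E Zero x = (\<lambda>c. c * v x) ` Rs E Zero Zero"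
    and "dual_basis E B gam"
    and "De_differential E B gam d"
    and "fd_dit_module (De E d) aM" and "local_basis E aM bM"
    and "fd_dit_module (De E d) aN" and "local_basis E aN bN"
  shows "dit_isomorphic (De E d) aM aN \<longleftrightarrow>
    (\<forall>x\<in>Pum E. dimv E aM x = dimv E aN x) \<and>
    (\<exists>T0 T1 T2.
       nonsingular (dimv E aM Zero) (Rs E Zero Zero) (eps E Zero) T0 \<and>
       (\<forall>x\<in>Pm E. nonsingular (dimv E aM x) (Rs E x x) (eps E x) (T1 x)) \<and>
       (\<forall>y\<in>Pm E. \<forall>x\<in>Pm E. y < x \<longrightarrow>
          T2 y x \<in> mats (dimv E aM y) (dimv E aM x) (Rs E y x)) \<and>
       (\<forall>x\<in>Pm E. stripe E v aM bM x =
          T0 * stripe E v aN bN x * map_mat (phi E v x) (T1 x) +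
          mat (dimv E aM Zero) (dimv E aM x) (\<lambda>(j, i).
            \<Sum>y\<in>{y \<in> Pm E. y < x}.
              (T0 * stripe E v aN bN y * map_mat (chi E v y x) (T2 y x)) $$ (j, i))))"
proof -
  have line: "line_datum E B gam d v"
  proof (intro line_datum.intro dit_datum.intro extendable_datum.intro dit_datum_axioms.intro line_datum_axioms.intro assms)
    show "eps E x \<noteq> 0" if "x \<in> Pum E" for x by (rule field_sub_ring(1)[OF assms(2)[OF that]])
    show "\<exists>c'. c' * c = eps E Zero" if "c \<in> Rs E Zero Zero" "c \<noteq> 0" for c
      by (rule field_sub_ring(2)[OF assms(2) that]) (simp add: Pum_def)
    \<comment> \<open>All multiples of a zero generator vanish, while R_{0,x} contains a non-zero
      element by one-dimensionality.\<close>
    show "v x \<noteq> 0" if "x \<in> Pm E" for x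
    proof
      assume "v x = 0"
      then have "Rs E Zero x \<subseteq> {0}" using assms(4)[OF that] by auto
      then show False using assms(3)[of x] that by (auto simp: Pum_def)
    qed
  qed
  have based: "based_mod E B gam d v aM (dimv E aM) bM" "based_mod E B gam d v aN (dimv E aN) bN"
    using assms(7-10)
    by (auto intro!: based_mod.intro dit_mod.intro dit_mod_axioms.intro based_mod_axioms.intro line
      simp: fd_dit_module_def local_basis_def)
  have dims: "dimv E aM x = dimv E aN x" if "dit_isomorphic (De E d) aM aN" "x \<in> Pum E" for x
    by (rule based_pair.dimv_isomorphic[OF based_pair.intro[OF line based] that])
  have square: "square_pair E B gam d v aM (dimv E aM) bM aN bN" if "\<forall>x\<in>Pum E. dimv E aM x = dimv E aN x"
  proof (intro square_pair.intro square_pair_axioms.intro based_pair.intro line based)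
    show "based_mod E B gam d v aN (dimv E aM) bN"
      using based(2) that by (simp add: based_mod_def based_mod_axioms_def)
  qed (use that in simp_all)
  show ?thesis
  \<comment> \<open>\<open>square_pair\<close> needs a common dimension vector; if the two vectors
    differ, both sides of the equivalence are false.\<close>
  proof (cases "\<forall>x\<in>Pum E. dimv E aM x = dimv E aN x")
    case True
    then interpret square_pair E B gam d v aM "dimv E aM" bM aN bN by (rule square)
    show ?thesis
      unfolding matrix_equivalent_def[symmetric]
      using True equivalent_if_isomorphic isomorphic_if_equivalent by blast
  qed (use dims in blast)
qed

end
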